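(* Let $\mathsf A$ be a Koszul $k(q)$-algebra minimally generated by $\mathsf x_1,\dots,\mathsf x_n$, and suppose the $k[q^{\pm1}]$-subalgebra $\mathcal A$ of $\mathsf A$ generated by the $\mathsf x_i$ is a $k[q^{\pm1}]$-form of $\mathsf A$ admitting a semiclassical limit $A=\mathcal A/(q-1)\mathcal A$ which is a polynomial algebra on the images $x_i$ of the $\mathsf x_i$. Let $\mathcal A'$ be the $k[q^{\pm1}]$-subalgebra of $\mathsf A^e=\mathsf A\otimes_{k(q)}\mathsf A^{\mathrm{op}}$ generated by the elements $\mathsf x_i\otimes1$ and $\tilde\Omega(\mathsf x_i)=\frac{\mathsf x_i\otimes1-1\otimes\mathsf x_i}{q-1}$, and suppose the surjective algebra homomorphism $P(A)\twoheadrightarrow\mathcal A'/(q-1)\mathcal A'$ given by $y_i\mapsto\overline{\mathsf x_i\otimes1}$, $\Omega(y_i)\mapsto\overline{\tilde\Omega(\mathsf x_i)}$ is an isomorphism. Then the differential graded algebra $\bar K_{\mathsf A^e}(\mathsf A)$ is a $q$-deformation of the differential graded algebra $\bar K_{P(A)}(A)$.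
   Context: $k$ is a field of characteristic zero, $q$ transcendental over $k$. Koszul algebras are quadratic: $\mathsf A=T(V)/(R)$ with $V$ finite-dimensional, $R\le V\otimes V$, graded with $V$ in degree one; the $\mathsf x_i$ form a basis of $V=\mathsf A_1$. The quadratic dual is $\mathsf A^!=T(V^* )/(R^\perp)$, with $R^\perp$ the annihilator of $R$ in $V^*\otimes V^*\cong (V\otimes V)^*$. Semiclassical limit: if $\mathcal A$ is a torsion-free $k[q^{\pm1}]$-algebra with $A=\mathcal A/(q-1)\mathcal A$ commutative, then $A$ is Poisson with $\{\bar a,\bar b\}=\overline{\beta(a,b)}$, where $ab-ba=(q-1)\beta(a,b)$, $\beta(a,b)\in\mathcal A$. In the present setting each $\{x_i,x_j\}$ is homogeneous of degree $2$. $P(A)$, for $A=k[x_1,\dots,x_n]$ Poisson, is the $k$-algebra generated by $y_i,\Omega(y_i)$ with relations $y_iy_j=y_jy_i$; $\Omega(y_i)y_j-y_j\Omega(y_i)=\iota_A(\{x_i,x_j\})$; $\Omega(y_i)\Omega(y_j)-\Omega(y_j)\Omega(y_i)=\sum_l\iota_A\!\left(\frac{\partial\{x_i,x_j\}}{\partial x_l}\right)\Omega(y_l)$, where $\iota_A:A\to P(A)$, $x_i\mapsto y_i$. (It is the Poisson enveloping algebra of $A$.) $\bar K_{\mathsf A^e}(\mathsf A)$ is the algebra $\mathsf A\otimes_{k(q)}\mathsf A^!$ (product $(\lambda\otimes\mu)(\lambda'\otimes\mu')=\lambda\lambda'\otimes\mu\mu'$, cohomological degree from $\mathsf A^!$)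 with differential $$\lambda\otimes\mu\mapsto\sum_i\left(\mathsf x_i\lambda\otimes\mathsf x_i^*\mu+(-1)^{|\mu|+1}\lambda\mathsf x_i\otimes\mu\mathsf x_i^*\right),$$ where $\mathsf x_i^*$ is the dual basis of $V^*=\mathsf A^!_1$. $\bar K_{P(A)}(A)$ is the algebra $A\otimes_kA^!$, where $A^!$ is the exterior algebra on $\Omega(y_1)^*,\dots,\Omega(y_n)^*$ (cohomological degree from $A^!$), with differential $$a\otimes\omega\mapsto\sum_j\left(x_ja\otimes y_j^*\cdot\omega+\{x_j,a\}\otimes\Omega(y_j)^*\omega\right),$$ where $y_j^*\cdot(-)$ is the graded (odd) derivation of $A^!$ of degree $+1$ with $y_j^*\cdot\Omega(y_m)^*=-\sum_{r<s}\frac{\partial^2\{x_r,x_s\}}{\partial x_m\partial x_j}\Omega(y_r)^*\Omega(y_s)^*$. $q$-deformation of DGAs: a sub-DG-$k[q^{\pm1}]$-algebra $\mathcal R$ of a DG-$k(q)$-algebra $\mathsf R$ is a $k[q^{\pm1}]$-form if the natural map $\mathcal R\otimes_{k[q^{\pm1}]}k(q)\to\mathsf R$ is an isomorphism; $\mathsf R$ is a $q$-deformation of a DG-$k$-algebra $R$ if it has a $k[q^{\pm1}]$-form $\mathcal R$ with $\mathcal R/(q-1)\mathcal R\cong R$ as DG-$k$-algebras. *)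

theory Defs
  imports
    "HOL-Computational_Algebra.Polynomial"
    "HOL-Computational_Algebra.Fraction_Field"
    "HOL-Algebra.Module"
    "HOL-Algebra.QuotRing"
    "HOL-Algebra.Subrings"
    "HOL-Algebra.Generated_Groups"
begin

section \<open>Algebras over a commutative ring\<close>

text \<open>
  Algebras are records of type \<^typ>\<open>('f, 'a) module\<close>, which carry a multiplication and a scalar
  multiplication.  The coefficient rings are subrings \<open>S\<close> of a commutative ring
  \<^typ>\<open>'f::comm_ring_1\<close> given as a type; \<open>scalars S\<close> is the corresponding record.
\<close>

definition scalars :: "'f::comm_ring_1 set \<Rightarrow> 'f ring" where
  "scalars S = \<lparr>carrier = S, mult = (*), one = 1, zero = 0, add = (+)\<rparr>"

definition scalar_algebra :: "'f::comm_ring_1 set \<Rightarrow> ('f, 'f) module" where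
  "scalar_algebra S =
     \<lparr>carrier = S, mult = (*), one = 1, zero = 0, add = (+), smult = (*)\<rparr>"

text \<open>Unlike \<^locale>\<open>algebra\<close> of the library, the algebras here need not be commutative.\<close>

locale assoc_algebra = module R M + ring M for R and M (structure) +
  assumes smult_mult_left:
      "\<lbrakk>c \<in> carrier R; a \<in> carrier M; b \<in> carrier M\<rbrakk> \<Longrightarrow> (c \<odot> a) \<otimes> b = c \<odot> (a \<otimes> b)"
    and smult_mult_right:
      "\<lbrakk>c \<in> carrier R; a \<in> carrier M; b \<in> carrier M\<rbrakk> \<Longrightarrow> a \<otimes> (c \<odot> b) = c \<odot> (a \<otimes> b)"

definition linear_map ::
  "'f set \<Rightarrow> ('f, 'a, 'm) module_scheme \<Rightarrow> ('f, 'b, 'n) module_scheme \<Rightarrow> ('a \<Rightarrow> 'b) \<Rightarrow> bool" where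
  "linear_map S M N h \<longleftrightarrow>
     (\<forall>a\<in>carrier M. h a \<in> carrier N) \<and>
     (\<forall>a\<in>carrier M. \<forall>b\<in>carrier M. h (a \<oplus>\<^bsub>M\<^esub> b) = h a \<oplus>\<^bsub>N\<^esub> h b) \<and>
     (\<forall>c\<in>S. \<forall>a\<in>carrier M. h (c \<odot>\<^bsub>M\<^esub> a) = c \<odot>\<^bsub>N\<^esub> h a)"

definition algebra_iso ::
  "'f set \<Rightarrow> ('f, 'a, 'm) module_scheme \<Rightarrow> ('f, 'b, 'n) module_scheme \<Rightarrow> ('a \<Rightarrow> 'b) set" where
  "algebra_iso S A B = {h \<in> ring_iso A B. linear_map S A B h}"

definition is_subalgebra :: "'f set \<Rightarrow> ('f, 'a, 'm) module_scheme \<Rightarrow> 'a set \<Rightarrow> bool" where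
  "is_subalgebra S A B \<longleftrightarrow> subring B A \<and> (\<forall>c\<in>S. \<forall>b\<in>B. c \<odot>\<^bsub>A\<^esub> b \<in> B)"

definition subalgebra_generated ::
  "'f set \<Rightarrow> ('f, 'a, 'm) module_scheme \<Rightarrow> 'a set \<Rightarrow> 'a set" where
  "subalgebra_generated S A X = \<Inter>{B. is_subalgebra S A B \<and> X \<subseteq> B}"

definition opposite :: "('f, 'a) module \<Rightarrow> ('f, 'a) module" where
  "opposite A = A\<lparr>mult := \<lambda>a b. b \<otimes>\<^bsub>A\<^esub> a\<rparr>"

definition quot_algebra ::
  "('f, 'a, 'm) module_scheme \<Rightarrow> 'a set \<Rightarrow> ('f, 'a set) module" where
  "quot_algebra A I =
     ring.extend (A Quot I) (module.fields (\<lambda>c X. \<Union>a\<in>X. I +>\<^bsub>A\<^esub> (c \<odot>\<^bsub>A\<^esub> a)))"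


section \<open>Monoid algebras, free algebras, polynomial algebras, tensor products\<close>

definition supp :: "('g \<Rightarrow> 'f::zero) \<Rightarrow> 'g set" where
  "supp f = {g. f g \<noteq> 0}"

definition basis_elt :: "'g \<Rightarrow> 'g \<Rightarrow> 'f::zero_neq_one" where
  "basis_elt g = (\<lambda>h. if h = g then 1 else 0)"

definition monoid_algebra ::
  "'f::comm_ring_1 set \<Rightarrow> ('g, 'm) monoid_scheme \<Rightarrow> ('f, 'g \<Rightarrow> 'f) module" where
  "monoid_algebra S G =
     \<lparr>carrier = {f. finite (supp f) \<and> supp f \<subseteq> carrier G \<and> range f \<subseteq> S},
      mult = (\<lambda>f g z. \<Sum>(u, v)\<in>{(u, v). u \<in> supp f \<and> v \<in> supp g \<and> u \<otimes>\<^bsub>G\<^esub> v = z}. f u * g v),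
      one = basis_elt \<one>\<^bsub>G\<^esub>,
      zero = (\<lambda>z. 0),
      add = (\<lambda>f g z. f z + g z),
      smult = (\<lambda>c f z. c * f z)\<rparr>"

text \<open>The linear extension to a monoid algebra of a map \<open>h\<close> given on the basis.\<close>

definition lin_ext ::
  "('f::comm_ring_1, 'a, 'm) module_scheme \<Rightarrow> ('g \<Rightarrow> 'a) \<Rightarrow> ('g \<Rightarrow> 'f) \<Rightarrow> 'a" where
  "lin_ext A h f = (\<Oplus>\<^bsub>A\<^esub>g\<in>supp f. f g \<odot>\<^bsub>A\<^esub> h g)"

definition free_monoid :: "'i set \<Rightarrow> 'i list monoid" where
  "free_monoid X = \<lparr>carrier = lists X, mult = (@), one = []\<rparr>"

definition free_algebra :: "'i set \<Rightarrow> ('f::comm_ring_1, 'i list \<Rightarrow> 'f) module" where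
  "free_algebra X = monoid_algebra UNIV (free_monoid X)"

definition free_part :: "'i set \<Rightarrow> nat \<Rightarrow> ('i list \<Rightarrow> 'f::comm_ring_1) set" where
  "free_part X i = {f \<in> carrier (free_algebra X). \<forall>w\<in>supp f. length w = i}"

definition word_eval :: "('f, 'a, 'm) module_scheme \<Rightarrow> ('i \<Rightarrow> 'a) \<Rightarrow> 'i list \<Rightarrow> 'a" where
  "word_eval A x w = foldr (\<lambda>i a. x i \<otimes>\<^bsub>A\<^esub> a) w \<one>\<^bsub>A\<^esub>"

definition free_eval ::
  "('f::comm_ring_1, 'a, 'm) module_scheme \<Rightarrow> ('i \<Rightarrow> 'a) \<Rightarrow> ('i list \<Rightarrow> 'f) \<Rightarrow> 'a" where
  "free_eval A x = lin_ext A (word_eval A x)"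

text \<open>
  The polynomial ring in the variables with indices \<open>0, \<dots>, n - 1\<close>; a polynomial maps exponent
  vectors to coefficients.
\<close>

type_synonym 'f mpol = "(nat \<Rightarrow> nat) \<Rightarrow> 'f"

definition exponents :: "nat \<Rightarrow> (nat \<Rightarrow> nat) monoid" where
  "exponents n = \<lparr>carrier = {e. \<forall>i\<ge>n. e i = 0}, mult = (\<lambda>d e i. d i + e i), one = (\<lambda>i. 0)\<rparr>"

definition poly_algebra :: "nat \<Rightarrow> ('f::comm_ring_1, 'f mpol) module" where
  "poly_algebra n = monoid_algebra UNIV (exponents n)"

definition Var :: "nat \<Rightarrow> 'f::comm_ring_1 mpol" where
  "Var i = basis_elt (\<lambda>j. if j = i then 1 else 0)"

definition pdiff :: "nat \<Rightarrow> 'f::comm_ring_1 mpol \<Rightarrow> 'f mpol" where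
  "pdiff l f = (\<lambda>e. of_nat (e l + 1) * f (e(l := e l + 1)))"

definition mono_eval ::
  "('f, 'a, 'm) module_scheme \<Rightarrow> nat \<Rightarrow> (nat \<Rightarrow> 'a) \<Rightarrow> (nat \<Rightarrow> nat) \<Rightarrow> 'a" where
  "mono_eval A n y e = foldr (\<lambda>i a. (y i [^]\<^bsub>A\<^esub> e i) \<otimes>\<^bsub>A\<^esub> a) [0..<n] \<one>\<^bsub>A\<^esub>"

text \<open>In a noncommutative algebra, monomials are evaluated as ordered products.\<close>

definition poly_eval ::
  "('f::comm_ring_1, 'a, 'm) module_scheme \<Rightarrow> nat \<Rightarrow> (nat \<Rightarrow> 'a) \<Rightarrow> 'f mpol \<Rightarrow> 'a" where
  "poly_eval A n y = lin_ext A (mono_eval A n y)"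

definition is_polynomial_algebra ::
  "('f::comm_ring_1, 'a, 'm) module_scheme \<Rightarrow> nat \<Rightarrow> (nat \<Rightarrow> 'a) \<Rightarrow> bool" where
  "is_polynomial_algebra A n y \<longleftrightarrow> poly_eval A n y \<in> algebra_iso UNIV (poly_algebra n) A"

text \<open>
  The tensor product over \<open>S\<close> of two unital \<open>S\<close>-algebras: the free \<open>S\<close>-module on the pairs,
  modulo the bilinearity relations.  The multiplication of pairs maps a relation multiplied by a
  pair to a relation, so that the span of the relations is the ideal they generate.
\<close>

definition tensor_relations ::
  "'f::comm_ring_1 set \<Rightarrow> ('f, 'a, 'm) module_scheme \<Rightarrow> ('f, 'b, 'n) module_scheme
     \<Rightarrow> ('a \<times> 'b \<Rightarrow> 'f) set" where
  "tensor_relations S M N =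
     {\<lambda>p. basis_elt (a \<oplus>\<^bsub>M\<^esub> a', b) p - basis_elt (a, b) p - basis_elt (a', b) p | a a' b.
        a \<in> carrier M \<and> a' \<in> carrier M \<and> b \<in> carrier N} \<union>
     {\<lambda>p. basis_elt (a, b \<oplus>\<^bsub>N\<^esub> b') p - basis_elt (a, b) p - basis_elt (a, b') p | a b b'.
        a \<in> carrier M \<and> b \<in> carrier N \<and> b' \<in> carrier N} \<union>
     {\<lambda>p. basis_elt (c \<odot>\<^bsub>M\<^esub> a, b) p - c * basis_elt (a, b) p | c a b.
        c \<in> S \<and> a \<in> carrier M \<and> b \<in> carrier N} \<union>
     {\<lambda>p. basis_elt (a, c \<odot>\<^bsub>N\<^esub> b) p - c * basis_elt (a, b) p | c a b.
        c \<in> S \<and> a \<in> carrier M \<and> b \<in> carrier N}"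

definition tensor_ideal ::
  "'f::comm_ring_1 set \<Rightarrow> ('f, 'a, 'm) module_scheme \<Rightarrow> ('f, 'b, 'n) module_scheme
     \<Rightarrow> ('a \<times> 'b \<Rightarrow> 'f) set" where
  "tensor_ideal S M N = Idl\<^bsub>monoid_algebra S (M \<times>\<times> N)\<^esub> (tensor_relations S M N)"

definition tensor_algebra ::
  "'f::comm_ring_1 set \<Rightarrow> ('f, 'a, 'm) module_scheme \<Rightarrow> ('f, 'b, 'n) module_scheme
     \<Rightarrow> ('f, ('a \<times> 'b \<Rightarrow> 'f) set) module" where
  "tensor_algebra S M N = quot_algebra (monoid_algebra S (M \<times>\<times> N)) (tensor_ideal S M N)"

definition tensor ::
  "'f::comm_ring_1 set \<Rightarrow> ('f, 'a, 'm) module_scheme \<Rightarrow> ('f, 'b, 'n) module_scheme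
     \<Rightarrow> 'a \<Rightarrow> 'b \<Rightarrow> ('a \<times> 'b \<Rightarrow> 'f) set" where
  "tensor S M N a b = tensor_ideal S M N +>\<^bsub>monoid_algebra S (M \<times>\<times> N)\<^esub> basis_elt (a, b)"


section \<open>Graded algebras and differential graded algebras\<close>

record ('f, 'a) graded = "('f, 'a) module" +
  grade :: "nat \<Rightarrow> 'a set"

record ('f, 'a) dga = "('f, 'a) graded" +
  diff :: "'a \<Rightarrow> 'a"

definition with_grade :: "('f, 'a) module \<Rightarrow> (nat \<Rightarrow> 'a set) \<Rightarrow> ('f, 'a) graded" where
  "with_grade A g = module.extend A (graded.fields g)"

definition with_diff :: "('f, 'a) graded \<Rightarrow> ('a \<Rightarrow> 'a) \<Rightarrow> ('f, 'a) dga" where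
  "with_diff A d = graded.extend A (dga.fields d)"

definition alt_sign :: "('a, 'm) ring_scheme \<Rightarrow> nat \<Rightarrow> 'a \<Rightarrow> 'a" where
  "alt_sign A i a = (if even i then a else \<ominus>\<^bsub>A\<^esub> a)"

locale dg_algebra = assoc_algebra R M for R and M :: "('f, 'a, 'm) dga_scheme" (structure) +
  assumes grade_submodule: "submodule (grade M i) R M"
    and grade_direct_sum:
      "a \<in> carrier M \<Longrightarrow>
         \<exists>!c. (\<forall>i. c i \<in> grade M i) \<and> finite {i. c i \<noteq> \<zero>} \<and>
              a = (\<Oplus>i\<in>{i. c i \<noteq> \<zero>}. c i)"
    and one_grade: "\<one> \<in> grade M 0"
    and mult_grade: "\<lbrakk>a \<in> grade M i; b \<in> grade M j\<rbrakk> \<Longrightarrow> a \<otimes> b \<in> grade M (i + j)"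
    and diff_linear: "linear_map (carrier R) M M (diff M)"
    and diff_grade: "a \<in> grade M i \<Longrightarrow> diff M a \<in> grade M (Suc i)"
    and diff_diff: "a \<in> carrier M \<Longrightarrow> diff M (diff M a) = \<zero>"
    and diff_mult:
      "\<lbrakk>a \<in> grade M i; b \<in> carrier M\<rbrakk> \<Longrightarrow>
         diff M (a \<otimes> b) = (diff M a \<otimes> b) \<oplus> alt_sign M i (a \<otimes> diff M b)"

definition dga_iso ::
  "'f set \<Rightarrow> ('f, 'a, 'm) dga_scheme \<Rightarrow> ('f, 'b, 'n) dga_scheme \<Rightarrow> ('a \<Rightarrow> 'b) set" where
  "dga_iso S A B =
     {h \<in> algebra_iso S A B.
        (\<forall>i. h ` grade A i = grade B i) \<and> (\<forall>a\<in>carrier A. h (diff A a) = diff B (h a))}"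

text \<open>The quotient of a free algebra by an ideal generated by homogeneous elements.\<close>

definition graded_free_quot ::
  "'i set \<Rightarrow> ('i list \<Rightarrow> 'f) set \<Rightarrow> ('f::comm_ring_1, ('i list \<Rightarrow> 'f) set) graded" where
  "graded_free_quot X I =
     with_grade (quot_algebra (free_algebra X) I)
       (\<lambda>i. {I +>\<^bsub>free_algebra X\<^esub> f | f. f \<in> free_part X i})"

text \<open>The grading of \<open>M \<otimes> N\<close> that is inherited from \<open>N\<close>.\<close>

definition tensor_grade ::
  "('f::comm_ring_1, 'a, 'm) module_scheme \<Rightarrow> ('f, 'b, 'n) graded_scheme
     \<Rightarrow> nat \<Rightarrow> ('a \<times> 'b \<Rightarrow> 'f) set set" where
  "tensor_grade M N i =
     generate (add_monoid (tensor_algebra UNIV M N))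
       {tensor UNIV M N a m | a m. a \<in> carrier M \<and> m \<in> grade N i}"


section \<open>The ring of Laurent polynomials, forms and specialisation at \<open>q = 1\<close>\<close>

text \<open>\<open>k(q)\<close> is the type \<^typ>\<open>'k poly fract\<close>; \<open>laurent\<close> is its subring generated by \<open>k\<close> and
  \<open>q\<close>, \<open>q\<^sup>-\<^sup>1\<close>.\<close>

definition qvar :: "'k::field poly fract" where
  "qvar = Fraction_Field.Fract [:0, 1:] 1"

definition const :: "'k::field \<Rightarrow> 'k poly fract" where
  "const c = Fraction_Field.Fract [:c:] 1"

definition laurent :: "'k::field poly fract set" where
  "laurent = {Fraction_Field.Fract p 1 / qvar ^ m | p m. True}"

text \<open>The natural map \<open>B \<otimes> k(q) \<rightarrow> A\<close>, with \<open>b \<otimes> c \<mapsto> c b\<close>, for a \<open>laurent\<close>-subalgebra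
  \<open>B\<close> of \<open>A\<close>.\<close>

definition form_map ::
  "('k::field poly fract, 'a, 'm) module_scheme
     \<Rightarrow> ('a \<times> 'k poly fract \<Rightarrow> 'k poly fract) set \<Rightarrow> 'a" where
  "form_map A X = the_elem (lin_ext A (\<lambda>(b, c). c \<odot>\<^bsub>A\<^esub> b) ` X)"

definition is_form :: "('k::field poly fract, 'a, 'm) module_scheme \<Rightarrow> 'a set \<Rightarrow> bool" where
  "is_form A B \<longleftrightarrow>
     is_subalgebra laurent A B \<and>
     form_map A \<in>
       algebra_iso laurent (tensor_algebra laurent (A\<lparr>carrier := B\<rparr>) (scalar_algebra UNIV)) A"

definition q1_ideal :: "('k::field poly fract, 'a, 'm) module_scheme \<Rightarrow> 'a set \<Rightarrow> 'a set" where
  "q1_ideal A B = (\<lambda>b. (qvar - 1) \<odot>\<^bsub>A\<^esub> b) ` B"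

definition spec_class ::
  "('k::field poly fract, 'a, 'm) module_scheme \<Rightarrow> 'a set \<Rightarrow> 'a \<Rightarrow> 'a set" where
  "spec_class A B b = q1_ideal A B +>\<^bsub>A\<^esub> b"

text \<open>\<open>B/(q - 1)B\<close>, as an algebra over \<open>k\<close>.\<close>

definition spec ::
  "('k::field poly fract, 'a, 'm) module_scheme \<Rightarrow> 'a set \<Rightarrow> ('k, 'a set) module" where
  "spec A B =
     ring.extend (A\<lparr>carrier := B\<rparr> Quot q1_ideal A B)
       (module.fields
          (\<lambda>c. smult (quot_algebra (A\<lparr>carrier := B\<rparr>) (q1_ideal A B)) (const c)))"

definition sub_dga :: "('f, 'a) dga \<Rightarrow> 'a set \<Rightarrow> ('f, 'a) dga" where
  "sub_dga R B = R\<lparr>carrier := B, grade := \<lambda>i. grade R i \<inter> B\<rparr>"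

definition is_dg_form :: "('k::field poly fract, 'a) dga \<Rightarrow> 'a set \<Rightarrow> bool" where
  "is_dg_form R B \<longleftrightarrow> dg_algebra (scalars laurent) (sub_dga R B) \<and> is_form R B"

definition spec_dga :: "('k::field poly fract, 'a) dga \<Rightarrow> 'a set \<Rightarrow> ('k, 'a set) dga" where
  "spec_dga R B =
     with_diff
       (with_grade (spec R B) (\<lambda>i. spec_class R B ` (grade R i \<inter> B)))
       (\<lambda>X. \<Union>b\<in>X. spec_class R B (diff R b))"

definition is_q_deformation ::
  "('k::field poly fract, 'a) dga \<Rightarrow> ('k, 'b) dga \<Rightarrow> bool" where
  "is_q_deformation R R0 \<longleftrightarrow>
     dg_algebra (scalars UNIV) R \<and> dg_algebra (scalars UNIV) R0 \<and>
     (\<exists>B. is_dg_form R B \<and> dga_iso UNIV (spec_dga R B) R0 \<noteq> {})"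

definition admits_semiclassical_limit ::
  "('k::field poly fract, 'a, 'm) module_scheme \<Rightarrow> 'a set \<Rightarrow> bool" where
  "admits_semiclassical_limit A B \<longleftrightarrow>
     is_subalgebra laurent A B \<and>
     (\<forall>c\<in>laurent. \<forall>b\<in>B. c \<odot>\<^bsub>A\<^esub> b = \<zero>\<^bsub>A\<^esub> \<longrightarrow> c = 0 \<or> b = \<zero>\<^bsub>A\<^esub>) \<and>
     cring (spec A B)"

text \<open>The union below is over equal cosets.\<close>

definition spec_bracket ::
  "('k::field poly fract, 'a, 'm) module_scheme \<Rightarrow> 'a set \<Rightarrow> 'a set \<Rightarrow> 'a set \<Rightarrow> 'a set" where
  "spec_bracket A B X Y =
     (\<Union>a\<in>X. \<Union>b\<in>Y.
        \<Union>\<beta>\<in>{\<beta> \<in> B. (a \<otimes>\<^bsub>A\<^esub> b) \<ominus>\<^bsub>A\<^esub> (b \<otimes>\<^bsub>A\<^esub> a) = (qvar - 1) \<odot>\<^bsub>A\<^esub> \<beta>}. spec_class A B \<beta>)"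


section \<open>Quadratic and Koszul algebras\<close>

text \<open>
  \<open>V\<close> has the basis \<open>x 0, \<dots>, x (n - 1)\<close> and \<open>T(V)\<close> is the free algebra on the indices.
  If \<open>A = T(V)/(R)\<close> with \<open>R \<subseteq> V \<otimes> V\<close>, then \<open>R\<close> is the degree two part of \<open>(R)\<close>, which is
  \<open>quad_relations A n x\<close>.
\<close>

definition quad_relations ::
  "('f::field, 'a) module \<Rightarrow> nat \<Rightarrow> (nat \<Rightarrow> 'a) \<Rightarrow> (nat list \<Rightarrow> 'f) set" where
  "quad_relations A n x = {f \<in> free_part {..<n} 2. free_eval A x f = \<zero>\<^bsub>A\<^esub>}"

definition is_quadratic_algebra :: "('f::field, 'a) module \<Rightarrow> nat \<Rightarrow> (nat \<Rightarrow> 'a) \<Rightarrow> bool" where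
  "is_quadratic_algebra A n x \<longleftrightarrow>
     assoc_algebra (scalars UNIV) A \<and>
     x ` {..<n} \<subseteq> carrier A \<and>
     free_eval A x ` carrier (free_algebra {..<n}) = carrier A \<and>
     {f \<in> carrier (free_algebra {..<n}). free_eval A x f = \<zero>\<^bsub>A\<^esub>} =
       Idl\<^bsub>free_algebra {..<n}\<^esub> (quad_relations A n x)"

definition annihilator :: "nat \<Rightarrow> (nat list \<Rightarrow> 'f::field) set \<Rightarrow> (nat list \<Rightarrow> 'f) set" where
  "annihilator n R =
     {g \<in> free_part {..<n} 2. \<forall>f\<in>R. (\<Sum>i<n. \<Sum>j<n. g [i, j] * f [i, j]) = 0}"

definition quad_dual_ideal ::
  "('f::field, 'a) module \<Rightarrow> nat \<Rightarrow> (nat \<Rightarrow> 'a) \<Rightarrow> (nat list \<Rightarrow> 'f) set" where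
  "quad_dual_ideal A n x = Idl\<^bsub>free_algebra {..<n}\<^esub> (annihilator n (quad_relations A n x))"

definition quad_dual ::
  "('f::field, 'a) module \<Rightarrow> nat \<Rightarrow> (nat \<Rightarrow> 'a) \<Rightarrow> ('f, (nat list \<Rightarrow> 'f) set) graded" where
  "quad_dual A n x = graded_free_quot {..<n} (quad_dual_ideal A n x)"

definition dual_gen ::
  "('f::field, 'a) module \<Rightarrow> nat \<Rightarrow> (nat \<Rightarrow> 'a) \<Rightarrow> nat \<Rightarrow> (nat list \<Rightarrow> 'f) set" where
  "dual_gen A n x i = quad_dual_ideal A n x +>\<^bsub>free_algebra {..<n}\<^esub> basis_elt [i]"

text \<open>
  Degree \<open>i\<close> of the Koszul dual coalgebra: the intersection of all \<open>V\<^sup>a \<otimes> R \<otimes> V\<^sup>b\<close> in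
  \<open>V\<^sup>i\<close>, where \<open>a + 2 + b = i\<close> (the ground field and \<open>V\<close> in degrees \<open>0\<close> and \<open>1\<close>).
\<close>

definition koszul_coalgebra ::
  "('f::field, 'a) module \<Rightarrow> nat \<Rightarrow> (nat \<Rightarrow> 'a) \<Rightarrow> nat \<Rightarrow> (nat list \<Rightarrow> 'f) set" where
  "koszul_coalgebra A n x i =
     {f \<in> free_part {..<n} i. \<forall>a b. a + 2 + b = i \<longrightarrow>
        f \<in> generate (add_monoid (free_algebra {..<n}))
              {g \<otimes>\<^bsub>free_algebra {..<n}\<^esub> r \<otimes>\<^bsub>free_algebra {..<n}\<^esub> h | g r h.
                 g \<in> free_part {..<n} a \<and> r \<in> quad_relations A n x \<and> h \<in> free_part {..<n} b}}"

text \<open>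
  An element of \<open>A \<otimes> T(V)\<close> is a finitely supported function from words to \<open>A\<close>; the term
  \<open>A \<otimes> koszul_coalgebra A n x i\<close> of the Koszul complex is embedded there.  The differential
  maps \<open>a \<otimes> v\<^sub>1 \<dots> v\<^sub>i\<close> to \<open>a v\<^sub>1 \<otimes> v\<^sub>2 \<dots> v\<^sub>i\<close>.
\<close>

inductive_set koszul_complex ::
  "('f::field, 'a) module \<Rightarrow> nat \<Rightarrow> (nat \<Rightarrow> 'a) \<Rightarrow> nat \<Rightarrow> (nat list \<Rightarrow> 'a) set"
  for A n x i where
  zero: "(\<lambda>w. \<zero>\<^bsub>A\<^esub>) \<in> koszul_complex A n x i"
| add: "\<lbrakk>c \<in> koszul_complex A n x i; a \<in> carrier A; f \<in> koszul_coalgebra A n x i\<rbrakk>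
    \<Longrightarrow> (\<lambda>w. c w \<oplus>\<^bsub>A\<^esub> (f w \<odot>\<^bsub>A\<^esub> a)) \<in> koszul_complex A n x i"

definition koszul_diff ::
  "('f::field, 'a) module \<Rightarrow> nat \<Rightarrow> (nat \<Rightarrow> 'a) \<Rightarrow> (nat list \<Rightarrow> 'a) \<Rightarrow> nat list \<Rightarrow> 'a" where
  "koszul_diff A n x c = (\<lambda>w. \<Oplus>\<^bsub>A\<^esub>i\<in>{..<n}. c (i # w) \<otimes>\<^bsub>A\<^esub> x i)"

text \<open>
  Koszulness: the Koszul complex is a resolution of the trivial module.  Its homology in degree
  \<open>0\<close> is \<open>A/(x 0, \<dots>, x (n - 1))\<close>, the trivial module, for every quadratic algebra.
\<close>

definition is_koszul_algebra :: "('f::field, 'a) module \<Rightarrow> nat \<Rightarrow> (nat \<Rightarrow> 'a) \<Rightarrow> bool" where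
  "is_koszul_algebra A n x \<longleftrightarrow>
     is_quadratic_algebra A n x \<and>
     (\<forall>i\<ge>1. {c \<in> koszul_complex A n x i. koszul_diff A n x c = (\<lambda>w. \<zero>\<^bsub>A\<^esub>)} =
              koszul_diff A n x ` koszul_complex A n x (Suc i))"


section \<open>The differential graded algebra of the quantum algebra\<close>

definition Kbar_env_diff ::
  "('f::field, 'a) module \<Rightarrow> nat \<Rightarrow> (nat \<Rightarrow> 'a)
     \<Rightarrow> ('a \<times> (nat list \<Rightarrow> 'f) set \<Rightarrow> 'f) set \<Rightarrow> ('a \<times> (nat list \<Rightarrow> 'f) set \<Rightarrow> 'f) set" where
  "Kbar_env_diff A n x =
     (let D = quad_dual A n x; T = tensor_algebra UNIV A D; \<xi> = dual_gen A n x in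
      THE d. d \<in> extensional (carrier T) \<and> linear_map UNIV T T d \<and>
        (\<forall>l\<in>carrier A. \<forall>p. \<forall>m\<in>grade D p.
           d (tensor UNIV A D l m) =
             (\<Oplus>\<^bsub>T\<^esub>i\<in>{..<n}.
                tensor UNIV A D (x i \<otimes>\<^bsub>A\<^esub> l) (\<xi> i \<otimes>\<^bsub>D\<^esub> m) \<oplus>\<^bsub>T\<^esub>
                alt_sign T (p + 1) (tensor UNIV A D (l \<otimes>\<^bsub>A\<^esub> x i) (m \<otimes>\<^bsub>D\<^esub> \<xi> i)))))"

definition Kbar_env ::
  "('f::field, 'a) module \<Rightarrow> nat \<Rightarrow> (nat \<Rightarrow> 'a)
     \<Rightarrow> ('f, ('a \<times> (nat list \<Rightarrow> 'f) set \<Rightarrow> 'f) set) dga" where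
  "Kbar_env A n x =
     with_diff
       (with_grade (tensor_algebra UNIV A (quad_dual A n x)) (tensor_grade A (quad_dual A n x)))
       (Kbar_env_diff A n x)"


section \<open>Poisson polynomial algebras\<close>

text \<open>
  In this section the polynomial algebra on \<open>n\<close> variables has the Poisson bracket \<open>pb\<close>.
  The generators \<open>y\<^sub>i\<close> and \<open>\<Omega>(y\<^sub>i)\<close> of the Poisson enveloping algebra are \<open>Inl i\<close> and
  \<open>Inr i\<close>.
\<close>

definition env_free :: "nat \<Rightarrow> ('k::field, (nat + nat) list \<Rightarrow> 'k) module" where
  "env_free n = free_algebra ({..<n} <+> {..<n})"

definition env_relations ::
  "nat \<Rightarrow> ('k::field mpol \<Rightarrow> 'k mpol \<Rightarrow> 'k mpol) \<Rightarrow> ((nat + nat) list \<Rightarrow> 'k) set" where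
  "env_relations n pb =
     (let F = env_free n;
          y = (\<lambda>i. basis_elt [Inl i]);
          \<Omega> = (\<lambda>i. basis_elt [Inr i]);
          \<iota> = poly_eval F n y in
      {(y i \<otimes>\<^bsub>F\<^esub> y j) \<ominus>\<^bsub>F\<^esub> (y j \<otimes>\<^bsub>F\<^esub> y i) | i j. i < n \<and> j < n} \<union>
      {((\<Omega> i \<otimes>\<^bsub>F\<^esub> y j) \<ominus>\<^bsub>F\<^esub> (y j \<otimes>\<^bsub>F\<^esub> \<Omega> i)) \<ominus>\<^bsub>F\<^esub> \<iota> (pb (Var i) (Var j)) | i j.
         i < n \<and> j < n} \<union>
      {((\<Omega> i \<otimes>\<^bsub>F\<^esub> \<Omega> j) \<ominus>\<^bsub>F\<^esub> (\<Omega> j \<otimes>\<^bsub>F\<^esub> \<Omega> i)) \<ominus>\<^bsub>F\<^esub>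
         (\<Oplus>\<^bsub>F\<^esub>l\<in>{..<n}. \<iota> (pdiff l (pb (Var i) (Var j))) \<otimes>\<^bsub>F\<^esub> \<Omega> l) | i j.
         i < n \<and> j < n})"

definition env_ideal ::
  "nat \<Rightarrow> ('k::field mpol \<Rightarrow> 'k mpol \<Rightarrow> 'k mpol) \<Rightarrow> ((nat + nat) list \<Rightarrow> 'k) set" where
  "env_ideal n pb = Idl\<^bsub>env_free n\<^esub> (env_relations n pb)"

definition poisson_env ::
  "nat \<Rightarrow> ('k::field mpol \<Rightarrow> 'k mpol \<Rightarrow> 'k mpol)
     \<Rightarrow> ('k, ((nat + nat) list \<Rightarrow> 'k) set) module" where
  "poisson_env n pb = quot_algebra (env_free n) (env_ideal n pb)"

definition env_gen ::
  "nat \<Rightarrow> ('k::field mpol \<Rightarrow> 'k mpol \<Rightarrow> 'k mpol) \<Rightarrow> nat + nat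
     \<Rightarrow> ((nat + nat) list \<Rightarrow> 'k) set" where
  "env_gen n pb s = env_ideal n pb +>\<^bsub>env_free n\<^esub> basis_elt [s]"

definition exterior_ideal :: "nat \<Rightarrow> (nat list \<Rightarrow> 'k::field) set" where
  "exterior_ideal n =
     Idl\<^bsub>free_algebra {..<n}\<^esub> {v \<otimes>\<^bsub>free_algebra {..<n}\<^esub> v | v. v \<in> free_part {..<n} 1}"

definition exterior_algebra :: "nat \<Rightarrow> ('k::field, (nat list \<Rightarrow> 'k) set) graded" where
  "exterior_algebra n = graded_free_quot {..<n} (exterior_ideal n)"

definition ext_gen :: "nat \<Rightarrow> nat \<Rightarrow> (nat list \<Rightarrow> 'k::field) set" where
  "ext_gen n i = exterior_ideal n +>\<^bsub>free_algebra {..<n}\<^esub> basis_elt [i]"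

text \<open>
  The derivation \<open>y\<^sub>j\<^sup>*\<cdot>\<close> of the exterior algebra.  The brackets of the variables being
  homogeneous of degree two, their second derivatives are the constants given by the coefficient
  at the zero exponent vector.
\<close>

definition dual_action ::
  "nat \<Rightarrow> ('k::field mpol \<Rightarrow> 'k mpol \<Rightarrow> 'k mpol) \<Rightarrow> nat
     \<Rightarrow> (nat list \<Rightarrow> 'k) set \<Rightarrow> (nat list \<Rightarrow> 'k) set" where
  "dual_action n pb j =
     (let E = exterior_algebra n in
      THE D. D \<in> extensional (carrier E) \<and> linear_map UNIV E E D \<and>
        (\<forall>p. \<forall>u\<in>grade E p. \<forall>v\<in>carrier E.
           D (u \<otimes>\<^bsub>E\<^esub> v) = (D u \<otimes>\<^bsub>E\<^esub> v) \<oplus>\<^bsub>E\<^esub> alt_sign E p (u \<otimes>\<^bsub>E\<^esub> D v)) \<and>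
        (\<forall>m<n. D (ext_gen n m) =
           \<ominus>\<^bsub>E\<^esub> (\<Oplus>\<^bsub>E\<^esub>s\<in>{..<n}. \<Oplus>\<^bsub>E\<^esub>r\<in>{..<s}.
              pdiff m (pdiff j (pb (Var r) (Var s))) (\<lambda>i. 0) \<odot>\<^bsub>E\<^esub>
                (ext_gen n r \<otimes>\<^bsub>E\<^esub> ext_gen n s))))"

definition Kbar_poisson_diff ::
  "nat \<Rightarrow> ('k::field mpol \<Rightarrow> 'k mpol \<Rightarrow> 'k mpol)
     \<Rightarrow> ('k mpol \<times> (nat list \<Rightarrow> 'k) set \<Rightarrow> 'k) set
     \<Rightarrow> ('k mpol \<times> (nat list \<Rightarrow> 'k) set \<Rightarrow> 'k) set" where
  "Kbar_poisson_diff n pb =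
     (let A = poly_algebra n; E = exterior_algebra n; T = tensor_algebra UNIV A E in
      THE d. d \<in> extensional (carrier T) \<and> linear_map UNIV T T d \<and>
        (\<forall>a\<in>carrier A. \<forall>u\<in>carrier E.
           d (tensor UNIV A E a u) =
             (\<Oplus>\<^bsub>T\<^esub>j\<in>{..<n}.
                tensor UNIV A E (Var j \<otimes>\<^bsub>A\<^esub> a) (dual_action n pb j u) \<oplus>\<^bsub>T\<^esub>
                tensor UNIV A E (pb (Var j) a) (ext_gen n j \<otimes>\<^bsub>E\<^esub> u))))"

definition Kbar_poisson ::
  "nat \<Rightarrow> ('k::field mpol \<Rightarrow> 'k mpol \<Rightarrow> 'k mpol)
     \<Rightarrow> ('k, ('k mpol \<times> (nat list \<Rightarrow> 'k) set \<Rightarrow> 'k) set) dga" where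
  "Kbar_poisson n pb =
     with_diff
       (with_grade (tensor_algebra UNIV (poly_algebra n) (exterior_algebra n))
          (tensor_grade (poly_algebra n) (exterior_algebra n)))
       (Kbar_poisson_diff n pb)"


section \<open>The semiclassical limit of a quantum algebra and its enveloping algebra\<close>

definition gen_form :: "('k::field poly fract, 'a) module \<Rightarrow> nat \<Rightarrow> (nat \<Rightarrow> 'a) \<Rightarrow> 'a set" where
  "gen_form A n x = subalgebra_generated laurent A (x ` {..<n})"

definition scl_limit ::
  "('k::field poly fract, 'a) module \<Rightarrow> nat \<Rightarrow> (nat \<Rightarrow> 'a) \<Rightarrow> ('k, 'a set) module" where
  "scl_limit A n x = spec A (gen_form A n x)"

definition scl_gen ::
  "('k::field poly fract, 'a) module \<Rightarrow> nat \<Rightarrow> (nat \<Rightarrow> 'a) \<Rightarrow> nat \<Rightarrow> 'a set" where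
  "scl_gen A n x i = spec_class A (gen_form A n x) (x i)"

text \<open>The bracket of the semiclassical limit, transported to polynomials in the \<open>scl_gen A n x i\<close>.\<close>

definition scl_bracket ::
  "('k::field poly fract, 'a) module \<Rightarrow> nat \<Rightarrow> (nat \<Rightarrow> 'a) \<Rightarrow> 'k mpol \<Rightarrow> 'k mpol \<Rightarrow> 'k mpol" where
  "scl_bracket A n x f g =
     (let \<phi> = poly_eval (scl_limit A n x) n (scl_gen A n x) in
      inv_into (carrier (poly_algebra n)) \<phi> (spec_bracket A (gen_form A n x) (\<phi> f) (\<phi> g)))"

definition enveloping ::
  "('f::field, 'a) module \<Rightarrow> ('f, ('a \<times> 'a \<Rightarrow> 'f) set) module" where
  "enveloping A = tensor_algebra UNIV A (opposite A)"

definition env_left :: "('f::field, 'a) module \<Rightarrow> 'a \<Rightarrow> ('a \<times> 'a \<Rightarrow> 'f) set" where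
  "env_left A a = tensor UNIV A (opposite A) a \<one>\<^bsub>A\<^esub>"

definition env_right :: "('f::field, 'a) module \<Rightarrow> 'a \<Rightarrow> ('a \<times> 'a \<Rightarrow> 'f) set" where
  "env_right A a = tensor UNIV A (opposite A) \<one>\<^bsub>A\<^esub> a"

definition Omega_tilde ::
  "('k::field poly fract, 'a) module \<Rightarrow> 'a \<Rightarrow> ('a \<times> 'a \<Rightarrow> 'k poly fract) set" where
  "Omega_tilde A a =
     (1 / (qvar - 1)) \<odot>\<^bsub>enveloping A\<^esub> (env_left A a \<ominus>\<^bsub>enveloping A\<^esub> env_right A a)"

definition env_form ::
  "('k::field poly fract, 'a) module \<Rightarrow> nat \<Rightarrow> (nat \<Rightarrow> 'a)
     \<Rightarrow> ('a \<times> 'a \<Rightarrow> 'k poly fract) set set" where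
  "env_form A n x =
     subalgebra_generated laurent (enveloping A)
       ((\<lambda>i. env_left A (x i)) ` {..<n} \<union> (\<lambda>i. Omega_tilde A (x i)) ` {..<n})"

end

(*
Put t = q - 1.  The differential of A (x) A^! is the graded commutator with theta = sum_i x_i (x) xi_i,
and theta^2 = 0 because the relations of A and of A^! are orthogonal.  Forms are constructed over the
local ring O of k[q] at t = 0, which contains k[q, 1/q].

Since A reduces to a polynomial ring, Nakayama's lemma gives a basis of A consisting of words, one for
each monomial, and the relations of A take the form w = sum_e gamma(w, e) w_e with gamma(w, e) in O
reducing to 0 or 1.  The relations of A^! are therefore an O-flat deformation of the symmetric forms,
which are the relations of the exterior algebra, and this flatness holds in degree three as well.  By the
exactness of the Koszul complex of the exterior algebra it propagates to all degrees: the O-subalgebra of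
A^! generated by the t xi_i reduces to the exterior algebra.

At t = 0 the first factor is commutative and the second graded commutative, so commutators are divisible
by t, and
  d(a (x) m) = sum_i a x_i (x) (xi_i m - (-1)^|m| m xi_i) + {x_i, a} (x) (t xi_i) m
preserves the O-form of A (x) A^!.  The first term reduces to the action of y_i^*, the derivation that is
induced by the graded commutator with xi_i, and the second one to the Poisson bracket.
*)

theory Submission
  imports Defs
begin

section \<open>The local ring at \<open>q = 1\<close>\<close>

text \<open>A form has to be a k[q, 1/q]-subalgebra that spans over k(q); nothing asks it to be
  finitely generated. Hence all points of the q-line other than q = 1 may be inverted, and flatness
  has to be controlled at t = 0 alone, where it means saturation: an integral a with t a in the
  ideal I lies in I itself. For A this comes from the polynomial limit. For A^! only the relations
  are given, and flatness of a space G of quadratic relations does not pass to higher degrees by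
  itself. The obstacle is that t a = \<nu> + \<mu> may hold with \<nu> in G \<otimes> V^p and \<mu>
  in V \<otimes> I, neither of them divisible by t. At t = 0 the part \<nu> then lies in both
  summands, and exactness describes it, modulo V \<otimes> V \<otimes> I, by tensors symmetric in
  three letters, which must be lifted: hence degree three. The differential of the limit and the
  derivations in it are specified by unique existence. Both are obtained as reductions of maps on
  lattices, so that their existence, and the axioms of the limit, are inherited.\<close>

text \<open>The localisation of \<open>k[q]\<close> at \<open>q - 1\<close>; it contains \<^term>\<open>laurent\<close>, and forms over \<^term>\<open>laurent\<close>
  may be taken to be modules over this discrete valuation ring.\<close>

definition loc :: "'k::field poly fract set" where
  "loc = {Fraction_Field.Fract p r | p r. poly r 1 \<noteq> 0}"

definition ev1 :: "'k::field poly fract \<Rightarrow> 'k" where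
  "ev1 c = (THE v. \<exists>p r. poly r 1 \<noteq> 0 \<and> c = Fraction_Field.Fract p r \<and> v = poly p 1 / poly r 1)"

abbreviation unif :: "'k::field poly fract" where
  "unif \<equiv> qvar - 1"

lemma ev1_Fract:
  fixes p r :: "'k::field poly"
  assumes "poly r 1 \<noteq> 0"
  shows "ev1 (Fraction_Field.Fract p r) = poly p 1 / poly r 1"
  unfolding ev1_def
proof (rule the_equality)
  show "\<exists>p' r'. poly r' 1 \<noteq> 0 \<and> Fraction_Field.Fract p r = Fraction_Field.Fract p' r' \<and>
      poly p 1 / poly r 1 = poly p' 1 / poly r' 1"
    using assms by blast
next
  fix v assume "\<exists>p' r'. poly r' 1 \<noteq> 0 \<and> Fraction_Field.Fract p r = Fraction_Field.Fract p' r' \<and>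
      v = poly p' 1 / poly r' 1"
  then obtain p' r' where h: "poly r' 1 \<noteq> 0" "Fraction_Field.Fract p r = Fraction_Field.Fract p' r'"
      "v = poly p' 1 / poly r' 1" by blast
  have "r \<noteq> 0" "r' \<noteq> 0" using assms h(1) by auto
  then have "p * r' = p' * r" using h(2) by (simp add: eq_fract)
  then have "poly p 1 * poly r' 1 = poly p' 1 * poly r 1" by (metis poly_mult)
  then show "v = poly p 1 / poly r 1" unfolding h(3) using assms h(1) by (simp add: frac_eq_eq)
qed

lemma loc_cases:
  assumes "c \<in> loc"
  obtains p r where "poly r 1 \<noteq> 0" "r \<noteq> 0" "c = Fraction_Field.Fract p r" "ev1 c = poly p 1 / poly r 1"
proof -
  from assms obtain p r where h: "poly r 1 \<noteq> 0" "c = Fraction_Field.Fract p r"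
    by (auto simp: loc_def)
  moreover have "r \<noteq> 0" using h by auto
  ultimately show ?thesis using that ev1_Fract by blast
qed

lemma loc_poly:
  fixes p :: "'a::field poly"
  shows "Fraction_Field.Fract p 1 \<in> loc" "ev1 (Fraction_Field.Fract p 1) = poly p 1"
proof -
  have "poly (1 :: 'a poly) 1 \<noteq> 0" by simp
  then show "Fraction_Field.Fract p 1 \<in> loc" unfolding loc_def by blast
  show "ev1 (Fraction_Field.Fract p 1) = poly p 1" using ev1_Fract[of 1 p] by simp
qed

lemma loc_add: "a \<in> loc \<Longrightarrow> b \<in> loc \<Longrightarrow> a + b \<in> loc"
  and ev1_add: "a \<in> loc \<Longrightarrow> b \<in> loc \<Longrightarrow> ev1 (a + b) = ev1 a + ev1 b"
proof -
  assume "a \<in> loc" "b \<in> loc"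
  then obtain p r p' r' where h: "poly r 1 \<noteq> 0" "r \<noteq> 0" "a = Fraction_Field.Fract p r" "ev1 a = poly p 1 / poly r 1"
    "poly r' 1 \<noteq> 0" "r' \<noteq> 0" "b = Fraction_Field.Fract p' r'" "ev1 b = poly p' 1 / poly r' 1"
    by (metis loc_cases)
  have s: "a + b = Fraction_Field.Fract (p * r' + p' * r) (r * r')" using h by simp
  have n: "poly (r * r') 1 \<noteq> 0" using h by simp
  show "a + b \<in> loc" unfolding loc_def using s n by blast
  show "ev1 (a + b) = ev1 a + ev1 b" unfolding s ev1_Fract[OF n] using h by (simp add: field_simps)
qed

lemma loc_mult: "a \<in> loc \<Longrightarrow> b \<in> loc \<Longrightarrow> a * b \<in> loc"
  and ev1_mult: "a \<in> loc \<Longrightarrow> b \<in> loc \<Longrightarrow> ev1 (a * b) = ev1 a * ev1 b"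
proof -
  assume "a \<in> loc" "b \<in> loc"
  then obtain p r p' r' where h: "poly r 1 \<noteq> 0" "r \<noteq> 0" "a = Fraction_Field.Fract p r" "ev1 a = poly p 1 / poly r 1"
    "poly r' 1 \<noteq> 0" "r' \<noteq> 0" "b = Fraction_Field.Fract p' r'" "ev1 b = poly p' 1 / poly r' 1"
    by (metis loc_cases)
  have s: "a * b = Fraction_Field.Fract (p * p') (r * r')" using h by simp
  have n: "poly (r * r') 1 \<noteq> 0" using h by simp
  show "a * b \<in> loc" unfolding loc_def using s n by blast
  show "ev1 (a * b) = ev1 a * ev1 b" unfolding s ev1_Fract[OF n] using h by (simp add: field_simps)
qed

lemma const_loc [simp]: "const c \<in> loc" and ev1_const [simp]: "ev1 (const c) = c"
  using loc_poly[of "[:c:]"] by (simp_all add: const_def)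

lemma const_0 [simp]: "const 0 = 0" and const_1 [simp]: "const 1 = 1"
  by (simp_all add: const_def Zero_fract_def One_fract_def one_pCons)

lemma const_add: "const (a + b) = const a + const b"
  by (simp add: const_def)

lemma loc_0 [simp]: "0 \<in> loc" and loc_1 [simp]: "1 \<in> loc"
  and ev1_0 [simp]: "ev1 0 = 0" and ev1_1 [simp]: "ev1 1 = 1"
  using const_loc[of 0] const_loc[of 1] ev1_const[of 0] ev1_const[of 1] by simp_all

lemma loc_uminus: "a \<in> loc \<Longrightarrow> - a \<in> loc" and ev1_uminus: "a \<in> loc \<Longrightarrow> ev1 (- a) = - ev1 a"
proof -
  assume a: "a \<in> loc"
  have m: "const (- 1) = (- 1 :: 'a poly fract)"
    by (metis add.right_inverse add_eq_0_iff const_0 const_1 const_add)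
  show "- a \<in> loc" "ev1 (- a) = - ev1 a"
    using loc_mult[OF const_loc[of "- 1"] a] ev1_mult[OF const_loc[of "- 1"] a]
    unfolding ev1_const by (simp_all add: m)
qed

lemma loc_diff: "a \<in> loc \<Longrightarrow> b \<in> loc \<Longrightarrow> a - b \<in> loc"
  and ev1_diff: "a \<in> loc \<Longrightarrow> b \<in> loc \<Longrightarrow> ev1 (a - b) = ev1 a - ev1 b"
  using loc_add[of a "- b"] ev1_add[of a "- b"] loc_uminus[of b] ev1_uminus[of b] by simp_all

lemma loc_power: "a \<in> loc \<Longrightarrow> a ^ m \<in> loc"
  by (induct m) (auto intro: loc_mult)

lemma loc_sum: "(\<And>i. i \<in> I \<Longrightarrow> f i \<in> loc) \<Longrightarrow> sum f I \<in> loc"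
  by (induct I rule: infinite_finite_induct) (auto intro: loc_add)

lemma ev1_sum: "(\<And>i. i \<in> I \<Longrightarrow> f i \<in> loc) \<Longrightarrow> ev1 (sum f I) = (\<Sum>i\<in>I. ev1 (f i))"
  by (induct I rule: infinite_finite_induct) (auto simp: ev1_add loc_sum)

lemma unif_eq: "unif = Fraction_Field.Fract [:- 1, 1:] 1"
  by (simp add: qvar_def One_fract_def one_pCons)

lemma unif_loc [simp]: "unif \<in> loc" and ev1_unif [simp]: "ev1 unif = 0"
  using loc_poly[of "[:- 1, 1:]"] by (simp_all add: unif_eq)

lemma unif_nonzero [simp]: "unif \<noteq> 0"
  by (simp add: unif_eq Zero_fract_def eq_fract)

lemma qvar_neq_1 [simp]: "qvar \<noteq> 1"
  using unif_nonzero by (simp del: unif_nonzero)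

lemma qvar_nonzero [simp]: "qvar \<noteq> 0"
  by (simp add: qvar_def Zero_fract_def eq_fract)

lemma loc_inverse:
  assumes "c \<in> loc" "ev1 c \<noteq> 0" shows "c \<noteq> 0" "inverse c \<in> loc"
proof -
  from assms obtain p r where h: "poly r 1 \<noteq> 0" "r \<noteq> 0" "c = Fraction_Field.Fract p r" "ev1 c = poly p 1 / poly r 1"
    by (metis loc_cases)
  then have "poly p 1 \<noteq> 0" using assms by auto
  then show "inverse c \<in> loc" using h by (auto simp: loc_def)
  show "c \<noteq> 0" using assms by auto
qed

lemma loc_divide: "a \<in> loc \<Longrightarrow> c \<in> loc \<Longrightarrow> ev1 c \<noteq> 0 \<Longrightarrow> a / c \<in> loc"
  using loc_inverse[of c] loc_mult[of a "inverse c"] by (simp add: divide_inverse)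

lemma laurent_loc: "c \<in> laurent \<Longrightarrow> (c :: 'a::field poly fract) \<in> loc"
proof -
  assume "c \<in> laurent"
  then obtain p m where c: "c = Fraction_Field.Fract p 1 / qvar ^ m" by (auto simp: laurent_def)
  have q: "(qvar :: 'a poly fract) \<in> loc" "ev1 (qvar :: 'a poly fract) = 1" using loc_poly[of "[:0,1:]"] by (simp_all add: qvar_def)
  have "ev1 (qvar ^ m :: 'a poly fract) = 1" by (induct m) (simp_all add: ev1_mult q loc_power)
  then show ?thesis unfolding c by (simp add: loc_divide loc_power q loc_poly)
qed

lemma poly_laurent: "Fraction_Field.Fract p 1 \<in> laurent"
  unfolding laurent_def by (rule CollectI, rule exI[of _ p], rule exI[of _ 0]) simp

lemma const_laurent: "const c \<in> laurent"
  by (simp add: const_def poly_laurent)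

lemma unif_laurent: "unif \<in> laurent"
  by (simp add: unif_eq poly_laurent)

text \<open>The maximal ideal of the local ring is generated by \<open>unif\<close>, since a
  numerator that vanishes at 1 has the factor q - 1. This is what lets a coefficient with value 0 at
  q = 1 be divided by \<open>unif\<close>.\<close>

lemma ev1_eq_0:
  assumes "c \<in> loc" "ev1 c = 0" shows "c / unif \<in> loc"
proof -
  from assms obtain p r where h: "poly r 1 \<noteq> 0" "r \<noteq> 0" "c = Fraction_Field.Fract p r" "ev1 c = poly p 1 / poly r 1"
    by (metis loc_cases)
  then have "poly p 1 = 0" using assms by auto
  then obtain p' where p: "p = [:- 1, 1:] * p'" by (metis dvd_def poly_eq_0_iff_dvd)
  have "c / unif = Fraction_Field.Fract p' r"
    using h unfolding unif_eq p by (simp add: eq_fract mult.commute del: mult_pCons_left mult_pCons_right)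
  then show ?thesis using h by (auto simp: loc_def)
qed

text \<open>The only prime of k[q] that is not inverted in \<open>loc\<close> is q - 1, so that a
  suitable exponent can be read off the denominator: its order of vanishing at 1.\<close>

lemma unif_power_loc: "\<exists>m. unif ^ m * c \<in> loc"
proof -
  obtain p r where c: "c = Fraction_Field.Fract p r" "r \<noteq> 0" by (cases c) auto
  obtain s where s: "r = [:- 1, 1:] ^ Polynomial.order 1 r * s" "\<not> [:- 1, 1:] dvd s"
    using Polynomial.order_decomp[OF c(2), of 1] by auto
  let ?m = "Polynomial.order 1 r"
  have e: "unif ^ m = Fraction_Field.Fract ([:- 1, 1:] ^ m) 1" for m
    by (induct m) (simp_all add: One_fract_def[symmetric] unif_eq del: mult_pCons_left)
  have s0: "s \<noteq> 0" using s(2) by auto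
  have s1: "poly s 1 \<noteq> 0" using s(2) by (metis poly_eq_0_iff_dvd)
  have "unif ^ ?m * c = Fraction_Field.Fract ([:- 1, 1:] ^ ?m * p) r" using c by (simp add: e)
  also have "\<dots> = Fraction_Field.Fract p s"
    using c(2) s0 by (subst eq_fract) (auto simp: s(1)[symmetric] mult.commute mult.left_commute, 
      metis mult.assoc mult.commute s(1))
  finally have "unif ^ ?m * c \<in> loc" using s1 by (auto simp: loc_def)
  then show ?thesis ..
qed

lemma unif_power_loc_mono: "unif ^ m * c \<in> loc \<Longrightarrow> m \<le> l \<Longrightarrow> unif ^ l * c \<in> loc"
  by (metis (no_types, lifting) le_add_diff_inverse2 loc_mult loc_power mult.assoc power_add unif_loc)

lemma unif_power_loc_finite:
  assumes "finite I" shows "\<exists>m. \<forall>i\<in>I. unif ^ m * f i \<in> loc"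
  using assms
proof induct
  case (insert i I)
  then obtain m where m: "\<forall>i\<in>I. unif ^ m * f i \<in> loc" by blast
  obtain l where l: "unif ^ l * f i \<in> loc" using unif_power_loc by blast
  have "\<forall>j\<in>insert i I. unif ^ (max m l) * f j \<in> loc"
    using m l unif_power_loc_mono[of _ _ "max m l"] by (metis insert_iff max.cobounded1 max.cobounded2)
  then show ?case by blast
qed auto

text \<open>A nonzero numerator vanishes at 1 only to finite order. This is used for the
  independence of the chosen words of A: the coefficients of a relation between them turn out to be
  divisible by every power of \<open>unif\<close>.\<close>

lemma loc_separated:
  assumes "\<And>m. \<exists>d\<in>loc. c = unif ^ m * d" shows "c = (0 :: 'k::field poly fract)"
proof -
  obtain d where "d \<in> loc" "c = unif ^ 0 * d" using assms by blast
  then have "c \<in> loc" by simp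
  then obtain p r where c: "poly r 1 \<noteq> 0" "r \<noteq> 0" "c = Fraction_Field.Fract p r" by (metis loc_cases)
  have e: "unif ^ m = Fraction_Field.Fract ([:- 1, 1:] ^ m) (1 :: 'k poly)" for m
    by (induct m) (simp_all add: One_fract_def[symmetric] unif_eq del: mult_pCons_left)
  have "p = 0"
  proof (rule ccontr)
    assume p: "p \<noteq> 0"
    let ?m = "Suc (Polynomial.order 1 p)"
    obtain d where d: "d \<in> loc" "c = unif ^ ?m * d" using assms by blast
    obtain p' r' where d': "poly r' 1 \<noteq> 0" "r' \<noteq> 0" "d = Fraction_Field.Fract p' r'" using d(1) by (metis loc_cases)
    have "Fraction_Field.Fract p r = Fraction_Field.Fract ([:- 1, 1:] ^ ?m * p') r'"
      using c(3) d(2) d'(3) by (simp add: e del: mult_pCons_left power_Suc)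
    then have eq: "p * r' = [:- 1, 1:] ^ ?m * p' * r"
      using c(2) d'(2) by (simp add: eq_fract del: mult_pCons_left power_Suc)
    have "Polynomial.order 1 (p * r') = Polynomial.order 1 p" using p d' by (simp add: Polynomial.order_mult Polynomial.order_0I)
    moreover have "[:- 1, 1:] ^ ?m dvd p * r'" unfolding eq by (simp add: mult.assoc del: mult_pCons_left power_Suc)
    moreover have "p * r' \<noteq> 0" using p d' by simp
    ultimately show False using Polynomial.order_divides[of 1 ?m "p * r'"] by simp
  qed
  then show ?thesis using c by (simp add: Zero_fract_def[symmetric] fract_collapse)
qed

text \<open>The semiclassical limit is formed from the algebra generated over k[q, 1/q], whereas the
  lattices have coefficients in \<open>loc\<close>. The factor \<open>r\<close> that leads from one
  to the other is the product of the denominators; it does not vanish at 1 and can be cancelled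
  after reduction.\<close>

lemma loc_denominator:
  assumes "finite I" "\<And>i. i \<in> I \<Longrightarrow> f i \<in> (loc :: 'k::field poly fract set)"
  shows "\<exists>r\<in>laurent. ev1 r \<noteq> 0 \<and> (\<forall>i\<in>I. r * f i \<in> laurent)"
  using assms
proof induct
  case empty
  then show ?case using const_laurent[of 1] by (intro bexI[of _ "const 1"]) (simp_all del: const_1)
next
  case (insert i I)
  then obtain r where r: "r \<in> laurent" "ev1 r \<noteq> 0" "\<forall>i\<in>I. r * f i \<in> laurent" by blast
  obtain p s where s: "poly s 1 \<noteq> 0" "s \<noteq> 0" "f i = Fraction_Field.Fract p s" using insert by (metis insertI1 loc_cases)
  let ?s = "Fraction_Field.Fract s 1"
  have lm: "a \<in> laurent \<Longrightarrow> Fraction_Field.Fract t 1 * a \<in> laurent" for a :: "'k poly fract" and t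
  proof -
    assume "a \<in> laurent"
    then obtain p m where "a = Fraction_Field.Fract p 1 / qvar ^ m" by (auto simp: laurent_def)
    then have "Fraction_Field.Fract t 1 * a = Fraction_Field.Fract (t * p) 1 / qvar ^ m" by simp
    then show ?thesis unfolding laurent_def by blast
  qed
  have "?s * f i = Fraction_Field.Fract p 1" using s by (simp add: eq_fract)
  then have "?s * r * f i = Fraction_Field.Fract p 1 * r" by (metis mult.assoc mult.commute)
  then have "?s * r * f i \<in> laurent" using lm[OF r(1), of p] by metis
  moreover have "?s * r * f j \<in> laurent" if "j \<in> I" for j using lm r that by (simp add: mult.assoc)
  moreover have "?s * r \<in> laurent" using lm r by simp
  moreover have "ev1 (?s * r) \<noteq> 0" using r s by (simp add: ev1_mult loc_poly laurent_loc)
  ultimately show ?case by blast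
qed

text \<open>For arbitrary elements of k(q) the denominator may vanish at 1, so that only
  \<open>r \<noteq> 0\<close> can be asked. This serves the comparison of a lattice with its
  extension to k(q).\<close>

lemma laurent_denominator: "\<exists>r\<in>laurent. r \<noteq> 0 \<and> r * c \<in> laurent"
proof -
  obtain p s where s: "s \<noteq> 0" "c = Fraction_Field.Fract p s" by (cases c) auto
  have "Fraction_Field.Fract s 1 * c = Fraction_Field.Fract p 1" using s by (simp add: eq_fract)
  moreover have "Fraction_Field.Fract s 1 \<noteq> 0" using s by (simp add: Zero_fract_def eq_fract)
  ultimately show ?thesis using poly_laurent by metis
qed

lemma laurent_mult: "a \<in> laurent \<Longrightarrow> b \<in> laurent \<Longrightarrow> a * b \<in> laurent"
proof -
  assume "a \<in> laurent" "b \<in> laurent"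
  then obtain p m p' m' where "a = Fraction_Field.Fract p 1 / qvar ^ m" "b = Fraction_Field.Fract p' 1 / qvar ^ m'"
    by (auto simp: laurent_def)
  then have "a * b = Fraction_Field.Fract (p * p') 1 / qvar ^ (m + m')" by (simp add: power_add)
  then show ?thesis unfolding laurent_def by blast
qed

lemma laurent_add: "a \<in> laurent \<Longrightarrow> b \<in> laurent \<Longrightarrow> a + b \<in> laurent"
proof -
  assume "a \<in> laurent" "b \<in> laurent"
  then obtain p m p' m' where h: "a = Fraction_Field.Fract p 1 / qvar ^ m" "b = Fraction_Field.Fract p' 1 / qvar ^ m'"
    by (auto simp: laurent_def)
  have e: "qvar ^ m = Fraction_Field.Fract ([:0, 1:] ^ m) 1" for m
    by (induct m) (simp_all add: qvar_def One_fract_def del: mult_pCons_left)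
  have "a + b = (qvar ^ m' * Fraction_Field.Fract p 1 + qvar ^ m * Fraction_Field.Fract p' 1) / qvar ^ (m + m')"
    unfolding h by (simp add: power_add field_simps)
  also have "\<dots> = Fraction_Field.Fract ([:0, 1:] ^ m' * p + [:0, 1:] ^ m * p') 1 / qvar ^ (m + m')"
    by (simp add: e del: mult_pCons_left)
  finally show ?thesis unfolding laurent_def by blast
qed

lemma laurent_0 [simp]: "0 \<in> laurent" and laurent_1 [simp]: "1 \<in> laurent"
  using const_laurent[of 0] const_laurent[of 1] by simp_all

lemma laurent_uminus: "a \<in> laurent \<Longrightarrow> - a \<in> laurent"
  using laurent_mult[OF const_laurent[of "- 1"], of a] 
  by (metis add.inverse_inverse const_1 const_add const_0 add_eq_0_iff mult_minus1)

section \<open>Quadratic ideals\<close>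

definition words :: "nat \<Rightarrow> nat \<Rightarrow> nat list set" where
  "words n p = {w. set w \<subseteq> {..<n} \<and> length w = p}"

lemma words_finite [simp]: "finite (words n p)"
  unfolding words_def by (rule finite_lists_length_eq) simp

lemma words_0 [simp]: "words n 0 = {[]}"
  by (auto simp: words_def)

lemma words_Cons [simp]: "i # w \<in> words n (Suc p) \<longleftrightarrow> i < n \<and> w \<in> words n p"
  by (auto simp: words_def)

lemma words_SucE:
  assumes "w \<in> words n (Suc p)" obtains i v where "w = i # v" "i < n" "v \<in> words n p"
  using assms by (cases w) (auto simp: words_def)

text \<open>Degree \<open>p\<close> of the ideal generated by the space \<open>G\<close> of quadratic forms, by the recursion
  \<open>I\<^sub>p\<^sub>+\<^sub>2 = G \<otimes> V\<^sup>p + V \<otimes> I\<^sub>p\<^sub>+\<^sub>1\<close>; elements of \<open>V\<^sup>p\<close> are given by their coefficients on words.\<close>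

fun in_quad :: "nat \<Rightarrow> ((nat \<Rightarrow> nat \<Rightarrow> 'c) \<Rightarrow> bool) \<Rightarrow> nat \<Rightarrow> (nat list \<Rightarrow> 'c::comm_ring_1) \<Rightarrow> bool" where
  "in_quad n G 0 a \<longleftrightarrow> a [] = 0"
| "in_quad n G (Suc 0) a \<longleftrightarrow> (\<forall>i<n. a [i] = 0)"
| "in_quad n G (Suc (Suc p)) a \<longleftrightarrow>
     (\<exists>\<nu>. (\<forall>v\<in>words n p. G (\<lambda>i j. \<nu> (i # j # v))) \<and>
          (\<forall>i<n. in_quad n G (Suc p) (\<lambda>w. a (i # w) - \<nu> (i # w))))"

text \<open>Quadratic forms are given by all their coefficients \<open>g i j\<close>; only those with \<open>i, j < n\<close> matter.\<close>

definition quad_space :: "nat \<Rightarrow> 'c::comm_ring_1 set \<Rightarrow> ((nat \<Rightarrow> nat \<Rightarrow> 'c) \<Rightarrow> bool) \<Rightarrow> bool" where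
  "quad_space n S G \<longleftrightarrow>
     (\<forall>g h. G g \<longrightarrow> (\<forall>i<n. \<forall>j<n. g i j = h i j) \<longrightarrow> G h) \<and>
     G (\<lambda>i j. 0) \<and>
     (\<forall>g h. G g \<longrightarrow> G h \<longrightarrow> G (\<lambda>i j. g i j + h i j)) \<and>
     (\<forall>c g. c \<in> S \<longrightarrow> G g \<longrightarrow> G (\<lambda>i j. c * g i j))"

lemma quad_spaceD:
  assumes "quad_space n S G"
  shows "G g \<Longrightarrow> (\<And>i j. i < n \<Longrightarrow> j < n \<Longrightarrow> g i j = h i j) \<Longrightarrow> G h"
    and "G (\<lambda>i j. 0)"
    and "G g \<Longrightarrow> G h \<Longrightarrow> G (\<lambda>i j. g i j + h i j)"
    and "c \<in> S \<Longrightarrow> G g \<Longrightarrow> G (\<lambda>i j. c * g i j)"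
  using assms unfolding quad_space_def by blast+

lemma in_quad_cong:
  assumes "quad_space n S G" "in_quad n G p a" "\<And>w. w \<in> words n p \<Longrightarrow> a w = b w"
  shows "in_quad n G p b"
  using assms(2,3)
proof (induction n G p a arbitrary: b rule: in_quad.induct)
  case (3 n G p a)
  obtain \<nu> where nu: "\<forall>v\<in>words n p. G (\<lambda>i j. \<nu> (i # j # v))"
      "\<forall>i<n. in_quad n G (Suc p) (\<lambda>w. a (i # w) - \<nu> (i # w))" using 3(2) by auto
  have "in_quad n G (Suc p) (\<lambda>w. b (i # w) - \<nu> (i # w))" if "i < n" for i
    by (rule 3(1)[of i]) (use that nu 3(3) in auto)
  then show ?case using nu by auto
qed (auto simp: words_def)

lemma in_quad_0: "quad_space n S G \<Longrightarrow> in_quad n G p (\<lambda>w. 0)"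
proof (induction p rule: nat_less_induct)
  case (1 p)
  show ?case
  proof (cases p)
    case (Suc q)
    then show ?thesis
    proof (cases q)
      case (Suc r)
      have "in_quad n G (Suc r) (\<lambda>w. 0)" using 1 Suc \<open>p = Suc q\<close> by simp
      then show ?thesis unfolding \<open>p = Suc q\<close> Suc using quad_spaceD(2)[OF 1(2)]
        by (auto intro!: exI[of _ "\<lambda>w. 0"])
    qed simp
  qed simp
qed

lemma in_quad_add:
  assumes "quad_space n S G" "in_quad n G p a" "in_quad n G p b"
  shows "in_quad n G p (\<lambda>w. a w + b w)"
  using assms
proof (induction n G p a arbitrary: b rule: in_quad.induct)
  case (3 n G p a)
  obtain \<nu> where nu: "\<forall>v\<in>words n p. G (\<lambda>i j. \<nu> (i # j # v))"
      "\<forall>i<n. in_quad n G (Suc p) (\<lambda>w. a (i # w) - \<nu> (i # w))" using 3 by auto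
  obtain \<mu> where mu: "\<forall>v\<in>words n p. G (\<lambda>i j. \<mu> (i # j # v))"
      "\<forall>i<n. in_quad n G (Suc p) (\<lambda>w. b (i # w) - \<mu> (i # w))" using 3 by auto
  have "in_quad n G (Suc p) (\<lambda>w. (a (i # w) - \<nu> (i # w)) + (b (i # w) - \<mu> (i # w)))" if "i < n" for i
    by (rule 3(1)[OF that 3(2)]) (use nu mu that in auto)
  then have "in_quad n G (Suc p) (\<lambda>w. (a (i # w) + b (i # w)) - (\<nu> (i # w) + \<mu> (i # w)))" if "i < n" for i
    using that by (simp add: algebra_simps)
  moreover have "\<forall>v\<in>words n p. G (\<lambda>i j. \<nu> (i # j # v) + \<mu> (i # j # v))"
    using nu mu quad_spaceD(3)[OF 3(2)] by simp
  ultimately show ?case by (auto intro!: exI[of _ "\<lambda>w. \<nu> w + \<mu> w"])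
qed auto

lemma in_quad_smult:
  assumes "quad_space n S G" "c \<in> S" "in_quad n G p a"
  shows "in_quad n G p (\<lambda>w. c * a w)"
  using assms
proof (induction n G p a rule: in_quad.induct)
  case (3 n G p a)
  obtain \<nu> where nu: "\<forall>v\<in>words n p. G (\<lambda>i j. \<nu> (i # j # v))"
      "\<forall>i<n. in_quad n G (Suc p) (\<lambda>w. a (i # w) - \<nu> (i # w))" using 3 by auto
  have "in_quad n G (Suc p) (\<lambda>w. c * (a (i # w) - \<nu> (i # w)))" if "i < n" for i
    using 3(1)[OF that 3(2,3)] nu that by simp
  then have "in_quad n G (Suc p) (\<lambda>w. c * a (i # w) - c * \<nu> (i # w))" if "i < n" for i
    using that by (simp add: algebra_simps)
  moreover have "\<forall>v\<in>words n p. G (\<lambda>i j. c * \<nu> (i # j # v))"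
    using nu quad_spaceD(4)[OF 3(2,3)] by simp
  ultimately show ?case by (auto intro!: exI[of _ "\<lambda>w. c * \<nu> w"])
qed auto

lemma in_quad_diff:
  assumes "quad_space n S G" "- 1 \<in> S" "in_quad n G p a" "in_quad n G p b"
  shows "in_quad n G p (\<lambda>w. a w - b w)"
  using in_quad_add[OF assms(1,3) in_quad_smult[OF assms(1,2,4)]] by simp

lemma in_quad_sum:
  assumes "quad_space n S G" "\<And>i. i \<in> X \<Longrightarrow> in_quad n G p (f i)"
  shows "in_quad n G p (\<lambda>w. \<Sum>i\<in>X. f i w)"
  using assms(2) by (induct X rule: infinite_finite_induct) (auto simp: in_quad_0[OF assms(1)] intro: in_quad_add[OF assms(1)])

text \<open>With \<nu> = 0 in the recursion the element lies in the summand V \<otimes> I. The next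
  lemma is the other summand, where \<nu> is the whole element.\<close>

lemma in_quad_Cons:
  assumes "quad_space n S G" "\<And>i. i < n \<Longrightarrow> in_quad n G p (\<lambda>w. a (i # w))"
  shows "in_quad n G (Suc p) a"
proof (cases p)
  case (Suc q)
  then show ?thesis using assms(2) quad_spaceD(2)[OF assms(1)]
    by (auto intro!: exI[of _ "\<lambda>w. 0"])
qed (use assms in auto)

lemma in_quad_gen:
  assumes "quad_space n S G" "\<And>v. v \<in> words n p \<Longrightarrow> G (\<lambda>i j. \<nu> (i # j # v))"
  shows "in_quad n G (Suc (Suc p)) \<nu>"
  using assms in_quad_0[OF assms(1), of "Suc p"] by (auto intro!: exI[of _ \<nu>])

section \<open>Exactness for symmetric forms\<close>

definition sym_form :: "nat \<Rightarrow> (nat \<Rightarrow> nat \<Rightarrow> 'c) \<Rightarrow> bool" where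
  "sym_form n g \<longleftrightarrow> (\<forall>i<n. \<forall>j<n. g i j = g j i)"

lemma sym_form_space [simp]: "quad_space n UNIV (sym_form n)"
  by (auto simp: quad_space_def sym_form_def)

text \<open>The contraction with the \<open>k\<close>-th basis vector is the odd derivation of the tensor algebra.
  It preserves the ideal generated by the symmetric forms, and Euler's formula holds modulo this
  ideal; together they give the exactness of the Koszul complex of the exterior algebra.\<close>

fun contr :: "nat \<Rightarrow> (nat list \<Rightarrow> 'c::comm_ring_1) \<Rightarrow> nat list \<Rightarrow> 'c" where
  "contr k a [] = a [k]"
| "contr k a (j # v) = a (k # j # v) - contr k (\<lambda>w. a (j # w)) v"

lemma contr_add: "contr k (\<lambda>w. a w + b w) v = contr k a v + contr k b v"
  by (induct k a v arbitrary: b rule: contr.induct) auto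

lemma contr_cong:
  assumes "\<And>w. w \<in> words n (Suc q) \<Longrightarrow> a w = b w" "v \<in> words n q" "k < n"
  shows "contr k a v = contr k b v"
  using assms
proof (induct v arbitrary: a b q)
  case (Cons j v)
  obtain q' where q: "q = Suc q'" using Cons(3) by (cases q) auto
  have "contr k (\<lambda>w. a (j # w)) v = contr k (\<lambda>w. b (j # w)) v"
    using Cons(2-4) q by (intro Cons(1)[of q']) auto
  moreover have "a (k # j # v) = b (k # j # v)" using Cons(2-4) q by simp
  ultimately show ?case by simp
qed (auto simp: words_def)

text \<open>A summand in V \<otimes> I is handled by the sign rule, which moves the contraction past
  the first letter and leaves a contraction of lower degree. In a summand S \<otimes> V^p, with S
  the symmetric forms, the contractions of the first two letters cancel.\<close>

lemma in_quad_contr: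
  assumes "in_quad n (sym_form n) (Suc p) a" "k < n"
  shows "in_quad n (sym_form n) p (contr k a)"
  using assms
proof (induction p arbitrary: a)
  case (Suc p)
  let ?I = "in_quad n (sym_form n)"
  obtain \<nu> where nu: "\<forall>v\<in>words n p. sym_form n (\<lambda>i j. \<nu> (i # j # v))"
      "\<forall>i<n. ?I (Suc p) (\<lambda>w. a (i # w) - \<nu> (i # w))" using Suc by auto
  define b where "b = (\<lambda>w. a w - \<nu> w)"
  have b: "i < n \<Longrightarrow> ?I (Suc p) (\<lambda>w. b (i # w))" for i using nu by (simp add: b_def)
  have "?I (Suc p) (contr k b)"
  proof -
    \<comment> \<open>Families indexed by the first letter are written with \<open>hd\<close> and
      \<open>tl\<close>, because \<open>in_quad\<close> takes one function of the whole
      word.\<close>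
    have "?I (Suc p) (\<lambda>w. contr k (\<lambda>v. b (hd w # v)) (tl w))"
      by (rule in_quad_Cons[OF sym_form_space]) (simp add: Suc b)
    then have "?I (Suc p) (\<lambda>w. b (k # w) - contr k (\<lambda>v. b (hd w # v)) (tl w))"
      by (intro in_quad_diff[OF sym_form_space]) (use b Suc in auto)
    then show ?thesis
      by (rule in_quad_cong[OF sym_form_space]) (auto elim!: words_SucE)
  qed
  moreover have "?I (Suc p) (contr k \<nu>)"
  proof (cases p)
    case 0
    then show ?thesis using nu Suc by (auto simp: sym_form_def)
  next
    case (Suc r)
    have s: "\<nu> (i # j # v) = \<nu> (j # i # v)" if "i < n" "j < n" "v \<in> words n p" for i j v
      using nu that by (auto simp: sym_form_def)
    \<comment> \<open>The leading terms \<open>\<nu> (k # i # j # v)\<close> and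
      \<open>\<nu> (i # k # j # v)\<close> cancel by symmetry; what remains contracts the tail only
      and is therefore again symmetric in i and j.\<close>
    have "contr k \<nu> (i # j # v) = contr k (\<lambda>w. \<nu> (i # j # w)) v \<and>
          contr k (\<lambda>w. \<nu> (i # j # w)) v = contr k (\<lambda>w. \<nu> (j # i # w)) v"
      if "i < n" "j < n" "v \<in> words n r" for i j v
    proof
      show "contr k \<nu> (i # j # v) = contr k (\<lambda>w. \<nu> (i # j # w)) v"
        using s[of k i "j # v"] that \<open>k < n\<close> Suc by simp
      show "contr k (\<lambda>w. \<nu> (i # j # w)) v = contr k (\<lambda>w. \<nu> (j # i # w)) v"
        using s that Suc \<open>k < n\<close> by (intro contr_cong[of n r]) auto
    qed
    then show ?thesis unfolding Suc
      by (intro in_quad_gen[OF sym_form_space]) (auto simp: sym_form_def simp del: contr.simps)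
  qed
  ultimately have "?I (Suc p) (\<lambda>w. contr k b w + contr k \<nu> w)"
    by (rule in_quad_add[OF sym_form_space])
  then show ?case by (simp add: contr_add[symmetric] b_def)
qed auto

text \<open>Contracting with a basis vector and multiplying by it again, summed over the basis, is
  multiplication by the degree on the exterior algebra. In the induction the sign rule leaves the
  term \<open>contr i\<close> of \<open>a (j # _)\<close>; adding the same term with i and j
  exchanged makes it symmetric, and the inductive case for \<open>a (i # _)\<close> removes what was
  added.\<close>

lemma in_quad_euler:
  "in_quad n (sym_form n) (Suc p) (\<lambda>w. of_nat (Suc p) * a w - contr (hd w) a (tl w))"
proof (induction p arbitrary: a)
  case (Suc p)
  let ?I = "in_quad n (sym_form n)"
  let ?\<nu> = "\<lambda>w. contr (hd w) (\<lambda>v. a (hd (tl w) # v)) (tl (tl w)) + contr (hd (tl w)) (\<lambda>v. a (hd w # v)) (tl (tl w))"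
  have "?I (Suc (Suc p)) ?\<nu>"
    by (rule in_quad_gen[OF sym_form_space]) (auto simp: sym_form_def algebra_simps)
  moreover have "?I (Suc (Suc p)) (\<lambda>w. of_nat (Suc p) * a w - contr (hd (tl w)) (\<lambda>v. a (hd w # v)) (tl (tl w)))"
    by (rule in_quad_Cons[OF sym_form_space]) (use Suc in simp)
  ultimately have "?I (Suc (Suc p)) (\<lambda>w. ?\<nu> w + (of_nat (Suc p) * a w - contr (hd (tl w)) (\<lambda>v. a (hd w # v)) (tl (tl w))))"
    by (rule in_quad_add[OF sym_form_space])
  then show ?case
    by (rule in_quad_cong[OF sym_form_space]) (auto elim!: words_SucE simp: algebra_simps)
qed auto

text \<open>With S^m the symmetric tensors and E_m the exterior powers, this is exactness at the
  middle of S^3 \<otimes> E_{p-1} \<rightarrow> S^2 \<otimes> E_p \<rightarrow> V \<otimes> E_{p+1}: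
  the two symmetries of \<eta> generate all permutations of its first three letters. The contracting
  homotopy is contraction of the exterior factor followed by symmetrisation; it inverts the Koszul
  differential up to the total degree p + 2, whence characteristic zero.\<close>

lemma sym_form_exact:
  fixes \<nu> :: "nat list \<Rightarrow> 'k::field_char_0"
  assumes nu: "\<And>v. v \<in> words n p \<Longrightarrow> sym_form n (\<lambda>i j. \<nu> (i # j # v))"
    and I: "\<And>i. i < n \<Longrightarrow> in_quad n (sym_form n) (Suc p) (\<lambda>w. \<nu> (i # w))"
  shows "\<exists>\<eta>. (p = 0 \<longrightarrow> (\<forall>w. \<eta> w = 0)) \<and> (\<forall>v q. p = Suc q \<longrightarrow> v \<in> words n q \<longrightarrow> (\<forall>i<n. sym_form n (\<lambda>j k. \<eta> (i # j # k # v)) \<and>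
                    sym_form n (\<lambda>j k. \<eta> (j # k # i # v)))) \<and>
             (\<forall>i<n. \<forall>j<n. in_quad n (sym_form n) p (\<lambda>w. \<nu> (i # j # w) - \<eta> (i # j # w)))"
proof (cases p)
  case 0
  \<comment> \<open>In the lowest degree there are no relations that could absorb \<nu>, so the
    second hypothesis makes it vanish. There is no third letter either, which is why \<eta> is then
    required to be 0 instead of symmetric.\<close>
  then show ?thesis using I by (auto intro!: exI[of _ "\<lambda>_. 0"])
next
  case (Suc r)
  let ?I = "in_quad n (sym_form n)"
  let ?n2 = "\<lambda>i j w. \<nu> (i # j # w)"
  have s: "?n2 i j w = ?n2 j i w" if "i < n" "j < n" "w \<in> words n p" for i j w
    using nu[OF that(3)] that(1,2) by (auto simp: sym_form_def)
  \<comment> \<open>Each summand contracts the tail of \<nu> with one of the three letters while the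
    other two stay in front; the sum is symmetric because \<nu> is.\<close>
  define \<eta> where "\<eta> = (\<lambda>u. let i = hd u; j = hd (tl u); k = hd (tl (tl u)); v = tl (tl (tl u)) in
     (contr k (?n2 i j) v + contr i (?n2 j k) v + contr j (?n2 i k) v) / of_nat (Suc (Suc p)))"
  have sc: "contr k (?n2 i j) v = contr k (?n2 j i) v" if "i < n" "j < n" "k < n" "v \<in> words n r" for i j k v
    using s that Suc by (intro contr_cong[of n r]) auto
  have 1: "sym_form n (\<lambda>j k. \<eta> (i # j # k # v)) \<and> sym_form n (\<lambda>j k. \<eta> (j # k # i # v))"
    if "v \<in> words n r" "i < n" for i v
  proof -
    have "\<eta> (i # j # k # v) = \<eta> (i # k # j # v) \<and> \<eta> (j # k # i # v) = \<eta> (k # j # i # v)"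
      if "j < n" "k < n" for j k
      using sc[OF that \<open>i < n\<close> \<open>v \<in> words n r\<close>] unfolding \<eta>_def Let_def list.sel by (simp only: add.commute add.left_commute)
    then show ?thesis unfolding sym_form_def by blast
  qed
  have 2: "?I p (\<lambda>w. ?n2 i j w - \<eta> (i # j # w))" if ij: "i < n" "j < n" for i j
  proof -
    have e: "?I p (\<lambda>w. of_nat p * ?n2 i j w - contr (hd w) (?n2 i j) (tl w))"
      unfolding Suc by (rule in_quad_euler)
    have d: "?I p (\<lambda>w. ?n2 l m w - contr m (?n2 l (hd w)) (tl w))" if "l < n" "m < n" for l m
    proof -
      have "?I p (contr m (\<lambda>w. \<nu> (l # w)))" using in_quad_contr[OF I[OF that(1)] that(2)] .
      then show ?thesis unfolding Suc
        by (rule in_quad_cong[OF sym_form_space]) (auto elim!: words_SucE)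
    qed
    \<comment> \<open>Euler's formula in degree p contributes p copies of \<nu>. The hypothesis on
      \<open>\<nu> (i # _)\<close> and on \<open>\<nu> (j # _)\<close>, each contracted once,
      contributes one more copy; together these are the p + 2 by which \<eta> was divided.\<close>
    have "?I p (\<lambda>w. (of_nat p * ?n2 i j w - contr (hd w) (?n2 i j) (tl w)) +
        ((?n2 i j w - contr j (?n2 i (hd w)) (tl w)) + (?n2 j i w - contr i (?n2 j (hd w)) (tl w))))"
      by (intro in_quad_add[OF sym_form_space] e d ij)
    then have "?I p (\<lambda>w. inverse (of_nat (Suc (Suc p))) * ((of_nat p * ?n2 i j w - contr (hd w) (?n2 i j) (tl w)) +
        ((?n2 i j w - contr j (?n2 i (hd w)) (tl w)) + (?n2 j i w - contr i (?n2 j (hd w)) (tl w)))))"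
      by (rule in_quad_smult[OF sym_form_space UNIV_I])
    then show ?thesis
    proof (rule in_quad_cong[OF sym_form_space])
      fix w assume w: "w \<in> words n p"
      then obtain k v where k: "w = k # v" "k < n" "v \<in> words n r" unfolding Suc by (blast elim: words_SucE)
      show "inverse (of_nat (Suc (Suc p))) * ((of_nat p * ?n2 i j w - contr (hd w) (?n2 i j) (tl w)) +
        ((?n2 i j w - contr j (?n2 i (hd w)) (tl w)) + (?n2 j i w - contr i (?n2 j (hd w)) (tl w))))
        = ?n2 i j w - \<eta> (i # j # w)"
      proof -
        have "of_nat (Suc (Suc p)) \<noteq> (0 :: 'k)" by (metis nat.simps(3) of_nat_eq_0_iff)
        moreover have "\<nu> (j # i # k # v) = \<nu> (i # j # k # v)" using s[OF ij w] k by simp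
        ultimately show ?thesis unfolding k \<eta>_def by (simp add: divide_simps del: of_nat_Suc) (simp add: algebra_simps)
      qed
    qed
  qed
  show ?thesis using 1 2 unfolding Suc by (intro exI[of _ \<eta>]) auto
qed

section \<open>Flat deformations of the symmetric forms\<close>

text \<open>\<open>lift2\<close> is flatness of the relations and \<open>lift3\<close> is flatness
  in degree three: a tensor symmetric in all three letters, that is, in the intersection of S
  \<otimes> V and V \<otimes> S for the symmetric forms S, lifts to the intersection of G \<otimes>
  V and V \<otimes> G. It is the only condition beyond degree two.\<close>

locale flat_forms =
  fixes n :: nat and G :: "(nat \<Rightarrow> nat \<Rightarrow> 'k::field_char_0 poly fract) \<Rightarrow> bool"
  assumes space: "quad_space n loc G"
    and G_loc: "G g \<Longrightarrow> i < n \<Longrightarrow> j < n \<Longrightarrow> g i j \<in> loc"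
    and saturated: "G (\<lambda>i j. unif * g i j) \<Longrightarrow> (\<And>i j. i < n \<Longrightarrow> j < n \<Longrightarrow> g i j \<in> loc) \<Longrightarrow> G g"
    and reduction: "G g \<Longrightarrow> sym_form n (\<lambda>i j. ev1 (g i j))"
    and lift2: "sym_form n s \<Longrightarrow> \<exists>g. G g \<and> (\<forall>i<n. \<forall>j<n. ev1 (g i j) = s i j)"
    and lift3: "(\<And>i. i < n \<Longrightarrow> sym_form n (\<lambda>j k. t i j k) \<and> sym_form n (\<lambda>j k. t j k i)) \<Longrightarrow>
      \<exists>h. (\<forall>i<n. G (\<lambda>j k. h i j k) \<and> G (\<lambda>j k. h j k i)) \<and>
          (\<forall>i<n. \<forall>j<n. \<forall>k<n. ev1 (h i j k) = t i j k)"
begin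

lemma in_quad_loc: "in_quad n G p a \<Longrightarrow> w \<in> words n p \<Longrightarrow> a w \<in> loc"
proof (induction p arbitrary: a w rule: nat_less_induct)
  case (1 p)
  show ?case
  proof (cases p)
    case 0
    then show ?thesis using 1 by simp
  next
    case (Suc q)
    show ?thesis
    proof (cases q)
      case 0
      then show ?thesis using 1 Suc by (auto elim!: words_SucE)
    next
      case (Suc r)
      obtain \<nu> where nu: "\<forall>v\<in>words n r. G (\<lambda>i j. \<nu> (i # j # v))"
        "\<forall>i<n. in_quad n G (Suc r) (\<lambda>w. a (i # w) - \<nu> (i # w))" using 1(2) Suc \<open>p = Suc q\<close> by auto
      obtain i j v where w: "w = i # j # v" "i < n" "j < n" "v \<in> words n r"
        using 1(3) Suc \<open>p = Suc q\<close> by (auto elim!: words_SucE)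
      have "a (i # (j # v)) - \<nu> (i # (j # v)) \<in> loc"
        using 1(1)[rule_format, of "Suc r" "\<lambda>w. a (i # w) - \<nu> (i # w)" "j # v"] nu w Suc \<open>p = Suc q\<close> by simp
      moreover have "\<nu> (i # j # v) \<in> loc" using G_loc nu w by blast
      ultimately show ?thesis unfolding w using loc_add by fastforce
    qed
  qed
qed

lemma in_quad_ev1: "in_quad n G p a \<Longrightarrow> in_quad n (sym_form n) p (\<lambda>w. ev1 (a w))"
proof (induction p arbitrary: a rule: nat_less_induct)
  case (1 p)
  show ?case
  proof (cases p)
    case 0
    then show ?thesis using 1 by simp
  next
    case (Suc q)
    show ?thesis
    proof (cases q)
      case 0
      then show ?thesis using 1 Suc by auto
    next
      case (Suc r)
      obtain \<nu> where nu: "\<forall>v\<in>words n r. G (\<lambda>i j. \<nu> (i # j # v))"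
        "\<forall>i<n. in_quad n G (Suc r) (\<lambda>w. a (i # w) - \<nu> (i # w))" using 1(2) Suc \<open>p = Suc q\<close> by auto
      have nl: "\<nu> (i # w) \<in> loc" if "i < n" "w \<in> words n (Suc r)" for i w
        using nu(1) G_loc that by (auto elim!: words_SucE)
      have al: "a (i # w) \<in> loc" if "i < n" "w \<in> words n (Suc r)" for i w
        using in_quad_loc[OF 1(2)] that Suc \<open>p = Suc q\<close> by simp
      have "in_quad n (sym_form n) (Suc r) (\<lambda>w. ev1 (a (i # w)) - ev1 (\<nu> (i # w)))" if "i < n" for i
      proof (rule in_quad_cong[OF sym_form_space])
        show "in_quad n (sym_form n) (Suc r) (\<lambda>w. ev1 (a (i # w) - \<nu> (i # w)))"
          using 1(1) nu(2) that Suc \<open>p = Suc q\<close> by blast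
      qed (simp add: ev1_diff al nl that)
      then show ?thesis unfolding \<open>p = Suc q\<close> Suc using nu reduction
        by (auto intro!: exI[of _ "\<lambda>w. ev1 (\<nu> w)"])
    qed
  qed
qed

text \<open>Both summands of the recursion are lifted independently, so that reduction maps the
  ideal of G onto the ideal of the symmetric forms. The harder half, that an element of the ideal
  with zero reduction is \<open>unif\<close> times an element of the ideal, is the saturation
  below.\<close>

lemma in_quad_lift:
  "in_quad n (sym_form n) p a \<Longrightarrow> \<exists>b. in_quad n G p b \<and> (\<forall>w\<in>words n p. ev1 (b w) = a w)"
proof (induction p arbitrary: a rule: nat_less_induct)
  case (1 p)
  show ?case
  proof (cases p)
    case 0
    then show ?thesis using 1 by (auto intro!: exI[of _ "\<lambda>w. 0"])
  next
    case (Suc q)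
    show ?thesis
    proof (cases q)
      case 0
      then show ?thesis using 1 Suc by (auto intro!: exI[of _ "\<lambda>w. 0"] elim!: words_SucE)
    next
      case (Suc r)
      obtain \<nu> where nu: "\<forall>v\<in>words n r. sym_form n (\<lambda>i j. \<nu> (i # j # v))"
        "\<forall>i<n. in_quad n (sym_form n) (Suc r) (\<lambda>w. a (i # w) - \<nu> (i # w))" using 1(2) Suc \<open>p = Suc q\<close> by auto
      have "\<forall>v\<in>words n r. \<exists>g. G g \<and> (\<forall>i<n. \<forall>j<n. ev1 (g i j) = \<nu> (i # j # v))"
        using nu(1) lift2 by blast
      then obtain g where g: "\<And>v. v \<in> words n r \<Longrightarrow> G (g v)"
        "\<And>v i j. v \<in> words n r \<Longrightarrow> i < n \<Longrightarrow> j < n \<Longrightarrow> ev1 (g v i j) = \<nu> (i # j # v)" by metis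
      have "\<forall>i\<in>{..<n}. \<exists>b. in_quad n G (Suc r) b \<and> (\<forall>w\<in>words n (Suc r). ev1 (b w) = a (i # w) - \<nu> (i # w))"
        using 1(1) nu(2) Suc \<open>p = Suc q\<close> by blast
      then obtain b where b: "\<And>i. i < n \<Longrightarrow> in_quad n G (Suc r) (b i)"
        "\<And>i w. i < n \<Longrightarrow> w \<in> words n (Suc r) \<Longrightarrow> ev1 (b i w) = a (i # w) - \<nu> (i # w)"
        by (metis lessThan_iff)
      let ?\<mu> = "\<lambda>w. g (tl (tl w)) (hd w) (hd (tl w))" and ?b = "\<lambda>w. b (hd w) (tl w)"
      have m: "in_quad n G (Suc (Suc r)) ?\<mu>" by (rule in_quad_gen[OF space]) (simp add: g)
      have bb: "in_quad n G (Suc (Suc r)) ?b" by (rule in_quad_Cons[OF space]) (simp add: b)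
      have "ev1 (?\<mu> w + ?b w) = a w" if "w \<in> words n (Suc (Suc r))" for w
      proof -
        have "ev1 (?\<mu> w + ?b w) = ev1 (?\<mu> w) + ev1 (?b w)"
          using in_quad_loc[OF m that] in_quad_loc[OF bb that] by (rule ev1_add)
        also have "\<dots> = a w" using that g b by (auto elim!: words_SucE)
        finally show ?thesis .
      qed
      then show ?thesis unfolding \<open>p = Suc q\<close> Suc using in_quad_add[OF space m bb] by blast
    qed
  qed
qed

text \<open>If \<open>(q - 1) a = \<nu> + \<mu>\<close> with \<open>\<nu> \<in> G \<otimes> V\<^sup>p\<close> and \<open>\<mu> \<in> V \<otimes> I\<^sub>p\<^sub>+\<^sub>1\<close>, then exactness at
  \<open>q = 1\<close> allows to move \<open>\<nu>\<close> into \<open>V \<otimes> I\<^sub>p\<^sub>+\<^sub>1\<close> up to a multiple of \<open>q - 1\<close>.\<close>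

theorem in_quad_saturated:
  assumes "in_quad n G p (\<lambda>w. unif * a w)" "\<And>w. w \<in> words n p \<Longrightarrow> a w \<in> loc"
  shows "in_quad n G p a"
  using assms
proof (induction p arbitrary: a rule: nat_less_induct)
  case (1 p)
  show ?case
  proof (cases p)
    case 0
    then show ?thesis using 1 by simp
  next
    case (Suc q)
    show ?thesis
    proof (cases q)
      case 0
      then show ?thesis using 1 Suc by auto
    next
      case (Suc r)
      note p = \<open>p = Suc q\<close>[unfolded Suc]
      obtain \<nu> where nu: "\<And>v. v\<in>words n r \<Longrightarrow> G (\<lambda>i j. \<nu> (i # j # v))"
        "\<And>i. i<n \<Longrightarrow> in_quad n G (Suc r) (\<lambda>w. unif * a (i # w) - \<nu> (i # w))" using 1(2) p by auto
      have nl: "\<nu> (i # w) \<in> loc" if "i < n" "w \<in> words n (Suc r)" for i w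
        using nu(1) G_loc that by (auto elim!: words_SucE)
      have al: "a (i # w) \<in> loc" if "i < n" "w \<in> words n (Suc r)" for i w
        using 1(3) that p by simp
      \<comment> \<open>At q = 1 the left side \<open>unif * a\<close> vanishes, so that the
        reduction of \<nu>, which lies in S \<otimes> V^r for the symmetric forms S, also lies in V
        \<otimes> I. This is the situation of \<open>sym_form_exact\<close>.\<close>
      have "\<exists>\<eta>. (r = 0 \<longrightarrow> (\<forall>w. \<eta> w = 0)) \<and> (\<forall>v s. r = Suc s \<longrightarrow> v \<in> words n s \<longrightarrow> (\<forall>i<n. sym_form n (\<lambda>j k. \<eta> (i # j # k # v)) \<and>
                    sym_form n (\<lambda>j k. \<eta> (j # k # i # v)))) \<and>
             (\<forall>i<n. \<forall>j<n. in_quad n (sym_form n) r (\<lambda>w. ev1 (\<nu> (i # j # w)) - \<eta> (i # j # w)))"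
      proof (rule sym_form_exact)
        show "sym_form n (\<lambda>i j. ev1 (\<nu> (i # j # v)))" if "v \<in> words n r" for v
          using reduction nu(1) that by blast
        show "in_quad n (sym_form n) (Suc r) (\<lambda>w. ev1 (\<nu> (i # w)))" if "i < n" for i
        proof (rule in_quad_cong[OF sym_form_space])
          show "in_quad n (sym_form n) (Suc r) (\<lambda>w. - 1 * ev1 (unif * a (i # w) - \<nu> (i # w)))"
            by (rule in_quad_smult[OF sym_form_space UNIV_I]) (rule in_quad_ev1[OF nu(2)[OF that]])
          show "- 1 * ev1 (unif * a (i # w) - \<nu> (i # w)) = ev1 (\<nu> (i # w))" if w: "w \<in> words n (Suc r)" for w
            using nl[OF \<open>i < n\<close> w] al[OF \<open>i < n\<close> w] by (simp add: ev1_diff ev1_mult loc_mult)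
        qed
      qed
      then obtain \<eta> where eta0: "\<And>w. r = 0 \<Longrightarrow> \<eta> w = 0" and eta: "\<And>v s i. r = Suc s \<Longrightarrow> v \<in> words n s \<Longrightarrow> i < n \<Longrightarrow> sym_form n (\<lambda>j k. \<eta> (i # j # k # v)) \<and>
                    sym_form n (\<lambda>j k. \<eta> (j # k # i # v))"
         "\<And>i j. i < n \<Longrightarrow> j < n \<Longrightarrow> in_quad n (sym_form n) r (\<lambda>w. ev1 (\<nu> (i # j # w)) - \<eta> (i # j # w))"
        apply (elim exE conjE) subgoal premises prems for \<eta> using prems by (intro prems(1)[of \<eta>]) auto done
      \<comment> \<open>The lift of \<eta> by \<open>lift3\<close> lies in both summands: it is a
        form in G in its first two letters, and a form in G in its second and third letter, hence in
        V \<otimes> I.\<close>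
      have "\<exists>\<nu>1. (\<forall>w\<in>words n r. G (\<lambda>i j. \<nu>1 (i # j # w))) \<and>
          (\<forall>i<n. in_quad n G (Suc r) (\<lambda>w. \<nu>1 (i # w))) \<and> (\<forall>w\<in>words n (Suc (Suc r)). ev1 (\<nu>1 w) = \<eta> w)"
      proof (cases r)
        case 0
        then show ?thesis using eta0 quad_spaceD(2)[OF space] in_quad_0[OF space]
          by (intro exI[of _ "\<lambda>w. 0"]) auto
      next
        case (Suc s)
        have "\<forall>v\<in>words n s. \<exists>h. (\<forall>i<n. G (\<lambda>j k. h i j k) \<and> G (\<lambda>j k. h j k i)) \<and>
          (\<forall>i<n. \<forall>j<n. \<forall>k<n. ev1 (h i j k) = \<eta> (i # j # k # v))"
          using eta(1)[OF Suc] by (intro ballI lift3) blast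
        then obtain h where h: "\<And>v i. v \<in> words n s \<Longrightarrow> i < n \<Longrightarrow> G (\<lambda>j k. h v i j k) \<and> G (\<lambda>j k. h v j k i)"
          "\<And>v i j k. v \<in> words n s \<Longrightarrow> i < n \<Longrightarrow> j < n \<Longrightarrow> k < n \<Longrightarrow> ev1 (h v i j k) = \<eta> (i # j # k # v)" by metis
        let ?h = "\<lambda>w. h (tl (tl (tl w))) (hd w) (hd (tl w)) (hd (tl (tl w)))"
        have "in_quad n G (Suc r) (\<lambda>w. ?h (i # w))" if "i < n" for i
          unfolding Suc by (rule in_quad_gen[OF space]) (simp add: h that)
        moreover have "G (\<lambda>i j. ?h (i # j # w))" if "w \<in> words n r" for w
          using that h unfolding Suc by (auto elim!: words_SucE)
        moreover have "ev1 (?h w) = \<eta> w" if "w \<in> words n (Suc (Suc r))" for w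
          using that h unfolding Suc by (auto elim!: words_SucE)
        ultimately show ?thesis by (intro exI[of _ ?h]) blast
      qed
      then obtain \<nu>1 where n1: "\<And>w. w \<in> words n r \<Longrightarrow> G (\<lambda>i j. \<nu>1 (i # j # w))"
          "\<And>i. i<n \<Longrightarrow> in_quad n G (Suc r) (\<lambda>w. \<nu>1 (i # w))"
          "\<And>w. w\<in>words n (Suc (Suc r)) \<Longrightarrow> ev1 (\<nu>1 w) = \<eta> w" by blast
      have n1l: "\<nu>1 (i # w) \<in> loc" if "i < n" "w \<in> words n (Suc r)" for i w
        using n1(1) G_loc that by (auto elim!: words_SucE)
      have "\<forall>i j. \<exists>b. i < n \<longrightarrow> j < n \<longrightarrow> in_quad n G r b \<and>
          (\<forall>w\<in>words n r. ev1 (b w) = ev1 (\<nu> (i # j # w)) - \<eta> (i # j # w))"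
        using in_quad_lift[OF eta(2)] by blast
      then obtain b where b: "\<And>i j. i < n \<Longrightarrow> j < n \<Longrightarrow> in_quad n G r (b i j)"
         "\<And>i j w. i < n \<Longrightarrow> j < n \<Longrightarrow> w \<in> words n r \<Longrightarrow> ev1 (b i j w) = ev1 (\<nu> (i # j # w)) - \<eta> (i # j # w)" by metis
      \<comment> \<open>The symmetrised unit matrices: a symmetric form is the combination of the
        \<open>E l m\<close> with its own entries as coefficients, also on the diagonal, thanks to
        the factor 1/2. Their lifts to G allow the correction below to stay inside G \<otimes>
        V^r.\<close>
      define E where "E = (\<lambda>(l::nat) (m::nat) (i::nat) (j::nat). ((if l = i \<and> m = j then 1 else 0) + (if l = j \<and> m = i then 1 else 0)) / (2 :: 'k))"
      have "\<forall>l m. \<exists>g. G g \<and> (\<forall>i<n. \<forall>j<n. ev1 (g i j) = E l m i j)"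
        by (intro allI lift2) (auto simp: sym_form_def E_def)
      then obtain g where g: "\<And>l m. G (g l m)"
        "\<And>l m i j. i < n \<Longrightarrow> j < n \<Longrightarrow> ev1 (g l m i j) = E l m i j" by metis
      \<comment> \<open>In its first two letters \<mu> is a combination of the forms
        \<open>g l m\<close> of G, and in its tail a combination of the elements
        \<open>b l m\<close> of the ideal. So it lies in both summands as well, and it takes care of
        \<nu> - \<eta>.\<close>
      define \<mu> where "\<mu> = (\<lambda>w. \<Sum>l<n. \<Sum>m<n. b l m (tl (tl w)) * g l m (hd w) (hd (tl w)))"
      have gl: "i < n \<Longrightarrow> j < n \<Longrightarrow> g l m i j \<in> loc" for l m i j using G_loc g by blast
      have bl: "i < n \<Longrightarrow> j < n \<Longrightarrow> w \<in> words n r \<Longrightarrow> b i j w \<in> loc" for i j w using in_quad_loc b by blast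
      have Gsum: "G (\<lambda>i j. \<Sum>x\<in>X. f x i j)" if "finite X" "\<And>x. x \<in> X \<Longrightarrow> G (f x)" for X :: "nat set" and f
        using that by (induct X) (auto intro: quad_spaceD(2,3)[OF space])
      have m1: "G (\<lambda>i j. \<mu> (i # j # w))" if "w \<in> words n r" for w
        unfolding \<mu>_def list.sel by (intro Gsum quad_spaceD(4)[OF space] g bl that) auto
      have m2: "in_quad n G (Suc r) (\<lambda>w. \<mu> (i # w))" if "i < n" for i
      proof (rule in_quad_Cons[OF space])
        fix j assume "j < n"
        show "in_quad n G r (\<lambda>w. \<mu> (i # j # w))"
          unfolding \<mu>_def list.sel using \<open>i < n\<close> \<open>j < n\<close>
          by (intro in_quad_sum[OF space]) (subst mult.commute, intro in_quad_smult[OF space] b gl, auto)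
      qed
      have ml: "\<mu> (i # w) \<in> loc" if "i < n" "w \<in> words n (Suc r)" for i w
        using m1 G_loc that by (auto elim!: words_SucE)
      have m3: "ev1 (\<mu> w) = ev1 (\<nu> w) - \<eta> w" if ww: "w \<in> words n (Suc (Suc r))" for w
      proof -
        obtain i j v where w: "w = i # j # v" "i < n" "j < n" "v \<in> words n r" using ww by (auto elim!: words_SucE)
        let ?e = "\<lambda>l m. ev1 (\<nu> (l # m # v)) - \<eta> (l # m # v)"
        have sy: "?e j i = ?e i j"
        proof -
          have "sym_form n (\<lambda>i j. ev1 (\<nu> (i # j # v)))" using reduction nu(1) w(4) by blast
          moreover have "\<eta> (j # i # v) = \<eta> (i # j # v)"
          proof (cases r)
            case (Suc s)
            then obtain k u where "v = k # u" "k < n" "u \<in> words n s" using w(4) by (auto elim!: words_SucE)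
            then show ?thesis using eta(1)[OF Suc, of u k] w by (auto simp: sym_form_def)
          qed (simp add: eta0)
          ultimately show ?thesis using w by (auto simp: sym_form_def)
        qed
        have "ev1 (\<mu> w) = (\<Sum>l<n. \<Sum>m<n. ?e l m * E l m i j)"
        proof -
          have "b l m v * g l m i j \<in> loc \<and> ev1 (b l m v * g l m i j) = ?e l m * E l m i j"
            if "l < n" "m < n" for l m
            using bl[OF that w(4)] gl[OF w(2,3), of l m] b(2)[OF that w(4)] g(2)[OF w(2,3), of l m]
            by (simp add: ev1_mult loc_mult)
          then show ?thesis unfolding \<mu>_def w list.sel
            by (subst ev1_sum, force intro: loc_sum, intro sum.cong refl, subst ev1_sum) auto
        qed
        also have "\<dots> = (\<Sum>l<n. \<Sum>m<n. (if m = j then if l = i then ?e l m / 2 else 0 else 0)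
            + (if m = i then if l = j then ?e l m / 2 else 0 else 0))"
          by (intro sum.cong refl) (auto simp: E_def)
        also have "\<dots> = ?e i j / 2 + ?e j i / 2"
          using w by (simp add: sum.distrib)
        also have "\<dots> = ?e i j" unfolding sy by simp
        finally show ?thesis using w by simp
      qed
      \<comment> \<open>After the correction by \<mu> and \<nu>1 the part in G \<otimes> V^r has
        zero reduction; the hypothesis that G is saturated keeps the quotient in G.\<close>
      define \<nu>2 where "\<nu>2 = (\<lambda>w. (\<nu> w - (\<mu> w + \<nu>1 w)) / unif)"
      have eq: "unif * \<nu>2 w = \<nu> w - (\<mu> w + \<nu>1 w)" for w by (simp add: \<nu>2_def)
      have n2l: "\<nu>2 (i # w) \<in> loc" if "i < n" "w \<in> words n (Suc r)" for i w
        unfolding \<nu>2_def using m3[of "i # w"] n1(3)[of "i # w"] that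
        by (intro ev1_eq_0) (auto simp: ev1_diff ev1_add loc_add loc_diff ml n1l nl)
      have G2: "G (\<lambda>i j. \<nu>2 (i # j # w))" if "w \<in> words n r" for w
      proof (rule saturated)
        have "G (\<lambda>i j. \<nu> (i # j # w) + (- 1) * (\<mu> (i # j # w) + \<nu>1 (i # j # w)))"
          by (intro quad_spaceD(3,4)[OF space] nu m1 n1 that) (simp add: loc_uminus)
        then show "G (\<lambda>i j. unif * \<nu>2 (i # j # w))"
          unfolding eq by (simp only: diff_conv_add_uminus mult_minus1)
      qed (use n2l that in auto)
      \<comment> \<open>The corrections taken from the first summand are given to the second one,
        where they also lie; the remainder is \<open>unif\<close> times an integral element of lower
        degree, to which the induction applies.\<close>
      have "in_quad n G (Suc r) (\<lambda>w. a (i # w) - \<nu>2 (i # w))" if i: "i < n" for i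
      proof (rule 1(1)[rule_format])
        have "in_quad n G (Suc r) (\<lambda>w. (unif * a (i # w) - \<nu> (i # w)) + (\<mu> (i # w) + \<nu>1 (i # w)))"
          by (intro in_quad_add[OF space] nu m2 n1 i)
        then show "in_quad n G (Suc r) (\<lambda>w. unif * (a (i # w) - \<nu>2 (i # w)))"
          unfolding right_diff_distrib eq by (simp add: algebra_simps)
      qed (use p in \<open>auto intro: loc_diff al n2l i\<close>)
      then show ?thesis unfolding p using G2 by auto
    qed
  qed
qed

end

section \<open>Algebras, monoid algebras and quotients\<close>

definition coeff_ring :: "'f::comm_ring_1 set \<Rightarrow> bool" where
  "coeff_ring S \<longleftrightarrow> 0 \<in> S \<and> 1 \<in> S \<and> (\<forall>a\<in>S. \<forall>b\<in>S. a + b \<in> S \<and> a * b \<in> S) \<and> (\<forall>a\<in>S. - a \<in> S)"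

lemma coeff_ringD:
  assumes "coeff_ring S"
  shows "0 \<in> S" "1 \<in> S" "a \<in> S \<Longrightarrow> b \<in> S \<Longrightarrow> a + b \<in> S" "a \<in> S \<Longrightarrow> b \<in> S \<Longrightarrow> a * b \<in> S" "a \<in> S \<Longrightarrow> - a \<in> S"
  using assms by (auto simp: coeff_ring_def)

lemma coeff_ring_sum: "coeff_ring S \<Longrightarrow> (\<And>i. i \<in> I \<Longrightarrow> f i \<in> S) \<Longrightarrow> sum f I \<in> S"
  by (induct I rule: infinite_finite_induct) (auto simp: coeff_ring_def)

lemma coeff_ring_UNIV [simp]: "coeff_ring UNIV" and coeff_ring_laurent [simp]: "coeff_ring laurent"
  by (auto simp: coeff_ring_def laurent_add laurent_mult laurent_uminus)

lemma scalars_sel [simp]: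
  "carrier (scalars S) = S" "a \<otimes>\<^bsub>scalars S\<^esub> b = a * b" "\<one>\<^bsub>scalars S\<^esub> = 1" "\<zero>\<^bsub>scalars S\<^esub> = 0"
  "a \<oplus>\<^bsub>scalars S\<^esub> b = a + b"
  by (simp_all add: scalars_def)

lemma scalars_cring: "coeff_ring S \<Longrightarrow> cring (scalars S)"
  by (intro cringI abelian_groupI comm_monoidI)
    (auto simp: coeff_ring_def algebra_simps, metis add.right_inverse)

locale coeff_algebra = assoc_algebra "scalars S" A
  for S :: "'f::comm_ring_1 set" and A :: "('f, 'a, 'm) module_scheme" (structure)
begin

lemma S: "coeff_ring S"
proof -
  interpret R: cring "scalars S" by unfold_locales
  have "- a \<in> S" if "a \<in> S" for a
  proof -
    have "\<ominus>\<^bsub>scalars S\<^esub> a \<in> S \<and> a + \<ominus>\<^bsub>scalars S\<^esub> a = 0" using that R.r_neg[of a] R.a_inv_closed[of a] by simp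
    then show ?thesis by (metis add_eq_0_iff)
  qed
  then show ?thesis using R.zero_closed R.one_closed R.a_closed R.m_closed unfolding coeff_ring_def by simp
qed

lemma sm_closed [simp, intro]: "c \<in> S \<Longrightarrow> a \<in> carrier A \<Longrightarrow> c \<odot> a \<in> carrier A"
  and sm_add: "c \<in> S \<Longrightarrow> d \<in> S \<Longrightarrow> a \<in> carrier A \<Longrightarrow> (c + d) \<odot> a = c \<odot> a \<oplus> d \<odot> a"
  and sm_add_r: "c \<in> S \<Longrightarrow> a \<in> carrier A \<Longrightarrow> b \<in> carrier A \<Longrightarrow> c \<odot> (a \<oplus> b) = c \<odot> a \<oplus> c \<odot> b"
  and sm_mult: "c \<in> S \<Longrightarrow> d \<in> S \<Longrightarrow> a \<in> carrier A \<Longrightarrow> (c * d) \<odot> a = c \<odot> (d \<odot> a)"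
  and sm_1 [simp]: "a \<in> carrier A \<Longrightarrow> 1 \<odot> a = a"
  and sm_ml: "c \<in> S \<Longrightarrow> a \<in> carrier A \<Longrightarrow> b \<in> carrier A \<Longrightarrow> (c \<odot> a) \<otimes> b = c \<odot> (a \<otimes> b)"
  and sm_mr: "c \<in> S \<Longrightarrow> a \<in> carrier A \<Longrightarrow> b \<in> carrier A \<Longrightarrow> a \<otimes> (c \<odot> b) = c \<odot> (a \<otimes> b)"
  and sm_r_0 [simp]: "c \<in> S \<Longrightarrow> c \<odot> \<zero> = \<zero>"
  and sm_l_0 [simp]: "a \<in> carrier A \<Longrightarrow> 0 \<odot> a = \<zero>"
  using smult_closed[of c a] smult_l_distr[of c d a] smult_r_distr[of c a b] smult_assoc1[of c d a] smult_one[of a]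
    smult_mult_left[of c a b] smult_mult_right[of c a b] smult_r_null[of c] smult_l_null[of a] by simp_all

lemma sm_minus: "c \<in> S \<Longrightarrow> a \<in> carrier A \<Longrightarrow> (- c) \<odot> a = \<ominus> (c \<odot> a)"
proof -
  assume h: "c \<in> S" "a \<in> carrier A"
  have "(- c) \<odot> a \<oplus> c \<odot> a = \<zero>" using h sm_add[of "- c" c a] coeff_ringD(5)[OF S] by simp
  then show ?thesis using h coeff_ringD(5)[OF S] by (intro minus_equality[symmetric]) auto
qed

lemma sm_minus_r: "c \<in> S \<Longrightarrow> a \<in> carrier A \<Longrightarrow> c \<odot> (\<ominus> a) = \<ominus> (c \<odot> a)"
proof -
  assume h: "c \<in> S" "a \<in> carrier A"
  have "c \<odot> (\<ominus> a) \<oplus> c \<odot> a = \<zero>" using h sm_add_r[of c "\<ominus> a" a] by (simp add: l_neg)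
  then show ?thesis using h by (intro minus_equality[symmetric]) auto
qed

lemma sm_diff_r: "c \<in> S \<Longrightarrow> a \<in> carrier A \<Longrightarrow> b \<in> carrier A \<Longrightarrow> c \<odot> (a \<ominus> b) = c \<odot> a \<ominus> c \<odot> b"
  by (simp add: a_minus_def sm_add_r sm_minus_r)

lemma minus_sm: "a \<in> carrier A \<Longrightarrow> \<ominus> a = (- 1) \<odot> a"
  using sm_minus[of 1 a] coeff_ringD[OF S] by simp

lemma sm_finsum: "c \<in> S \<Longrightarrow> f \<in> I \<rightarrow> carrier A \<Longrightarrow> c \<odot> (\<Oplus>i\<in>I. f i) = (\<Oplus>i\<in>I. c \<odot> f i)"
proof (induct I rule: infinite_finite_induct)
  case (insert i I)
  then have "f i \<in> carrier A" "f \<in> I \<rightarrow> carrier A" "(\<lambda>i. c \<odot> f i) \<in> I \<rightarrow> carrier A" "(\<Oplus>i\<in>I. f i) \<in> carrier A" by auto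
  then show ?case using insert by (simp add: sm_add_r)
qed (auto simp: finsum_infinite)

end

lemma linear_mapD:
  assumes "linear_map S A B h"
  shows "a \<in> carrier A \<Longrightarrow> h a \<in> carrier B"
    and "a \<in> carrier A \<Longrightarrow> b \<in> carrier A \<Longrightarrow> h (a \<oplus>\<^bsub>A\<^esub> b) = h a \<oplus>\<^bsub>B\<^esub> h b"
    and "c \<in> S \<Longrightarrow> a \<in> carrier A \<Longrightarrow> h (c \<odot>\<^bsub>A\<^esub> a) = c \<odot>\<^bsub>B\<^esub> h a"
  using assms by (auto simp: linear_map_def)

lemma linear_mapI:
  assumes "\<And>a. a \<in> carrier A \<Longrightarrow> h a \<in> carrier B"
    and "\<And>a b. a \<in> carrier A \<Longrightarrow> b \<in> carrier A \<Longrightarrow> h (a \<oplus>\<^bsub>A\<^esub> b) = h a \<oplus>\<^bsub>B\<^esub> h b"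
    and "\<And>c a. c \<in> S \<Longrightarrow> a \<in> carrier A \<Longrightarrow> h (c \<odot>\<^bsub>A\<^esub> a) = c \<odot>\<^bsub>B\<^esub> h a"
  shows "linear_map S A B h"
  using assms by (auto simp: linear_map_def)

locale additive = A: ring A + B: ring B for A B +
  fixes h
  assumes closed [simp]: "a \<in> carrier A \<Longrightarrow> h a \<in> carrier B"
    and add: "a \<in> carrier A \<Longrightarrow> b \<in> carrier A \<Longrightarrow> h (a \<oplus>\<^bsub>A\<^esub> b) = h a \<oplus>\<^bsub>B\<^esub> h b"
begin

lemma zero [simp]: "h \<zero>\<^bsub>A\<^esub> = \<zero>\<^bsub>B\<^esub>"
proof -
  have "h \<zero>\<^bsub>A\<^esub> \<oplus>\<^bsub>B\<^esub> h \<zero>\<^bsub>A\<^esub> = h \<zero>\<^bsub>A\<^esub> \<oplus>\<^bsub>B\<^esub> \<zero>\<^bsub>B\<^esub>" using add[of "\<zero>\<^bsub>A\<^esub>" "\<zero>\<^bsub>A\<^esub>"] by simp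
  then show ?thesis by (simp del: B.r_zero)
qed

lemma minus: "a \<in> carrier A \<Longrightarrow> h (\<ominus>\<^bsub>A\<^esub> a) = \<ominus>\<^bsub>B\<^esub> h a"
  using add[of "\<ominus>\<^bsub>A\<^esub> a" a] by (intro B.minus_equality[symmetric]) (auto simp: A.l_neg)

lemma diff: "a \<in> carrier A \<Longrightarrow> b \<in> carrier A \<Longrightarrow> h (a \<ominus>\<^bsub>A\<^esub> b) = h a \<ominus>\<^bsub>B\<^esub> h b"
  by (simp add: a_minus_def add minus)

lemma finsum: "f \<in> I \<rightarrow> carrier A \<Longrightarrow> h (\<Oplus>\<^bsub>A\<^esub>i\<in>I. f i) = (\<Oplus>\<^bsub>B\<^esub>i\<in>I. h (f i))"
proof (induct I rule: infinite_finite_induct)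
  case (insert i I)
  then have "f i \<in> carrier A" "f \<in> I \<rightarrow> carrier A" "(\<lambda>i. h (f i)) \<in> I \<rightarrow> carrier B" "(\<Oplus>\<^bsub>A\<^esub>i\<in>I. f i) \<in> carrier A" by (auto simp: Pi_iff)
  then show ?case using insert by (simp add: add)
qed (auto simp: A.finsum_infinite B.finsum_infinite)

end

lemma linear_additive: "ring A \<Longrightarrow> ring B \<Longrightarrow> linear_map S A B h \<Longrightarrow> additive A B h"
  by (simp add: additive_def additive_axioms_def linear_map_def)

definition algebra_hom ::
  "'f set \<Rightarrow> ('f, 'a, 'm) module_scheme \<Rightarrow> ('f, 'b, 'n) module_scheme \<Rightarrow> ('a \<Rightarrow> 'b) \<Rightarrow> bool" where
  "algebra_hom S A B h \<longleftrightarrow> linear_map S A B h \<and> h \<one>\<^bsub>A\<^esub> = \<one>\<^bsub>B\<^esub> \<and>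
     (\<forall>a\<in>carrier A. \<forall>b\<in>carrier A. h (a \<otimes>\<^bsub>A\<^esub> b) = h a \<otimes>\<^bsub>B\<^esub> h b)"

lemma algebra_isoI:
  assumes "algebra_hom S A B h" "inj_on h (carrier A)" "carrier B \<subseteq> h ` carrier A"
  shows "h \<in> algebra_iso S A B"
  using assms unfolding algebra_iso_def ring_iso_def ring_hom_def algebra_hom_def linear_map_def bij_betw_def
  by auto

lemma algebra_isoD:
  assumes "h \<in> algebra_iso S A B"
  shows "algebra_hom S A B h" "inj_on h (carrier A)" "h ` carrier A = carrier B"
  using assms unfolding algebra_iso_def ring_iso_def ring_hom_def algebra_hom_def linear_map_def bij_betw_def
  by auto

locale monoid_algebra_loc = monoid G for S :: "'f::comm_ring_1 set" and G :: "('g, 'm) monoid_scheme" (structure) +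
  assumes SS: "coeff_ring S"
begin

abbreviation M where "M \<equiv> monoid_algebra S G"

lemma M_sel [simp]:
  "\<one>\<^bsub>M\<^esub> = basis_elt \<one>" "\<zero>\<^bsub>M\<^esub> = (\<lambda>z. 0)" "f \<oplus>\<^bsub>M\<^esub> g = (\<lambda>z. f z + g z)" "c \<odot>\<^bsub>M\<^esub> f = (\<lambda>z. c * f z)"
  by (simp_all add: monoid_algebra_def)

lemma carrier_M: "f \<in> carrier M \<longleftrightarrow> finite (supp f) \<and> supp f \<subseteq> carrier G \<and> (\<forall>z. f z \<in> S)"
  by (auto simp: monoid_algebra_def)

lemma mult_M:
  assumes "finite X" "finite Y" "supp f \<subseteq> X" "supp g \<subseteq> Y"
  shows "(f \<otimes>\<^bsub>M\<^esub> g) z = (\<Sum>u\<in>X. \<Sum>v\<in>Y. if u \<otimes> v = z then f u * g v else 0)"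
proof -
  have "(f \<otimes>\<^bsub>M\<^esub> g) z = (\<Sum>(u, v)\<in>{(u, v). u \<in> supp f \<and> v \<in> supp g \<and> u \<otimes> v = z}. f u * g v)"
    by (simp add: monoid_algebra_def)
  also have "\<dots> = (\<Sum>(u, v)\<in>X \<times> Y. if u \<otimes> v = z then f u * g v else 0)"
    by (rule sum.mono_neutral_cong_left) (use assms in \<open>auto simp: supp_def subset_iff split: if_splits\<close>)
  finally show ?thesis by (simp add: sum.cartesian_product)
qed

lemma supp_mult_M: "supp (f \<otimes>\<^bsub>M\<^esub> g) \<subseteq> (\<lambda>(u, v). u \<otimes> v) ` (supp f \<times> supp g)"
proof
  fix z assume "z \<in> supp (f \<otimes>\<^bsub>M\<^esub> g)"
  then have "(\<Sum>(u, v)\<in>{(u, v). u \<in> supp f \<and> v \<in> supp g \<and> u \<otimes> v = z}. f u * g v) \<noteq> 0"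
    by (simp add: monoid_algebra_def supp_def)
  then have "{(u, v). u \<in> supp f \<and> v \<in> supp g \<and> u \<otimes> v = z} \<noteq> {}" by (metis sum.empty)
  then show "z \<in> (\<lambda>(u, v). u \<otimes> v) ` (supp f \<times> supp g)" by force
qed

lemma mult_closed_M: "f \<in> carrier M \<Longrightarrow> g \<in> carrier M \<Longrightarrow> f \<otimes>\<^bsub>M\<^esub> g \<in> carrier M"
proof -
  assume h: "f \<in> carrier M" "g \<in> carrier M"
  have "finite (supp (f \<otimes>\<^bsub>M\<^esub> g))" by (rule finite_subset[OF supp_mult_M]) (use h in \<open>auto simp: carrier_M\<close>)
  moreover have "supp (f \<otimes>\<^bsub>M\<^esub> g) \<subseteq> carrier G" using supp_mult_M[of f g] h by (force simp: carrier_M)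
  moreover have "(f \<otimes>\<^bsub>M\<^esub> g) z \<in> S" for z
    using h coeff_ringD[OF SS]
    by (subst mult_M[of "supp f" "supp g"]) (auto simp: carrier_M intro!: coeff_ring_sum[OF SS])
  ultimately show ?thesis by (auto simp: carrier_M)
qed

lemma mult_assoc_M:
  assumes f: "f \<in> carrier M" and g: "g \<in> carrier M" and h: "h \<in> carrier M"
  shows "(f \<otimes>\<^bsub>M\<^esub> g) \<otimes>\<^bsub>M\<^esub> h = f \<otimes>\<^bsub>M\<^esub> (g \<otimes>\<^bsub>M\<^esub> h)"
proof
  fix z
  let ?X = "supp f" and ?Y = "supp g" and ?Z = "supp h"
  let ?XY = "(\<lambda>(u, v). u \<otimes> v) ` (?X \<times> ?Y)" and ?YZ = "(\<lambda>(u, v). u \<otimes> v) ` (?Y \<times> ?Z)"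
  have fin: "finite ?X" "finite ?Y" "finite ?Z" "finite ?XY" "finite ?YZ" using f g h by (auto simp: carrier_M)
  have sub: "?X \<subseteq> carrier G" "?Y \<subseteq> carrier G" "?Z \<subseteq> carrier G" using f g h by (auto simp: carrier_M)
  have e: "(if P then (\<Sum>u\<in>X. \<Sum>v\<in>Y. if Q u v then k u v else 0) * c else 0) =
      (\<Sum>u\<in>X. \<Sum>v\<in>Y. if Q u v then (if P then k u v * c else 0) else 0)"
    for P Q k and c :: 'f and X Y :: "'g set"
  proof (cases P)
    case True
    then show ?thesis unfolding sum_distrib_right sum_distrib_left if_P[OF True]
      by (intro sum.cong refl) (auto simp: mult.assoc)
  qed (simp cong: if_cong)
  have e': "(if P then c * (\<Sum>u\<in>X. \<Sum>v\<in>Y. if Q u v then r u * s v else 0) else 0) =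
      (\<Sum>u\<in>X. \<Sum>v\<in>Y. if Q u v then (if P then c * r u * s v else 0) else 0)"
    for P Q r s and c :: 'f and X Y :: "'g set"
  proof (cases P)
    case True
    then show ?thesis unfolding sum_distrib_right sum_distrib_left if_P[OF True]
      by (intro sum.cong refl) (auto simp: mult.assoc)
  qed (simp cong: if_cong)
  have "((f \<otimes>\<^bsub>M\<^esub> g) \<otimes>\<^bsub>M\<^esub> h) z = (\<Sum>t\<in>?XY. \<Sum>w\<in>?Z. if t \<otimes> w = z then (f \<otimes>\<^bsub>M\<^esub> g) t * h w else 0)"
    by (rule mult_M) (use fin supp_mult_M in auto)
  also have "\<dots> = (\<Sum>t\<in>?XY. \<Sum>w\<in>?Z. \<Sum>u\<in>?X. \<Sum>v\<in>?Y. if u \<otimes> v = t then (if t \<otimes> w = z then f u * g v * h w else 0) else 0)"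
    unfolding mult_M[of ?X ?Y f g, OF fin(1,2) order_refl order_refl] e ..
  also have "\<dots> = (\<Sum>w\<in>?Z. \<Sum>u\<in>?X. \<Sum>v\<in>?Y. \<Sum>t\<in>?XY. if u \<otimes> v = t then (if t \<otimes> w = z then f u * g v * h w else 0) else 0)"
    by (simp only: sum.swap[where A = ?XY])
  also have "\<dots> = (\<Sum>w\<in>?Z. \<Sum>u\<in>?X. \<Sum>v\<in>?Y. if u \<otimes> v \<otimes> w = z then f u * g v * h w else 0)"
    by (intro sum.cong refl) (subst sum.delta', use fin in auto)
  finally have 1: "((f \<otimes>\<^bsub>M\<^esub> g) \<otimes>\<^bsub>M\<^esub> h) z = \<dots>" .
  have "(f \<otimes>\<^bsub>M\<^esub> (g \<otimes>\<^bsub>M\<^esub> h)) z = (\<Sum>u\<in>?X. \<Sum>t\<in>?YZ. if u \<otimes> t = z then f u * (g \<otimes>\<^bsub>M\<^esub> h) t else 0)"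
    by (rule mult_M) (use fin supp_mult_M in auto)
  also have "\<dots> = (\<Sum>u\<in>?X. \<Sum>t\<in>?YZ. \<Sum>v\<in>?Y. \<Sum>w\<in>?Z. if v \<otimes> w = t then (if u \<otimes> t = z then f u * g v * h w else 0) else 0)"
    unfolding mult_M[of ?Y ?Z g h, OF fin(2,3) order_refl order_refl] e' ..
  also have "\<dots> = (\<Sum>u\<in>?X. \<Sum>v\<in>?Y. \<Sum>w\<in>?Z. \<Sum>t\<in>?YZ. if v \<otimes> w = t then (if u \<otimes> t = z then f u * g v * h w else 0) else 0)"
    by (simp only: sum.swap[where A = ?YZ])
  also have "\<dots> = (\<Sum>u\<in>?X. \<Sum>v\<in>?Y. \<Sum>w\<in>?Z. if u \<otimes> v \<otimes> w = z then f u * g v * h w else 0)"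
    by (intro sum.cong refl) (subst sum.delta', use fin sub in \<open>auto simp: m_assoc subset_iff\<close>)
  also have "\<dots> = (\<Sum>w\<in>?Z. \<Sum>u\<in>?X. \<Sum>v\<in>?Y. if u \<otimes> v \<otimes> w = z then f u * g v * h w else 0)"
    by (simp only: sum.swap[where A = ?Z])
  finally show "((f \<otimes>\<^bsub>M\<^esub> g) \<otimes>\<^bsub>M\<^esub> h) z = (f \<otimes>\<^bsub>M\<^esub> (g \<otimes>\<^bsub>M\<^esub> h)) z" unfolding 1 by simp
qed

lemma basis_elt_M [simp]: "u \<in> carrier G \<Longrightarrow> basis_elt u \<in> carrier M"
  and supp_basis_elt [simp]: "supp (basis_elt u :: 'g \<Rightarrow> 'f) = {u}"
  using coeff_ringD[OF SS] by (auto simp: carrier_M supp_def basis_elt_def)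

lemma basis_elt_mult: "basis_elt u \<otimes>\<^bsub>M\<^esub> basis_elt v = basis_elt (u \<otimes> v)"
  by (rule ext) (subst mult_M[of "{u}" "{v}"], auto simp: basis_elt_def supp_def)

lemma supp_sum_subset: "supp (\<lambda>z. f z + (g z :: 'f)) \<subseteq> supp f \<union> supp g" "supp (\<lambda>z. c * (f z :: 'f)) \<subseteq> supp f"
  by (auto simp: supp_def)

lemma add_closed_M: "f \<in> carrier M \<Longrightarrow> g \<in> carrier M \<Longrightarrow> (\<lambda>z. f z + g z) \<in> carrier M"
  using supp_sum_subset(1)[of f g] coeff_ringD[OF SS] by (auto simp: carrier_M intro: finite_subset)

lemma smult_closed_M: "c \<in> S \<Longrightarrow> f \<in> carrier M \<Longrightarrow> (\<lambda>z. c * f z) \<in> carrier M"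
  using supp_sum_subset(2)[of c f] coeff_ringD[OF SS] by (auto simp: carrier_M intro: finite_subset)

lemma coeff_algebra_M: "coeff_algebra S M"
proof -
  have fin: "f \<in> carrier M \<Longrightarrow> finite (supp f)" for f by (simp add: carrier_M)
  have z: "(\<lambda>z. 0) \<in> carrier M" using coeff_ringD[OF SS] by (simp add: carrier_M supp_def)
  have ex: "(f \<otimes>\<^bsub>M\<^esub> g) z = (\<Sum>u\<in>X. \<Sum>v\<in>Y. if u \<otimes> v = z then f u * g v else 0)"
    if "finite X" "finite Y" "supp f \<subseteq> X" "supp g \<subseteq> Y" for f g X Y z using mult_M that by blast
  have ldist: "(\<lambda>z. f z + g z) \<otimes>\<^bsub>M\<^esub> h = (\<lambda>z. (f \<otimes>\<^bsub>M\<^esub> h) z + (g \<otimes>\<^bsub>M\<^esub> h) z)"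
    if "f \<in> carrier M" "g \<in> carrier M" "h \<in> carrier M" for f g h
  proof
    fix z
    show "((\<lambda>z. f z + g z) \<otimes>\<^bsub>M\<^esub> h) z = (f \<otimes>\<^bsub>M\<^esub> h) z + (g \<otimes>\<^bsub>M\<^esub> h) z"
      using fin[OF that(1)] fin[OF that(2)] fin[OF that(3)] supp_sum_subset(1)[of f g]
      by (subst (1 2 3) ex[of "supp f \<union> supp g" "supp h"])
        (auto simp: sum.distrib[symmetric] algebra_simps intro!: sum.cong)
  qed
  have rdist: "h \<otimes>\<^bsub>M\<^esub> (\<lambda>z. f z + g z) = (\<lambda>z. (h \<otimes>\<^bsub>M\<^esub> f) z + (h \<otimes>\<^bsub>M\<^esub> g) z)"
    if "f \<in> carrier M" "g \<in> carrier M" "h \<in> carrier M" for f g h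
  proof
    fix z
    show "(h \<otimes>\<^bsub>M\<^esub> (\<lambda>z. f z + g z)) z = (h \<otimes>\<^bsub>M\<^esub> f) z + (h \<otimes>\<^bsub>M\<^esub> g) z"
      using fin[OF that(1)] fin[OF that(2)] fin[OF that(3)] supp_sum_subset(1)[of f g]
      by (subst (1 2 3) ex[of "supp h" "supp f \<union> supp g"])
        (auto simp: sum.distrib[symmetric] algebra_simps intro!: sum.cong)
  qed
  have sl: "(\<lambda>z. c * f z) \<otimes>\<^bsub>M\<^esub> g = (\<lambda>z. c * (f \<otimes>\<^bsub>M\<^esub> g) z)" if "f \<in> carrier M" "g \<in> carrier M" for c f g
  proof
    fix z
    show "((\<lambda>z. c * f z) \<otimes>\<^bsub>M\<^esub> g) z = c * (f \<otimes>\<^bsub>M\<^esub> g) z"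
      using fin[OF that(1)] fin[OF that(2)] supp_sum_subset(2)[of c f]
      by (subst (1 2) ex[of "supp f" "supp g"])
        (auto simp: sum_distrib_left mult.assoc intro!: sum.cong)
  qed
  have sr: "f \<otimes>\<^bsub>M\<^esub> (\<lambda>z. c * g z) = (\<lambda>z. c * (f \<otimes>\<^bsub>M\<^esub> g) z)" if "f \<in> carrier M" "g \<in> carrier M" for c f g
  proof
    fix z
    show "(f \<otimes>\<^bsub>M\<^esub> (\<lambda>z. c * g z)) z = c * (f \<otimes>\<^bsub>M\<^esub> g) z"
      using fin[OF that(1)] fin[OF that(2)] supp_sum_subset(2)[of c g]
      by (subst (1 2) ex[of "supp f" "supp g"])
        (auto simp: sum_distrib_left mult.left_commute intro!: sum.cong)
  qed
  have l1: "basis_elt \<one> \<otimes>\<^bsub>M\<^esub> f = f" if "f \<in> carrier M" for f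
  proof
    fix z
    have "(basis_elt \<one> \<otimes>\<^bsub>M\<^esub> f) z = (\<Sum>v\<in>supp f. if \<one> \<otimes> v = z then f v else 0)"
      using fin[OF that] by (subst ex[of "{\<one>}" "supp f"]) (auto simp: supp_def basis_elt_def intro!: sum.cong)
    also have "\<dots> = (\<Sum>v\<in>supp f. if v = z then f v else 0)"
      using that by (intro sum.cong) (auto simp: carrier_M subset_iff)
    also have "\<dots> = f z" using fin[OF that] by (simp add: supp_def)
    finally show "(basis_elt \<one> \<otimes>\<^bsub>M\<^esub> f) z = f z" .
  qed
  have r1: "f \<otimes>\<^bsub>M\<^esub> basis_elt \<one> = f" if "f \<in> carrier M" for f
  proof
    fix z
    have "(f \<otimes>\<^bsub>M\<^esub> basis_elt \<one>) z = (\<Sum>v\<in>supp f. if v \<otimes> \<one> = z then f v else 0)"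
      using fin[OF that] by (subst ex[of "supp f" "{\<one>}"]) (auto simp: supp_def basis_elt_def intro!: sum.cong)
    also have "\<dots> = (\<Sum>v\<in>supp f. if v = z then f v else 0)"
      using that by (intro sum.cong) (auto simp: carrier_M subset_iff)
    also have "\<dots> = f z" using fin[OF that] by (simp add: supp_def)
    finally show "(f \<otimes>\<^bsub>M\<^esub> basis_elt \<one>) z = f z" .
  qed
  have inv: "\<exists>g\<in>carrier M. g \<oplus>\<^bsub>M\<^esub> f = \<zero>\<^bsub>M\<^esub>" if "f \<in> carrier M" for f
    using smult_closed_M[of "- 1" f] that coeff_ringD[OF SS] by (intro bexI[of _ "\<lambda>z. - 1 * f z"]) auto
  have ab: "abelian_group M"
    by (rule abelian_groupI) (use z add_closed_M inv in \<open>auto simp: algebra_simps\<close>)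
  have mon: "monoid M"
    by (rule monoidI) (simp_all add: mult_closed_M mult_assoc_M l1 r1)
  have R: "ring M" by (rule ringI[OF ab mon]) (simp_all add: ldist rdist)
  have "module (scalars S) M"
    by (rule moduleI[OF scalars_cring[OF SS] ab]) (simp_all add: smult_closed_M algebra_simps)
  then show ?thesis
    unfolding coeff_algebra_def assoc_algebra_def assoc_algebra_axioms_def
    using R by (simp add: sl sr)
qed

sublocale M: coeff_algebra S M by (rule coeff_algebra_M)

lemma finsum_M: "f \<in> I \<rightarrow> carrier M \<Longrightarrow> (\<Oplus>\<^bsub>M\<^esub>i\<in>I. f i) z = (\<Sum>i\<in>I. f i z)"
proof (induct I rule: infinite_finite_induct)
  case (insert i I)
  then have "f i \<in> carrier M" "f \<in> I \<rightarrow> carrier M" by auto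
  then show ?case using insert by simp
qed (auto simp: M.finsum_infinite)

lemma M_expand:
  assumes "f \<in> carrier M" shows "f = (\<Oplus>\<^bsub>M\<^esub>u\<in>supp f. f u \<odot>\<^bsub>M\<^esub> basis_elt u)"
proof
  fix z
  have c: "(\<lambda>u. f u \<odot>\<^bsub>M\<^esub> basis_elt u) \<in> supp f \<rightarrow> carrier M"
    using assms by (intro Pi_I M.sm_closed basis_elt_M) (auto simp: carrier_M)
  have "(\<Oplus>\<^bsub>M\<^esub>u\<in>supp f. f u \<odot>\<^bsub>M\<^esub> basis_elt u) z = (\<Sum>u\<in>supp f. f u * basis_elt u z)"
    using finsum_M[OF c] by simp
  also have "\<dots> = (\<Sum>u\<in>supp f. if z = u then f u else 0)" by (intro sum.cong) (auto simp: basis_elt_def)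
  also have "\<dots> = f z" using assms by (auto simp: carrier_M supp_def)
  finally show "f z = (\<Oplus>\<^bsub>M\<^esub>u\<in>supp f. f u \<odot>\<^bsub>M\<^esub> basis_elt u) z" by simp
qed

lemma M_induct [consumes 1, case_names basis add smult]:
  assumes f: "f \<in> carrier M"
    and b: "\<And>u. u \<in> carrier G \<Longrightarrow> P (basis_elt u)"
    and a: "\<And>f g. f \<in> carrier M \<Longrightarrow> g \<in> carrier M \<Longrightarrow> P f \<Longrightarrow> P g \<Longrightarrow> P (f \<oplus>\<^bsub>M\<^esub> g)"
    and s: "\<And>c f. c \<in> S \<Longrightarrow> f \<in> carrier M \<Longrightarrow> P f \<Longrightarrow> P (c \<odot>\<^bsub>M\<^esub> f)"
  shows "P f"
proof -
  have z: "P \<zero>\<^bsub>M\<^esub>" using s[OF coeff_ringD(1)[OF SS] basis_elt_M[OF one_closed] b[OF one_closed]] by simp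
  have "P (\<Oplus>\<^bsub>M\<^esub>u\<in>X. f u \<odot>\<^bsub>M\<^esub> basis_elt u)" if "finite X" "X \<subseteq> supp f" for X
    using that
  proof (induct X)
    case empty
    then show ?case using z by simp
  next
    case (insert u X)
    have c: "\<And>v. v \<in> insert u X \<Longrightarrow> v \<in> carrier G" "\<And>v. f v \<in> S" using f insert by (auto simp: carrier_M)
    have m: "\<And>v. v \<in> insert u X \<Longrightarrow> f v \<odot>\<^bsub>M\<^esub> basis_elt v \<in> carrier M"
      by (intro M.sm_closed c(2) basis_elt_M c(1))
    have "(\<Oplus>\<^bsub>M\<^esub>v\<in>X. f v \<odot>\<^bsub>M\<^esub> basis_elt v) \<in> carrier M" by (intro M.finsum_closed Pi_I m) simp
    moreover have "P (f u \<odot>\<^bsub>M\<^esub> basis_elt u)" using s b c by simp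
    moreover have "(\<Oplus>\<^bsub>M\<^esub>v\<in>insert u X. f v \<odot>\<^bsub>M\<^esub> basis_elt v) = f u \<odot>\<^bsub>M\<^esub> basis_elt u \<oplus>\<^bsub>M\<^esub> (\<Oplus>\<^bsub>M\<^esub>v\<in>X. f v \<odot>\<^bsub>M\<^esub> basis_elt v)"
      by (rule M.finsum_insert) (use insert m in auto)
    ultimately show ?case using a m insert by simp
  qed
  from this[of "supp f"] show ?thesis using f M_expand[OF f] by (simp add: carrier_M)
qed

context
  fixes A :: "('f, 'a, 'r) module_scheme" and h
  assumes A: "coeff_algebra S A" and h: "\<And>u. u \<in> carrier G \<Longrightarrow> h u \<in> carrier A"
begin

interpretation A: coeff_algebra S A by (rule A)

lemma lin_ext_superset:
  assumes "f \<in> carrier M" "finite X" "supp f \<subseteq> X" "X \<subseteq> carrier G"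
  shows "lin_ext A h f = (\<Oplus>\<^bsub>A\<^esub>u\<in>X. f u \<odot>\<^bsub>A\<^esub> h u)"
  unfolding lin_ext_def
  by (rule A.add.finprod_mono_neutral_cong_left) (use assms h in \<open>auto simp: carrier_M supp_def subset_iff\<close>)

lemma lin_ext_linear: "linear_map S M A (lin_ext A h)"
proof (rule linear_mapI)
  fix f assume f: "f \<in> carrier M"
  show "lin_ext A h f \<in> carrier A" unfolding lin_ext_def
    by (rule A.finsum_closed) (use f h in \<open>auto simp: carrier_M\<close>)
  fix c assume c: "c \<in> S"
  have "lin_ext A h (c \<odot>\<^bsub>M\<^esub> f) = (\<Oplus>\<^bsub>A\<^esub>u\<in>supp f. (c * f u) \<odot>\<^bsub>A\<^esub> h u)"
    using lin_ext_superset[of "c \<odot>\<^bsub>M\<^esub> f" "supp f"] f smult_closed_M[OF c f] supp_sum_subset(2)[of c f]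
    by (simp add: carrier_M)
  also have "\<dots> = (\<Oplus>\<^bsub>A\<^esub>u\<in>supp f. c \<odot>\<^bsub>A\<^esub> (f u \<odot>\<^bsub>A\<^esub> h u))"
    by (rule A.add.finprod_cong') (use f h c in \<open>auto simp: carrier_M A.sm_mult\<close>)
  also have "\<dots> = c \<odot>\<^bsub>A\<^esub> lin_ext A h f" unfolding lin_ext_def
    by (rule A.sm_finsum[symmetric]) (use f h c in \<open>auto simp: carrier_M\<close>)
  finally show "lin_ext A h (c \<odot>\<^bsub>M\<^esub> f) = c \<odot>\<^bsub>A\<^esub> lin_ext A h f" .
next
  fix f g assume fg: "f \<in> carrier M" "g \<in> carrier M"
  let ?X = "supp f \<union> supp g"
  have X: "finite ?X" "?X \<subseteq> carrier G" using fg by (auto simp: carrier_M)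
  have S: "f u \<in> S" "g u \<in> S" for u using fg by (auto simp: carrier_M)
  have "lin_ext A h (f \<oplus>\<^bsub>M\<^esub> g) = (\<Oplus>\<^bsub>A\<^esub>u\<in>?X. (f u + g u) \<odot>\<^bsub>A\<^esub> h u)"
    using lin_ext_superset[of "f \<oplus>\<^bsub>M\<^esub> g" ?X] fg add_closed_M[OF fg] supp_sum_subset(1)[of f g] X by simp
  also have "\<dots> = (\<Oplus>\<^bsub>A\<^esub>u\<in>?X. f u \<odot>\<^bsub>A\<^esub> h u \<oplus>\<^bsub>A\<^esub> g u \<odot>\<^bsub>A\<^esub> h u)"
    by (rule A.add.finprod_cong') (use X h S in \<open>auto simp: A.sm_add subset_iff\<close>)
  also have "\<dots> = (\<Oplus>\<^bsub>A\<^esub>u\<in>?X. f u \<odot>\<^bsub>A\<^esub> h u) \<oplus>\<^bsub>A\<^esub> (\<Oplus>\<^bsub>A\<^esub>u\<in>?X. g u \<odot>\<^bsub>A\<^esub> h u)"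
    by (rule A.finsum_addf) (use X h S in auto)
  also have "\<dots> = lin_ext A h f \<oplus>\<^bsub>A\<^esub> lin_ext A h g"
    using lin_ext_superset[of f ?X] lin_ext_superset[of g ?X] fg X by simp
  finally show "lin_ext A h (f \<oplus>\<^bsub>M\<^esub> g) = lin_ext A h f \<oplus>\<^bsub>A\<^esub> lin_ext A h g" .
qed

lemma lin_ext_basis [simp]: "u \<in> carrier G \<Longrightarrow> lin_ext A h (basis_elt u) = h u"
  unfolding lin_ext_def supp_basis_elt by (simp add: h basis_elt_def)

lemma lin_ext_hom:
  assumes one: "h \<one> = \<one>\<^bsub>A\<^esub>" and mult: "\<And>u v. u \<in> carrier G \<Longrightarrow> v \<in> carrier G \<Longrightarrow> h (u \<otimes> v) = h u \<otimes>\<^bsub>A\<^esub> h v"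
  shows "algebra_hom S M A (lin_ext A h)"
  unfolding algebra_hom_def
proof (intro conjI ballI lin_ext_linear)
  show "lin_ext A h \<one>\<^bsub>M\<^esub> = \<one>\<^bsub>A\<^esub>" by (simp add: one)
  note L = linear_mapD[OF lin_ext_linear]
  fix f g assume f: "f \<in> carrier M" and g: "g \<in> carrier M"
  have b: "lin_ext A h (basis_elt u \<otimes>\<^bsub>M\<^esub> g) = h u \<otimes>\<^bsub>A\<^esub> lin_ext A h g" if u: "u \<in> carrier G" for u
    using g
  proof (induct g rule: M_induct)
    case (basis v)
    then show ?case using u by (simp add: basis_elt_mult mult)
  next
    case (add f g)
    then show ?case using u h by (simp add: M.r_distr L A.r_distr del: M_sel)
  next
    case (smult c f)
    then show ?case using u h by (simp add: M.sm_mr L A.sm_mr M.m_closed del: M_sel)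
  qed
  show "lin_ext A h (f \<otimes>\<^bsub>M\<^esub> g) = lin_ext A h f \<otimes>\<^bsub>A\<^esub> lin_ext A h g"
    using f
  proof (induct f rule: M_induct)
    case (basis v)
    then show ?case by (simp add: b)
  next
    case (add f f')
    then show ?case using g by (simp add: M.l_distr L A.l_distr del: M_sel)
  next
    case (smult c f)
    then show ?case using g by (simp add: M.sm_ml L A.sm_ml M.m_closed del: M_sel)
  qed
qed

end

end

locale algebra_ideal = coeff_algebra S A + ideal I A for S :: "'f::comm_ring_1 set" and A :: "('f, 'a, 'm) module_scheme" (structure) and I
begin

abbreviation Q where "Q \<equiv> quot_algebra A I"
abbreviation cl where "cl a \<equiv> I +> a"

lemma Q_sel: "carrier Q = a_rcosets I" "mult Q = rcoset_mult A I" "one Q = I +> \<one>" "zero Q = I"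
  "add Q = set_add A" "smult Q = (\<lambda>c X. \<Union>a\<in>X. I +> (c \<odot> a))"
  by (simp_all add: quot_algebra_def FactRing_def ring.defs module.defs)

lemma cl_eq: "a \<in> carrier A \<Longrightarrow> b \<in> carrier A \<Longrightarrow> cl a = cl b \<longleftrightarrow> a \<ominus> b \<in> I"
  using quotient_eq_iff_same_a_r_cos[OF is_ideal] by simp

lemma cl_carrier: "carrier Q = cl ` carrier A"
  by (auto simp: Q_sel A_RCOSETS_def')

lemma I_sm: "c \<in> S \<Longrightarrow> a \<in> I \<Longrightarrow> c \<odot> a \<in> I"
proof -
  assume h: "c \<in> S" "a \<in> I"
  then have a: "a \<in> carrier A" using a_subset by auto
  have "(c \<odot> \<one>) \<otimes> a \<in> I" using h by (intro I_l_closed) auto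
  then show ?thesis using h a by (simp add: sm_ml)
qed

lemma cl_mem: "b \<in> cl a \<Longrightarrow> a \<in> carrier A \<Longrightarrow> b \<in> carrier A \<and> cl b = cl a"
  using a_repr_independence' a_elemrcos_carrier by metis

lemma self_in_cl: "a \<in> carrier A \<Longrightarrow> a \<in> cl a"
  by (rule a_rcos_self)

lemma cl_hom:
  shows cl_add: "a \<in> carrier A \<Longrightarrow> b \<in> carrier A \<Longrightarrow> cl a \<oplus>\<^bsub>Q\<^esub> cl b = cl (a \<oplus> b)"
    and cl_mult: "a \<in> carrier A \<Longrightarrow> b \<in> carrier A \<Longrightarrow> cl a \<otimes>\<^bsub>Q\<^esub> cl b = cl (a \<otimes> b)"
    and cl_smult: "c \<in> S \<Longrightarrow> a \<in> carrier A \<Longrightarrow> c \<odot>\<^bsub>Q\<^esub> cl a = cl (c \<odot> a)"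
    and cl_one: "\<one>\<^bsub>Q\<^esub> = cl \<one>"
    and cl_zero: "\<zero>\<^bsub>Q\<^esub> = cl \<zero>"
proof -
  show "\<one>\<^bsub>Q\<^esub> = cl \<one>" "\<zero>\<^bsub>Q\<^esub> = cl \<zero>" using a_coset_add_zero[OF a_subset] by (simp_all add: Q_sel)
  show "cl a \<oplus>\<^bsub>Q\<^esub> cl b = cl (a \<oplus> b)" "cl a \<otimes>\<^bsub>Q\<^esub> cl b = cl (a \<otimes> b)" if "a \<in> carrier A" "b \<in> carrier A"
    using that by (simp_all add: Q_sel a_rcos_sum rcoset_mult_add)
  show "c \<odot>\<^bsub>Q\<^esub> cl a = cl (c \<odot> a)" if c: "c \<in> S" and a: "a \<in> carrier A"
  proof -
    have "cl (c \<odot> b) = cl (c \<odot> a)" if "b \<in> cl a" for b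
    proof -
      have b: "b \<in> carrier A" "b \<ominus> a \<in> I" using cl_mem[OF that a] cl_eq a by auto
      then have "c \<odot> b \<ominus> c \<odot> a \<in> I" using I_sm[OF c b(2)] c a by (simp add: sm_diff_r)
      then show ?thesis using cl_eq b a c by simp
    qed
    then have "(\<Union>b\<in>cl a. cl (c \<odot> b)) = (\<Union>b\<in>cl a. cl (c \<odot> a))" by simp
    then show ?thesis using self_in_cl[OF a] by (auto simp: Q_sel)
  qed
qed

lemma cl_closed [simp]: "a \<in> carrier A \<Longrightarrow> cl a \<in> carrier Q"
  by (auto simp: cl_carrier)

lemma Q_algebra: "coeff_algebra S Q"
proof -
  have "\<exists>b\<in>carrier Q. b \<oplus>\<^bsub>Q\<^esub> cl a = \<zero>\<^bsub>Q\<^esub>" if "a \<in> carrier A" for a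
    using that by (intro bexI[of _ "cl (\<ominus> a)"]) (auto simp: cl_add cl_zero l_neg)
  then have "abelian_group Q"
    by (intro abelian_groupI) (auto simp: cl_carrier cl_add cl_zero a_ac)
  moreover have "monoid Q"
    by (rule monoidI) (auto simp: cl_carrier cl_mult cl_one m_assoc)
  ultimately have R: "ring Q"
    by (rule ringI) (auto simp: cl_carrier cl_mult cl_add l_distr r_distr)
  then interpret Q: ring Q .
  have "module (scalars S) Q"
    by (rule moduleI[OF scalars_cring[OF S] Q.is_abelian_group])
      (auto simp: cl_carrier cl_smult cl_add cl_hom sm_add sm_add_r sm_mult coeff_ringD[OF S])
  then show ?thesis unfolding coeff_algebra_def assoc_algebra_def assoc_algebra_axioms_def
    using R by (auto simp: cl_carrier cl_smult cl_mult sm_ml sm_mr)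
qed

lemma cl_algebra_hom: "algebra_hom S A Q cl"
  by (auto simp: algebra_hom_def linear_map_def cl_add cl_mult cl_smult cl_one)

lemma lift_cl:
  assumes "a \<in> carrier A" "\<And>b. b \<in> carrier A \<Longrightarrow> b \<ominus> a \<in> I \<Longrightarrow> h b = h a"
  shows "the_elem (h ` cl a) = h a"
proof -
  have "h b = h a" if "b \<in> cl a" for b
    using assms(2) cl_mem[OF that assms(1)] cl_eq[OF _ assms(1)] by blast
  then have "h ` cl a = {h a}" using self_in_cl[OF assms(1)] by blast
  then show ?thesis by simp
qed

lemma lift_hom:
  assumes B: "ring B" and h: "linear_map S A B h" and I: "\<And>a. a \<in> I \<Longrightarrow> h a = \<zero>\<^bsub>B\<^esub>"
  shows lift_hom_cl: "\<And>a. a \<in> carrier A \<Longrightarrow> the_elem (h ` cl a) = h a"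
    and lift_linear: "linear_map S Q B (\<lambda>X. the_elem (h ` X))"
    and "algebra_hom S A B h \<Longrightarrow> algebra_hom S Q B (\<lambda>X. the_elem (h ` X))"
proof -
  interpret B: ring B by (rule B)
  interpret h: additive A B h by (rule linear_additive[OF _ B h]) unfold_locales
  have *: "the_elem (h ` cl a) = h a" if "a \<in> carrier A" for a
  proof (rule lift_cl[OF that])
    fix b assume b: "b \<in> carrier A" "b \<ominus> a \<in> I"
    then have "h b \<ominus>\<^bsub>B\<^esub> h a = \<zero>\<^bsub>B\<^esub>" using I h.diff that by metis
    then show "h b = h a" using b that by (metis B.r_right_minus_eq h.closed)
  qed
  then show "\<And>a. a \<in> carrier A \<Longrightarrow> the_elem (h ` cl a) = h a" .
  show "linear_map S Q B (\<lambda>X. the_elem (h ` X))"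
    using linear_mapD[OF h] by (auto simp: linear_map_def cl_carrier cl_add cl_smult *)
  then show "algebra_hom S Q B (\<lambda>X. the_elem (h ` X))" if "algebra_hom S A B h"
    using that by (auto simp: algebra_hom_def cl_carrier cl_mult cl_one *)
qed

end

lemma (in coeff_algebra) subalgebra_algebra:
  assumes S': "coeff_ring S'" "S' \<subseteq> S" and B: "is_subalgebra S' A B"
  shows "coeff_algebra S' (A\<lparr>carrier := B\<rparr>)"
proof -
  have R: "ring (A\<lparr>carrier := B\<rparr>)" using B subring_is_ring by (simp add: is_subalgebra_def)
  then interpret B: ring "A\<lparr>carrier := B\<rparr>" .
  have sub: "B \<subseteq> carrier A" using B by (simp add: is_subalgebra_def subringE(1))
  have "module (scalars S') (A\<lparr>carrier := B\<rparr>)"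
    by (rule moduleI[OF scalars_cring[OF S'(1)] B.is_abelian_group])
      (use B sub S' in \<open>auto simp: is_subalgebra_def sm_add sm_add_r sm_mult subset_iff\<close>)
  then show ?thesis unfolding coeff_algebra_def assoc_algebra_def assoc_algebra_axioms_def
    using R sub S' by (auto simp: sm_ml sm_mr subset_iff)
qed

section \<open>Tensor products\<close>

lemma (in ring) eq_add_if_minus:
  assumes "x \<ominus> y \<ominus> z = \<zero>" "x \<in> carrier R" "y \<in> carrier R" "z \<in> carrier R"
  shows "x = y \<oplus> z"
proof -
  have "x \<ominus> y = z" using assms by simp
  then show ?thesis using assms(2-4) by (metis a_minus_def add.inv_solve_right' add.m_comm)
qed

definition bilinear ::
  "'f set \<Rightarrow> ('f, 'a, 'm) module_scheme \<Rightarrow> ('f, 'b, 'n) module_scheme \<Rightarrow> ('f, 'c, 'r) module_scheme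
     \<Rightarrow> ('a \<Rightarrow> 'b \<Rightarrow> 'c) \<Rightarrow> bool" where
  "bilinear S M N B \<phi> \<longleftrightarrow>
     (\<forall>a\<in>carrier M. linear_map S N B (\<phi> a)) \<and> (\<forall>b\<in>carrier N. linear_map S M B (\<lambda>a. \<phi> a b))"

lemma bilinearD:
  assumes "bilinear S M N B \<phi>"
  shows "a \<in> carrier M \<Longrightarrow> b \<in> carrier N \<Longrightarrow> \<phi> a b \<in> carrier B"
    and "a \<in> carrier M \<Longrightarrow> a' \<in> carrier M \<Longrightarrow> b \<in> carrier N \<Longrightarrow> \<phi> (a \<oplus>\<^bsub>M\<^esub> a') b = \<phi> a b \<oplus>\<^bsub>B\<^esub> \<phi> a' b"
    and "a \<in> carrier M \<Longrightarrow> b \<in> carrier N \<Longrightarrow> b' \<in> carrier N \<Longrightarrow> \<phi> a (b \<oplus>\<^bsub>N\<^esub> b') = \<phi> a b \<oplus>\<^bsub>B\<^esub> \<phi> a b'"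
    and "c \<in> S \<Longrightarrow> a \<in> carrier M \<Longrightarrow> b \<in> carrier N \<Longrightarrow> \<phi> (c \<odot>\<^bsub>M\<^esub> a) b = c \<odot>\<^bsub>B\<^esub> \<phi> a b"
    and "c \<in> S \<Longrightarrow> a \<in> carrier M \<Longrightarrow> b \<in> carrier N \<Longrightarrow> \<phi> a (c \<odot>\<^bsub>N\<^esub> b) = c \<odot>\<^bsub>B\<^esub> \<phi> a b"
  using assms by (auto simp: bilinear_def linear_map_def)

lemma bilinearI:
  assumes "\<And>a b. a \<in> carrier M \<Longrightarrow> b \<in> carrier N \<Longrightarrow> \<phi> a b \<in> carrier B"
    and "\<And>a a' b. a \<in> carrier M \<Longrightarrow> a' \<in> carrier M \<Longrightarrow> b \<in> carrier N \<Longrightarrow> \<phi> (a \<oplus>\<^bsub>M\<^esub> a') b = \<phi> a b \<oplus>\<^bsub>B\<^esub> \<phi> a' b"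
    and "\<And>a b b'. a \<in> carrier M \<Longrightarrow> b \<in> carrier N \<Longrightarrow> b' \<in> carrier N \<Longrightarrow> \<phi> a (b \<oplus>\<^bsub>N\<^esub> b') = \<phi> a b \<oplus>\<^bsub>B\<^esub> \<phi> a b'"
    and "\<And>c a b. c \<in> S \<Longrightarrow> a \<in> carrier M \<Longrightarrow> b \<in> carrier N \<Longrightarrow> \<phi> (c \<odot>\<^bsub>M\<^esub> a) b = c \<odot>\<^bsub>B\<^esub> \<phi> a b"
    and "\<And>c a b. c \<in> S \<Longrightarrow> a \<in> carrier M \<Longrightarrow> b \<in> carrier N \<Longrightarrow> \<phi> a (c \<odot>\<^bsub>N\<^esub> b) = c \<odot>\<^bsub>B\<^esub> \<phi> a b"
  shows "bilinear S M N B \<phi>"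
  using assms by (auto simp: bilinear_def linear_map_def)

text \<open>This has the shape of \<open>form_map\<close>, which becomes the lift of the bilinear
  map sending b and c to c b.\<close>

definition tensor_lift ::
  "('f::comm_ring_1, 'c, 'r) module_scheme \<Rightarrow> ('a \<Rightarrow> 'b \<Rightarrow> 'c) \<Rightarrow> ('a \<times> 'b \<Rightarrow> 'f) set \<Rightarrow> 'c" where
  "tensor_lift B \<phi> X = the_elem (lin_ext B (\<lambda>(a, b). \<phi> a b) ` X)"

locale tensor_product = MA: coeff_algebra S M + NA: coeff_algebra S N
  for S :: "'f::comm_ring_1 set" and M :: "('f, 'a, 'm) module_scheme" and N :: "('f, 'b, 'n) module_scheme"
begin

lemma MN_sel [simp]:
  "carrier (M \<times>\<times> N) = carrier M \<times> carrier N" "\<one>\<^bsub>M \<times>\<times> N\<^esub> = (\<one>\<^bsub>M\<^esub>, \<one>\<^bsub>N\<^esub>)"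
  "(a, b) \<otimes>\<^bsub>M \<times>\<times> N\<^esub> (a', b') = (a \<otimes>\<^bsub>M\<^esub> a', b \<otimes>\<^bsub>N\<^esub> b')"
  by (simp_all add: DirProd_def)

sublocale P: monoid_algebra_loc S "M \<times>\<times> N"
  unfolding monoid_algebra_loc_def monoid_algebra_loc_axioms_def
  using MA.S DirProd_monoid[OF MA.monoid_axioms NA.monoid_axioms] by simp

abbreviation J where "J \<equiv> tensor_ideal S M N"
abbreviation T where "T \<equiv> tensor_algebra S M N"
abbreviation tens where "tens \<equiv> tensor S M N"

lemma P_minus: "f \<in> carrier P.M \<Longrightarrow> g \<in> carrier P.M \<Longrightarrow> f \<ominus>\<^bsub>P.M\<^esub> g = (\<lambda>z. f z - g z)"
  using P.M.minus_sm[of g] by (simp add: a_minus_def)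

lemma basis_minus3:
  assumes "u \<in> carrier (M \<times>\<times> N)" "v \<in> carrier (M \<times>\<times> N)" "w \<in> carrier (M \<times>\<times> N)"
  shows "basis_elt u \<ominus>\<^bsub>P.M\<^esub> basis_elt v \<ominus>\<^bsub>P.M\<^esub> basis_elt w = (\<lambda>p. basis_elt u p - basis_elt v p - basis_elt w p)"
proof -
  note b = assms[THEN P.basis_elt_M]
  show ?thesis using P_minus[OF P.M.minus_closed[OF b(1,2)] b(3)] P_minus[OF b(1,2)] by simp
qed

lemma basis_minus2:
  assumes "u \<in> carrier (M \<times>\<times> N)" "v \<in> carrier (M \<times>\<times> N)" "c \<in> S"
  shows "basis_elt u \<ominus>\<^bsub>P.M\<^esub> c \<odot>\<^bsub>P.M\<^esub> basis_elt v = (\<lambda>p. basis_elt u p - c * basis_elt v p)"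
  using P_minus[OF P.basis_elt_M[OF assms(1)] P.M.sm_closed[OF assms(3) P.basis_elt_M[OF assms(2)]]] by simp

lemma relation_cases:
  assumes "r \<in> tensor_relations S M N"
  obtains (left) a a' b where "a \<in> carrier M" "a' \<in> carrier M" "b \<in> carrier N"
      "r = basis_elt (a \<oplus>\<^bsub>M\<^esub> a', b) \<ominus>\<^bsub>P.M\<^esub> basis_elt (a, b) \<ominus>\<^bsub>P.M\<^esub> basis_elt (a', b)"
    | (right) a b b' where "a \<in> carrier M" "b \<in> carrier N" "b' \<in> carrier N"
      "r = basis_elt (a, b \<oplus>\<^bsub>N\<^esub> b') \<ominus>\<^bsub>P.M\<^esub> basis_elt (a, b) \<ominus>\<^bsub>P.M\<^esub> basis_elt (a, b')"
    | (sleft) c a b where "c \<in> S" "a \<in> carrier M" "b \<in> carrier N"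
      "r = basis_elt (c \<odot>\<^bsub>M\<^esub> a, b) \<ominus>\<^bsub>P.M\<^esub> c \<odot>\<^bsub>P.M\<^esub> basis_elt (a, b)"
    | (sright) c a b where "c \<in> S" "a \<in> carrier M" "b \<in> carrier N"
      "r = basis_elt (a, c \<odot>\<^bsub>N\<^esub> b) \<ominus>\<^bsub>P.M\<^esub> c \<odot>\<^bsub>P.M\<^esub> basis_elt (a, b)"
proof -
  from assms show thesis unfolding tensor_relations_def
  proof (elim UnE CollectE exE conjE)
    fix a a' b assume h: "r = (\<lambda>p. basis_elt (a \<oplus>\<^bsub>M\<^esub> a', b) p - basis_elt (a, b) p - basis_elt (a', b) p)"
      "a \<in> carrier M" "a' \<in> carrier M" "b \<in> carrier N"
    then show thesis using left[of a a' b] by (simp add: basis_minus3 del: P.M_sel)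
  next
    fix a b b' assume h: "r = (\<lambda>p. basis_elt (a, b \<oplus>\<^bsub>N\<^esub> b') p - basis_elt (a, b) p - basis_elt (a, b') p)"
      "a \<in> carrier M" "b \<in> carrier N" "b' \<in> carrier N"
    then show thesis using right[of a b b'] by (simp add: basis_minus3 del: P.M_sel)
  next
    fix c a b assume h: "r = (\<lambda>p. basis_elt (c \<odot>\<^bsub>M\<^esub> a, b) p - c * basis_elt (a, b) p)"
      "c \<in> S" "a \<in> carrier M" "b \<in> carrier N"
    then show thesis using sleft[of c a b] by (simp add: basis_minus2 del: P.M_sel)
  next
    fix c a b assume h: "r = (\<lambda>p. basis_elt (a, c \<odot>\<^bsub>N\<^esub> b) p - c * basis_elt (a, b) p)"
      "c \<in> S" "a \<in> carrier M" "b \<in> carrier N"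
    then show thesis using sright[of c a b] by (simp add: basis_minus2 del: P.M_sel)
  qed
qed

lemma relations_carrier: "tensor_relations S M N \<subseteq> carrier P.M"
  by (auto elim!: relation_cases intro!: P.M.minus_closed P.M.sm_closed P.basis_elt_M simp del: P.M_sel)

sublocale J: algebra_ideal S P.M J
  unfolding algebra_ideal_def
  using P.coeff_algebra_M P.M.genideal_ideal[OF relations_carrier] by (simp add: tensor_ideal_def)

lemma relation_J: "r \<in> tensor_relations S M N \<Longrightarrow> r \<in> J"
  using P.M.genideal_self[OF relations_carrier] by (auto simp: tensor_ideal_def)

lemma tens_eq: "tens a b = J.cl (basis_elt (a, b))"
  by (simp add: tensor_def)

lemma T_algebra: "coeff_algebra S T"
  using J.Q_algebra by (simp add: tensor_algebra_def)

sublocale T: coeff_algebra S T by (rule T_algebra)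

lemma T_eq: "T = J.Q"
  by (simp add: tensor_algebra_def)

lemma tens_closed [simp, intro]: "a \<in> carrier M \<Longrightarrow> b \<in> carrier N \<Longrightarrow> tens a b \<in> carrier T"
  by (simp add: T_eq tens_eq)

lemma J_0: "f \<in> carrier P.M \<Longrightarrow> J.cl f = \<zero>\<^bsub>T\<^esub> \<longleftrightarrow> f \<in> J"
  using J.cl_eq[of f "\<zero>\<^bsub>P.M\<^esub>"] by (simp add: T_eq J.cl_zero a_minus_def P.M.minus_zero del: P.M_sel)

lemma cl_minus: "f \<in> carrier P.M \<Longrightarrow> g \<in> carrier P.M \<Longrightarrow> J.cl (f \<ominus>\<^bsub>P.M\<^esub> g) = J.cl f \<ominus>\<^bsub>T\<^esub> J.cl g"
proof -
  assume h: "f \<in> carrier P.M" "g \<in> carrier P.M"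
  have T: "additive P.M T J.cl"
    using linear_additive[of P.M T S J.cl] P.M.ring_axioms T.ring_axioms J.cl_algebra_hom
    by (simp add: algebra_hom_def T_eq)
  show ?thesis using additive.diff[OF T] h by blast
qed

lemma tens_bilinear: "bilinear S M N T tens"
proof (rule bilinearI)
  fix a a' b assume h: "a \<in> carrier M" "a' \<in> carrier M" "b \<in> carrier N"
  have "basis_elt (a \<oplus>\<^bsub>M\<^esub> a', b) \<ominus>\<^bsub>P.M\<^esub> basis_elt (a, b) \<ominus>\<^bsub>P.M\<^esub> basis_elt (a', b) \<in> tensor_relations S M N"
    using h by (subst basis_minus3) (simp, simp, simp, unfold tensor_relations_def, blast)
  then have "tens (a \<oplus>\<^bsub>M\<^esub> a') b \<ominus>\<^bsub>T\<^esub> tens a b \<ominus>\<^bsub>T\<^esub> tens a' b = \<zero>\<^bsub>T\<^esub>"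
    using relation_J h J_0 by (simp add: tens_eq cl_minus[symmetric] del: P.M_sel)
  then show "tens (a \<oplus>\<^bsub>M\<^esub> a') b = tens a b \<oplus>\<^bsub>T\<^esub> tens a' b"
    using h by (intro T.eq_add_if_minus) auto
next
  fix a b b' assume h: "a \<in> carrier M" "b \<in> carrier N" "b' \<in> carrier N"
  have "basis_elt (a, b \<oplus>\<^bsub>N\<^esub> b') \<ominus>\<^bsub>P.M\<^esub> basis_elt (a, b) \<ominus>\<^bsub>P.M\<^esub> basis_elt (a, b') \<in> tensor_relations S M N"
    using h by (subst basis_minus3) (simp, simp, simp, unfold tensor_relations_def, blast)
  then have "tens a (b \<oplus>\<^bsub>N\<^esub> b') \<ominus>\<^bsub>T\<^esub> tens a b \<ominus>\<^bsub>T\<^esub> tens a b' = \<zero>\<^bsub>T\<^esub>"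
    using relation_J h J_0 by (simp add: tens_eq cl_minus[symmetric] del: P.M_sel)
  then show "tens a (b \<oplus>\<^bsub>N\<^esub> b') = tens a b \<oplus>\<^bsub>T\<^esub> tens a b'"
    using h by (intro T.eq_add_if_minus) auto
next
  fix c a b assume h: "c \<in> S" "a \<in> carrier M" "b \<in> carrier N"
  have "basis_elt (c \<odot>\<^bsub>M\<^esub> a, b) \<ominus>\<^bsub>P.M\<^esub> c \<odot>\<^bsub>P.M\<^esub> basis_elt (a, b) \<in> tensor_relations S M N"
    using h by (subst basis_minus2) (simp, simp, simp, unfold tensor_relations_def, blast)
  then have "tens (c \<odot>\<^bsub>M\<^esub> a) b \<ominus>\<^bsub>T\<^esub> c \<odot>\<^bsub>T\<^esub> tens a b = \<zero>\<^bsub>T\<^esub>"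
    using relation_J h J_0 by (simp add: tens_eq T_eq J.cl_smult cl_minus[symmetric, unfolded T_eq] del: P.M_sel)
  then show "tens (c \<odot>\<^bsub>M\<^esub> a) b = c \<odot>\<^bsub>T\<^esub> tens a b" using h by simp
next
  fix c a b assume h: "c \<in> S" "a \<in> carrier M" "b \<in> carrier N"
  have "basis_elt (a, c \<odot>\<^bsub>N\<^esub> b) \<ominus>\<^bsub>P.M\<^esub> c \<odot>\<^bsub>P.M\<^esub> basis_elt (a, b) \<in> tensor_relations S M N"
    using h by (subst basis_minus2) (simp, simp, simp, unfold tensor_relations_def, blast)
  then have "tens a (c \<odot>\<^bsub>N\<^esub> b) \<ominus>\<^bsub>T\<^esub> c \<odot>\<^bsub>T\<^esub> tens a b = \<zero>\<^bsub>T\<^esub>"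
    using relation_J h J_0 by (simp add: tens_eq T_eq J.cl_smult cl_minus[symmetric, unfolded T_eq] del: P.M_sel)
  then show "tens a (c \<odot>\<^bsub>N\<^esub> b) = c \<odot>\<^bsub>T\<^esub> tens a b" using h by simp
qed simp

lemmas tens = bilinearD[OF tens_bilinear]

lemma tens_mult:
  "a \<in> carrier M \<Longrightarrow> b \<in> carrier N \<Longrightarrow> a' \<in> carrier M \<Longrightarrow> b' \<in> carrier N \<Longrightarrow>
     tens a b \<otimes>\<^bsub>T\<^esub> tens a' b' = tens (a \<otimes>\<^bsub>M\<^esub> a') (b \<otimes>\<^bsub>N\<^esub> b')"
  by (simp add: tens_eq T_eq J.cl_mult P.basis_elt_mult)

lemma tens_one: "\<one>\<^bsub>T\<^esub> = tens \<one>\<^bsub>M\<^esub> \<one>\<^bsub>N\<^esub>"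
  by (simp add: tens_eq T_eq J.cl_one)

lemma tens_zero [simp]: "b \<in> carrier N \<Longrightarrow> tens \<zero>\<^bsub>M\<^esub> b = \<zero>\<^bsub>T\<^esub>" "a \<in> carrier M \<Longrightarrow> tens a \<zero>\<^bsub>N\<^esub> = \<zero>\<^bsub>T\<^esub>"
  using tens(4)[of 0 "\<zero>\<^bsub>M\<^esub>" b] tens(5)[of 0 a "\<zero>\<^bsub>N\<^esub>"] coeff_ringD(1)[OF MA.S] by simp_all

lemma tens_additive:
  "b \<in> carrier N \<Longrightarrow> additive M T (\<lambda>a. tens a b)" "a \<in> carrier M \<Longrightarrow> additive N T (tens a)"
  using tens_bilinear linear_additive MA.ring_axioms NA.ring_axioms T.ring_axioms unfolding bilinear_def by blast+

lemma tensor_induct [consumes 1, case_names tens add]: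
  assumes "t \<in> carrier T" "\<And>a b. a \<in> carrier M \<Longrightarrow> b \<in> carrier N \<Longrightarrow> P (tens a b)"
    "\<And>s t. s \<in> carrier T \<Longrightarrow> t \<in> carrier T \<Longrightarrow> P s \<Longrightarrow> P t \<Longrightarrow> P (s \<oplus>\<^bsub>T\<^esub> t)"
  shows "P t"
proof -
  obtain f where f: "f \<in> carrier P.M" "t = J.cl f" using assms(1) by (auto simp: T_eq J.cl_carrier)
  \<comment> \<open>The scalar is carried along because P is not assumed to be stable under scalars;
    on a pure tensor it is absorbed into the first factor.\<close>
  have "P (c \<odot>\<^bsub>T\<^esub> J.cl f)" if "c \<in> S" for c
    using f(1) that
  proof (induct f arbitrary: c rule: P.M_induct)
    case (basis u)
    then obtain a b where u: "u = (a, b)" "a \<in> carrier M" "b \<in> carrier N" by auto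
    then show ?case using assms(2)[of "c \<odot>\<^bsub>M\<^esub> a" b] basis by (simp add: tens tens_eq[symmetric])
  next
    case (add f g)
    then show ?case using assms(3)[of "c \<odot>\<^bsub>T\<^esub> J.cl f" "c \<odot>\<^bsub>T\<^esub> J.cl g"]
      by (simp add: T_eq J.cl_add[symmetric] T.sm_add_r[unfolded T_eq] T.sm_closed[unfolded T_eq] del: P.M_sel)
  next
    case (smult d f)
    then show ?case using smult(3)[of "c * d"] coeff_ringD(4)[OF MA.S, of c d]
      by (simp add: T_eq J.cl_smult[symmetric] T.sm_mult[unfolded T_eq] del: P.M_sel)
  qed
  from this[of 1] show ?thesis using f coeff_ringD[OF MA.S] by (simp add: T_eq T.sm_1[unfolded T_eq])
qed

lemma T_linear_eq:
  assumes "linear_map S T B h" "linear_map S T B k" "\<And>a b. a \<in> carrier M \<Longrightarrow> b \<in> carrier N \<Longrightarrow> h (tens a b) = k (tens a b)"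
    "t \<in> carrier T"
  shows "h t = k t"
  using assms(4) by (induct t rule: tensor_induct) (simp_all add: assms(3) linear_mapD[OF assms(1)] linear_mapD[OF assms(2)])

context
  fixes B :: "('f, 'c, 'r) module_scheme" and \<phi>
  assumes B: "coeff_algebra S B" and phi: "bilinear S M N B \<phi>"
begin

interpretation B: coeff_algebra S B by (rule B)

abbreviation \<phi>\<phi> where "\<phi>\<phi> \<equiv> \<lambda>(a, b). \<phi> a b"

lemma phi_carrier: "u \<in> carrier (M \<times>\<times> N) \<Longrightarrow> \<phi>\<phi> u \<in> carrier B"
  using bilinearD(1)[OF phi] by auto

lemma lin_phi: "linear_map S P.M B (lin_ext B \<phi>\<phi>)"
  by (rule P.lin_ext_linear[OF B]) (rule phi_carrier)

lemma basis_phi: "u \<in> carrier (M \<times>\<times> N) \<Longrightarrow> lin_ext B \<phi>\<phi> (basis_elt u) = \<phi>\<phi> u"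
  by (rule P.lin_ext_basis[OF B]) (rule phi_carrier)

text \<open>The relations generate J as an ideal, but \<phi> is only bilinear, so the kernel of its
  extension has no reason to be an ideal. The elements that are killed even after multiplication by
  pairs on both sides do form an ideal, and it contains the relations because a relation multiplied
  by pairs is mapped like a relation.\<close>

lemma lin_ext_J: "f \<in> J \<Longrightarrow> lin_ext B \<phi>\<phi> f = \<zero>\<^bsub>B\<^esub>"
proof -
  let ?L = "lin_ext B \<phi>\<phi>"
  note L = linear_mapD[OF lin_phi]
  have Lb: "?L (basis_elt u) = \<phi>\<phi> u" if "u \<in> carrier M \<times> carrier N" for u
    using basis_phi that by simp
  interpret L: additive P.M B ?L
    using linear_additive[OF P.M.ring_axioms B.ring_axioms lin_phi] .
  let ?K = "{f \<in> carrier P.M. \<forall>u\<in>carrier (M \<times>\<times> N). \<forall>v\<in>carrier (M \<times>\<times> N). ?L (basis_elt u \<otimes>\<^bsub>P.M\<^esub> f \<otimes>\<^bsub>P.M\<^esub> basis_elt v) = \<zero>\<^bsub>B\<^esub>}"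
  have b: "basis_elt u \<in> carrier P.M" if "u \<in> carrier (M \<times>\<times> N)" for u using that by (rule P.basis_elt_M)
  have "ideal ?K P.M"
  proof (rule idealI[OF P.M.ring_axioms])
    show "subgroup ?K (add_monoid P.M)"
    proof (rule P.M.add.subgroupI)
      show "?K \<noteq> {}" using b P.M.zero_closed by (auto simp del: P.M_sel MN_sel intro!: exI[of _ "\<zero>\<^bsub>P.M\<^esub>"])
      fix f g assume f: "f \<in> ?K" and g: "g \<in> ?K"
      show "\<ominus>\<^bsub>P.M\<^esub> f \<in> ?K" using f b
        by (auto simp: P.M.r_minus P.M.l_minus L.minus simp del: P.M_sel MN_sel)
      show "f \<oplus>\<^bsub>P.M\<^esub> g \<in> ?K" using f g b
        by (auto simp: P.M.r_distr P.M.l_distr L.add simp del: P.M_sel MN_sel)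
    qed (auto simp del: P.M_sel)
    fix f g assume fK: "f \<in> ?K" and g: "g \<in> carrier P.M"
    then have f: "f \<in> carrier P.M" and fz: "\<And>u v. u \<in> carrier (M \<times>\<times> N) \<Longrightarrow> v \<in> carrier (M \<times>\<times> N) \<Longrightarrow>
       ?L (basis_elt u \<otimes>\<^bsub>P.M\<^esub> f \<otimes>\<^bsub>P.M\<^esub> basis_elt v) = \<zero>\<^bsub>B\<^esub>" by blast+
    show "g \<otimes>\<^bsub>P.M\<^esub> f \<in> ?K"
    proof -
      have "?L (basis_elt u \<otimes>\<^bsub>P.M\<^esub> (g \<otimes>\<^bsub>P.M\<^esub> f) \<otimes>\<^bsub>P.M\<^esub> basis_elt v) = \<zero>\<^bsub>B\<^esub>"
        if uv: "u \<in> carrier (M \<times>\<times> N)" "v \<in> carrier (M \<times>\<times> N)" for u v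
        using g
      proof (induct g rule: P.M_induct)
        case (basis w)
        then have "basis_elt u \<otimes>\<^bsub>P.M\<^esub> (basis_elt w \<otimes>\<^bsub>P.M\<^esub> f) = basis_elt (u \<otimes>\<^bsub>M \<times>\<times> N\<^esub> w) \<otimes>\<^bsub>P.M\<^esub> f"
          using f b[OF uv(1)] b[OF basis] by (simp add: P.M.m_assoc[symmetric] P.basis_elt_mult del: P.M_sel MN_sel)
        then show ?case using fz[OF P.m_closed[OF uv(1) basis] uv(2)] by simp
      next
        case (add g h)
        then show ?case using f b[OF uv(1)] b[OF uv(2)] by (simp add: P.M.r_distr P.M.l_distr L.add del: P.M_sel MN_sel)
      next
        case (smult c g)
        then show ?case using f b[OF uv(1)] b[OF uv(2)] by (simp add: P.M.sm_mr P.M.sm_ml L(3) P.M.m_closed del: P.M_sel MN_sel)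
      qed
      then show ?thesis using f g P.M.m_closed by blast
    qed
    show "f \<otimes>\<^bsub>P.M\<^esub> g \<in> ?K"
    proof -
      have "?L (basis_elt u \<otimes>\<^bsub>P.M\<^esub> (f \<otimes>\<^bsub>P.M\<^esub> g) \<otimes>\<^bsub>P.M\<^esub> basis_elt v) = \<zero>\<^bsub>B\<^esub>"
        if uv: "u \<in> carrier (M \<times>\<times> N)" "v \<in> carrier (M \<times>\<times> N)" for u v
        using g
      proof (induct g rule: P.M_induct)
        case (basis w)
        then have "basis_elt u \<otimes>\<^bsub>P.M\<^esub> (f \<otimes>\<^bsub>P.M\<^esub> basis_elt w) \<otimes>\<^bsub>P.M\<^esub> basis_elt v = basis_elt u \<otimes>\<^bsub>P.M\<^esub> f \<otimes>\<^bsub>P.M\<^esub> basis_elt (w \<otimes>\<^bsub>M \<times>\<times> N\<^esub> v)"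
          using f b[OF uv(1)] b[OF uv(2)] b[OF basis] by (simp add: P.M.m_assoc P.basis_elt_mult[symmetric] del: P.M_sel MN_sel)
        then show ?case using fz[OF uv(1) P.m_closed[OF basis uv(2)]] by simp
      next
        case (add g h)
        then show ?case using f b[OF uv(1)] b[OF uv(2)] by (simp add: P.M.r_distr P.M.l_distr L.add del: P.M_sel MN_sel)
      next
        case (smult c g)
        then show ?case using f b[OF uv(1)] b[OF uv(2)] by (simp add: P.M.sm_mr P.M.sm_ml L(3) P.M.m_closed del: P.M_sel MN_sel)
      qed
      then show ?thesis using f g P.M.m_closed by blast
    qed
  qed
  moreover have "tensor_relations S M N \<subseteq> ?K"
  proof
    fix r assume r: "r \<in> tensor_relations S M N"
    have "?L (basis_elt (c, d) \<otimes>\<^bsub>P.M\<^esub> r \<otimes>\<^bsub>P.M\<^esub> basis_elt (c', d')) = \<zero>\<^bsub>B\<^esub>"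
      if cd: "c \<in> carrier M" "c' \<in> carrier M" "d \<in> carrier N" "d' \<in> carrier N" for c d c' d'
    proof -
      have bb: "a \<in> carrier M \<Longrightarrow> e \<in> carrier N \<Longrightarrow> basis_elt (a, e) \<in> carrier P.M" for a e by simp
      have m: "basis_elt (c, d) \<otimes>\<^bsub>P.M\<^esub> basis_elt (a, e) \<otimes>\<^bsub>P.M\<^esub> basis_elt (c', d') =
          basis_elt (c \<otimes>\<^bsub>M\<^esub> a \<otimes>\<^bsub>M\<^esub> c', d \<otimes>\<^bsub>N\<^esub> e \<otimes>\<^bsub>N\<^esub> d')" for a e by (simp add: P.basis_elt_mult)
      have dist: "basis_elt (c, d) \<otimes>\<^bsub>P.M\<^esub> (f \<ominus>\<^bsub>P.M\<^esub> g) \<otimes>\<^bsub>P.M\<^esub> basis_elt (c', d') =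
          (basis_elt (c, d) \<otimes>\<^bsub>P.M\<^esub> f \<otimes>\<^bsub>P.M\<^esub> basis_elt (c', d')) \<ominus>\<^bsub>P.M\<^esub> (basis_elt (c, d) \<otimes>\<^bsub>P.M\<^esub> g \<otimes>\<^bsub>P.M\<^esub> basis_elt (c', d'))"
        if "f \<in> carrier P.M" "g \<in> carrier P.M" for f g
        using that cd bb[OF cd(1,3)] bb[OF cd(2,4)]
        by (simp add: a_minus_def P.M.r_distr P.M.l_distr P.M.r_minus P.M.l_minus del: P.M_sel MN_sel)
      note ph = bilinearD[OF phi]
      note simps = dist m bb cd L.diff Lb ph MA.r_distr MA.l_distr NA.r_distr NA.l_distr MA.sm_ml MA.sm_mr NA.sm_ml NA.sm_mr
         P.M.sm_ml P.M.sm_mr L(3) P.M.minus_closed P.M.sm_closed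
      have c2: "x \<oplus>\<^bsub>B\<^esub> y \<ominus>\<^bsub>B\<^esub> x \<ominus>\<^bsub>B\<^esub> y = \<zero>\<^bsub>B\<^esub>" if "x \<in> carrier B" "y \<in> carrier B" for x y
      proof -
        have "x \<oplus>\<^bsub>B\<^esub> y \<ominus>\<^bsub>B\<^esub> x \<ominus>\<^bsub>B\<^esub> y = (x \<oplus>\<^bsub>B\<^esub> y) \<oplus>\<^bsub>B\<^esub> \<ominus>\<^bsub>B\<^esub> (x \<oplus>\<^bsub>B\<^esub> y)"
          using that by (simp add: a_minus_def B.minus_add B.a_assoc)
        then show ?thesis using that by (simp add: B.r_neg)
      qed
      have c1: "x \<ominus>\<^bsub>B\<^esub> x = \<zero>\<^bsub>B\<^esub>" if "x \<in> carrier B" for x using that by (simp add: a_minus_def B.r_neg)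
      from r show ?thesis
      proof (cases rule: relation_cases)
        case (left a a' b) then show ?thesis by (simp add: simps c2 del: P.M_sel)
      next
        case (right a b b') then show ?thesis by (simp add: simps c2 del: P.M_sel)
      next
        case (sleft c a b) then show ?thesis by (simp add: simps c1 del: P.M_sel)
      next
        case (sright c a b) then show ?thesis by (simp add: simps c1 del: P.M_sel)
      qed
    qed
    then show "r \<in> ?K" using relations_carrier r by (auto simp del: P.M_sel)
  qed
  ultimately have "J \<subseteq> ?K" unfolding tensor_ideal_def by (rule P.M.genideal_minimal)
  moreover assume "f \<in> J"
  ultimately have f: "f \<in> ?K" by blast
  then have "?L (\<one>\<^bsub>P.M\<^esub> \<otimes>\<^bsub>P.M\<^esub> f \<otimes>\<^bsub>P.M\<^esub> \<one>\<^bsub>P.M\<^esub>) = \<zero>\<^bsub>B\<^esub>" unfolding P.M_sel(1) using P.one_closed by blast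
  then show ?thesis using f by (simp del: P.M_sel)
qed

lemma tensor_lift_tens: "a \<in> carrier M \<Longrightarrow> b \<in> carrier N \<Longrightarrow> tensor_lift B \<phi> (tens a b) = \<phi> a b"
proof -
  assume h: "a \<in> carrier M" "b \<in> carrier N"
  have "tensor_lift B \<phi> (tens a b) = lin_ext B \<phi>\<phi> (basis_elt (a, b))"
    unfolding tensor_lift_def tens_eq
    by (rule J.lift_hom_cl[OF B.ring_axioms lin_phi lin_ext_J]) (use h in auto)
  then show ?thesis using basis_phi h by simp
qed

lemma tensor_lift_linear: "linear_map S T B (tensor_lift B \<phi>)"
proof -
  have "linear_map S T B (\<lambda>X. the_elem (lin_ext B \<phi>\<phi> ` X))" unfolding T_eq
    by (rule J.lift_linear[OF B.ring_axioms lin_phi lin_ext_J])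
  then show ?thesis by (simp add: tensor_lift_def[abs_def])
qed

lemma tensor_lift_hom:
  assumes one: "\<phi> \<one>\<^bsub>M\<^esub> \<one>\<^bsub>N\<^esub> = \<one>\<^bsub>B\<^esub>"
    and mult: "\<And>a a' b b'. a \<in> carrier M \<Longrightarrow> a' \<in> carrier M \<Longrightarrow> b \<in> carrier N \<Longrightarrow> b' \<in> carrier N \<Longrightarrow>
      \<phi> (a \<otimes>\<^bsub>M\<^esub> a') (b \<otimes>\<^bsub>N\<^esub> b') = \<phi> a b \<otimes>\<^bsub>B\<^esub> \<phi> a' b'"
  shows "algebra_hom S T B (tensor_lift B \<phi>)"
proof -
  note L = linear_mapD[OF tensor_lift_linear] and ph = bilinearD[OF phi]
  have 1: "tensor_lift B \<phi> (tens a b \<otimes>\<^bsub>T\<^esub> t) = \<phi> a b \<otimes>\<^bsub>B\<^esub> tensor_lift B \<phi> t"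
    if "a \<in> carrier M" "b \<in> carrier N" "t \<in> carrier T" for a b t
    using that(3)
    by (induct t rule: tensor_induct) (use that in \<open>simp_all add: tens_mult tensor_lift_tens mult T.r_distr B.r_distr L ph\<close>)
  have "tensor_lift B \<phi> (s \<otimes>\<^bsub>T\<^esub> t) = tensor_lift B \<phi> s \<otimes>\<^bsub>B\<^esub> tensor_lift B \<phi> t"
    if "s \<in> carrier T" "t \<in> carrier T" for s t
    using that(1)
    by (induct s rule: tensor_induct) (use that in \<open>simp_all add: 1 tensor_lift_tens T.l_distr B.l_distr L\<close>)
  then show ?thesis using tensor_lift_linear one by (simp add: algebra_hom_def tens_one tensor_lift_tens)
qed

end

end

section \<open>Gradings and differential graded algebras\<close>

text \<open>Gradings are handled through their projections.\<close>

definition graded_by ::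
  "'f set \<Rightarrow> ('f, 'a, 'm) module_scheme \<Rightarrow> (nat \<Rightarrow> 'a set) \<Rightarrow> (nat \<Rightarrow> 'a \<Rightarrow> 'a) \<Rightarrow> bool" where
  "graded_by S A g pr \<longleftrightarrow>
     (\<forall>i. linear_map S A A (pr i) \<and> g i = {a \<in> carrier A. pr i a = a}) \<and>
     (\<forall>i j. \<forall>a\<in>carrier A. pr i (pr j a) = (if i = j then pr j a else \<zero>\<^bsub>A\<^esub>)) \<and>
     (\<forall>a\<in>carrier A. \<exists>K. finite K \<and> (\<forall>i. i \<notin> K \<longrightarrow> pr i a = \<zero>\<^bsub>A\<^esub>) \<and> a = (\<Oplus>\<^bsub>A\<^esub>i\<in>K. pr i a)) \<and>
     \<one>\<^bsub>A\<^esub> \<in> g 0 \<and> (\<forall>i j. \<forall>a\<in>g i. \<forall>b\<in>g j. a \<otimes>\<^bsub>A\<^esub> b \<in> g (i + j))"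

context coeff_algebra
begin

context
  fixes g pr assumes gr: "graded_by S A g pr"
begin

lemma pr_linear: "linear_map S A A (pr i)"
  and g_iff: "a \<in> g i \<longleftrightarrow> a \<in> carrier A \<and> pr i a = a"
  and pr_pr: "a \<in> carrier A \<Longrightarrow> pr i (pr j a) = (if i = j then pr j a else \<zero>)"
  and pr_sum: "a \<in> carrier A \<Longrightarrow> \<exists>K. finite K \<and> (\<forall>i. i \<notin> K \<longrightarrow> pr i a = \<zero>) \<and> a = (\<Oplus>i\<in>K. pr i a)"
  and one_g: "\<one> \<in> g 0" and mult_g: "a \<in> g i \<Longrightarrow> b \<in> g j \<Longrightarrow> a \<otimes> b \<in> g (i + j)"
  using gr unfolding graded_by_def by auto

lemma pr_closed [simp]: "a \<in> carrier A \<Longrightarrow> pr i a \<in> carrier A"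
  using linear_mapD(1)[OF pr_linear] .

lemma pr_in_g: "a \<in> carrier A \<Longrightarrow> pr i a \<in> g i"
  by (simp add: g_iff pr_pr)

lemma g_induct [consumes 1, case_names homogeneous add]:
  assumes "a \<in> carrier A" "\<And>i a. a \<in> g i \<Longrightarrow> P a" "\<And>a b. a \<in> carrier A \<Longrightarrow> b \<in> carrier A \<Longrightarrow> P a \<Longrightarrow> P b \<Longrightarrow> P (a \<oplus> b)"
  shows "P a"
proof -
  obtain K where K: "finite K" "a = (\<Oplus>i\<in>K. pr i a)" using pr_sum[OF assms(1)] by blast
  have z: "P \<zero>" using assms(2)[of \<zero> 0] additive.zero[OF linear_additive[OF ring_axioms ring_axioms pr_linear]] by (simp add: g_iff)
  have "P (\<Oplus>i\<in>L. pr i a)" if "finite L" for L :: "nat set"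
    using that
  proof (induct L)
    case (insert i L)
    have "P (pr i a)" using assms(2) pr_in_g assms(1) by blast
    then show ?case using insert assms(1) by (simp add: assms(3))
  qed (simp add: z)
  then show ?thesis using K by metis
qed

lemma graded_direct_sum:
  assumes a: "a \<in> carrier A"
  shows "\<exists>!c. (\<forall>i. c i \<in> g i) \<and> finite {i. c i \<noteq> \<zero>} \<and> a = (\<Oplus>i\<in>{i. c i \<noteq> \<zero>}. c i)"
proof -
  obtain K where K: "finite K" "\<And>i. i \<notin> K \<Longrightarrow> pr i a = \<zero>" "a = (\<Oplus>i\<in>K. pr i a)" using pr_sum[OF a] by blast
  have sub: "{i. pr i a \<noteq> \<zero>} \<subseteq> K" using K by auto
  have "(\<Oplus>i\<in>{i. pr i a \<noteq> \<zero>}. pr i a) = (\<Oplus>i\<in>K. pr i a)"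
    by (rule add.finprod_mono_neutral_cong_left) (use K sub a in auto)
  then have 1: "a = (\<Oplus>i\<in>{i. pr i a \<noteq> \<zero>}. pr i a)" using K by simp
  have 2: "c = (\<lambda>i. pr i a)" if c: "\<forall>i. c i \<in> g i" "finite {i. c i \<noteq> \<zero>}" "a = (\<Oplus>i\<in>{i. c i \<noteq> \<zero>}. c i)" for c
  proof
    fix j
    have cc: "c i \<in> carrier A" "pr i (c i) = c i" for i using c(1) by (auto simp: g_iff)
    have p: "pr j (c i) = (if i = j then c j else \<zero>)" for i using pr_pr[of "c i" j i] cc by (auto split: if_splits)
    have "pr j a = (\<Oplus>i\<in>{i. c i \<noteq> \<zero>}. pr j (c i))"
      by (subst c(3), rule additive.finsum[OF linear_additive[OF ring_axioms ring_axioms pr_linear]]) (use cc in auto)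
    also have "\<dots> = (\<Oplus>i\<in>{i. c i \<noteq> \<zero>}. if j = i then c i else \<zero>)" by (rule finsum_cong') (auto simp: p cc)
    also have "\<dots> = c j"
    proof (cases "c j = \<zero>")
      case True
      then have "(\<Oplus>i\<in>{i. c i \<noteq> \<zero>}. if j = i then c i else \<zero>) = (\<Oplus>i\<in>{i. c i \<noteq> \<zero>}. \<zero>)" by (intro finsum_cong') auto
      then show ?thesis using True by simp
    qed (use add.finprod_singleton[of j "{i. c i \<noteq> \<zero>}" c] c cc in auto)
    finally show "c j = pr j a" by simp
  qed
  have 3: "finite {i. pr i a \<noteq> \<zero>}" using K(1) sub finite_subset by blast
  show ?thesis
  proof (rule ex1I[of _ "\<lambda>i. pr i a"])
    show "(\<forall>i. pr i a \<in> g i) \<and> finite {i. pr i a \<noteq> \<zero>} \<and> a = (\<Oplus>i\<in>{i. pr i a \<noteq> \<zero>}. pr i a)"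
      using 1 3 pr_in_g[OF a] by blast
  qed (use 2 in blast)
qed

lemma g_submodule: "submodule (g i) (scalars S) A"
proof (rule submoduleI)
  interpret p: additive A A "pr i" by (rule linear_additive[OF ring_axioms ring_axioms pr_linear])
  show "g i \<subseteq> carrier A" "\<zero> \<in> g i" by (auto simp: g_iff)
  show "\<ominus> a \<in> g i" if "a \<in> g i" for a using that by (auto simp: g_iff p.minus)
  show "a \<oplus> b \<in> g i" if "a \<in> g i" "b \<in> g i" for a b using that by (auto simp: g_iff p.add)
  show "c \<odot> a \<in> g i" if "c \<in> carrier (scalars S)" "a \<in> g i" for c a
    using that linear_mapD(3)[OF pr_linear] by (auto simp: g_iff)
qed

end

end

lemma dg_algebraI:
  assumes "coeff_algebra S R" "graded_by S R (grade R) pr" "linear_map S R R (diff R)"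
    "\<And>a i. a \<in> grade R i \<Longrightarrow> diff R a \<in> grade R (Suc i)"
    "\<And>a. a \<in> carrier R \<Longrightarrow> diff R (diff R a) = \<zero>\<^bsub>R\<^esub>"
    "\<And>a b i. a \<in> grade R i \<Longrightarrow> b \<in> carrier R \<Longrightarrow>
       diff R (a \<otimes>\<^bsub>R\<^esub> b) = (diff R a \<otimes>\<^bsub>R\<^esub> b) \<oplus>\<^bsub>R\<^esub> alt_sign R i (a \<otimes>\<^bsub>R\<^esub> diff R b)"
  shows "dg_algebra (scalars S) R"
proof -
  interpret R: coeff_algebra S R by fact
  show ?thesis unfolding dg_algebra_def dg_algebra_axioms_def
    using R.assoc_algebra_axioms R.g_submodule[OF assms(2)] R.graded_direct_sum[OF assms(2)] R.one_g[OF assms(2)]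
      R.mult_g[OF assms(2)] assms(3-6) by simp
qed

text \<open>The graded commutator with an element of degree one. Its sign is carried by the
  automorphism \<sigma>, so that it is given by one formula on all elements and not only on
  homogeneous ones. It is applied to the tensor product for the differential, and to the quadratic
  dual for the derivations of the limit.\<close>

locale inner_differential = coeff_algebra S A for S and A (structure) +
  fixes g pr \<sigma> e
  assumes gr: "graded_by S A g pr" and sigma: "algebra_hom S A A \<sigma>"
    and sign: "a \<in> g i \<Longrightarrow> \<sigma> a = alt_sign A i a"
    and e: "e \<in> g 1"
begin

definition "D a = e \<otimes> a \<ominus> \<sigma> a \<otimes> e"

lemma e_closed [simp]: "e \<in> carrier A"
  using e g_iff[OF gr] by blast

lemma sigma_simps [simp]:
  shows "a \<in> carrier A \<Longrightarrow> \<sigma> a \<in> carrier A"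
    and "a \<in> carrier A \<Longrightarrow> b \<in> carrier A \<Longrightarrow> \<sigma> (a \<oplus> b) = \<sigma> a \<oplus> \<sigma> b"
    and "a \<in> carrier A \<Longrightarrow> b \<in> carrier A \<Longrightarrow> \<sigma> (a \<ominus> b) = \<sigma> a \<ominus> \<sigma> b"
    and "a \<in> carrier A \<Longrightarrow> b \<in> carrier A \<Longrightarrow> \<sigma> (a \<otimes> b) = \<sigma> a \<otimes> \<sigma> b"
    and "c \<in> S \<Longrightarrow> a \<in> carrier A \<Longrightarrow> \<sigma> (c \<odot> a) = c \<odot> \<sigma> a"
    and "\<sigma> e = \<ominus> e"
proof -
  have l: "linear_map S A A \<sigma>" using sigma by (simp add: algebra_hom_def)
  show "a \<in> carrier A \<Longrightarrow> \<sigma> a \<in> carrier A" "a \<in> carrier A \<Longrightarrow> b \<in> carrier A \<Longrightarrow> \<sigma> (a \<oplus> b) = \<sigma> a \<oplus> \<sigma> b"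
    "c \<in> S \<Longrightarrow> a \<in> carrier A \<Longrightarrow> \<sigma> (c \<odot> a) = c \<odot> \<sigma> a" using linear_mapD[OF l] by blast+
  show "a \<in> carrier A \<Longrightarrow> b \<in> carrier A \<Longrightarrow> \<sigma> (a \<ominus> b) = \<sigma> a \<ominus> \<sigma> b"
    using additive.diff[OF linear_additive[OF ring_axioms ring_axioms l]] .
  show "a \<in> carrier A \<Longrightarrow> b \<in> carrier A \<Longrightarrow> \<sigma> (a \<otimes> b) = \<sigma> a \<otimes> \<sigma> b" using sigma by (simp add: algebra_hom_def)
  show "\<sigma> e = \<ominus> e" using sign[OF e] by (simp add: alt_sign_def)
qed

lemma D_closed [simp]: "a \<in> carrier A \<Longrightarrow> D a \<in> carrier A"
  by (simp add: D_def)

lemma D_linear: "linear_map S A A D"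
proof (rule linear_mapI)
  show "D (a \<oplus> b) = D a \<oplus> D b" if "a \<in> carrier A" "b \<in> carrier A" for a b
    using that by (simp add: D_def r_distr l_distr a_minus_def minus_add a_ac)
  show "D (c \<odot> a) = c \<odot> D a" if "c \<in> S" "a \<in> carrier A" for c a
    using that by (simp add: D_def sm_mr sm_ml sm_diff_r)
qed simp

lemma D_grade:
  assumes "a \<in> g i" shows "D a \<in> g (Suc i)"
proof -
  have a: "a \<in> carrier A" using assms g_iff[OF gr] by blast
  note G = g_submodule[OF gr, of "Suc i"]
  have "\<sigma> a = a \<or> \<sigma> a = \<ominus> a" using sign[OF assms] by (simp add: alt_sign_def)
  moreover have "a \<otimes> e \<in> g (Suc i)" "e \<otimes> a \<in> g (Suc i)"
    using mult_g[OF gr assms e] mult_g[OF gr e assms] by simp_all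
  moreover from this(1) have "\<ominus> (a \<otimes> e) \<in> g (Suc i)" by (rule submoduleE(3)[OF G])
  ultimately show ?thesis using submoduleE(5)[OF G] a
    by (auto simp: D_def a_minus_def l_minus)
qed

text \<open>The outer terms contain the square of e, and the two mixed terms cancel because \<sigma>
  changes the sign of e.\<close>

lemma D_D: "e \<otimes> e = \<zero> \<Longrightarrow> a \<in> carrier A \<Longrightarrow> D (D a) = \<zero>"
proof -
  assume ee: "e \<otimes> e = \<zero>" and a: "a \<in> carrier A"
  let ?s = "\<sigma> a"
  have "e \<otimes> (e \<otimes> a) = \<zero>" using a ee by (simp add: m_assoc[symmetric])
  moreover have "\<sigma> ?s \<otimes> e \<otimes> e = \<zero>" using a ee by (simp add: m_assoc)
  moreover have "\<sigma> (\<ominus> (?s \<otimes> e)) = \<sigma> ?s \<otimes> e"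
    using a minus_sm[of "?s \<otimes> e"] sigma_simps(5)[of "- 1" "?s \<otimes> e"] coeff_ringD(2,5)[OF S]
    by (simp add: r_minus minus_sm[of "\<sigma> ?s \<otimes> e", symmetric] sm_minus_r)
  ultimately show ?thesis using a
    by (simp add: D_def a_minus_def r_distr l_distr l_minus r_minus m_assoc ee minus_add r_neg l_neg)
qed

lemma D_mult: "a \<in> carrier A \<Longrightarrow> b \<in> carrier A \<Longrightarrow> D (a \<otimes> b) = D a \<otimes> b \<oplus> \<sigma> a \<otimes> D b"
proof -
  assume h: "a \<in> carrier A" "b \<in> carrier A"
  let ?x = "e \<otimes> a \<otimes> b" and ?y = "\<sigma> a \<otimes> e \<otimes> b" and ?z = "\<sigma> a \<otimes> \<sigma> b \<otimes> e"
  have "D a \<otimes> b \<oplus> \<sigma> a \<otimes> D b = (?x \<ominus> ?y) \<oplus> (?y \<ominus> ?z)"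
    using h by (simp add: D_def a_minus_def r_distr l_distr l_minus r_minus m_assoc)
  also have "\<dots> = ?x \<ominus> ?z" using h by (simp add: a_minus_def a_assoc r_neg1)
  finally show ?thesis using h by (simp add: D_def m_assoc)
qed

lemma D_leibniz: "a \<in> g i \<Longrightarrow> b \<in> carrier A \<Longrightarrow> D (a \<otimes> b) = D a \<otimes> b \<oplus> alt_sign A i (a \<otimes> D b)"
  using D_mult[of a b] sign[of a i] g_iff[OF gr, of a i] by (auto simp: alt_sign_def l_minus)

end

lemma coeff_algebra_cong:
  assumes A: "coeff_algebra S A"
    and [simp]: "carrier B = carrier A" "mult B = mult A" "one B = one A" "zero B = zero A" "add B = add A" "smult B = smult A"
  shows "coeff_algebra S B"
proof -
  interpret A: coeff_algebra S A by (rule A)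
  have ab: "abelian_group B"
    by (rule abelian_groupI) (auto simp: A.a_ac intro!: bexI[of _ "\<ominus>\<^bsub>A\<^esub> _"] A.l_neg)
  have m: "monoid B" by (rule monoidI) (auto simp: A.m_assoc)
  have R: "ring B" by (rule ringI[OF ab m]) (auto simp: A.l_distr A.r_distr)
  have "module (scalars S) B"
    by (rule moduleI[OF scalars_cring[OF A.S] ab]) (auto simp: A.sm_add A.sm_add_r A.sm_mult)
  then show ?thesis unfolding coeff_algebra_def assoc_algebra_def assoc_algebra_axioms_def
    using R by (auto simp: A.sm_ml A.sm_mr)
qed

lemma with_grade_sel [simp]:
  "carrier (with_grade A g) = carrier A" "mult (with_grade A g) = mult A" "one (with_grade A g) = one A"
  "zero (with_grade A g) = zero A" "add (with_grade A g) = add A" "smult (with_grade A g) = smult A" "grade (with_grade A g) = g"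
  by (simp_all add: with_grade_def module.defs graded.defs)

lemma with_diff_sel [simp]:
  "carrier (with_diff A d) = carrier A" "mult (with_diff A d) = mult A" "one (with_diff A d) = one A"
  "zero (with_diff A d) = zero A" "add (with_diff A d) = add A" "smult (with_diff A d) = smult A"
  "grade (with_diff A d) = grade A" "diff (with_diff A d) = d"
  by (simp_all add: with_diff_def graded.defs dga.defs)

section \<open>Free algebras and quadratic algebras\<close>

locale free_alg =
  fixes n :: nat and ty :: "'f::field itself"
begin

abbreviation F where "F \<equiv> (free_algebra {..<n} :: ('f, nat list \<Rightarrow> 'f) module)"

lemma W_sel [simp]: "carrier (free_monoid {..<n}) = lists {..<n}" "\<one>\<^bsub>free_monoid {..<n}\<^esub> = []"
  "u \<otimes>\<^bsub>free_monoid {..<n}\<^esub> v = u @ v"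
  by (simp_all add: free_monoid_def)

sublocale W: monoid_algebra_loc "UNIV :: 'f set" "free_monoid {..<n}"
  rewrites "monoid_algebra UNIV (free_monoid {..<n}) = F"
  by (unfold_locales) (auto simp: free_algebra_def free_monoid_def)

abbreviation bs :: "nat list \<Rightarrow> nat list \<Rightarrow> 'f" where "bs \<equiv> basis_elt"

lemma bs_closed [simp]: "set w \<subseteq> {..<n} \<Longrightarrow> bs w \<in> carrier F"
  using W.basis_elt_M[of w] by (simp add: in_lists_conv_set subset_iff)

lemma bs_mult: "bs u \<otimes>\<^bsub>F\<^esub> bs v = bs (u @ v)"
  using W.basis_elt_mult[of u v] by simp

lemma bs_induct [consumes 1, case_names basis add smult]:
  assumes f: "f \<in> carrier F"
    and b: "\<And>w. set w \<subseteq> {..<n} \<Longrightarrow> P (bs w)"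
    and a: "\<And>f g. f \<in> carrier F \<Longrightarrow> g \<in> carrier F \<Longrightarrow> P f \<Longrightarrow> P g \<Longrightarrow> P (f \<oplus>\<^bsub>F\<^esub> g)"
    and s: "\<And>c f. f \<in> carrier F \<Longrightarrow> P f \<Longrightarrow> P (c \<odot>\<^bsub>F\<^esub> f)"
  shows "P f"
  using f
proof (induct f rule: W.M_induct)
  case (basis u)
  then show ?case using b[of u] by auto
next
  case (add f g)
  then show ?case by (rule a)
next
  case (smult c f)
  then show ?case using s[of f c] by simp
qed

lemma carrier_F: "f \<in> carrier F \<longleftrightarrow> finite (supp f) \<and> supp f \<subseteq> lists {..<n}"
  by (simp add: W.carrier_M)

lemma carrier_F_bound:
  assumes "f \<in> carrier F" shows "\<exists>k. \<forall>w. f w \<noteq> 0 \<longrightarrow> length w < k"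
proof -
  have "finite (length ` supp f)" using assms by (simp add: carrier_F)
  then obtain k where "\<forall>l\<in>length ` supp f. l < k" using finite_nat_set_iff_bounded by blast
  then show ?thesis by (auto simp: supp_def)
qed

lemma restrict_F: "f \<in> carrier F \<Longrightarrow> (\<And>w. f w = 0 \<Longrightarrow> g w = 0) \<Longrightarrow> g \<in> carrier F"
proof -
  assume h: "f \<in> carrier F" "\<And>w. f w = 0 \<Longrightarrow> g w = 0"
  then have "supp g \<subseteq> supp f" by (auto simp: supp_def)
  then show ?thesis using h by (auto simp: carrier_F intro: finite_subset)
qed

lemma words_F: "(\<And>w. w \<notin> words n p \<Longrightarrow> f w = 0) \<Longrightarrow> f \<in> carrier F"
proof -
  assume h: "\<And>w. w \<notin> words n p \<Longrightarrow> f w = 0"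
  then have "supp f \<subseteq> words n p" by (auto simp: supp_def)
  then show ?thesis using words_finite[of n p] by (auto simp: carrier_F words_def intro: finite_subset)
qed

lemma F_minus: "f \<in> carrier F \<Longrightarrow> g \<in> carrier F \<Longrightarrow> f \<ominus>\<^bsub>F\<^esub> g = (\<lambda>w. f w - g w)"
  using W.M.minus_sm[of g] by (simp add: a_minus_def)

definition trunc :: "nat \<Rightarrow> (nat list \<Rightarrow> 'f) \<Rightarrow> nat list \<Rightarrow> 'f" where
  "trunc p f = (\<lambda>w. if length w = p then f w else 0)"

lemma trunc_closed [simp]: "f \<in> carrier F \<Longrightarrow> trunc p f \<in> carrier F"
  by (rule restrict_F[of f]) (auto simp: trunc_def)

lemma free_part_iff: "f \<in> free_part {..<n} p \<longleftrightarrow> f \<in> carrier F \<and> trunc p f = f"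
  by (auto simp: free_part_def trunc_def supp_def fun_eq_iff)

lemma free_part_words:
  fixes f :: "nat list \<Rightarrow> 'f"
  shows "f \<in> free_part {..<n} p \<longleftrightarrow> (\<forall>w. w \<notin> words n p \<longrightarrow> f w = 0)"
proof
  assume "f \<in> free_part {..<n} p"
  then show "\<forall>w. w \<notin> words n p \<longrightarrow> f w = 0"
    by (auto simp: free_part_def carrier_F supp_def words_def)
next
  assume h: "\<forall>w. w \<notin> words n p \<longrightarrow> f w = 0"
  then have "f \<in> carrier F" using words_F[of p f] by blast
  then show "f \<in> free_part {..<n} p" using h by (auto simp: free_part_def supp_def words_def)
qed

lemma F_sum_trunc:
  assumes "f \<in> carrier F"
  shows "\<exists>K. finite K \<and> (\<forall>i. i \<notin> K \<longrightarrow> trunc i f = \<zero>\<^bsub>F\<^esub>) \<and> f = (\<Oplus>\<^bsub>F\<^esub>i\<in>K. trunc i f)"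
proof -
  let ?K = "length ` supp f"
  have K: "finite ?K" using assms by (simp add: carrier_F)
  have z: "trunc i f = (\<lambda>w. 0)" if "i \<notin> ?K" for i
    using that by (auto simp: trunc_def supp_def fun_eq_iff)
  have "f = (\<Oplus>\<^bsub>F\<^esub>i\<in>?K. trunc i f)"
  proof
    fix w
    have "(\<Oplus>\<^bsub>F\<^esub>i\<in>?K. trunc i f) w = (\<Sum>i\<in>?K. trunc i f w)"
      by (rule W.finsum_M) (use assms in auto)
    also have "\<dots> = (\<Sum>i\<in>?K. if length w = i then f w else 0)" by (simp add: trunc_def)
    also have "\<dots> = f w" using K by (auto simp: supp_def)
    finally show "f w = (\<Oplus>\<^bsub>F\<^esub>i\<in>?K. trunc i f) w" by simp
  qed
  then show ?thesis using K z by (intro exI[of _ ?K]) auto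
qed

lemma mult_word: "f \<in> carrier F \<Longrightarrow> (bs [i] \<otimes>\<^bsub>F\<^esub> f) w = (case w of [] \<Rightarrow> 0 | j # v \<Rightarrow> if j = i then f v else 0)"
  and word_mult: "f \<in> carrier F \<Longrightarrow> (f \<otimes>\<^bsub>F\<^esub> bs [i]) w = (if w \<noteq> [] \<and> last w = i then f (butlast w) else 0)"
proof -
  assume f: "f \<in> carrier F"
  have fin: "finite (supp f)" using f by (simp add: carrier_F)
  have s: "supp (bs [i]) \<subseteq> {[i]}" by simp
  have "(bs [i] \<otimes>\<^bsub>F\<^esub> f) w = (\<Sum>v\<in>supp f. if i # v = w then f v else 0)"
    using W.mult_M[of "{[i]}" "supp f" "bs [i]" f w] fin s by (simp add: basis_elt_def cong: if_cong)
  also have "\<dots> = (case w of [] \<Rightarrow> 0 | j # v \<Rightarrow> if j = i then f v else 0)"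
    using fin by (cases w) (auto simp: supp_def if_distrib cong: if_cong)
  finally show "(bs [i] \<otimes>\<^bsub>F\<^esub> f) w = (case w of [] \<Rightarrow> 0 | j # v \<Rightarrow> if j = i then f v else 0)" .
  have "(f \<otimes>\<^bsub>F\<^esub> bs [i]) w = (\<Sum>v\<in>supp f. if v @ [i] = w then f v else 0)"
    using W.mult_M[of "supp f" "{[i]}" f "bs [i]" w] fin s by (simp add: basis_elt_def cong: if_cong)
  also have "\<dots> = (if w \<noteq> [] \<and> last w = i then f (butlast w) else 0)"
    using fin by (cases w rule: rev_cases) (auto simp: supp_def if_distrib cong: if_cong)
  finally show "(f \<otimes>\<^bsub>F\<^esub> bs [i]) w = (if w \<noteq> [] \<and> last w = i then f (butlast w) else 0)" .
qed

definition forms :: "((nat \<Rightarrow> nat \<Rightarrow> 'f) \<Rightarrow> bool) \<Rightarrow> (nat list \<Rightarrow> 'f) set" where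
  "forms G = {f \<in> free_part {..<n} 2. G (\<lambda>i j. f [i, j])}"

lemma forms_carrier: "forms G \<subseteq> carrier F"
  by (auto simp: forms_def free_part_def)

text \<open>In degree p the predicate \<open>in_quad\<close> reads only the words of length p, so
  that asking it for all p says that every homogeneous component lies in the ideal.\<close>

definition quad_ideal :: "((nat \<Rightarrow> nat \<Rightarrow> 'f) \<Rightarrow> bool) \<Rightarrow> (nat list \<Rightarrow> 'f) set" where
  "quad_ideal G = {f \<in> carrier F. \<forall>p. in_quad n G p f}"

text \<open>The recursion for \<open>in_quad\<close> splits off letters on the left, so that
  stability under multiplication from the right needs an argument: a letter appended at the end
  passes through both summands of the recursion.\<close>

lemma in_quad_snoc:
  fixes a :: "nat list \<Rightarrow> 'f"
  assumes "quad_space n UNIV G" "in_quad n G p a"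
  shows "in_quad n G (Suc p) (\<lambda>w. if w \<noteq> [] \<and> last w = l then a (butlast w) else 0)"
  using assms
proof (induction n G p a rule: in_quad.induct)
  case (1 n G a)
  then show ?case by simp
next
  case (2 n G a)
  show ?case by (rule in_quad_cong[OF 2(1) in_quad_0[OF 2(1)]]) (use 2(2) in \<open>auto elim!: words_SucE\<close>)
next
  case (3 n G p a)
  let ?r = "\<lambda>a w. if w \<noteq> [] \<and> last w = l then a (butlast w) else (0 :: 'f)"
  obtain \<nu> where nu: "\<forall>v\<in>words n p. G (\<lambda>i j. \<nu> (i # j # v))"
      "\<forall>i<n. in_quad n G (Suc p) (\<lambda>w. a (i # w) - \<nu> (i # w))" using 3 by auto
  have "G (\<lambda>i j. ?r \<nu> (i # j # v))" if v: "v \<in> words n (Suc p)" for v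
  proof -
    have "v \<noteq> []" "butlast v \<in> words n p" using v by (auto simp: words_def dest: in_set_butlastD)
    then show ?thesis using nu quad_spaceD(2)[OF 3(2)] by (cases "last v = l") simp_all
  qed
  moreover have "in_quad n G (Suc (Suc p)) (\<lambda>w. ?r a (i # w) - ?r \<nu> (i # w))" if "i < n" for i
    by (rule in_quad_cong[OF 3(2) 3(1)[OF that 3(2)]]) (use nu that in \<open>auto simp: words_def\<close>)
  ultimately show ?case unfolding in_quad.simps(3) by (intro exI[of _ "?r \<nu>"]) blast
qed

context
  fixes G :: "(nat \<Rightarrow> nat \<Rightarrow> 'f) \<Rightarrow> bool" assumes G: "quad_space n UNIV G"
begin

lemma quad_ideal_ideal: "ideal (quad_ideal G) F"
proof (rule idealI[OF W.M.ring_axioms])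
  note sub = quad_ideal_def
  show "subgroup (quad_ideal G) (add_monoid F)"
  proof (rule W.M.add.subgroupI)
    show "quad_ideal G \<noteq> {}" using in_quad_0[OF G] W.M.zero_closed by (auto simp: quad_ideal_def intro!: exI[of _ "\<lambda>w. 0"])
    show "\<ominus>\<^bsub>F\<^esub> f \<in> quad_ideal G" if "f \<in> quad_ideal G" for f
      using that in_quad_smult[OF G, of "- 1" _ f] W.M.minus_sm[of f] W.smult_closed_M[of "- 1" f] by (auto simp: quad_ideal_def)
    show "f \<oplus>\<^bsub>F\<^esub> g \<in> quad_ideal G" if "f \<in> quad_ideal G" "g \<in> quad_ideal G" for f g
      using that in_quad_add[OF G] W.add_closed_M by (auto simp: quad_ideal_def)
  qed (auto simp: quad_ideal_def)
  have add: "f \<oplus>\<^bsub>F\<^esub> g \<in> quad_ideal G" if "f \<in> quad_ideal G" "g \<in> quad_ideal G" for f g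
    using that in_quad_add[OF G] W.add_closed_M by (auto simp: quad_ideal_def)
  have sm: "c \<odot>\<^bsub>F\<^esub> f \<in> quad_ideal G" if "f \<in> quad_ideal G" for c f
    using that in_quad_smult[OF G, of c] W.smult_closed_M[of c f] by (auto simp: quad_ideal_def)
  have left: "bs w \<otimes>\<^bsub>F\<^esub> f \<in> quad_ideal G" if "f \<in> quad_ideal G" "set w \<subseteq> {..<n}" for f w
    using that(2)
  proof (induct w)
    case Nil
    then show ?case using that W.M.l_one[of f] by (simp add: quad_ideal_def)
  next
    case (Cons i w)
    let ?g = "bs w \<otimes>\<^bsub>F\<^esub> f"
    have g: "?g \<in> carrier F" "\<And>p. in_quad n G p ?g" using Cons by (auto simp: quad_ideal_def)
    have "in_quad n G p (bs [i] \<otimes>\<^bsub>F\<^esub> ?g)" for p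
    proof (cases p)
      case 0
      then show ?thesis using mult_word[OF g(1)] by simp
    next
      case (Suc q)
      have "in_quad n G q (\<lambda>w. (bs [i] \<otimes>\<^bsub>F\<^esub> ?g) (j # w))" for j
        using mult_word[OF g(1), of i] g(2)[of q] in_quad_0[OF G, of q] by (cases "j = i") simp_all
      then show ?thesis unfolding Suc by (rule in_quad_Cons[OF G])
    qed
    moreover have "bs (i # w) \<otimes>\<^bsub>F\<^esub> f = bs [i] \<otimes>\<^bsub>F\<^esub> ?g"
      using that Cons(2) by (subst W.M.m_assoc[symmetric]) (auto simp: bs_mult quad_ideal_def)
    ultimately show ?case using g Cons(2) by (simp add: quad_ideal_def)
  qed
  have right: "f \<otimes>\<^bsub>F\<^esub> bs w \<in> quad_ideal G" if "f \<in> quad_ideal G" "set w \<subseteq> {..<n}" for f w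
    using that(2)
  proof (induct w rule: rev_induct)
    case Nil
    then show ?case using that W.M.r_one[of f] by (simp add: quad_ideal_def)
  next
    case (snoc i w)
    let ?g = "f \<otimes>\<^bsub>F\<^esub> bs w"
    have g: "?g \<in> carrier F" "\<And>p. in_quad n G p ?g" using snoc by (auto simp: quad_ideal_def)
    have "in_quad n G p (?g \<otimes>\<^bsub>F\<^esub> bs [i])" for p
    proof (cases p)
      case 0
      then show ?thesis using word_mult[OF g(1)] by simp
    next
      case (Suc q)
      have "?g \<otimes>\<^bsub>F\<^esub> bs [i] = (\<lambda>w. if w \<noteq> [] \<and> last w = i then ?g (butlast w) else 0)"
        by (rule ext) (rule word_mult[OF g(1)])
      then show ?thesis using in_quad_snoc[OF G g(2)[of q], of i] Suc by simp
    qed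
    moreover have "f \<otimes>\<^bsub>F\<^esub> bs (w @ [i]) = ?g \<otimes>\<^bsub>F\<^esub> bs [i]"
      using that snoc(2) by (subst W.M.m_assoc) (auto simp: bs_mult quad_ideal_def)
    ultimately show ?case using g snoc(2) by (simp add: quad_ideal_def)
  qed
  fix f h assume f: "f \<in> quad_ideal G" and h: "h \<in> carrier F"
  then have fc: "f \<in> carrier F" by (simp add: quad_ideal_def)
  show "h \<otimes>\<^bsub>F\<^esub> f \<in> quad_ideal G" using h
    by (induct h rule: bs_induct) (simp_all add: left f fc add sm W.M.l_distr W.M.sm_ml del: W.M_sel)
  show "f \<otimes>\<^bsub>F\<^esub> h \<in> quad_ideal G" using h
    by (induct h rule: bs_induct) (simp_all add: right f fc add sm W.M.r_distr W.M.sm_mr del: W.M_sel)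
qed

lemma forms_quad_ideal: "forms G \<subseteq> quad_ideal G"
proof
  fix f assume f: "f \<in> forms G"
  have w: "f w = 0" if "w \<notin> words n 2" for w using f that by (auto simp: forms_def free_part_words)
  have "in_quad n G p f" for p
  proof (cases "p = 2")
    case True
    have "in_quad n G (Suc (Suc 0)) f" by (rule in_quad_gen[OF G]) (use f in \<open>simp add: forms_def\<close>)
    then show ?thesis using True by (simp add: numeral_2_eq_2)
  next
    case False
    show ?thesis by (rule in_quad_cong[OF G in_quad_0[OF G]]) (use w False in \<open>auto simp: words_def\<close>)
  qed
  then show "f \<in> quad_ideal G" using f forms_carrier by (auto simp: quad_ideal_def)
qed

text \<open>Minimality of the ideal: the recursion, read as an identity in the free algebra, writes
  an element of degree p by forms in G times words and by letters times elements of degree p - 1 to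
  which the induction applies.\<close>

lemma in_quad_Idl:
  assumes "ideal I F" "forms G \<subseteq> I" "in_quad n G p a" "\<And>w. w \<notin> words n p \<Longrightarrow> a w = 0"
  shows "a \<in> I"
  using assms(3,4)
proof (induction p arbitrary: a rule: nat_less_induct)
  case (1 p)
  interpret I: ideal I F by (rule assms(1))
  have sm: "c \<odot>\<^bsub>F\<^esub> f \<in> I" if "f \<in> I" for c f
  proof -
    have "f \<in> carrier F" using that I.a_subset by auto
    moreover have "(c \<odot>\<^bsub>F\<^esub> \<one>\<^bsub>F\<^esub>) \<otimes>\<^bsub>F\<^esub> f \<in> I" using that by (intro I.I_l_closed W.M.sm_closed W.M.one_closed) simp_all
    ultimately show ?thesis using W.M.sm_ml[of c "\<one>\<^bsub>F\<^esub>" f] W.M.l_one[of f] by (simp del: W.M_sel)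
  qed
  have fs: "(\<Oplus>\<^bsub>F\<^esub>x\<in>X. f x) \<in> I" if "\<And>x. x \<in> X \<Longrightarrow> f x \<in> I" for X :: "'c set" and f
    using that
  proof (induct X rule: infinite_finite_induct)
    case (insert x X)
    then have "f \<in> X \<rightarrow> carrier F" "f x \<in> carrier F" using I.a_subset by auto
    then show ?case using insert by (simp add: I.a_closed del: W.M_sel)
  qed (simp_all add: W.M.finsum_infinite I.zero_closed del: W.M_sel)
  have z: "(\<lambda>w. 0) \<in> I" using I.zero_closed by simp
  have zero: "a \<in> I" if "\<And>w. w \<in> words n p \<Longrightarrow> a w = 0"
  proof -
    have "a = (\<lambda>w. 0)" using that 1(3) by auto
    then show ?thesis using z by simp
  qed
  show ?case
  proof (cases p)
    case 0
    then show ?thesis using 1(2) by (intro zero) simp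
  next
    case (Suc q)
    show ?thesis
    proof (cases q)
      case 0
      then show ?thesis using 1(2) Suc by (intro zero) (auto elim!: words_SucE)
    next
      case (Suc r)
      note p = \<open>p = Suc q\<close>[unfolded Suc]
      obtain \<nu> where nu: "\<And>v. v\<in>words n r \<Longrightarrow> G (\<lambda>i j. \<nu> (i # j # v))"
        "\<And>i. i<n \<Longrightarrow> in_quad n G (Suc r) (\<lambda>w. a (i # w) - \<nu> (i # w))" using 1(2) p by auto
      \<comment> \<open>The function \<nu> of the recursion is arbitrary off the words of length p;
        it is set to 0 there to obtain elements of the free algebra.\<close>
      define \<mu> where "\<mu> w = (if w \<in> words n p then \<nu> w else 0)" for w
      define g where "g v w = (case w of [i, j] \<Rightarrow> \<mu> (i # j # v) | _ \<Rightarrow> 0)" for v w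
      define b where "b i w = a (i # w) - \<mu> (i # w)" for i w
      have gF: "g v \<in> forms G" if "v \<in> words n r" for v
      proof -
        have "g v w = 0" if "w \<notin> words n 2" for w
          using that by (auto simp: g_def \<mu>_def words_def split: list.splits)
        moreover have "G (\<lambda>i j. g v [i, j])"
          by (rule quad_spaceD(1)[OF G nu(1)[OF that]]) (use that p in \<open>auto simp: g_def \<mu>_def\<close>)
        ultimately show ?thesis by (auto simp: forms_def free_part_words)
      qed
      have bI: "b i \<in> I" if "i < n" for i
      proof (rule 1(1)[rule_format])
        show "in_quad n G (Suc r) (b i)"
          by (rule in_quad_cong[OF G nu(2)[OF that]]) (use that p in \<open>auto simp: b_def \<mu>_def\<close>)
        show "b i w = 0" if "w \<notin> words n (Suc r)" for w
          using that 1(3)[of "i # w"] p by (auto simp: b_def \<mu>_def)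
      qed (use p in simp)
      have bc: "b i \<in> carrier F" if "i < n" for i using bI[OF that] I.a_subset by auto
      have gc: "g v \<in> carrier F" if "v \<in> words n r" for v using gF[OF that] forms_carrier by auto
      have vc: "bs v \<in> carrier F" if "v \<in> words n r" for v using that by (auto simp: words_def)
      have ic: "bs [i] \<in> carrier F" if "i < n" for i using that by auto
      have gv: "(g v \<otimes>\<^bsub>F\<^esub> bs v) w = (if drop 2 w = v \<and> length w = Suc (Suc r) then \<mu> w else 0)" if v: "v \<in> words n r" for v w
      proof -
        have sg: "supp (g v) \<subseteq> words n 2" using gF[OF v] by (auto simp: forms_def free_part_words supp_def)
        have bv: "bs v v = 1" by (simp add: basis_elt_def)
        have "(g v \<otimes>\<^bsub>F\<^esub> bs v) w = (\<Sum>u\<in>words n 2. if u @ v = w then g v u else 0)"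
          using W.mult_M[OF words_finite _ sg, of "{v}" "bs v" w] by (simp add: bv cong: if_cong)
        also have "\<dots> = (\<Sum>u\<in>words n 2. if u = take 2 w then (if drop 2 w = v \<and> length w = Suc (Suc r) then g v (take 2 w) else 0) else 0)"
        proof (intro sum.cong refl)
          fix u assume "u \<in> words n 2"
          then have "u @ v = w \<longleftrightarrow> u = take 2 w \<and> drop 2 w = v \<and> length w = Suc (Suc r)"
            using v by (auto simp: words_def append_eq_conv_conj)
          then show "(if u @ v = w then g v u else 0) =
              (if u = take 2 w then (if drop 2 w = v \<and> length w = Suc (Suc r) then g v (take 2 w) else 0) else 0)" by auto
        qed
        also have "\<dots> = (if take 2 w \<in> words n 2 \<and> drop 2 w = v \<and> length w = Suc (Suc r) then g v (take 2 w) else 0)"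
          by simp
        also have "\<dots> = (if drop 2 w = v \<and> length w = Suc (Suc r) then \<mu> w else 0)"
        proof (cases "drop 2 w = v \<and> length w = Suc (Suc r)")
          case True
          then obtain i j where w: "w = i # j # v" by (cases w; cases "tl w") auto
          show ?thesis using True v p unfolding w by (auto simp: g_def \<mu>_def words_def)
        qed auto
        finally show ?thesis .
      qed
      \<comment> \<open>Both sides are compared on each word: the first sum contributes \<mu>, since
        the tail of the word selects one summand, and the second one contributes a - \<mu>, since
        the first letter does.\<close>
      have eq: "a = (\<Oplus>\<^bsub>F\<^esub>v\<in>words n r. g v \<otimes>\<^bsub>F\<^esub> bs v) \<oplus>\<^bsub>F\<^esub> (\<Oplus>\<^bsub>F\<^esub>i\<in>{..<n}. bs [i] \<otimes>\<^bsub>F\<^esub> b i)"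
      proof
        fix w
        have "(\<Oplus>\<^bsub>F\<^esub>v\<in>words n r. g v \<otimes>\<^bsub>F\<^esub> bs v) w = (\<Sum>v\<in>words n r. if drop 2 w = v \<and> length w = Suc (Suc r) then \<mu> w else 0)"
          by (subst W.finsum_M) (use gc vc in \<open>auto simp: gv\<close>)
        also have "\<dots> = (\<Sum>v\<in>words n r. if v = drop 2 w then (if length w = Suc (Suc r) then \<mu> w else 0) else 0)"
          by (intro sum.cong) auto
        also have "\<dots> = (if drop 2 w \<in> words n r then (if length w = Suc (Suc r) then \<mu> w else 0) else 0)" by simp
        also have "\<dots> = \<mu> w" using p by (auto simp: \<mu>_def words_def dest: in_set_dropD)
        finally have s1: "(\<Oplus>\<^bsub>F\<^esub>v\<in>words n r. g v \<otimes>\<^bsub>F\<^esub> bs v) w = \<mu> w" .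
        have "(\<Oplus>\<^bsub>F\<^esub>i\<in>{..<n}. bs [i] \<otimes>\<^bsub>F\<^esub> b i) w = (\<Sum>i<n. case w of [] \<Rightarrow> 0 | j # v \<Rightarrow> if j = i then b i v else 0)"
          by (subst W.finsum_M) (use bc ic mult_word in auto)
        also have "\<dots> = a w - \<mu> w"
        proof (cases w)
          case Nil
          then show ?thesis using 1(3)[of "[]"] p by (simp add: \<mu>_def words_def)
        next
          case (Cons j v)
          then show ?thesis using 1(3)[of w] p by (cases "j < n") (auto simp: b_def \<mu>_def)
        qed
        finally show "a w = ((\<Oplus>\<^bsub>F\<^esub>v\<in>words n r. g v \<otimes>\<^bsub>F\<^esub> bs v) \<oplus>\<^bsub>F\<^esub> (\<Oplus>\<^bsub>F\<^esub>i\<in>{..<n}. bs [i] \<otimes>\<^bsub>F\<^esub> b i)) w"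
          using s1 by simp
      qed
      have "g v \<otimes>\<^bsub>F\<^esub> bs v \<in> I" if "v \<in> words n r" for v
        using gF[OF that] assms(2) vc[OF that] by (intro I.I_r_closed) auto
      moreover have "bs [i] \<otimes>\<^bsub>F\<^esub> b i \<in> I" if "i < n" for i
        using bI[OF that] ic[OF that] by (rule I.I_l_closed)
      ultimately show ?thesis by (subst eq, intro I.a_closed fs) auto
    qed
  qed
qed

text \<open>The recursion thus computes the generated ideal. The ideal of the quadratic dual, the
  exterior ideal and the kernel of the presentation of A are all accessed through it.\<close>

lemma quad_ideal_Idl: "Idl\<^bsub>F\<^esub> (forms G) = quad_ideal G"
proof
  show "Idl\<^bsub>F\<^esub> (forms G) \<subseteq> quad_ideal G"
    using W.M.genideal_minimal[OF quad_ideal_ideal forms_quad_ideal] .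
  show "quad_ideal G \<subseteq> Idl\<^bsub>F\<^esub> (forms G)"
  proof
    fix f assume f: "f \<in> quad_ideal G"
    interpret I: ideal "Idl\<^bsub>F\<^esub> (forms G)" F by (rule W.M.genideal_ideal[OF forms_carrier])
    have t: "trunc p f \<in> Idl\<^bsub>F\<^esub> (forms G)" for p
    proof (rule in_quad_Idl[OF I.is_ideal W.M.genideal_self[OF forms_carrier]])
      show "in_quad n G p (trunc p f)"
        by (rule in_quad_cong[OF G]) (use f in \<open>auto simp: quad_ideal_def trunc_def words_def\<close>)
      show "trunc p f w = 0" if "w \<notin> words n p" for w
        using that f by (auto simp: trunc_def quad_ideal_def carrier_F supp_def words_def)
    qed
    obtain K where K: "finite K" "f = (\<Oplus>\<^bsub>F\<^esub>i\<in>K. trunc i f)" using F_sum_trunc[of f] f by (auto simp: quad_ideal_def)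
    have "(\<Oplus>\<^bsub>F\<^esub>i\<in>K. trunc i f) \<in> Idl\<^bsub>F\<^esub> (forms G)" using K(1)
    proof (induct K)
      case (insert i K)
      have "\<And>i. trunc i f \<in> carrier F" using t I.a_subset by auto
      then show ?case using insert t by (simp add: I.a_closed del: W.M_sel)
    qed (simp add: I.zero_closed del: W.M_sel)
    then show "f \<in> Idl\<^bsub>F\<^esub> (forms G)" using K(2) by simp
  qed
qed

end

end

lemma with_grade_ops [simp]:
  "finsum (with_grade A g) = finsum A" "a_inv (with_grade A g) = a_inv A"
  "a_minus (with_grade A g) = a_minus A" "alt_sign (with_grade A g) = alt_sign A" "linear_map S (with_grade A g) B = linear_map S A B"
  "linear_map S B (with_grade A g) = linear_map S B A"
  by (simp_all add: finsum_def finprod_def a_inv_def m_inv_def a_minus_def alt_sign_def linear_map_def fun_eq_iff)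

lemma with_diff_ops [simp]:
  "finsum (with_diff A g) = finsum A" "a_inv (with_diff A g) = a_inv A"
  "a_minus (with_diff A g) = a_minus A" "alt_sign (with_diff A g) = alt_sign A" "linear_map S (with_diff A g) B = linear_map S A B"
  "linear_map S B (with_diff A g) = linear_map S B A"
  by (simp_all add: finsum_def finprod_def a_inv_def m_inv_def a_minus_def alt_sign_def linear_map_def fun_eq_iff)

lemma graded_by_with [simp]:
  "graded_by S (with_grade A g') g pr = graded_by S A g pr" "graded_by S (with_diff B d) g pr = graded_by S B g pr"
  by (simp_all add: graded_by_def)

lemma algebra_hom_with [simp]:
  "algebra_hom S (with_grade A g) B = algebra_hom S A B" "algebra_hom S B (with_grade A g) = algebra_hom S B A"
  "algebra_hom S (with_diff A' d) B = algebra_hom S A' B" "algebra_hom S B (with_diff A' d) = algebra_hom S B A'"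
  by (simp_all add: algebra_hom_def fun_eq_iff)

locale graded_quot = free_alg n ty for n and ty :: "'f::field itself" +
  fixes I :: "(nat list \<Rightarrow> 'f) set"
  assumes I: "ideal I F" and homogeneous: "f \<in> I \<Longrightarrow> trunc p f \<in> I"
begin

sublocale Q: algebra_ideal UNIV F I
  unfolding algebra_ideal_def using W.coeff_algebra_M I by (simp add: free_algebra_def)

abbreviation cls where "cls \<equiv> Q.cl"
abbreviation E where "E \<equiv> graded_free_quot {..<n} I"

lemma E_eq: "E = with_grade Q.Q (\<lambda>i. {cls f | f. f \<in> free_part {..<n} i})"
  by (simp add: graded_free_quot_def)

lemma E_algebra: "coeff_algebra UNIV E"
  unfolding E_eq by (rule coeff_algebra_cong[OF Q.Q_algebra]) simp_all

sublocale E: coeff_algebra UNIV E by (rule E_algebra)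

lemma E_carrier: "carrier E = cls ` carrier F"
  by (simp add: E_eq Q.cl_carrier)

lemma cls_closed [simp, intro]: "f \<in> carrier F \<Longrightarrow> cls f \<in> carrier E"
  by (simp add: E_eq)

lemma cls_hom:
  "f \<in> carrier F \<Longrightarrow> g \<in> carrier F \<Longrightarrow> cls f \<oplus>\<^bsub>E\<^esub> cls g = cls (f \<oplus>\<^bsub>F\<^esub> g)"
  "f \<in> carrier F \<Longrightarrow> g \<in> carrier F \<Longrightarrow> cls f \<otimes>\<^bsub>E\<^esub> cls g = cls (f \<otimes>\<^bsub>F\<^esub> g)"
  "f \<in> carrier F \<Longrightarrow> c \<odot>\<^bsub>E\<^esub> cls f = cls (c \<odot>\<^bsub>F\<^esub> f)"
  "\<one>\<^bsub>E\<^esub> = cls \<one>\<^bsub>F\<^esub>" "\<zero>\<^bsub>E\<^esub> = cls \<zero>\<^bsub>F\<^esub>"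
  by (simp_all add: E_eq Q.cl_hom del: W.M_sel)

lemma cls_algebra_hom: "algebra_hom UNIV F E cls"
  using Q.cl_algebra_hom by (simp add: E_eq)

lemma cls_additive: "additive F E cls"
  using linear_additive[OF W.M.ring_axioms E.ring_axioms] cls_algebra_hom unfolding algebra_hom_def by blast

lemma cls_eq_0: "f \<in> carrier F \<Longrightarrow> cls f = \<zero>\<^bsub>E\<^esub> \<longleftrightarrow> f \<in> I"
  using Q.cl_eq[of f "\<zero>\<^bsub>F\<^esub>"] by (simp add: cls_hom(5) a_minus_def W.M.minus_zero del: W.M_sel)

abbreviation xi where "xi i \<equiv> cls (bs [i])"

lemma xi_closed [simp, intro]: "i < n \<Longrightarrow> xi i \<in> carrier E"
  by auto

lemma cls_bs_Cons: "i < n \<Longrightarrow> set w \<subseteq> {..<n} \<Longrightarrow> cls (bs (i # w)) = xi i \<otimes>\<^bsub>E\<^esub> cls (bs w)"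
  by (simp add: cls_hom(2) bs_mult)

lemma trunc_linear: "linear_map UNIV F F (trunc p)"
  by (rule linear_mapI, simp) (auto simp: trunc_def fun_eq_iff)

definition neg :: "(nat list \<Rightarrow> 'f) \<Rightarrow> nat list \<Rightarrow> 'f" where
  "neg f = (\<lambda>w. (- 1) ^ length w * f w)"

lemma neg_closed [simp]: "f \<in> carrier F \<Longrightarrow> neg f \<in> carrier F"
  by (rule restrict_F[of f]) (auto simp: neg_def)

lemma neg_trunc: "neg (trunc p f) = (- 1) ^ p \<odot>\<^bsub>F\<^esub> trunc p f"
  by (auto simp: neg_def trunc_def fun_eq_iff)

lemma neg_linear: "linear_map UNIV F F neg"
  by (rule linear_mapI, simp) (auto simp: neg_def fun_eq_iff algebra_simps)

lemma neg_hom: "algebra_hom UNIV F F neg"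
proof -
  have b: "neg (bs w) = (- 1) ^ length w \<odot>\<^bsub>F\<^esub> bs w" for w by (auto simp: neg_def basis_elt_def fun_eq_iff)
  note L = linear_mapD[OF neg_linear]
  have 1: "neg (bs w \<otimes>\<^bsub>F\<^esub> g) = neg (bs w) \<otimes>\<^bsub>F\<^esub> neg g" if "g \<in> carrier F" "set w \<subseteq> {..<n}" for w g
    using that(1)
  proof (induct g rule: bs_induct)
    case (basis v)
    then show ?case using that by (simp add: b bs_mult W.M.sm_ml W.M.sm_mr W.M.sm_mult[symmetric] power_add mult.commute del: W.M_sel)
  qed (use that in \<open>simp_all add: W.M.r_distr W.M.sm_mr L del: W.M_sel\<close>)
  have "neg (f \<otimes>\<^bsub>F\<^esub> g) = neg f \<otimes>\<^bsub>F\<^esub> neg g" if "f \<in> carrier F" "g \<in> carrier F" for f g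
    using that(1) by (induct f rule: bs_induct) (use that in \<open>simp_all add: 1 W.M.l_distr W.M.sm_ml L del: W.M_sel\<close>)
  moreover have "neg \<one>\<^bsub>F\<^esub> = \<one>\<^bsub>F\<^esub>" using b[of "[]"] by simp
  ultimately show ?thesis using neg_linear by (simp add: algebra_hom_def)
qed

lemma I_finsum: "finite K \<Longrightarrow> (\<And>i. i \<in> K \<Longrightarrow> h i \<in> I) \<Longrightarrow> (\<Oplus>\<^bsub>F\<^esub>i\<in>K. h i) \<in> I"
proof (induct K rule: finite_induct)
  case (insert i K)
  then have "h \<in> K \<rightarrow> carrier F" "h i \<in> carrier F" using Q.a_subset by auto
  then show ?case using insert by (simp add: Q.a_closed del: W.M_sel)
qed (simp add: Q.zero_closed del: W.M_sel)

lemma neg_I: "f \<in> I \<Longrightarrow> neg f \<in> I"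
proof -
  assume f: "f \<in> I"
  then have fc: "f \<in> carrier F" using Q.a_subset by auto
  obtain K where K: "finite K" "f = (\<Oplus>\<^bsub>F\<^esub>i\<in>K. trunc i f)" using F_sum_trunc[OF fc] by blast
  have "neg f = (\<Oplus>\<^bsub>F\<^esub>i\<in>K. neg (trunc i f))"
    by (subst K(2), rule additive.finsum[OF linear_additive[OF W.M.ring_axioms W.M.ring_axioms neg_linear]]) (use fc in auto)
  also have "\<dots> \<in> I" using homogeneous[OF f] Q.I_sm by (intro I_finsum K) (simp add: neg_trunc del: W.M_sel)
  finally show ?thesis .
qed

definition prE where "prE p = (\<lambda>X. the_elem ((\<lambda>f. cls (trunc p f)) ` X))"
definition sgE where "sgE = (\<lambda>X. the_elem ((\<lambda>f. cls (neg f)) ` X))"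

lemma prE_cls: "f \<in> carrier F \<Longrightarrow> prE p (cls f) = cls (trunc p f)"
  and prE_linear: "linear_map UNIV E E (prE p)"
proof -
  have h: "linear_map UNIV F E (\<lambda>f. cls (trunc p f))"
    using linear_mapD[OF trunc_linear] by (auto simp: linear_map_def cls_hom simp del: W.M_sel)
  have z: "cls (trunc p f) = \<zero>\<^bsub>E\<^esub>" if "f \<in> I" for f using homogeneous[OF that] cls_eq_0 Q.a_subset by auto
  show "f \<in> carrier F \<Longrightarrow> prE p (cls f) = cls (trunc p f)"
    unfolding prE_def by (rule Q.lift_hom_cl[OF E.ring_axioms h z])
  have "linear_map UNIV Q.Q E (prE p)" unfolding prE_def by (rule Q.lift_linear[OF E.ring_axioms h z])
  then show "linear_map UNIV E E (prE p)" using E_eq by simp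
qed

lemma sgE_cls: "f \<in> carrier F \<Longrightarrow> sgE (cls f) = cls (neg f)"
  and sgE_hom: "algebra_hom UNIV E E sgE"
proof -
  have hh: "algebra_hom UNIV F E (\<lambda>f. cls (neg f))"
    using neg_hom cls_algebra_hom by (auto simp: algebra_hom_def linear_map_def simp del: W.M_sel)
  then have h: "linear_map UNIV F E (\<lambda>f. cls (neg f))" by (simp add: algebra_hom_def)
  have z: "cls (neg f) = \<zero>\<^bsub>E\<^esub>" if "f \<in> I" for f using neg_I[OF that] cls_eq_0 Q.a_subset by auto
  show "f \<in> carrier F \<Longrightarrow> sgE (cls f) = cls (neg f)"
    unfolding sgE_def by (rule Q.lift_hom_cl[OF E.ring_axioms h z])
  have "algebra_hom UNIV Q.Q E sgE" unfolding sgE_def by (rule Q.lift_hom(3)[OF E.ring_axioms h z hh])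
  then show "algebra_hom UNIV E E sgE" using E_eq by simp
qed

lemma E_grade: "grade E i = {cls f | f. f \<in> free_part {..<n} i}"
  by (simp add: E_eq)

lemma E_grade_iff: "a \<in> grade E i \<longleftrightarrow> a \<in> carrier E \<and> prE i a = a"
proof
  assume "a \<in> grade E i"
  then show "a \<in> carrier E \<and> prE i a = a" by (auto simp: E_grade prE_cls free_part_iff)
next
  assume h: "a \<in> carrier E \<and> prE i a = a"
  then obtain f where f: "f \<in> carrier F" "a = cls f" by (auto simp: E_carrier)
  then have "a = cls (trunc i f)" using h prE_cls by metis
  moreover have "trunc i f \<in> free_part {..<n} i" using f by (simp add: free_part_iff) (simp add: trunc_def cong: if_cong)
  ultimately show "a \<in> grade E i" by (auto simp: E_grade)
qed

lemma E_graded: "graded_by UNIV E (grade E) prE"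
  unfolding graded_by_def
proof (intro conjI allI ballI)
  fix i j a assume a: "a \<in> carrier E"
  then obtain f where f: "f \<in> carrier F" "a = cls f" by (auto simp: E_carrier)
  have "trunc i (trunc j f) = (if i = j then trunc j f else \<zero>\<^bsub>F\<^esub>)" by (auto simp: trunc_def fun_eq_iff)
  then show "prE i (prE j a) = (if i = j then prE j a else \<zero>\<^bsub>E\<^esub>)" using f by (auto simp: prE_cls cls_hom(5) simp del: W.M_sel)
next
  fix a assume a: "a \<in> carrier E"
  then obtain f where f: "f \<in> carrier F" "a = cls f" by (auto simp: E_carrier)
  obtain K where K: "finite K" "\<forall>i. i \<notin> K \<longrightarrow> trunc i f = \<zero>\<^bsub>F\<^esub>" "f = (\<Oplus>\<^bsub>F\<^esub>i\<in>K. trunc i f)" using F_sum_trunc[OF f(1)] by blast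
  have "a = (\<Oplus>\<^bsub>E\<^esub>i\<in>K. cls (trunc i f))" unfolding f(2)
    by (subst K(3), rule additive.finsum[OF cls_additive]) (use f in auto)
  moreover have "\<dots> = (\<Oplus>\<^bsub>E\<^esub>i\<in>K. prE i a)" by (rule E.finsum_cong') (use f prE_cls in auto)
  ultimately have e: "a = (\<Oplus>\<^bsub>E\<^esub>i\<in>K. prE i a)" by (rule trans)
  have "\<forall>i. i \<notin> K \<longrightarrow> prE i a = \<zero>\<^bsub>E\<^esub>" using K(2) f by (simp add: prE_cls cls_hom(5) del: W.M_sel)
  then show "\<exists>K. finite K \<and> (\<forall>i. i \<notin> K \<longrightarrow> prE i a = \<zero>\<^bsub>E\<^esub>) \<and> a = (\<Oplus>\<^bsub>E\<^esub>i\<in>K. prE i a)"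
    by (intro exI[of _ K] conjI K(1) e)
next
  have "trunc 0 \<one>\<^bsub>F\<^esub> = \<one>\<^bsub>F\<^esub>" by (auto simp: trunc_def basis_elt_def fun_eq_iff)
  then show "\<one>\<^bsub>E\<^esub> \<in> grade E 0" by (simp add: E_grade_iff prE_cls cls_hom(4) del: W.M_sel)
next
  fix i j a b assume "a \<in> grade E i" "b \<in> grade E j"
  then obtain f g where f: "f \<in> free_part {..<n} i" "a = cls f" and g: "g \<in> free_part {..<n} j" "b = cls g"
    by (auto simp: E_grade)
  then have c: "f \<in> carrier F" "g \<in> carrier F" by (auto simp: free_part_iff)
  have "f \<otimes>\<^bsub>F\<^esub> g \<in> free_part {..<n} (i + j)"
    using W.supp_mult_M[of f g] f g c W.M.m_closed[of f g] by (fastforce simp: free_part_def simp del: W.M_sel)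
  then show "a \<otimes>\<^bsub>E\<^esub> b \<in> grade E (i + j)" using f g c by (auto simp: cls_hom(2) E_grade)
qed (auto simp: prE_linear E_grade_iff)

lemma sgE_sign: "a \<in> grade E i \<Longrightarrow> sgE a = alt_sign E i a"
proof -
  assume "a \<in> grade E i"
  then obtain f where f: "f \<in> free_part {..<n} i" "a = cls f" by (auto simp: E_grade)
  then have "neg f = (- 1) ^ i \<odot>\<^bsub>F\<^esub> f" "f \<in> carrier F" using neg_trunc[of i f] by (auto simp: free_part_iff)
  then have "sgE a = (- 1) ^ i \<odot>\<^bsub>E\<^esub> a" using f by (simp add: sgE_cls cls_hom(3))
  moreover have "a \<in> carrier E" using f(2) \<open>f \<in> carrier F\<close> by auto
  ultimately show ?thesis by (cases "even i") (simp_all add: alt_sign_def E.minus_sm)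
qed

lemma E_induct [consumes 1, case_names one xi add smult]:
  assumes a: "a \<in> carrier E" and one: "P \<one>\<^bsub>E\<^esub>"
    and xi: "\<And>i a. i < n \<Longrightarrow> a \<in> carrier E \<Longrightarrow> P a \<Longrightarrow> P (xi i \<otimes>\<^bsub>E\<^esub> a)"
    and add: "\<And>a b. a \<in> carrier E \<Longrightarrow> b \<in> carrier E \<Longrightarrow> P a \<Longrightarrow> P b \<Longrightarrow> P (a \<oplus>\<^bsub>E\<^esub> b)"
    and smult: "\<And>c a. a \<in> carrier E \<Longrightarrow> P a \<Longrightarrow> P (c \<odot>\<^bsub>E\<^esub> a)"
  shows "P a"
proof -
  obtain f where f: "f \<in> carrier F" "a = cls f" using a by (auto simp: E_carrier)
  have b: "P (cls (bs w))" if "set w \<subseteq> {..<n}" for w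
    using that
  proof (induct w)
    case Nil
    then show ?case using one by (simp add: cls_hom(4))
  next
    case (Cons i w)
    then have "i < n" "set w \<subseteq> {..<n}" "P (cls (bs w))" by auto
    then show ?case using xi[of i "cls (bs w)"] by (simp only: cls_bs_Cons cls_closed bs_closed)
  qed
  show ?thesis unfolding f(2) using f(1)
    by (induct f rule: bs_induct) (auto simp: b cls_hom(1)[symmetric] cls_hom(3)[symmetric] add smult simp del: W.M_sel)
qed

end

section \<open>Gradings of tensor products\<close>

locale graded_tensor = tensor_product UNIV M N
  for M :: "('f::comm_ring_1, 'a, 'm) module_scheme" and N :: "('f, 'b, 'n) graded_scheme" +
  fixes prN sgN
  assumes N_graded: "graded_by UNIV N (grade N) prN" and sgN_hom: "algebra_hom UNIV N N sgN"
    and sgN_sign: "a \<in> grade N i \<Longrightarrow> sgN a = alt_sign N i a"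
begin

definition onN where "onN h = tensor_lift T (\<lambda>a m. tens a (h m))"

lemma onN_bilinear: "linear_map UNIV N N h \<Longrightarrow> bilinear UNIV M N T (\<lambda>a m. tens a (h m))"
  by (rule bilinearI) (auto simp: linear_mapD[of UNIV N N h] tens)

lemma onN_tens: "linear_map UNIV N N h \<Longrightarrow> a \<in> carrier M \<Longrightarrow> m \<in> carrier N \<Longrightarrow> onN h (tens a m) = tens a (h m)"
  unfolding onN_def by (rule tensor_lift_tens[OF T_algebra onN_bilinear])

lemma onN_linear: "linear_map UNIV N N h \<Longrightarrow> linear_map UNIV T T (onN h)"
  unfolding onN_def by (rule tensor_lift_linear[OF T_algebra onN_bilinear])

definition "prT i = onN (prN i)"
definition "sgT = onN sgN"

lemma sgN_linear: "linear_map UNIV N N sgN"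
  using sgN_hom by (simp add: algebra_hom_def)

lemmas prN_linear = NA.pr_linear[OF N_graded]
lemmas prT_linear = onN_linear[OF prN_linear, folded prT_def]
lemmas prT_tens = onN_tens[OF prN_linear, folded prT_def]
lemmas sgT_tens = onN_tens[OF sgN_linear, folded sgT_def]
lemmas sgT_linear = onN_linear[OF sgN_linear, folded sgT_def]

lemma sgT_hom: "algebra_hom UNIV T T sgT"
  unfolding sgT_def onN_def
  by (rule tensor_lift_hom[OF T_algebra onN_bilinear[OF sgN_linear]])
    (use sgN_hom in \<open>auto simp: tens_one tens_mult algebra_hom_def linear_map_def\<close>)

text \<open>The grading of the tensor product is given as a subgroup generated by tensors.
  Describing it as the image of a projection makes it possible to treat all gradings in the same
  way.\<close>

lemma tensor_grade_iff: "t \<in> tensor_grade M N i \<longleftrightarrow> t \<in> carrier T \<and> prT i t = t"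
proof
  have X: "{tens a m | a m. a \<in> carrier M \<and> m \<in> grade N i} \<subseteq> carrier T"
    using NA.g_iff[OF N_graded] by auto
  interpret p: additive T T "prT i" by (rule linear_additive[OF T.ring_axioms T.ring_axioms prT_linear])
  {
    assume "t \<in> tensor_grade M N i"
    then show "t \<in> carrier T \<and> prT i t = t" unfolding tensor_grade_def
    proof (induct t rule: generate.induct)
      case (inv h)
      then show ?case using NA.g_iff[OF N_graded] X
        by (auto simp: prT_tens p.minus simp flip: a_inv_def)
    next
      case (incl h)
      then show ?case using NA.g_iff[OF N_graded] by (auto simp: prT_tens)
    qed (auto simp: p.add)
  }
  assume t: "t \<in> carrier T \<and> prT i t = t"
  have "prT i s \<in> tensor_grade M N i" if "s \<in> carrier T" for s
    using that
  proof (induct s rule: tensor_induct)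
    case (tens a b)
    then show ?case unfolding tensor_grade_def
      by (intro generate.incl) (use NA.pr_in_g[OF N_graded] in \<open>auto simp: prT_tens\<close>)
  next
    case (add s t)
    then show ?case using generate.eng[of _ "add_monoid T"] by (simp add: p.add tensor_grade_def)
  qed
  then show "t \<in> tensor_grade M N i" using t by metis
qed

lemma tens_grade: "a \<in> carrier M \<Longrightarrow> m \<in> grade N i \<Longrightarrow> tens a m \<in> tensor_grade M N i"
  using NA.g_iff[OF N_graded] by (simp add: tensor_grade_iff prT_tens)

lemma T_graded: "graded_by UNIV T (tensor_grade M N) prT"
proof -
  note L = linear_mapD[OF prT_linear]
  have add: "additive T T (prT i)" for i by (rule linear_additive[OF T.ring_axioms T.ring_axioms prT_linear])
  have 1: "prT i (prT j t) = (if i = j then prT j t else \<zero>\<^bsub>T\<^esub>)" if "t \<in> carrier T" for i j t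
    using that by (induct t rule: tensor_induct)
      (auto simp: prT_tens NA.pr_closed[OF N_graded] NA.pr_pr[OF N_graded] L)
  have 2: "\<exists>K. finite K \<and> (\<forall>i. i \<notin> K \<longrightarrow> prT i t = \<zero>\<^bsub>T\<^esub>) \<and> t = (\<Oplus>\<^bsub>T\<^esub>i\<in>K. prT i t)" if "t \<in> carrier T" for t
    using that
  proof (induct t rule: tensor_induct)
    case (tens a m)
    obtain K where K: "finite K" "\<forall>i. i \<notin> K \<longrightarrow> prN i m = \<zero>\<^bsub>N\<^esub>" "m = (\<Oplus>\<^bsub>N\<^esub>i\<in>K. prN i m)"
      using NA.pr_sum[OF N_graded tens(2)] by blast
    have "tens a m = (\<Oplus>\<^bsub>T\<^esub>i\<in>K. tens a (prN i m))"
      by (subst K(3), rule additive.finsum[OF tens_additive(2)[OF tens(1)]]) (use tens NA.pr_closed[OF N_graded] in auto)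
    moreover have "\<dots> = (\<Oplus>\<^bsub>T\<^esub>i\<in>K. prT i (tens a m))"
      by (rule T.finsum_cong') (use tens NA.pr_closed[OF N_graded] prT_tens in auto)
    ultimately have e: "tens a m = (\<Oplus>\<^bsub>T\<^esub>i\<in>K. prT i (tens a m))" by (rule trans)
    have "\<forall>i. i \<notin> K \<longrightarrow> prT i (tens a m) = \<zero>\<^bsub>T\<^esub>" using K(2) tens by (simp add: prT_tens)
    then show ?case by (intro exI[of _ K] conjI K(1) e)
  next
    case (add s t)
    obtain K L where K: "finite K" "\<forall>i. i \<notin> K \<longrightarrow> prT i s = \<zero>\<^bsub>T\<^esub>" "s = (\<Oplus>\<^bsub>T\<^esub>i\<in>K. prT i s)"
       and L': "finite L" "\<forall>i. i \<notin> L \<longrightarrow> prT i t = \<zero>\<^bsub>T\<^esub>" "t = (\<Oplus>\<^bsub>T\<^esub>i\<in>L. prT i t)" using add by auto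
    have s: "s = (\<Oplus>\<^bsub>T\<^esub>i\<in>K \<union> L. prT i s)"
      by (subst K(3), rule T.add.finprod_mono_neutral_cong_left) (use K L' L(1) add in auto)
    have t: "t = (\<Oplus>\<^bsub>T\<^esub>i\<in>K \<union> L. prT i t)"
      by (subst L'(3), rule T.add.finprod_mono_neutral_cong_left) (use K L' L(1) add in auto)
    have "s \<oplus>\<^bsub>T\<^esub> t = (\<Oplus>\<^bsub>T\<^esub>i\<in>K \<union> L. prT i s) \<oplus>\<^bsub>T\<^esub> (\<Oplus>\<^bsub>T\<^esub>i\<in>K \<union> L. prT i t)" using s t by simp
    also have "\<dots> = (\<Oplus>\<^bsub>T\<^esub>i\<in>K \<union> L. prT i s \<oplus>\<^bsub>T\<^esub> prT i t)"
      by (rule T.finsum_addf[symmetric]) (use add L(1) in auto)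
    also have "\<dots> = (\<Oplus>\<^bsub>T\<^esub>i\<in>K \<union> L. prT i (s \<oplus>\<^bsub>T\<^esub> t))" using add by (simp add: L(2))
    finally have e: "s \<oplus>\<^bsub>T\<^esub> t = (\<Oplus>\<^bsub>T\<^esub>i\<in>K \<union> L. prT i (s \<oplus>\<^bsub>T\<^esub> t))" .
    have "\<forall>i. i \<notin> K \<union> L \<longrightarrow> prT i (s \<oplus>\<^bsub>T\<^esub> t) = \<zero>\<^bsub>T\<^esub>"
      using K(2) L'(2) add by (simp add: L(2))
    then show ?case by (intro exI[of _ "K \<union> L"] conjI e) (use K(1) L'(1) in simp)
  qed
  have 3: "\<one>\<^bsub>T\<^esub> \<in> tensor_grade M N 0" using tens_grade NA.one_g[OF N_graded] by (simp add: tens_one)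
  have m: "prT i s \<otimes>\<^bsub>T\<^esub> prT j t \<in> tensor_grade M N (i + j)" if "s \<in> carrier T" "t \<in> carrier T" for s t i j
    using that(1)
  proof (induct s rule: tensor_induct)
    case (tens a m)
    show ?case using that(2)
    proof (induct t rule: tensor_induct)
      case (tens b m')
      then show ?case using \<open>a \<in> carrier M\<close> \<open>m \<in> carrier N\<close> NA.pr_in_g[OF N_graded] NA.mult_g[OF N_graded]
        by (simp add: prT_tens tens_mult tens_grade NA.pr_closed[OF N_graded])
    next
      case (add s t)
      then show ?case using \<open>a \<in> carrier M\<close> \<open>m \<in> carrier N\<close>
        by (simp add: L T.r_distr tensor_grade_iff)
    qed
  next
    case (add s s')
    then show ?case using that by (simp add: L T.l_distr tensor_grade_iff)
  qed
  have 4: "a \<otimes>\<^bsub>T\<^esub> b \<in> tensor_grade M N (i + j)" if "a \<in> tensor_grade M N i" "b \<in> tensor_grade M N j" for a b i j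
    using that m[of a b i j] by (simp add: tensor_grade_iff)
  show ?thesis unfolding graded_by_def
  proof (intro conjI allI ballI)
    show "tensor_grade M N i = {a \<in> carrier T. prT i a = a}" for i using tensor_grade_iff by blast
  qed (rule prT_linear, erule 1, erule 2, rule 3, erule (1) 4)
qed

lemma sgT_sign: "t \<in> tensor_grade M N i \<Longrightarrow> sgT t = alt_sign T i t"
proof -
  assume t: "t \<in> tensor_grade M N i"
  interpret s: additive T T sgT by (rule linear_additive[OF T.ring_axioms T.ring_axioms sgT_linear])
  have "t \<in> carrier T \<and> sgT t = alt_sign T i t" using t unfolding tensor_grade_def
  proof (induct t rule: generate.induct)
    case one
    then show ?case by (simp add: alt_sign_def)
  next
    case (incl h)
    then show ?case using NA.g_iff[OF N_graded] additive.minus[OF tens_additive(2)]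
      by (auto simp: sgT_tens sgN_sign alt_sign_def)
  next
    case (inv h)
    then show ?case using NA.g_iff[OF N_graded] additive.minus[OF tens_additive(2)]
      by (auto simp: sgT_tens sgN_sign alt_sign_def s.minus simp flip: a_inv_def)
  next
    case (eng s t)
    then show ?case by (auto simp: alt_sign_def s.add T.minus_add)
  qed
  then show ?thesis by simp
qed

text \<open>The formula that specifies the differential on the quantum side speaks of homogeneous
  second factors only, because its sign depends on the degree. Linearity makes this enough for
  uniqueness.\<close>

lemma linear_eq_homogeneous:
  assumes h: "linear_map UNIV T B h" and k: "linear_map UNIV T B k"
    and eq: "\<And>a m i. a \<in> carrier M \<Longrightarrow> m \<in> grade N i \<Longrightarrow> h (tens a m) = k (tens a m)"
    and t: "t \<in> carrier T"
  shows "h t = k t"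
proof (rule T_linear_eq[OF h k _ t])
  fix a m assume a: "a \<in> carrier M" and m: "m \<in> carrier N"
  show "h (tens a m) = k (tens a m)"
    by (rule NA.g_induct[OF N_graded m])
      (use a eq in \<open>simp_all add: tens linear_mapD[OF h] linear_mapD[OF k]\<close>)
qed

end

section \<open>Lattices and their reductions at \<open>q = 1\<close>\<close>

lemma coeff_ring_loc [simp]: "coeff_ring loc"
  by (auto simp: coeff_ring_def loc_add loc_mult loc_uminus)

lemma coeff_algebra_restrict:
  assumes "coeff_algebra S A" "coeff_ring S'" "S' \<subseteq> S"
  shows "coeff_algebra S' A"
proof -
  interpret coeff_algebra S A by fact
  have "is_subalgebra S' A (carrier A)"
    using assms(3) by (auto simp: is_subalgebra_def intro!: carrier_is_subring)
  from subalgebra_algebra[OF assms(2,3) this] show ?thesis by simp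
qed

lemma scalar_algebra_algebra: "coeff_ring S \<Longrightarrow> coeff_algebra S (scalar_algebra UNIV)"
proof -
  assume S: "coeff_ring S"
  have "abelian_group (scalar_algebra (UNIV :: 'a set))"
    by (rule abelian_groupI) (auto simp: scalar_algebra_def algebra_simps intro: exI[of _ "- _"] )
  moreover have "monoid (scalar_algebra (UNIV :: 'a set))"
    by (rule monoidI) (auto simp: scalar_algebra_def algebra_simps)
  ultimately have R: "ring (scalar_algebra (UNIV :: 'a set))" and ab: "abelian_group (scalar_algebra (UNIV :: 'a set))"
    by (auto intro!: ringI simp: scalar_algebra_def algebra_simps)
  have "module (scalars S) (scalar_algebra UNIV)"
    by (rule moduleI[OF scalars_cring[OF S] ab]) (auto simp: scalar_algebra_def algebra_simps)
  then show ?thesis unfolding coeff_algebra_def assoc_algebra_def assoc_algebra_axioms_def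
    using R by (auto simp: scalar_algebra_def algebra_simps)
qed

locale laurent_lattice = coeff_algebra UNIV A for A :: "('k::field poly fract, 'a, 'm) module_scheme" (structure) +
  fixes B :: "'a set"
  assumes B: "is_subalgebra laurent A B"
begin

abbreviation "AB \<equiv> A\<lparr>carrier := B\<rparr>"

lemma B_subring: "subring B A"
  using B by (simp add: is_subalgebra_def)

lemma B_carrier [intro, simp]: "a \<in> B \<Longrightarrow> a \<in> carrier A"
  using subringE(1)[OF B_subring] by auto

lemma B_closed [simp, intro]:
  "a \<in> B \<Longrightarrow> b \<in> B \<Longrightarrow> a \<oplus> b \<in> B" "a \<in> B \<Longrightarrow> b \<in> B \<Longrightarrow> a \<otimes> b \<in> B" "a \<in> B \<Longrightarrow> \<ominus> a \<in> B"
  "a \<in> B \<Longrightarrow> b \<in> B \<Longrightarrow> a \<ominus> b \<in> B" "\<zero> \<in> B" "\<one> \<in> B" "c \<in> laurent \<Longrightarrow> a \<in> B \<Longrightarrow> c \<odot> a \<in> B"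
  using subringE[OF B_subring] B by (auto simp: is_subalgebra_def a_minus_def)

lemma AB_algebra: "coeff_algebra laurent AB"
  by (rule subalgebra_algebra[OF coeff_ring_laurent _ B]) simp

sublocale AB: coeff_algebra laurent AB by (rule AB_algebra)

lemma AB_minus: "a \<in> B \<Longrightarrow> \<ominus>\<^bsub>AB\<^esub> a = \<ominus> a" "a \<in> B \<Longrightarrow> b \<in> B \<Longrightarrow> a \<ominus>\<^bsub>AB\<^esub> b = a \<ominus> b"
proof -
  have inc: "additive AB A (\<lambda>a. a)" by unfold_locales auto
  show "a \<in> B \<Longrightarrow> \<ominus>\<^bsub>AB\<^esub> a = \<ominus> a" "a \<in> B \<Longrightarrow> b \<in> B \<Longrightarrow> a \<ominus>\<^bsub>AB\<^esub> b = a \<ominus> b"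
    using additive.minus[OF inc, of a] additive.diff[OF inc, of a b] by simp_all
qed

lemma q1_algebra_ideal: "algebra_ideal laurent AB (q1_ideal A B)"
proof -
  have "ideal (q1_ideal A B) AB"
  proof (rule idealI[OF AB.ring_axioms])
    show "subgroup (q1_ideal A B) (add_monoid AB)"
    proof (rule AB.add.subgroupI)
      show "q1_ideal A B \<noteq> {}" using B_closed(5) by (auto simp: q1_ideal_def)
      show "q1_ideal A B \<subseteq> carrier AB" using unif_laurent by (auto simp: q1_ideal_def)
      fix a b assume a: "a \<in> q1_ideal A B" and b: "b \<in> q1_ideal A B"
      then obtain a' b' where ab: "a' \<in> B" "a = unif \<odot> a'" "b' \<in> B" "b = unif \<odot> b'" by (auto simp: q1_ideal_def)
      then have "\<ominus>\<^bsub>AB\<^esub> a = unif \<odot> (\<ominus> a')" "a \<oplus>\<^bsub>AB\<^esub> b = unif \<odot> (a' \<oplus> b')"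
        using AB_minus(1)[of a] B_closed(7)[OF unif_laurent, of a'] by (simp_all add: sm_minus_r sm_add_r)
      then show "\<ominus>\<^bsub>AB\<^esub> a \<in> q1_ideal A B" "a \<oplus>\<^bsub>AB\<^esub> b \<in> q1_ideal A B" using ab by (auto simp: q1_ideal_def)
    qed
    fix a b assume a: "a \<in> q1_ideal A B" and b: "b \<in> carrier AB"
    then obtain a' where a': "a' \<in> B" "a = unif \<odot> a'" by (auto simp: q1_ideal_def)
    then have "b \<otimes>\<^bsub>AB\<^esub> a = unif \<odot> (b \<otimes> a')" "a \<otimes>\<^bsub>AB\<^esub> b = unif \<odot> (a' \<otimes> b)" using b by (simp_all add: sm_mr sm_ml)
    then show "b \<otimes>\<^bsub>AB\<^esub> a \<in> q1_ideal A B" "a \<otimes>\<^bsub>AB\<^esub> b \<in> q1_ideal A B" using a' b by (auto simp: q1_ideal_def)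
  qed
  then show ?thesis using AB_algebra by (simp add: algebra_ideal_def)
qed

abbreviation cls where "cls \<equiv> spec_class A B"

lemma spec_class:
  shows carrier_spec: "carrier (spec A B) = cls ` B"
    and cls_add: "a \<in> B \<Longrightarrow> b \<in> B \<Longrightarrow> cls a \<oplus>\<^bsub>spec A B\<^esub> cls b = cls (a \<oplus> b)"
    and cls_mult: "a \<in> B \<Longrightarrow> b \<in> B \<Longrightarrow> cls a \<otimes>\<^bsub>spec A B\<^esub> cls b = cls (a \<otimes> b)"
    and cls_smult: "a \<in> B \<Longrightarrow> c \<odot>\<^bsub>spec A B\<^esub> cls a = cls (const c \<odot> a)"
    and cls_one: "\<one>\<^bsub>spec A B\<^esub> = cls \<one>" and cls_zero: "\<zero>\<^bsub>spec A B\<^esub> = cls \<zero>"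
    and cls_eq: "a \<in> B \<Longrightarrow> b \<in> B \<Longrightarrow> cls a = cls b \<longleftrightarrow> a \<ominus> b \<in> q1_ideal A B"
    and cls_mem: "a \<in> B \<Longrightarrow> b \<in> cls a \<longleftrightarrow> b \<in> B \<and> cls b = cls a"
proof -
  interpret Q: algebra_ideal laurent AB "q1_ideal A B" by (rule q1_algebra_ideal)
  have cl: "cls = (\<lambda>a. Q.cl a)" by (simp add: spec_class_def a_r_coset_def r_coset_def fun_eq_iff)
  have e: "carrier (spec A B) = carrier Q.Q" "add (spec A B) = add Q.Q" "mult (spec A B) = mult Q.Q"
     "one (spec A B) = one Q.Q" "zero (spec A B) = zero Q.Q" "smult (spec A B) c = smult Q.Q (const c)" for c
    by (simp_all add: spec_def quot_algebra_def ring.defs module.defs)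
  show "carrier (spec A B) = cls ` B" by (simp add: e Q.cl_carrier cl)
  show "\<one>\<^bsub>spec A B\<^esub> = cls \<one>" "\<zero>\<^bsub>spec A B\<^esub> = cls \<zero>" by (simp_all add: e Q.cl_one Q.cl_zero cl)
  show "a \<in> B \<Longrightarrow> b \<in> B \<Longrightarrow> cls a \<oplus>\<^bsub>spec A B\<^esub> cls b = cls (a \<oplus> b)"
    "a \<in> B \<Longrightarrow> b \<in> B \<Longrightarrow> cls a \<otimes>\<^bsub>spec A B\<^esub> cls b = cls (a \<otimes> b)"
    "a \<in> B \<Longrightarrow> c \<odot>\<^bsub>spec A B\<^esub> cls a = cls (const c \<odot> a)"
    using Q.cl_add[of a b] Q.cl_mult[of a b] Q.cl_smult[of "const c" a] const_laurent[of c] by (simp_all add: e cl)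
  show "a \<in> B \<Longrightarrow> b \<in> B \<Longrightarrow> cls a = cls b \<longleftrightarrow> a \<ominus> b \<in> q1_ideal A B"
    using Q.cl_eq[of a b] AB_minus(2)[of a b] by (simp add: cl)
  show "a \<in> B \<Longrightarrow> b \<in> cls a \<longleftrightarrow> b \<in> B \<and> cls b = cls a"
    using Q.cl_mem[of b a] Q.self_in_cl[of b] by (auto simp: cl)
qed

end

text \<open>L is a lattice over the local ring. Its quotient by \<open>unif\<close> is described by
  a map onto a named algebra with kernel \<open>unif\<close> L, so that the limits can be the
  polynomial algebra, the exterior algebra and their tensor product themselves and no identification
  of quotients has to be carried along.\<close>

locale reduction = A: coeff_algebra UNIV A + A0: coeff_algebra UNIV A0
  for A :: "('k::field poly fract, 'a, 'm) module_scheme" (structure) and A0 :: "('k, 'b, 'n) module_scheme" +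
  fixes L :: "'a set" and r :: "'a \<Rightarrow> 'b"
  assumes L: "is_subalgebra loc A L"
    and r_closed [simp]: "a \<in> L \<Longrightarrow> r a \<in> carrier A0"
    and r_add: "a \<in> L \<Longrightarrow> b \<in> L \<Longrightarrow> r (a \<oplus> b) = r a \<oplus>\<^bsub>A0\<^esub> r b"
    and r_mult: "a \<in> L \<Longrightarrow> b \<in> L \<Longrightarrow> r (a \<otimes> b) = r a \<otimes>\<^bsub>A0\<^esub> r b"
    and r_one: "r \<one> = \<one>\<^bsub>A0\<^esub>"
    and r_sm: "c \<in> loc \<Longrightarrow> a \<in> L \<Longrightarrow> r (c \<odot> a) = ev1 c \<odot>\<^bsub>A0\<^esub> r a"
    and r_surj: "y \<in> carrier A0 \<Longrightarrow> \<exists>a\<in>L. r a = y"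
    and r_ker: "a \<in> L \<Longrightarrow> r a = \<zero>\<^bsub>A0\<^esub> \<Longrightarrow> \<exists>b\<in>L. a = unif \<odot> b"
    and span: "a \<in> carrier A \<Longrightarrow> \<exists>m. unif ^ m \<odot> a \<in> L"
begin

lemma L_subring: "subring L A"
  using L by (simp add: is_subalgebra_def)

lemma L_carrier [intro, simp]: "a \<in> L \<Longrightarrow> a \<in> carrier A"
  using subringE(1)[OF L_subring] by auto

lemma L_closed [simp, intro]:
  "a \<in> L \<Longrightarrow> b \<in> L \<Longrightarrow> a \<oplus> b \<in> L" "a \<in> L \<Longrightarrow> b \<in> L \<Longrightarrow> a \<otimes> b \<in> L" "a \<in> L \<Longrightarrow> \<ominus> a \<in> L"
  "a \<in> L \<Longrightarrow> b \<in> L \<Longrightarrow> a \<ominus> b \<in> L" "\<zero> \<in> L" "\<one> \<in> L" "c \<in> loc \<Longrightarrow> a \<in> L \<Longrightarrow> c \<odot> a \<in> L"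
  using subringE[OF L_subring] L by (auto simp: is_subalgebra_def a_minus_def)

lemma L_finsum [intro]: "f \<in> K \<rightarrow> L \<Longrightarrow> (\<Oplus>i\<in>K. f i) \<in> L"
proof (induct K rule: infinite_finite_induct)
  case (insert i K)
  then have "f \<in> K \<rightarrow> carrier A" "f i \<in> carrier A" by auto
  then show ?case using insert by simp
qed (auto simp: A.finsum_infinite)

lemma r_zero [simp]: "r \<zero> = \<zero>\<^bsub>A0\<^esub>"
  using r_sm[of 0 "\<zero>"] by simp

lemma r_minus: "a \<in> L \<Longrightarrow> r (\<ominus> a) = \<ominus>\<^bsub>A0\<^esub> r a"
  using r_sm[of "- 1" a] by (simp add: A.minus_sm A0.minus_sm loc_uminus ev1_uminus)

lemma r_diff: "a \<in> L \<Longrightarrow> b \<in> L \<Longrightarrow> r (a \<ominus> b) = r a \<ominus>\<^bsub>A0\<^esub> r b"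
  by (simp add: a_minus_def r_add r_minus)

lemma r_finsum: "f \<in> K \<rightarrow> L \<Longrightarrow> r (\<Oplus>i\<in>K. f i) = (\<Oplus>\<^bsub>A0\<^esub>i\<in>K. r (f i))"
proof (induct K rule: infinite_finite_induct)
  case (insert i K)
  then have "f \<in> K \<rightarrow> carrier A" "f i \<in> L" "f \<in> K \<rightarrow> L" "(\<lambda>i. r (f i)) \<in> K \<rightarrow> carrier A0" by (auto simp: Pi_iff)
  then show ?case using insert by (simp add: r_add L_finsum)
qed (auto simp: A.finsum_infinite A0.finsum_infinite)

lemma unif_r [simp]: "a \<in> L \<Longrightarrow> r (unif \<odot> a) = \<zero>\<^bsub>A0\<^esub>"
  by (simp add: r_sm)

lemma r_eq_iff: "a \<in> L \<Longrightarrow> b \<in> L \<Longrightarrow> r a = r b \<longleftrightarrow> (\<exists>c\<in>L. a = b \<oplus> unif \<odot> c)"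
proof
  assume h: "a \<in> L" "b \<in> L" "r a = r b"
  then have "r (a \<ominus> b) = \<zero>\<^bsub>A0\<^esub>" by (simp add: r_diff)
  then obtain c where "c \<in> L" "a \<ominus> b = unif \<odot> c" using r_ker[of "a \<ominus> b"] h by auto
  then show "\<exists>c\<in>L. a = b \<oplus> unif \<odot> c"
    using h A.eq_add_if_minus[of a b "unif \<odot> c"] by (intro bexI[of _ c]) auto
qed (auto simp: r_add)

lemma unif_cancel:
  assumes "a \<in> carrier A" "b \<in> carrier A" "unif \<odot> a = unif \<odot> b"
  shows "a = b"
proof -
  have "a = (inverse unif * unif) \<odot> a" using assms(1) by simp
  also have "\<dots> = inverse unif \<odot> (unif \<odot> b)" using assms by (simp only: A.sm_mult UNIV_I)
  also have "\<dots> = (inverse unif * unif) \<odot> b" using assms by (simp only: A.sm_mult UNIV_I)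
  finally show ?thesis using assms by simp
qed

text \<open>Over k[q, 1/q] all denominators in an element of L \<otimes> k(q) can be collected into
  one, so that every element is a single tensor of an element b of L with 1/s. Injectivity follows
  because s is invertible on A; surjectivity is \<open>span\<close>.\<close>

theorem form: "is_form A L"
proof -
  let ?S = "laurent :: 'k poly fract set" and ?B = "A\<lparr>carrier := L\<rparr>" and ?N = "scalar_algebra (UNIV :: 'k poly fract set)"
  have ls: "c \<in> laurent \<Longrightarrow> c \<in> loc" for c :: "'k poly fract" by (rule laurent_loc)
  have sub: "is_subalgebra laurent A L" using L ls by (auto simp: is_subalgebra_def)
  have B: "coeff_algebra ?S ?B" by (rule A.subalgebra_algebra[OF coeff_ring_laurent _ sub]) simp
  have N: "coeff_algebra ?S ?N" by (rule scalar_algebra_algebra) simp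
  have Al: "coeff_algebra ?S A" by (rule coeff_algebra_restrict[OF A.coeff_algebra_axioms]) simp_all
  interpret T: tensor_product ?S ?B ?N using B N by (simp add: tensor_product_def)
  let ?p = "\<lambda>b c. c \<odot> b"
  have [simp]: "carrier ?N = UNIV" "c \<oplus>\<^bsub>?N\<^esub> d = c + d" "c \<otimes>\<^bsub>?N\<^esub> d = c * d" "\<one>\<^bsub>?N\<^esub> = 1" "c \<odot>\<^bsub>?N\<^esub> d = c * d" "\<zero>\<^bsub>?N\<^esub> = 0"
    for c d :: "'k poly fract" by (simp_all add: scalar_algebra_def)
  have bil: "bilinear ?S ?B ?N A ?p"
    by (rule bilinearI) (auto simp: A.sm_add A.sm_add_r A.sm_mult[symmetric] mult.commute)
  have fm: "form_map A = tensor_lift A ?p" by (simp add: fun_eq_iff form_map_def tensor_lift_def)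
  have hom: "algebra_hom ?S T.T A (form_map A)" unfolding fm
    by (rule T.tensor_lift_hom[OF Al bil]) (auto simp: A.sm_mult[symmetric] A.sm_ml A.sm_mr mult.commute)
  have ft: "form_map A (T.tens b c) = c \<odot> b" if "b \<in> L" for b c
    unfolding fm using that by (subst T.tensor_lift_tens[OF Al bil]) simp_all
  \<comment> \<open>The numerator s c is moved to the first factor, which is allowed because it lies
    in \<open>laurent\<close>; a sum is first brought to the common denominator s s'.\<close>
  have rep: "\<exists>b\<in>L. \<exists>s\<in>laurent. s \<noteq> 0 \<and> t = T.tens b (1 / s)" if "t \<in> carrier T.T" for t
    using that
  proof (induct t rule: T.tensor_induct)
    case (tens b c)
    then have b: "b \<in> L" by simp
    obtain s where s: "s \<in> laurent" "s \<noteq> 0" "s * c \<in> laurent" using laurent_denominator by blast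
    have "T.tens b c = T.tens b ((s * c) * (1 / s))" using s by simp
    also have "\<dots> = (s * c) \<odot>\<^bsub>T.T\<^esub> T.tens b (1 / s)" using T.tens(5)[OF s(3), of b "1 / s"] b by simp
    also have "\<dots> = T.tens ((s * c) \<odot> b) (1 / s)" using T.tens(4)[OF s(3), of b "1 / s"] b by simp
    finally show ?case using s b ls by blast
  next
    case (add t t')
    obtain b s where b: "b \<in> L" "s \<in> laurent" "s \<noteq> 0" "t = T.tens b (1 / s)" using add by blast
    obtain b' s' where b': "b' \<in> L" "s' \<in> laurent" "s' \<noteq> 0" "t' = T.tens b' (1 / s')" using add by blast
    have "t = s' \<odot>\<^bsub>T.T\<^esub> T.tens b (1 / (s * s'))" using T.tens(5)[OF b'(2), of b "1 / (s * s')"] b b' by simp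
    then have t: "t = T.tens (s' \<odot> b) (1 / (s * s'))" using T.tens(4)[OF b'(2), of b "1 / (s * s')"] b by simp
    have "t' = s \<odot>\<^bsub>T.T\<^esub> T.tens b' (1 / (s * s'))" using T.tens(5)[OF b(2), of b' "1 / (s * s')"] b b' by simp
    then have t': "t' = T.tens (s \<odot> b') (1 / (s * s'))" using T.tens(4)[OF b(2), of b' "1 / (s * s')"] b' by simp
    have c: "s' \<odot> b \<in> L" "s \<odot> b' \<in> L" using b b' ls by auto
    have "t \<oplus>\<^bsub>T.T\<^esub> t' = T.tens (s' \<odot> b \<oplus> s \<odot> b') (1 / (s * s'))"
      unfolding t t' using T.tens(2)[of "s' \<odot> b" "s \<odot> b'" "1 / (s * s')"] c by simp
    moreover have "s * s' \<in> laurent" "s * s' \<noteq> 0" using b b' laurent_mult by auto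
    ultimately show ?case using c by blast
  qed
  interpret fa: additive T.T A "form_map A"
    using hom linear_additive[OF T.T.ring_axioms A.ring_axioms] unfolding algebra_hom_def by blast
  have zero: "t = \<zero>\<^bsub>T.T\<^esub>" if t: "t \<in> carrier T.T" and f: "form_map A t = \<zero>" for t
  proof -
    obtain b s where b: "b \<in> L" "s \<in> laurent" "s \<noteq> 0" "t = T.tens b (1 / s)" using rep[OF t] by blast
    then have "(1 / s) \<odot> b = \<zero>" using f ft by simp
    then have "s \<odot> ((1 / s) \<odot> b) = \<zero>" by simp
    then have "b = \<zero>" using b by (simp add: A.sm_mult[symmetric])
    then show ?thesis using b T.tens_zero(1)[of "1 / s"] by simp
  qed
  have inj: "inj_on (form_map A) (carrier T.T)"
  proof (rule inj_onI)
    fix s t assume h: "s \<in> carrier T.T" "t \<in> carrier T.T" "form_map A s = form_map A t"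
    then have "form_map A (s \<ominus>\<^bsub>T.T\<^esub> t) = \<zero>" by (simp add: fa.diff)
    then show "s = t" using zero[of "s \<ominus>\<^bsub>T.T\<^esub> t"] h by simp
  qed
  have surj: "carrier A \<subseteq> form_map A ` carrier T.T"
  proof
    fix a assume a: "a \<in> carrier A"
    then obtain m where m: "unif ^ m \<odot> a \<in> L" using span by blast
    have "form_map A (T.tens (unif ^ m \<odot> a) (1 / unif ^ m)) = (1 / unif ^ m * unif ^ m) \<odot> a"
      unfolding ft[OF m] using a by (simp only: A.sm_mult UNIV_I)
    also have "\<dots> = a" using a by simp
    finally have e: "form_map A (T.tens (unif ^ m \<odot> a) (1 / unif ^ m)) = a" .
    have "T.tens (unif ^ m \<odot> a) (1 / unif ^ m) \<in> carrier T.T" by (rule T.tens_closed) (use m in simp_all)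
    then show "a \<in> form_map A ` carrier T.T" using e by (metis imageI)
  qed
  show ?thesis unfolding is_form_def using sub algebra_isoI[OF hom inj surj] by simp
qed

lemma q1_ideal_eq: "q1_ideal A L = {a \<in> L. r a = \<zero>\<^bsub>A0\<^esub>}"
  unfolding q1_ideal_def using r_ker by auto

sublocale laurent_lattice A L
  using L laurent_loc by unfold_locales (auto simp: is_subalgebra_def)

lemma spec_class_eq: "a \<in> L \<Longrightarrow> b \<in> L \<Longrightarrow> spec_class A L a = spec_class A L b \<longleftrightarrow> r a = r b"
  by (simp add: cls_eq q1_ideal_eq r_diff)

lemma spec_class_mem: "a \<in> L \<Longrightarrow> b \<in> spec_class A L a \<longleftrightarrow> b \<in> L \<and> r b = r a"
  using cls_mem[of a b] spec_class_eq[of b a] by auto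

definition spec_map where "spec_map X = the_elem (r ` X)"

lemma spec_map_class: "a \<in> L \<Longrightarrow> spec_map (spec_class A L a) = r a"
proof -
  assume a: "a \<in> L"
  have "r ` spec_class A L a = {r a}" using spec_class_mem[OF a] a by auto
  then show ?thesis by (simp add: spec_map_def)
qed

lemma spec_map_iso: "spec_map \<in> algebra_iso UNIV (spec A L) A0"
proof (rule algebra_isoI)
  show "algebra_hom UNIV (spec A L) A0 spec_map"
    by (auto simp: algebra_hom_def linear_map_def carrier_spec cls_add cls_mult cls_smult cls_one spec_map_class r_add r_mult r_one r_sm)
  show "inj_on spec_map (carrier (spec A L))"
  proof (rule inj_onI)
    fix X Y assume "X \<in> carrier (spec A L)" "Y \<in> carrier (spec A L)" and e: "spec_map X = spec_map Y"
    then obtain a b where ab: "a \<in> L" "b \<in> L" "X = spec_class A L a" "Y = spec_class A L b"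
      by (auto simp: carrier_spec)
    then have "r a = r b" using e by (simp add: spec_map_class)
    then show "X = Y" using spec_class_eq[OF ab(1,2)] ab(3,4) by simp
  qed
  show "carrier A0 \<subseteq> spec_map ` carrier (spec A L)"
    using r_surj by (force simp: carrier_spec spec_map_class image_iff)
qed

text \<open>For maps \<open>f\<close> of the lattice that are linear over \<^term>\<open>loc\<close> the choice of the lift does not matter.\<close>

definition induced :: "('a \<Rightarrow> 'a) \<Rightarrow> 'b \<Rightarrow> 'b" where
  "induced f = restrict (\<lambda>y. r (f (SOME a. a \<in> L \<and> r a = y))) (carrier A0)"

context
  fixes f
  assumes f_closed: "\<And>a. a \<in> L \<Longrightarrow> f a \<in> L"
    and f_add: "\<And>a b. a \<in> L \<Longrightarrow> b \<in> L \<Longrightarrow> f (a \<oplus> b) = f a \<oplus> f b"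
    and f_sm: "\<And>c a. c \<in> loc \<Longrightarrow> a \<in> L \<Longrightarrow> f (c \<odot> a) = c \<odot> f a"
begin

lemma induced_r: "a \<in> L \<Longrightarrow> induced f (r a) = r (f a)"
proof -
  assume a: "a \<in> L"
  let ?b = "SOME b. b \<in> L \<and> r b = r a"
  have b: "?b \<in> L \<and> r ?b = r a" by (rule someI[of _ a]) (use a in auto)
  then obtain c where c: "c \<in> L" "?b = a \<oplus> unif \<odot> c" using r_eq_iff[of ?b a] a by blast
  then have "f ?b = f a \<oplus> unif \<odot> f c" using a by (simp add: f_add f_sm)
  then have "r (f ?b) = r (f a)" using a c f_closed by (simp add: r_add)
  then show ?thesis using a by (simp add: induced_def)
qed

lemma induced_linear: "linear_map UNIV A0 A0 (induced f)"
proof (rule linear_mapI)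
  fix x y assume x: "x \<in> carrier A0" and y: "y \<in> carrier A0"
  then obtain a b where ab: "a \<in> L" "b \<in> L" "x = r a" "y = r b" using r_surj by metis
  show "induced f x \<in> carrier A0" using ab f_closed by (simp add: induced_r)
  have "induced f (r (a \<oplus> b)) = r (f (a \<oplus> b))" using ab by (intro induced_r) simp
  also have "\<dots> = r (f a) \<oplus>\<^bsub>A0\<^esub> r (f b)" using ab f_closed by (simp add: f_add r_add)
  finally have "induced f (r (a \<oplus> b)) = r (f a) \<oplus>\<^bsub>A0\<^esub> r (f b)" .
  then show "induced f (x \<oplus>\<^bsub>A0\<^esub> y) = induced f x \<oplus>\<^bsub>A0\<^esub> induced f y" using ab by (simp add: induced_r r_add)
  fix c
  have "induced f (r (const c \<odot> a)) = r (f (const c \<odot> a))" using ab by (intro induced_r) simp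
  also have "\<dots> = c \<odot>\<^bsub>A0\<^esub> r (f a)" using ab f_closed by (simp add: f_sm r_sm)
  finally have "induced f (r (const c \<odot> a)) = c \<odot>\<^bsub>A0\<^esub> r (f a)" .
  then show "induced f (c \<odot>\<^bsub>A0\<^esub> x) = c \<odot>\<^bsub>A0\<^esub> induced f x" using ab by (simp add: induced_r r_sm)
qed

end

end

section \<open>Reduction of a differential graded algebra\<close>

text \<open>That the limit is a differential graded algebra is part of the conclusion: each axiom is
  transported from lifts in the lattice, and the Leibniz rule, whose sign depends on a degree, needs
  lifts that are homogeneous.\<close>

lemma reduction_deformation:
  fixes R :: "('k::field poly fract, 'a) dga" and R0 :: "('k, 'b) dga"
  assumes red: "reduction R R0 B \<psi>"
    and gr: "graded_by UNIV R (grade R) pr" and gr0: "graded_by UNIV R0 (grade R0) pr0"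
    and d_lin: "linear_map UNIV R R (diff R)"
    and d_grade: "\<And>a i. a \<in> grade R i \<Longrightarrow> diff R a \<in> grade R (Suc i)"
    and d_d: "\<And>a. a \<in> carrier R \<Longrightarrow> diff R (diff R a) = \<zero>\<^bsub>R\<^esub>"
    and d_mult: "\<And>a b i. a \<in> grade R i \<Longrightarrow> b \<in> carrier R \<Longrightarrow>
       diff R (a \<otimes>\<^bsub>R\<^esub> b) = (diff R a \<otimes>\<^bsub>R\<^esub> b) \<oplus>\<^bsub>R\<^esub> alt_sign R i (a \<otimes>\<^bsub>R\<^esub> diff R b)"
    and B_pr: "\<And>b i. b \<in> B \<Longrightarrow> pr i b \<in> B" and B_d: "\<And>b. b \<in> B \<Longrightarrow> diff R b \<in> B"
    and psi_pr: "\<And>b i. b \<in> B \<Longrightarrow> \<psi> (pr i b) = pr0 i (\<psi> b)"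
    and psi_d: "\<And>b. b \<in> B \<Longrightarrow> \<psi> (diff R b) = diff R0 (\<psi> b)"
  shows "is_q_deformation R R0"
proof -
  interpret reduction R R0 B \<psi> by (rule red)
  note gi = A.g_iff[OF gr] and gi0 = A0.g_iff[OF gr0]
  have psi_grade: "\<psi> b \<in> grade R0 i" if "b \<in> B" "b \<in> grade R i" for b i
    using that psi_pr[of b i] by (simp add: gi gi0)
  \<comment> \<open>Any lift may be projected to degree i: the projection preserves the lattice and
    commutes with the reduction, so that it fixes the reduction of a homogeneous element.\<close>
  have lift: "\<exists>b\<in>B. b \<in> grade R i \<and> \<psi> b = y" if "y \<in> grade R0 i" for y i
  proof -
    have y: "y \<in> carrier R0" "pr0 i y = y" using that by (auto simp: gi0)
    then obtain b where b: "b \<in> B" "\<psi> b = y" using r_surj by blast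
    then show ?thesis using y psi_pr[of b i] B_pr A.pr_in_g[OF gr] by (intro bexI[of _ "pr i b"]) auto
  qed
  have sign: "\<psi> (alt_sign R i b) = alt_sign R0 i (\<psi> b)" "alt_sign R i b \<in> B" if "b \<in> B" for b i
    using that by (simp_all add: alt_sign_def r_minus)
  have 1: "dg_algebra (scalars UNIV) R"
    using dg_algebraI[OF A.coeff_algebra_axioms gr d_lin d_grade d_d d_mult] .
  have 2: "dg_algebra (scalars UNIV) R0"
  proof (rule dg_algebraI[OF A0.coeff_algebra_axioms gr0])
    note dl = linear_mapD[OF d_lin]
    show "linear_map UNIV R0 R0 (diff R0)"
    proof (rule linear_mapI)
      fix x y assume x: "x \<in> carrier R0" and y: "y \<in> carrier R0"
      then obtain a b where ab: "a \<in> B" "b \<in> B" "x = \<psi> a" "y = \<psi> b" using r_surj by metis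
      show "diff R0 x \<in> carrier R0" using ab B_d psi_d[of a] r_closed by metis
      show "diff R0 (x \<oplus>\<^bsub>R0\<^esub> y) = diff R0 x \<oplus>\<^bsub>R0\<^esub> diff R0 y"
        using ab B_d by (simp add: psi_d[symmetric] r_add[symmetric] dl)
      fix c
      have "diff R0 (\<psi> (const c \<odot>\<^bsub>R\<^esub> a)) = \<psi> (diff R (const c \<odot>\<^bsub>R\<^esub> a))" using ab by (intro psi_d[symmetric]) simp
      also have "\<dots> = c \<odot>\<^bsub>R0\<^esub> \<psi> (diff R a)" using ab B_d by (simp add: dl r_sm)
      finally have "diff R0 (\<psi> (const c \<odot>\<^bsub>R\<^esub> a)) = c \<odot>\<^bsub>R0\<^esub> \<psi> (diff R a)" .
      then show "diff R0 (c \<odot>\<^bsub>R0\<^esub> x) = c \<odot>\<^bsub>R0\<^esub> diff R0 x" using ab by (simp add: r_sm psi_d)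
    qed
    show "diff R0 x \<in> grade R0 (Suc i)" if "x \<in> grade R0 i" for x i
    proof -
      obtain b where "b \<in> B" "b \<in> grade R i" "\<psi> b = x" using lift[OF \<open>x \<in> grade R0 i\<close>] by blast
      then show ?thesis using psi_grade[of "diff R b" "Suc i"] d_grade B_d psi_d[of b] by simp
    qed
    show "diff R0 (diff R0 x) = \<zero>\<^bsub>R0\<^esub>" if x: "x \<in> carrier R0" for x
    proof -
      obtain b where "b \<in> B" "\<psi> b = x" using r_surj[OF x] by blast
      then show ?thesis using psi_d[of b] psi_d[of "diff R b"] B_d d_d[of b] by auto
    qed
    show "diff R0 (x \<otimes>\<^bsub>R0\<^esub> y) = diff R0 x \<otimes>\<^bsub>R0\<^esub> y \<oplus>\<^bsub>R0\<^esub> alt_sign R0 i (x \<otimes>\<^bsub>R0\<^esub> diff R0 y)"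
      if x: "x \<in> grade R0 i" and y: "y \<in> carrier R0" for x y i
    proof -
      obtain a where a: "a \<in> B" "a \<in> grade R i" "\<psi> a = x" using lift[OF x] by blast
      obtain b where b: "b \<in> B" "\<psi> b = y" using r_surj[OF y] by blast
      have "diff R0 (x \<otimes>\<^bsub>R0\<^esub> y) = diff R0 (\<psi> (a \<otimes>\<^bsub>R\<^esub> b))" using a b by (simp add: r_mult)
      also have "\<dots> = \<psi> (diff R (a \<otimes>\<^bsub>R\<^esub> b))" using a b by (intro psi_d[symmetric]) simp
      also have "diff R (a \<otimes>\<^bsub>R\<^esub> b) = (diff R a \<otimes>\<^bsub>R\<^esub> b) \<oplus>\<^bsub>R\<^esub> alt_sign R i (a \<otimes>\<^bsub>R\<^esub> diff R b)"
        using d_mult a b by simp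
      also have "\<psi> \<dots> = diff R0 x \<otimes>\<^bsub>R0\<^esub> y \<oplus>\<^bsub>R0\<^esub> alt_sign R0 i (x \<otimes>\<^bsub>R0\<^esub> diff R0 y)"
        using a b B_d by (simp add: r_add sign r_mult psi_d)
      finally show ?thesis .
    qed
  qed
  let ?B = "sub_dga R B"
  have sel [simp]: "carrier ?B = B" "add ?B = add R" "mult ?B = mult R" "one ?B = one R" "zero ?B = zero R"
    "smult ?B = smult R" "grade ?B = (\<lambda>i. grade R i \<inter> B)" "diff ?B = diff R" by (simp_all add: sub_dga_def)
  have sub: "is_subalgebra laurent R B" using L laurent_loc by (auto simp: is_subalgebra_def)
  have cB: "coeff_algebra laurent ?B"
    by (rule coeff_algebra_cong[OF A.subalgebra_algebra[OF coeff_ring_laurent _ sub]]) simp_all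
  interpret B: coeff_algebra laurent ?B by (rule cB)
  have inc: "additive ?B R (\<lambda>a. a)" by unfold_locales auto
  have alt: "alt_sign ?B i a = alt_sign R i a" if "a \<in> B" for a i
    using additive.minus[OF inc] that by (simp add: alt_sign_def)
  have fs: "finsum ?B f K = finsum R f K" if "f \<in> K \<rightarrow> B" for f and K :: "nat set"
    using additive.finsum[OF inc, of f K] that by simp
  have grB: "graded_by laurent ?B (grade ?B) pr"
    unfolding graded_by_def
  proof (intro conjI allI ballI)
    show "linear_map laurent ?B ?B (pr i)" for i
      by (rule linear_mapI) (auto simp: B_pr linear_mapD[OF A.pr_linear[OF gr]])
    show "grade ?B i = {a \<in> carrier ?B. pr i a = a}" for i by (auto simp: gi)
    show "pr i (pr j a) = (if i = j then pr j a else \<zero>\<^bsub>?B\<^esub>)" if "a \<in> carrier ?B" for i j a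
      using that A.pr_pr[OF gr, of a] by simp
    show "\<exists>K. finite K \<and> (\<forall>i. i \<notin> K \<longrightarrow> pr i a = \<zero>\<^bsub>?B\<^esub>) \<and> a = (\<Oplus>\<^bsub>?B\<^esub>i\<in>K. pr i a)" if "a \<in> carrier ?B" for a
    proof -
      have a: "a \<in> B" using that by simp
      have "(\<lambda>i. pr i a) \<in> K \<rightarrow> B" for K using B_pr a by blast
      then show ?thesis using A.pr_sum[OF gr L_carrier[OF a]] fs by simp
    qed
    show "\<one>\<^bsub>?B\<^esub> \<in> grade ?B 0" using A.one_g[OF gr] by simp
    show "a \<otimes>\<^bsub>?B\<^esub> b \<in> grade ?B (i + j)" if "a \<in> grade ?B i" "b \<in> grade ?B j" for a b i j
      using A.mult_g[OF gr, of a i b j] that by simp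
  qed
  have 3: "dg_algebra (scalars laurent) ?B"
    by (rule dg_algebraI[OF cB grB])
      (auto simp: linear_map_def B_d linear_mapD[OF d_lin] d_grade d_d d_mult alt)
  have "spec_map \<in> dga_iso UNIV (spec_dga R B) R0"
  proof -
    have e [simp]: "carrier (spec_dga R B) = carrier (spec R B)" by (simp add: spec_dga_def)
    have iso: "spec_map \<in> algebra_iso UNIV (spec_dga R B) R0"
      using spec_map_iso by (simp add: spec_dga_def algebra_iso_def ring_iso_def ring_hom_def linear_map_def)
    have gm: "spec_map ` grade (spec_dga R B) i = grade R0 i" for i
    proof
      show "spec_map ` grade (spec_dga R B) i \<subseteq> grade R0 i"
        by (auto simp: spec_dga_def spec_map_class psi_grade)
      show "grade R0 i \<subseteq> spec_map ` grade (spec_dga R B) i"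
      proof
        fix y assume "y \<in> grade R0 i"
        then obtain b where b: "b \<in> B" "b \<in> grade R i" "\<psi> b = y" using lift by blast
        then have "spec_class R B b \<in> grade (spec_dga R B) i" by (simp add: spec_dga_def)
        then show "y \<in> spec_map ` grade (spec_dga R B) i" using spec_map_class[OF b(1)] b(3) by (metis imageI)
      qed
    qed
    have dm: "spec_map (diff (spec_dga R B) X) = diff R0 (spec_map X)" if X: "X \<in> carrier (spec_dga R B)" for X
    proof -
      obtain a where a: "a \<in> B" "X = spec_class R B a" using X carrier_spec by auto
      \<comment> \<open>The differential of the specialisation is a union over a coset. All its
        members contribute the same class because the reduction of \<open>diff R b\<close> depends
        on the reduction of b only.\<close>
      have "spec_class R B (diff R b) = spec_class R B (diff R a)" if "b \<in> X" for b
      proof -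
        have "b \<in> B" "\<psi> b = \<psi> a" using that a spec_class_mem by auto
        then show ?thesis using a B_d by (simp add: spec_class_eq psi_d)
      qed
      moreover have "a \<in> X" using a spec_class_mem by auto
      ultimately have "(\<Union>b\<in>X. spec_class R B (diff R b)) = spec_class R B (diff R a)" by blast
      then have "diff (spec_dga R B) X = spec_class R B (diff R a)" by (simp add: spec_dga_def)
      then show ?thesis using a B_d by (simp add: spec_map_class psi_d)
    qed
    show ?thesis using iso gm dm by (simp add: dga_iso_def)
  qed
  then show ?thesis unfolding is_q_deformation_def is_dg_form_def using 1 2 3 form by blast
qed

section \<open>Reductions of tensor products\<close>

text \<open>A tensor product given by generators and relations offers no direct way to see that an
  element is nonzero or divisible by \<open>unif\<close>. A basis of the first factor, with its
  coordinate functions \<phi>, replaces a tensor by a family of elements of the second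
  factor.\<close>

locale based_tensor = tensor_product UNIV M N
  for M :: "('f::comm_ring_1, 'a, 'm) module_scheme" and N :: "('f, 'b, 'n) module_scheme" +
  fixes X :: "'e set" and b :: "'e \<Rightarrow> 'a" and \<phi> :: "'a \<Rightarrow> 'e \<Rightarrow> 'f"
  assumes b_closed [simp]: "e \<in> X \<Longrightarrow> b e \<in> carrier M"
    and phi_add: "a \<in> carrier M \<Longrightarrow> a' \<in> carrier M \<Longrightarrow> \<phi> (a \<oplus>\<^bsub>M\<^esub> a') e = \<phi> a e + \<phi> a' e"
    and phi_sm: "a \<in> carrier M \<Longrightarrow> \<phi> (c \<odot>\<^bsub>M\<^esub> a) e = c * \<phi> a e"
    and phi_expand: "a \<in> carrier M \<Longrightarrow>
      \<exists>K. finite K \<and> K \<subseteq> X \<and> (\<forall>e. e \<notin> K \<longrightarrow> \<phi> a e = 0) \<and> a = (\<Oplus>\<^bsub>M\<^esub>e\<in>K. \<phi> a e \<odot>\<^bsub>M\<^esub> b e)"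
begin

lemmas tens_rules = bilinearD[OF tens_bilinear]

definition coeff where "coeff e = tensor_lift N (\<lambda>a m. \<phi> a e \<odot>\<^bsub>N\<^esub> m)"

lemma coeff_bilinear: "bilinear UNIV M N N (\<lambda>a m. \<phi> a e \<odot>\<^bsub>N\<^esub> m)"
  by (rule bilinearI) (auto simp: phi_add phi_sm NA.sm_add NA.sm_add_r NA.sm_mult[symmetric] mult.commute)

lemma coeff_tens: "a \<in> carrier M \<Longrightarrow> m \<in> carrier N \<Longrightarrow> coeff e (tens a m) = \<phi> a e \<odot>\<^bsub>N\<^esub> m"
  unfolding coeff_def by (rule tensor_lift_tens[OF NA.coeff_algebra_axioms coeff_bilinear])

lemma coeff_linear: "linear_map UNIV T N (coeff e)"
  unfolding coeff_def by (rule tensor_lift_linear[OF NA.coeff_algebra_axioms coeff_bilinear])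

lemmas coeff = linear_mapD[OF coeff_linear]

lemma coeff_zero [simp]: "coeff e \<zero>\<^bsub>T\<^esub> = \<zero>\<^bsub>N\<^esub>"
  by (rule additive.zero[OF linear_additive[OF T.ring_axioms NA.ring_axioms coeff_linear]])

lemma coeff_expand:
  "t \<in> carrier T \<Longrightarrow> \<exists>K. finite K \<and> K \<subseteq> X \<and> (\<forall>e. e \<notin> K \<longrightarrow> coeff e t = \<zero>\<^bsub>N\<^esub>) \<and> t = (\<Oplus>\<^bsub>T\<^esub>e\<in>K. tens (b e) (coeff e t))"
proof (induct t rule: tensor_induct)
  case (tens a m)
  obtain K where K: "finite K" "K \<subseteq> X" "\<forall>e. e \<notin> K \<longrightarrow> \<phi> a e = 0" "a = (\<Oplus>\<^bsub>M\<^esub>e\<in>K. \<phi> a e \<odot>\<^bsub>M\<^esub> b e)"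
    using phi_expand[OF tens(1)] by blast
  have "tens a m = (\<Oplus>\<^bsub>T\<^esub>e\<in>K. tens (\<phi> a e \<odot>\<^bsub>M\<^esub> b e) m)"
    by (subst K(4), rule additive.finsum[OF tens_additive(1)[OF tens(2)]]) (use K(2) in auto)
  also have "\<dots> = (\<Oplus>\<^bsub>T\<^esub>e\<in>K. tens (b e) (coeff e (tens a m)))"
    by (rule T.finsum_cong') (use K(2) tens coeff(1) in \<open>auto simp: coeff_tens tens_rules(4,5) subset_iff\<close>)
  finally have "tens a m = (\<Oplus>\<^bsub>T\<^esub>e\<in>K. tens (b e) (coeff e (tens a m)))" .
  moreover have "\<forall>e. e \<notin> K \<longrightarrow> coeff e (tens a m) = \<zero>\<^bsub>N\<^esub>" using K(3) tens by (simp add: coeff_tens)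
  ultimately show ?case using K(1,2) by (intro exI[of _ K] conjI)
next
  case (add s t)
  obtain K where K: "finite K" "K \<subseteq> X" "\<forall>e. e \<notin> K \<longrightarrow> coeff e s = \<zero>\<^bsub>N\<^esub>" "s = (\<Oplus>\<^bsub>T\<^esub>e\<in>K. tens (b e) (coeff e s))"
    using add by blast
  obtain L where L: "finite L" "L \<subseteq> X" "\<forall>e. e \<notin> L \<longrightarrow> coeff e t = \<zero>\<^bsub>N\<^esub>" "t = (\<Oplus>\<^bsub>T\<^esub>e\<in>L. tens (b e) (coeff e t))"
    using add by blast
  have c: "(\<lambda>e. tens (b e) (coeff e u)) \<in> K \<union> L \<rightarrow> carrier T" if "u \<in> carrier T" for u
    using that K(2) L(2) coeff(1) by auto
  have s: "s = (\<Oplus>\<^bsub>T\<^esub>e\<in>K \<union> L. tens (b e) (coeff e s))"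
    by (subst K(4), rule T.add.finprod_mono_neutral_cong_left) (use K(1-3) L(1,2) c add(1) in auto)
  have t: "t = (\<Oplus>\<^bsub>T\<^esub>e\<in>K \<union> L. tens (b e) (coeff e t))"
    by (subst L(4), rule T.add.finprod_mono_neutral_cong_left) (use L(1-3) K(1,2) c add(2) in auto)
  have "s \<oplus>\<^bsub>T\<^esub> t = (\<Oplus>\<^bsub>T\<^esub>e\<in>K \<union> L. tens (b e) (coeff e s)) \<oplus>\<^bsub>T\<^esub> (\<Oplus>\<^bsub>T\<^esub>e\<in>K \<union> L. tens (b e) (coeff e t))"
    using s t by simp
  also have "\<dots> = (\<Oplus>\<^bsub>T\<^esub>e\<in>K \<union> L. tens (b e) (coeff e s) \<oplus>\<^bsub>T\<^esub> tens (b e) (coeff e t))"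
    by (rule T.finsum_addf[symmetric]) (use c add in auto)
  also have "\<dots> = (\<Oplus>\<^bsub>T\<^esub>e\<in>K \<union> L. tens (b e) (coeff e (s \<oplus>\<^bsub>T\<^esub> t)))"
    by (rule T.finsum_cong') (use c[of "s \<oplus>\<^bsub>T\<^esub> t"] K(2) L(2) add coeff in \<open>auto simp: tens_rules(3)\<close>)
  finally have e: "s \<oplus>\<^bsub>T\<^esub> t = (\<Oplus>\<^bsub>T\<^esub>e\<in>K \<union> L. tens (b e) (coeff e (s \<oplus>\<^bsub>T\<^esub> t)))" .
  have "\<forall>e. e \<notin> K \<union> L \<longrightarrow> coeff e (s \<oplus>\<^bsub>T\<^esub> t) = \<zero>\<^bsub>N\<^esub>" using K(3) L(3) add by (simp add: coeff)
  then show ?case using K(1,2) L(1,2) by (intro exI[of _ "K \<union> L"] conjI e) auto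
qed

lemma coeff_eqI: "s \<in> carrier T \<Longrightarrow> t \<in> carrier T \<Longrightarrow> (\<And>e. coeff e s = coeff e t) \<Longrightarrow> s = t"
proof -
  assume h: "s \<in> carrier T" "t \<in> carrier T" "\<And>e. coeff e s = coeff e t"
  interpret c: additive T N "coeff e" for e by (rule linear_additive[OF T.ring_axioms NA.ring_axioms coeff_linear])
  let ?d = "s \<ominus>\<^bsub>T\<^esub> t"
  have d: "?d \<in> carrier T" "\<And>e. coeff e ?d = \<zero>\<^bsub>N\<^esub>" using h by (simp_all add: c.diff coeff(1))
  obtain K where K: "K \<subseteq> X" "?d = (\<Oplus>\<^bsub>T\<^esub>e\<in>K. tens (b e) (coeff e ?d))" using coeff_expand[OF d(1)] by blast
  have "(\<Oplus>\<^bsub>T\<^esub>e\<in>K. tens (b e) (coeff e ?d)) = (\<Oplus>\<^bsub>T\<^esub>e\<in>K. \<zero>\<^bsub>T\<^esub>)"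
    by (rule T.finsum_cong') (use K(1) d(2) in auto)
  then have "?d = \<zero>\<^bsub>T\<^esub>" using K(2) by simp
  then show "s = t" using h by simp
qed

end

text \<open>The lattice in \<open>A \<otimes> E\<close> spanned by the tensors of lattice elements consists of the tensors whose
  coefficients with respect to a basis \<open>b\<close> of the first lattice lie in the second one.\<close>

locale tensor_reduction =
  RA: reduction A A0 LA rA + RE: reduction E E0 LE rE +
  T: based_tensor A E X b \<phi> + T0: based_tensor A0 E0 X "\<lambda>e. rA (b e)" \<phi>0
  for A :: "('k::field poly fract, 'a, 'm) module_scheme" and A0 :: "('k, 'b, 'n) module_scheme" and LA rA
    and E :: "('k poly fract, 'c, 'p) module_scheme" and E0 :: "('k, 'd, 'r) module_scheme" and LE rE
    and X :: "'e set" and b \<phi> \<phi>0 +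
  assumes b_LA: "e \<in> X \<Longrightarrow> b e \<in> LA"
    and phi_loc: "a \<in> LA \<Longrightarrow> \<phi> a e \<in> loc"
    and phi_ev1: "a \<in> LA \<Longrightarrow> \<phi>0 (rA a) e = ev1 (\<phi> a e)"
begin

definition B where "B = {t \<in> carrier T.T. \<forall>e. T.coeff e t \<in> LE}"

definition psi where "psi t = (THE s. s \<in> carrier T0.T \<and> (\<forall>e. T0.coeff e s = rE (T.coeff e t)))"

lemma B_carrier: "t \<in> B \<Longrightarrow> t \<in> carrier T.T"
  by (simp add: B_def)

lemma tens_B [simp]: "a \<in> LA \<Longrightarrow> m \<in> LE \<Longrightarrow> T.tens a m \<in> B"
  by (simp add: B_def T.coeff_tens phi_loc)

lemma B_add: "s \<in> B \<Longrightarrow> t \<in> B \<Longrightarrow> s \<oplus>\<^bsub>T.T\<^esub> t \<in> B"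
  by (simp add: B_def T.coeff)

lemma B_sm: "c \<in> loc \<Longrightarrow> t \<in> B \<Longrightarrow> c \<odot>\<^bsub>T.T\<^esub> t \<in> B"
  by (simp add: B_def T.coeff)

lemma B_zero: "\<zero>\<^bsub>T.T\<^esub> \<in> B"
  by (simp add: B_def)

lemma B_finsum: "finite K \<Longrightarrow> (\<And>e. e \<in> K \<Longrightarrow> f e \<in> B) \<Longrightarrow> (\<Oplus>\<^bsub>T.T\<^esub>e\<in>K. f e) \<in> B"
proof (induct K rule: finite_induct)
  case (insert x F)
  then have "f \<in> F \<rightarrow> carrier T.T" "f x \<in> carrier T.T" using B_carrier by auto
  then show ?case using insert by (simp add: B_add)
qed (simp add: B_zero)

text \<open>Membership in B is tested on coordinates, which suits divisibility, but products are
  computed on pure tensors. The expansion in the basis links the two, because the basis lies in the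
  lattice of the first factor.\<close>

lemma B_induct [consumes 1, case_names tens add]:
  assumes t: "t \<in> B" and tens: "\<And>a m. a \<in> LA \<Longrightarrow> m \<in> LE \<Longrightarrow> P (T.tens a m)"
    and add: "\<And>s t. s \<in> B \<Longrightarrow> t \<in> B \<Longrightarrow> P s \<Longrightarrow> P t \<Longrightarrow> P (s \<oplus>\<^bsub>T.T\<^esub> t)"
  shows "P t"
proof -
  obtain K where K: "finite K" "K \<subseteq> X" "t = (\<Oplus>\<^bsub>T.T\<^esub>e\<in>K. T.tens (b e) (T.coeff e t))"
    using T.coeff_expand[OF B_carrier[OF t]] by blast
  have c: "T.coeff e t \<in> LE" for e using t by (simp add: B_def)
  have z: "P \<zero>\<^bsub>T.T\<^esub>" using tens[of "\<zero>\<^bsub>A\<^esub>" "\<zero>\<^bsub>E\<^esub>"] by simp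
  have "P (\<Oplus>\<^bsub>T.T\<^esub>e\<in>K. T.tens (b e) (T.coeff e t))" using K(1,2)
  proof (induct K rule: finite_induct)
    case (insert x F)
    then have m: "T.tens (b x) (T.coeff x t) \<in> B" "\<And>e. e \<in> F \<Longrightarrow> T.tens (b e) (T.coeff e t) \<in> B" using b_LA c by auto
    then have "(\<lambda>e. T.tens (b e) (T.coeff e t)) \<in> F \<rightarrow> carrier T.T" "T.tens (b x) (T.coeff x t) \<in> carrier T.T"
      using B_carrier by auto
    then show ?case using insert m c tens[of "b x" "T.coeff x t"] b_LA by (simp add: add B_finsum)
  qed (simp add: z)
  then show ?thesis using K(3) by simp
qed

lemma psi_ex: "t \<in> B \<Longrightarrow> \<exists>s. s \<in> carrier T0.T \<and> (\<forall>e. T0.coeff e s = rE (T.coeff e t))"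
proof (induct t rule: B_induct)
  case (tens a m)
  then show ?case
    by (intro exI[of _ "T0.tens (rA a) (rE m)"]) (simp add: T0.coeff_tens T.coeff_tens phi_ev1 phi_loc RE.r_sm)
next
  case (add s t)
  then obtain s' t' where "s' \<in> carrier T0.T" "\<forall>e. T0.coeff e s' = rE (T.coeff e s)"
     "t' \<in> carrier T0.T" "\<forall>e. T0.coeff e t' = rE (T.coeff e t)" by blast
  then show ?case using add(1,2)
    by (intro exI[of _ "s' \<oplus>\<^bsub>T0.T\<^esub> t'"]) (simp add: B_def T0.coeff T.coeff RE.r_add)
qed

lemma psi_eqI: "t \<in> B \<Longrightarrow> s \<in> carrier T0.T \<Longrightarrow> (\<And>e. T0.coeff e s = rE (T.coeff e t)) \<Longrightarrow> psi t = s"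
  unfolding psi_def by (rule the_equality) (simp, elim conjE, rule T0.coeff_eqI, simp_all)

lemma psi_closed: "t \<in> B \<Longrightarrow> psi t \<in> carrier T0.T" and coeff_psi: "t \<in> B \<Longrightarrow> T0.coeff e (psi t) = rE (T.coeff e t)"
  using psi_ex[of t] psi_eqI[of t] by metis+

lemma psi_tens: "a \<in> LA \<Longrightarrow> m \<in> LE \<Longrightarrow> psi (T.tens a m) = T0.tens (rA a) (rE m)"
  by (rule psi_eqI) (simp_all add: T0.coeff_tens T.coeff_tens phi_ev1 phi_loc RE.r_sm)

lemma psi_add: "s \<in> B \<Longrightarrow> t \<in> B \<Longrightarrow> psi (s \<oplus>\<^bsub>T.T\<^esub> t) = psi s \<oplus>\<^bsub>T0.T\<^esub> psi t"
proof (rule psi_eqI)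
  assume h: "s \<in> B" "t \<in> B"
  then show "s \<oplus>\<^bsub>T.T\<^esub> t \<in> B" "psi s \<oplus>\<^bsub>T0.T\<^esub> psi t \<in> carrier T0.T" by (simp_all add: B_add psi_closed)
  show "T0.coeff e (psi s \<oplus>\<^bsub>T0.T\<^esub> psi t) = rE (T.coeff e (s \<oplus>\<^bsub>T.T\<^esub> t))" for e
    using h h[unfolded B_def] by (simp add: T0.coeff(2) T.coeff(2) psi_closed coeff_psi RE.r_add)
qed

lemma psi_sm: "c \<in> loc \<Longrightarrow> t \<in> B \<Longrightarrow> psi (c \<odot>\<^bsub>T.T\<^esub> t) = ev1 c \<odot>\<^bsub>T0.T\<^esub> psi t"
proof (rule psi_eqI)
  assume h: "c \<in> loc" "t \<in> B"
  then show "c \<odot>\<^bsub>T.T\<^esub> t \<in> B" "ev1 c \<odot>\<^bsub>T0.T\<^esub> psi t \<in> carrier T0.T" by (simp_all add: B_sm psi_closed)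
  show "T0.coeff e (ev1 c \<odot>\<^bsub>T0.T\<^esub> psi t) = rE (T.coeff e (c \<odot>\<^bsub>T.T\<^esub> t))" for e
    using h h(2)[unfolded B_def] by (simp add: T0.coeff(3) T.coeff(3) psi_closed coeff_psi RE.r_sm)
qed

lemma tens_mult_B: "a \<in> LA \<Longrightarrow> m \<in> LE \<Longrightarrow> t \<in> B \<Longrightarrow>
  T.tens a m \<otimes>\<^bsub>T.T\<^esub> t \<in> B \<and> psi (T.tens a m \<otimes>\<^bsub>T.T\<^esub> t) = psi (T.tens a m) \<otimes>\<^bsub>T0.T\<^esub> psi t"
proof -
  assume a: "a \<in> LA" and m: "m \<in> LE" and t: "t \<in> B"
  show ?thesis using t
  proof (induct t rule: B_induct)
    case (tens a' m')
    then show ?case using a m by (simp add: T.tens_mult T0.tens_mult psi_tens RA.r_mult RE.r_mult)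
  next
    case (add s t)
    then show ?case using a m
      by (simp add: T.T.r_distr B_carrier B_add psi_add T0.T.r_distr psi_closed)
  qed
qed

lemma mult_B: "s \<in> B \<Longrightarrow> t \<in> B \<Longrightarrow> s \<otimes>\<^bsub>T.T\<^esub> t \<in> B \<and> psi (s \<otimes>\<^bsub>T.T\<^esub> t) = psi s \<otimes>\<^bsub>T0.T\<^esub> psi t"
proof -
  assume s: "s \<in> B" and t: "t \<in> B"
  show ?thesis using s
  proof (induct s rule: B_induct)
    case (tens a m)
    then show ?case using tens_mult_B t by blast
  next
    case (add s s')
    then show ?case using t
      by (simp add: T.T.l_distr B_carrier B_add psi_add T0.T.l_distr psi_closed)
  qed
qed

theorem tensor_reduction: "reduction T.T T0.T B psi"
proof -
  have one: "\<one>\<^bsub>T.T\<^esub> \<in> B" by (simp add: T.tens_one)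
  have minus: "\<ominus>\<^bsub>T.T\<^esub> t \<in> B" if "t \<in> B" for t
    using B_sm[of "- 1" t] that by (simp add: T.T.minus_sm B_carrier loc_uminus)
  have "subring B T.T"
    by (rule T.T.subringI) (use B_carrier one minus mult_B B_add in auto)
  then have sub: "is_subalgebra loc T.T B" by (simp add: is_subalgebra_def B_sm)
  have surj: "\<exists>t\<in>B. psi t = y" if "y \<in> carrier T0.T" for y
    using that
  proof (induct y rule: T0.tensor_induct)
    case (tens x y)
    then obtain a m where "a \<in> LA" "rA a = x" "m \<in> LE" "rE m = y" using RA.r_surj RE.r_surj by metis
    then show ?case using psi_tens tens_B by blast
  next
    case (add x y)
    then show ?case using psi_add B_add by metis
  qed
  have ker: "\<exists>s\<in>B. t = unif \<odot>\<^bsub>T.T\<^esub> s" if t: "t \<in> B" and z: "psi t = \<zero>\<^bsub>T0.T\<^esub>" for t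
  proof -
    \<comment> \<open>The division by \<open>unif\<close> is carried out coordinate by coordinate in
      the second lattice and the results are reassembled with the basis.\<close>
    have "\<exists>m\<in>LE. T.coeff e t = unif \<odot>\<^bsub>E\<^esub> m" for e
      using coeff_psi[OF t, of e] z t by (intro RE.r_ker) (auto simp: B_def)
    then obtain m where m: "\<And>e. m e \<in> LE" "\<And>e. T.coeff e t = unif \<odot>\<^bsub>E\<^esub> m e" by metis
    obtain K where K: "finite K" "K \<subseteq> X" "t = (\<Oplus>\<^bsub>T.T\<^esub>e\<in>K. T.tens (b e) (T.coeff e t))"
      using T.coeff_expand[OF B_carrier[OF t]] by blast
    have mb: "T.tens (b e) (m e) \<in> B" if "e \<in> K" for e using that K(2) b_LA m by auto
    have "(\<Oplus>\<^bsub>T.T\<^esub>e\<in>K. T.tens (b e) (T.coeff e t)) = (\<Oplus>\<^bsub>T.T\<^esub>e\<in>K. unif \<odot>\<^bsub>T.T\<^esub> T.tens (b e) (m e))"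
      by (rule T.T.finsum_cong') (use K(2) m b_LA in \<open>auto simp: T.tens(5) subset_iff\<close>)
    also have "\<dots> = unif \<odot>\<^bsub>T.T\<^esub> (\<Oplus>\<^bsub>T.T\<^esub>e\<in>K. T.tens (b e) (m e))"
      by (rule T.T.sm_finsum[symmetric]) (use mb B_carrier in auto)
    finally have "t = unif \<odot>\<^bsub>T.T\<^esub> (\<Oplus>\<^bsub>T.T\<^esub>e\<in>K. T.tens (b e) (m e))" using K(3) by simp
    moreover have "(\<Oplus>\<^bsub>T.T\<^esub>e\<in>K. T.tens (b e) (m e)) \<in> B" by (rule B_finsum[OF K(1)]) (rule mb)
    ultimately show ?thesis by (rule bexI)
  qed
  have span: "\<exists>m. unif ^ m \<odot>\<^bsub>T.T\<^esub> t \<in> B" if "t \<in> carrier T.T" for t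
    using that
  proof (induct t rule: T.tensor_induct)
    case (tens a m)
    obtain i j where ij: "unif ^ i \<odot>\<^bsub>A\<^esub> a \<in> LA" "unif ^ j \<odot>\<^bsub>E\<^esub> m \<in> LE"
      using RA.span[OF tens(1)] RE.span[OF tens(2)] by blast
    have "unif ^ (i + j) \<odot>\<^bsub>T.T\<^esub> T.tens a m = unif ^ i \<odot>\<^bsub>T.T\<^esub> (unif ^ j \<odot>\<^bsub>T.T\<^esub> T.tens a m)"
      unfolding power_add using tens by (intro T.T.sm_mult) auto
    also have "\<dots> = T.tens (unif ^ i \<odot>\<^bsub>A\<^esub> a) (unif ^ j \<odot>\<^bsub>E\<^esub> m)"
      using T.tens(4)[OF UNIV_I, of a "unif ^ j \<odot>\<^bsub>E\<^esub> m" "unif ^ i"] T.tens(5)[OF UNIV_I tens, of "unif ^ j"] tens by simp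
    finally show ?case using tens_B[OF ij] by metis
  next
    case (add s t)
    then obtain i j where ij: "unif ^ i \<odot>\<^bsub>T.T\<^esub> s \<in> B" "unif ^ j \<odot>\<^bsub>T.T\<^esub> t \<in> B" by blast
    have p: "unif ^ l \<in> loc" for l by (simp add: loc_power)
    have "unif ^ (i + j) \<odot>\<^bsub>T.T\<^esub> (s \<oplus>\<^bsub>T.T\<^esub> t) = unif ^ j \<odot>\<^bsub>T.T\<^esub> (unif ^ i \<odot>\<^bsub>T.T\<^esub> s) \<oplus>\<^bsub>T.T\<^esub> unif ^ i \<odot>\<^bsub>T.T\<^esub> (unif ^ j \<odot>\<^bsub>T.T\<^esub> t)"
      using add(1,2) T.T.sm_mult[of "unif ^ j" "unif ^ i" s] T.T.sm_mult[of "unif ^ i" "unif ^ j" t]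
      by (simp add: T.T.sm_add_r power_add mult.commute)
    then show ?case using B_add[OF B_sm[OF p ij(1)] B_sm[OF p ij(2)]] by metis
  qed
  show ?thesis
    unfolding reduction_def reduction_axioms_def
    using T.T_algebra T0.T_algebra sub psi_closed psi_add mult_B psi_sm surj ker span one
    by (simp add: T.tens_one T0.tens_one psi_tens RA.r_one RE.r_one)
qed

end

section \<open>Reductions from presentations\<close>

context free_alg
begin

context
  fixes A :: "('f, 'a, 'm) module_scheme" and y
  assumes A: "coeff_algebra UNIV A" and y: "\<And>i. i < n \<Longrightarrow> y i \<in> carrier A"
begin

interpretation A: coeff_algebra UNIV A by (rule A)

lemma word_eval_closed [simp]: "set w \<subseteq> {..<n} \<Longrightarrow> word_eval A y w \<in> carrier A"
  by (induct w) (auto simp: word_eval_def y)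

lemma word_eval_append: "set u \<subseteq> {..<n} \<Longrightarrow> set v \<subseteq> {..<n} \<Longrightarrow> word_eval A y (u @ v) = word_eval A y u \<otimes>\<^bsub>A\<^esub> word_eval A y v"
proof (induct u)
  case Nil
  then show ?case using word_eval_closed[of v] by (simp add: word_eval_def)
next
  case (Cons i u)
  have "word_eval A y u \<in> carrier A" "word_eval A y v \<in> carrier A" "y i \<in> carrier A" using Cons y by auto
  moreover have "word_eval A y (u @ v) = word_eval A y u \<otimes>\<^bsub>A\<^esub> word_eval A y v" using Cons by simp
  ultimately show ?case by (simp add: word_eval_def A.m_assoc)
qed

lemma free_eval_hom: "algebra_hom UNIV F A (free_eval A y)"
  using W.lin_ext_hom[OF A, of "word_eval A y"] word_eval_append
  by (simp add: free_eval_def in_lists_conv_set subset_iff free_algebra_def word_eval_def[of _ _ "[]"])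

lemmas free_eval_linear = free_eval_hom[unfolded algebra_hom_def, THEN conjunct1]

lemma free_eval_bs: "set w \<subseteq> {..<n} \<Longrightarrow> free_eval A y (bs w) = word_eval A y w"
  using W.lin_ext_basis[OF A, of "word_eval A y" w] by (simp add: free_eval_def in_lists_conv_set subset_iff)

lemma free_eval_one: "free_eval A y \<one>\<^bsub>F\<^esub> = \<one>\<^bsub>A\<^esub>"
  using free_eval_hom by (simp add: algebra_hom_def del: W.M_sel)

lemma free_eval_sum:
  assumes "f \<in> carrier F" "finite X" "supp f \<subseteq> X" "X \<subseteq> lists {..<n}"
  shows "free_eval A y f = (\<Oplus>\<^bsub>A\<^esub>w\<in>X. f w \<odot>\<^bsub>A\<^esub> word_eval A y w)"
  unfolding free_eval_def by (rule W.lin_ext_superset[OF A]) (use assms in \<open>auto simp: in_lists_conv_set subset_iff\<close>)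

end

end

text \<open>Two algebras, over k(q) and over k, on corresponding generators. By
  \<open>relations\<close> an integral relation remains a relation when its coefficients are
  evaluated at q = 1, so that reduction is well defined; \<open>flat\<close> is the converse up to
  multiples of \<open>unif\<close> and gives the kernel of reduction. Both A with its polynomial
  limit and the rescaled dual with the exterior algebra are treated in this way.\<close>

locale presentation =
  F: free_alg n "TYPE('k poly fract)" + F0: free_alg n "TYPE('k)" + A: coeff_algebra UNIV A + A0: coeff_algebra UNIV A0
  for n and A :: "('k::field poly fract, 'a, 'm) module_scheme" (structure) and A0 :: "('k, 'b, 'n) module_scheme" +
  fixes y z
  assumes y: "i < n \<Longrightarrow> y i \<in> carrier A" and z: "i < n \<Longrightarrow> z i \<in> carrier A0"
    and y_surj: "carrier A \<subseteq> free_eval A y ` carrier F.F" and z_surj: "carrier A0 \<subseteq> free_eval A0 z ` carrier F0.F"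
    and relations: "f \<in> carrier F.F \<Longrightarrow> (\<And>w. f w \<in> loc) \<Longrightarrow> free_eval A y f = \<zero> \<Longrightarrow> free_eval A0 z (ev1 \<circ> f) = \<zero>\<^bsub>A0\<^esub>"
    and flat: "f \<in> carrier F.F \<Longrightarrow> (\<And>w. f w \<in> loc) \<Longrightarrow> free_eval A0 z (ev1 \<circ> f) = \<zero>\<^bsub>A0\<^esub> \<Longrightarrow>
      \<exists>g\<in>carrier F.F. (\<forall>w. g w \<in> loc) \<and> free_eval A y f = unif \<odot> free_eval A y g"
begin

definition LF where "LF = {f \<in> carrier F.F. \<forall>w. f w \<in> loc}"
definition lattice where "lattice = free_eval A y ` LF"
definition red where "red a = free_eval A0 z (ev1 \<circ> (SOME f. f \<in> LF \<and> free_eval A y f = a))"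

lemma LF_D: "f \<in> LF \<Longrightarrow> f \<in> carrier F.F" "f \<in> LF \<Longrightarrow> f w \<in> loc"
  by (auto simp: LF_def)

lemma LF_closed:
  "f \<in> LF \<Longrightarrow> g \<in> LF \<Longrightarrow> f \<oplus>\<^bsub>F.F\<^esub> g \<in> LF" "c \<in> loc \<Longrightarrow> f \<in> LF \<Longrightarrow> c \<odot>\<^bsub>F.F\<^esub> f \<in> LF"
  "f \<in> LF \<Longrightarrow> g \<in> LF \<Longrightarrow> f \<otimes>\<^bsub>F.F\<^esub> g \<in> LF" "set w \<subseteq> {..<n} \<Longrightarrow> basis_elt w \<in> LF"
proof -
  show "f \<in> LF \<Longrightarrow> g \<in> LF \<Longrightarrow> f \<oplus>\<^bsub>F.F\<^esub> g \<in> LF" using F.W.add_closed_M by (auto simp: LF_def intro: loc_add)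
  show "c \<in> loc \<Longrightarrow> f \<in> LF \<Longrightarrow> c \<odot>\<^bsub>F.F\<^esub> f \<in> LF" using F.W.smult_closed_M[of c f] by (auto simp: LF_def intro: loc_mult)
  show "f \<otimes>\<^bsub>F.F\<^esub> g \<in> LF" if fg: "f \<in> LF" "g \<in> LF"
  proof -
    have "(f \<otimes>\<^bsub>F.F\<^esub> g) w \<in> loc" for w
      by (subst F.W.mult_M[of "supp f" "supp g"]) (use fg in \<open>auto simp: LF_def F.carrier_F intro!: loc_sum loc_mult\<close>)
    then show ?thesis using fg F.W.M.m_closed by (auto simp: LF_def)
  qed
  show "set w \<subseteq> {..<n} \<Longrightarrow> basis_elt w \<in> LF" using F.bs_closed by (auto simp: LF_def basis_elt_def)
qed

lemma ev1_F0: "f \<in> carrier F.F \<Longrightarrow> ev1 \<circ> f \<in> carrier F0.F"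
proof -
  assume f: "f \<in> carrier F.F"
  have "supp (ev1 \<circ> f) \<subseteq> supp f" by (auto simp: supp_def)
  then show ?thesis using f by (auto simp: F.carrier_F F0.carrier_F intro: finite_subset)
qed

lemma ev1_mult_F: "f \<in> LF \<Longrightarrow> g \<in> LF \<Longrightarrow> ev1 \<circ> (f \<otimes>\<^bsub>F.F\<^esub> g) = (ev1 \<circ> f) \<otimes>\<^bsub>F0.F\<^esub> (ev1 \<circ> g)"
proof
  fix w
  assume f: "f \<in> LF" and g: "g \<in> LF"
  have fin: "finite (supp f)" "finite (supp g)" using f g by (auto simp: LF_def F.carrier_F)
  have s: "supp (ev1 \<circ> f) \<subseteq> supp f" "supp (ev1 \<circ> g) \<subseteq> supp g" by (auto simp: supp_def)
  have l: "(if P then f u * g v else 0) \<in> loc" for P u v using f g LF_D by (auto intro: loc_mult)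
  have "ev1 ((f \<otimes>\<^bsub>F.F\<^esub> g) w) = ev1 (\<Sum>u\<in>supp f. \<Sum>v\<in>supp g. if u @ v = w then f u * g v else 0)"
    using F.W.mult_M[OF fin order_refl order_refl, of w] by simp
  also have "\<dots> = (\<Sum>u\<in>supp f. \<Sum>v\<in>supp g. if u @ v = w then ev1 (f u) * ev1 (g v) else 0)"
    using f g LF_D by (simp add: ev1_sum loc_sum l if_distrib[of ev1] ev1_mult cong: if_cong)
  also have "\<dots> = ((ev1 \<circ> f) \<otimes>\<^bsub>F0.F\<^esub> (ev1 \<circ> g)) w"
    by (subst F0.W.mult_M[OF fin s]) (simp cong: if_cong)
  finally show "(ev1 \<circ> (f \<otimes>\<^bsub>F.F\<^esub> g)) w = ((ev1 \<circ> f) \<otimes>\<^bsub>F0.F\<^esub> (ev1 \<circ> g)) w" by simp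
qed

lemma ey:
  shows "f \<in> carrier F.F \<Longrightarrow> free_eval A y f \<in> carrier A"
    and "f \<in> carrier F.F \<Longrightarrow> g \<in> carrier F.F \<Longrightarrow> free_eval A y (f \<oplus>\<^bsub>F.F\<^esub> g) = free_eval A y f \<oplus> free_eval A y g"
    and "f \<in> carrier F.F \<Longrightarrow> free_eval A y (c \<odot>\<^bsub>F.F\<^esub> f) = c \<odot> free_eval A y f"
    and "f \<in> carrier F.F \<Longrightarrow> g \<in> carrier F.F \<Longrightarrow> free_eval A y (f \<otimes>\<^bsub>F.F\<^esub> g) = free_eval A y f \<otimes> free_eval A y g"
    and "free_eval A y \<one>\<^bsub>F.F\<^esub> = \<one>"
  using F.free_eval_hom[OF A.coeff_algebra_axioms y] by (simp_all add: algebra_hom_def linear_map_def del: F.W.M_sel)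

lemma ez:
  shows "f \<in> carrier F0.F \<Longrightarrow> free_eval A0 z f \<in> carrier A0"
    and "f \<in> carrier F0.F \<Longrightarrow> g \<in> carrier F0.F \<Longrightarrow> free_eval A0 z (f \<oplus>\<^bsub>F0.F\<^esub> g) = free_eval A0 z f \<oplus>\<^bsub>A0\<^esub> free_eval A0 z g"
    and "f \<in> carrier F0.F \<Longrightarrow> free_eval A0 z (c \<odot>\<^bsub>F0.F\<^esub> f) = c \<odot>\<^bsub>A0\<^esub> free_eval A0 z f"
    and "f \<in> carrier F0.F \<Longrightarrow> g \<in> carrier F0.F \<Longrightarrow> free_eval A0 z (f \<otimes>\<^bsub>F0.F\<^esub> g) = free_eval A0 z f \<otimes>\<^bsub>A0\<^esub> free_eval A0 z g"
    and "free_eval A0 z \<one>\<^bsub>F0.F\<^esub> = \<one>\<^bsub>A0\<^esub>"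
  using F0.free_eval_hom[OF A0.coeff_algebra_axioms z] by (simp_all add: algebra_hom_def linear_map_def del: F0.W.M_sel)

text \<open>\<open>red\<close> chooses an integral representative. The difference of two of them is
  an integral relation, hence evaluates to zero at q = 1.\<close>

lemma red_eval: "f \<in> LF \<Longrightarrow> red (free_eval A y f) = free_eval A0 z (ev1 \<circ> f)"
proof -
  assume f: "f \<in> LF"
  let ?g = "SOME g. g \<in> LF \<and> free_eval A y g = free_eval A y f"
  have g: "?g \<in> LF \<and> free_eval A y ?g = free_eval A y f" by (rule someI[of _ f]) (use f in auto)
  let ?h = "?g \<oplus>\<^bsub>F.F\<^esub> (- 1) \<odot>\<^bsub>F.F\<^esub> f"
  have h: "?h \<in> LF" using g f by (intro LF_closed) (auto simp: loc_uminus)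
  have c: "?g \<in> carrier F.F" "f \<in> carrier F.F" "(- 1) \<odot>\<^bsub>F.F\<^esub> f \<in> carrier F.F" using g f LF_D F.W.M.sm_closed[of "- 1" f] by auto
  have "free_eval A y ?h = free_eval A y f \<oplus> (- 1) \<odot> free_eval A y f"
    using ey(2)[OF c(1,3)] ey(3)[OF c(2)] g by metis
  also have "\<dots> = \<zero>" using ey(1)[OF c(2)] by (simp add: A.minus_sm[symmetric] A.r_neg)
  finally have "free_eval A0 z (ev1 \<circ> ?h) = \<zero>\<^bsub>A0\<^esub>" using relations h by (auto simp: LF_def)
  moreover have "ev1 \<circ> ?h = (ev1 \<circ> ?g) \<oplus>\<^bsub>F0.F\<^esub> (- 1) \<odot>\<^bsub>F0.F\<^esub> (ev1 \<circ> f)"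
  proof
    fix w
    have "?g w \<in> loc" "f w \<in> loc" using g f LF_D by auto
    then show "(ev1 \<circ> ?h) w = ((ev1 \<circ> ?g) \<oplus>\<^bsub>F0.F\<^esub> (- 1) \<odot>\<^bsub>F0.F\<^esub> (ev1 \<circ> f)) w"
      by (simp add: ev1_diff)
  qed
  ultimately have "free_eval A0 z (ev1 \<circ> ?g) \<oplus>\<^bsub>A0\<^esub> (- 1) \<odot>\<^bsub>A0\<^esub> free_eval A0 z (ev1 \<circ> f) = \<zero>\<^bsub>A0\<^esub>"
    using ez(2)[OF ev1_F0[OF c(1)] F0.W.M.sm_closed[OF UNIV_I ev1_F0[OF c(2)]]] ez(3)[OF ev1_F0[OF c(2)]] by metis
  then have "free_eval A0 z (ev1 \<circ> ?g) = free_eval A0 z (ev1 \<circ> f)"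
    using ez(1)[OF ev1_F0[OF c(1)]] ez(1)[OF ev1_F0[OF c(2)]]
    by (simp add: A0.minus_sm[symmetric] a_minus_def[symmetric])
  then show ?thesis by (simp add: red_def)
qed

theorem reduction: "reduction A A0 lattice red"
proof -
  have mem: "a \<in> lattice \<longleftrightarrow> (\<exists>f\<in>LF. a = free_eval A y f)" for a by (auto simp: lattice_def)
  have add: "free_eval A y f \<oplus> free_eval A y g = free_eval A y (f \<oplus>\<^bsub>F.F\<^esub> g)" if "f \<in> LF" "g \<in> LF" for f g
    using that ey(2) LF_D by metis
  have sm: "c \<odot> free_eval A y f = free_eval A y (c \<odot>\<^bsub>F.F\<^esub> f)" if "f \<in> LF" for c f
    using that ey(3) LF_D by metis
  have mult: "free_eval A y f \<otimes> free_eval A y g = free_eval A y (f \<otimes>\<^bsub>F.F\<^esub> g)" if "f \<in> LF" "g \<in> LF" for f g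
    using that ey(4) LF_D by metis
  have one: "\<one> = free_eval A y \<one>\<^bsub>F.F\<^esub>" "\<one>\<^bsub>F.F\<^esub> \<in> LF"
    using ey(5) LF_closed(4)[of "[]"] by simp_all
  have car: "lattice \<subseteq> carrier A" using ey(1) LF_D by (auto simp: mem)
  have sml: "c \<odot> a \<in> lattice" if "c \<in> loc" "a \<in> lattice" for c a using that sm LF_closed(2) unfolding mem by metis
  have "subring lattice A"
  proof (rule A.subringI)
    show "\<ominus> a \<in> lattice" if "a \<in> lattice" for a
      using sml[of "- 1" a] that car by (auto simp: A.minus_sm loc_uminus subset_iff)
    show "a \<oplus> b \<in> lattice" if "a \<in> lattice" "b \<in> lattice" for a b using that add LF_closed(1) unfolding mem by metis
    show "a \<otimes> b \<in> lattice" if "a \<in> lattice" "b \<in> lattice" for a b using that mult LF_closed(3) unfolding mem by metis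
    show "\<one> \<in> lattice" using one unfolding mem by blast
  qed (rule car)
  then have sub: "is_subalgebra loc A lattice" using sml by (simp add: is_subalgebra_def)
  show ?thesis
  proof
    show "is_subalgebra loc A lattice" by (rule sub)
    show "red a \<in> carrier A0" if "a \<in> lattice" for a
      using that ez(1)[OF ev1_F0] LF_D unfolding mem by (auto simp: red_eval)
    fix a b assume a: "a \<in> lattice" and b: "b \<in> lattice"
    then obtain f g where f: "f \<in> LF" "a = free_eval A y f" and g: "g \<in> LF" "b = free_eval A y g" unfolding mem by blast
    note c = ev1_F0[OF LF_D(1)[OF f(1)]] ev1_F0[OF LF_D(1)[OF g(1)]]
    have "ev1 \<circ> (f \<oplus>\<^bsub>F.F\<^esub> g) = (ev1 \<circ> f) \<oplus>\<^bsub>F0.F\<^esub> (ev1 \<circ> g)" using LF_D f g by (auto simp: ev1_add)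
    then show "red (a \<oplus> b) = red a \<oplus>\<^bsub>A0\<^esub> red b"
      using ez(2)[OF c] by (simp only: f(2) g(2) add[OF f(1) g(1)] red_eval f(1) g(1) LF_closed)
    show "red (a \<otimes> b) = red a \<otimes>\<^bsub>A0\<^esub> red b"
      using ez(4)[OF c] by (simp only: f(2) g(2) mult[OF f(1) g(1)] red_eval f(1) g(1) LF_closed ev1_mult_F)
    show "red (c \<odot> a) = ev1 c \<odot>\<^bsub>A0\<^esub> red a" if "c \<in> loc" for c
    proof -
      have "ev1 \<circ> (c \<odot>\<^bsub>F.F\<^esub> f) = ev1 c \<odot>\<^bsub>F0.F\<^esub> (ev1 \<circ> f)" using LF_D f that by (auto simp: ev1_mult)
      then show ?thesis using ez(3)[OF c(1)] LF_closed(2)[OF that f(1)]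
        by (simp only: f(2) sm[OF f(1)] red_eval f(1))
    qed
    show "\<exists>b\<in>lattice. a = unif \<odot> b" if "red a = \<zero>\<^bsub>A0\<^esub>"
    proof -
      have "free_eval A0 z (ev1 \<circ> f) = \<zero>\<^bsub>A0\<^esub>" using that f by (simp add: red_eval)
      then obtain g where "g \<in> LF" "a = unif \<odot> free_eval A y g" using flat[of f] f by (auto simp: LF_def)
      then show ?thesis unfolding lattice_def by (intro bexI[of _ "free_eval A y g"]) auto
    qed
  next
    have "ev1 \<circ> \<one>\<^bsub>F.F\<^esub> = \<one>\<^bsub>F0.F\<^esub>" by (auto simp: basis_elt_def)
    then show "red \<one> = \<one>\<^bsub>A0\<^esub>" using ez(5)
      by (simp only: one(1) red_eval[OF one(2)])
  next
    fix b assume "b \<in> carrier A0"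
    then obtain f where f: "f \<in> carrier F0.F" "b = free_eval A0 z f" using z_surj by blast
    have s: "supp (const \<circ> f) = supp f" by (auto simp: supp_def) (metis const_0 ev1_const)
    have "const \<circ> f \<in> LF" using f s by (auto simp: LF_def F.carrier_F F0.carrier_F)
    moreover have "ev1 \<circ> (const \<circ> f) = f" by auto
    ultimately show "\<exists>a\<in>lattice. red a = b"
      using f(2) by (intro bexI[of _ "free_eval A y (const \<circ> f)"]) (simp_all add: red_eval lattice_def)
  next
    fix a assume "a \<in> carrier A"
    then obtain f where f: "f \<in> carrier F.F" "a = free_eval A y f" using y_surj by blast
    obtain m where m: "\<forall>w\<in>supp f. unif ^ m * f w \<in> loc" using unif_power_loc_finite[of "supp f" f] f(1) by (auto simp: F.carrier_F)
    then have "unif ^ m * f w \<in> loc" for w by (cases "f w = 0") (auto simp: supp_def)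
    then have "unif ^ m \<odot>\<^bsub>F.F\<^esub> f \<in> LF" using f(1) F.W.smult_closed_M[of "unif ^ m" f] by (auto simp: LF_def)
    then show "\<exists>m. unif ^ m \<odot> a \<in> lattice" unfolding mem using ey(3)[OF f(1)] f(2) by metis
  qed
qed

end

section \<open>Polynomial algebras\<close>

definition cnt :: "nat list \<Rightarrow> nat \<Rightarrow> nat" where
  "cnt w = count_list w"

lemma cnt_simps: "cnt [] = (\<lambda>i. 0)" "cnt (i # w) = (\<lambda>j. (if j = i then 1 else 0) + cnt w j)"
  by (auto simp: cnt_def fun_eq_iff)

lemma cnt_length: "set w \<subseteq> {..<n} \<Longrightarrow> length w = (\<Sum>i<n. cnt w i)"
  unfolding cnt_def by (rule sum_count_set[symmetric]) simp_all

definition exps :: "nat \<Rightarrow> (nat \<Rightarrow> nat) set" where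
  "exps n = {e. \<forall>i\<ge>n. e i = 0}"

lemma cnt_exps: "set w \<subseteq> {..<n} \<Longrightarrow> cnt w \<in> exps n"
  by (induct w) (auto simp: cnt_simps exps_def)

lemma exps_cnt: "e \<in> exps n \<Longrightarrow> \<exists>w. set w \<subseteq> {..<n} \<and> cnt w = e"
proof (induct "\<Sum>i<n. e i" arbitrary: e)
  case 0
  have "e i = 0" for i using 0 by (cases "i < n") (auto simp: exps_def)
  then have "e = (\<lambda>i. 0)" by (rule ext)
  then show ?case by (intro exI[of _ "[]"]) (simp add: cnt_simps)
next
  case (Suc k)
  then obtain i where i: "i < n" "e i \<noteq> 0" by (metis lessThan_iff nat.distinct(1) sum.neutral)
  let ?d = "e(i := e i - 1)"
  have "(\<Sum>i<n. e i) = e i + (\<Sum>i\<in>{..<n} - {i}. e i)" "(\<Sum>i<n. ?d i) = (e i - 1) + (\<Sum>i\<in>{..<n} - {i}. e i)"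
    using i by (simp_all add: sum.remove[of _ i])
  then have "k = (\<Sum>i<n. ?d i)" using Suc(2) i by simp
  moreover have "?d \<in> exps n" using Suc(3) by (auto simp: exps_def)
  ultimately obtain w where w: "set w \<subseteq> {..<n}" "cnt w = ?d" using Suc(1) by blast
  then show ?case using i by (intro exI[of _ "i # w"]) (auto simp: cnt_simps fun_eq_iff)
qed

locale polynomials =
  fixes n :: nat and ty :: "'f::field itself"
begin

abbreviation P where "P \<equiv> (poly_algebra n :: ('f, 'f mpol) module)"

lemma exponents_sel [simp]: "carrier (exponents n) = exps n" "\<one>\<^bsub>exponents n\<^esub> = (\<lambda>i. 0)"
  "d \<otimes>\<^bsub>exponents n\<^esub> e = (\<lambda>i. d i + e i)"
  by (simp_all add: exponents_def exps_def)

sublocale X: monoid_algebra_loc "UNIV :: 'f set" "exponents n"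
  rewrites "monoid_algebra UNIV (exponents n) = P"
  by (unfold_locales) (auto simp: poly_algebra_def exponents_def)

lemma P_algebra: "coeff_algebra UNIV P"
  by (rule X.M.coeff_algebra_axioms)

lemma mon_closed [simp]: "e \<in> exps n \<Longrightarrow> basis_elt e \<in> carrier P"
  using X.basis_elt_M[of e] by simp

lemma mon_mult: "basis_elt d \<otimes>\<^bsub>P\<^esub> basis_elt e = basis_elt (\<lambda>i. d i + e i)"
  using X.basis_elt_mult[of d e] by simp

lemma Var_eq: "Var i = basis_elt (\<lambda>j. if j = i then 1 else 0)"
  by (simp add: Var_def)

lemma Var_closed [simp]: "i < n \<Longrightarrow> Var i \<in> carrier P"
  unfolding Var_eq by (rule mon_closed) (auto simp: exps_def)

lemma word_eval_P: "set w \<subseteq> {..<n} \<Longrightarrow> word_eval P Var w = basis_elt (cnt w)"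
  by (induct w) (simp_all add: word_eval_def cnt_simps Var_eq mon_mult)

lemma P_comm: "f \<in> carrier P \<Longrightarrow> g \<in> carrier P \<Longrightarrow> f \<otimes>\<^bsub>P\<^esub> g = g \<otimes>\<^bsub>P\<^esub> f"
proof -
  assume f: "f \<in> carrier P" and g: "g \<in> carrier P"
  have b: "basis_elt d \<otimes>\<^bsub>P\<^esub> g = g \<otimes>\<^bsub>P\<^esub> basis_elt d" if d: "d \<in> exps n" for d using g
  proof (induct g rule: X.M_induct)
    case (basis e)
    then show ?case by (simp add: mon_mult add.commute)
  qed (use d in \<open>simp_all add: X.M.l_distr X.M.r_distr X.M.sm_ml X.M.sm_mr del: X.M_sel\<close>)
  show ?thesis using f
    by (induct f rule: X.M_induct) (use b g in \<open>simp_all add: X.M.l_distr X.M.r_distr X.M.sm_ml X.M.sm_mr del: X.M_sel\<close>)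
qed

lemma mono_eval_single:
  assumes M: "monoid M" and i: "i < n" and y: "y i \<in> carrier M"
  shows "mono_eval (M :: ('f, 'b, 'm) module_scheme) n y (\<lambda>j. if j = i then 1 else 0) = y i"
proof -
  interpret M: monoid M by (rule M)
  have "foldr (\<lambda>i' a. y i' [^]\<^bsub>M\<^esub> (if i' = i then 1 else 0 :: nat) \<otimes>\<^bsub>M\<^esub> a) js \<one>\<^bsub>M\<^esub> = (if i \<in> set js then y i else \<one>\<^bsub>M\<^esub>)"
    if "distinct js" "i \<in> set js \<or> True" for js
    using that
  proof (induct js)
    case (Cons j js)
    have p: "y j' [^]\<^bsub>M\<^esub> (0 :: nat) = \<one>\<^bsub>M\<^esub>" for j' by (simp add: nat_pow_def)
    show ?case using Cons y by (cases "j = i") (auto simp: p)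
  qed simp
  from this[of "[0..<n]"] show ?thesis using i by (simp add: mono_eval_def)
qed

end

section \<open>Subalgebras generated over a coefficient ring\<close>

context free_alg
begin

context
  fixes A :: "('f, 'a, 'm) module_scheme" (structure) and y and S :: "'f set"
  assumes A: "coeff_algebra UNIV A" and y: "\<And>i. i < n \<Longrightarrow> y i \<in> carrier A" and S: "coeff_ring S"
begin

interpretation A: coeff_algebra UNIV A by (rule A)

text \<open>For \<open>laurent\<close> this describes the given form of A by values of
  noncommutative polynomials with Laurent coefficients, which can be compared with the lattice,
  whose elements are such values with coefficients in \<open>loc\<close>.\<close>

lemma subalgebra_generated_eq:
  "subalgebra_generated S A (y ` {..<n}) = free_eval A y ` {f \<in> carrier F. \<forall>w. f w \<in> S}" (is "?L = ?R")
proof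
  interpret WS: monoid_algebra_loc S "free_monoid {..<n}"
    using S by unfold_locales (auto simp: free_monoid_def)
  note h = free_eval_hom[OF A y, unfolded algebra_hom_def linear_map_def]
  have c: "{f \<in> carrier F. \<forall>w. f w \<in> S} = carrier WS.M"
    by (auto simp only: set_eq_iff mem_Collect_eq carrier_F WS.carrier_M W_sel)
  have eb: "set w \<subseteq> {..<n} \<Longrightarrow> free_eval A y (bs w) = word_eval A y w" for w by (rule free_eval_bs[OF A y])
  have lin: "linear_map UNIV F A (free_eval A y)" by (rule free_eval_linear[OF A y])
  have m: "f \<otimes>\<^bsub>WS.M\<^esub> g = f \<otimes>\<^bsub>F\<^esub> g" for f g :: "nat list \<Rightarrow> 'f" by (simp add: free_algebra_def monoid_algebra_def)
  have sub: "carrier WS.M \<subseteq> carrier F" using c by blast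
  have e: "f \<in> carrier WS.M \<Longrightarrow> f \<in> carrier F" for f using sub by blast
  have "is_subalgebra S A ?R" unfolding is_subalgebra_def c
  proof (intro conjI ballI)
    have sm: "s \<odot> a \<in> free_eval A y ` carrier WS.M" if s: "s \<in> S" and a: "a \<in> free_eval A y ` carrier WS.M" for s a
    proof -
      obtain f where f: "f \<in> carrier WS.M" "a = free_eval A y f" using a by blast
      have "s \<odot> a = free_eval A y (s \<odot>\<^bsub>F\<^esub> f)" using h e[OF f(1)] f(2) by simp
      then show ?thesis using WS.smult_closed_M[OF s f(1)] by simp
    qed
    then show "s \<odot> a \<in> free_eval A y ` carrier WS.M" if "s \<in> S" "a \<in> free_eval A y ` carrier WS.M" for s a using that .
    show "subring (free_eval A y ` carrier WS.M) A"
    proof (rule A.subringI)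
      show "free_eval A y ` carrier WS.M \<subseteq> carrier A" using h e by auto
      show "\<one> \<in> free_eval A y ` carrier WS.M" 
      proof
        show "\<one> = free_eval A y (bs [])" using free_eval_one[OF A y] by simp
        show "bs [] \<in> carrier WS.M" using WS.basis_elt_M[of "[]"] by simp
      qed
      fix a b assume a: "a \<in> free_eval A y ` carrier WS.M" and b: "b \<in> free_eval A y ` carrier WS.M"
      then obtain f g where f: "f \<in> carrier WS.M" "a = free_eval A y f" and g: "g \<in> carrier WS.M" "b = free_eval A y g" by blast
      have "a \<in> carrier A" using f e h by auto
      then show "\<ominus> a \<in> free_eval A y ` carrier WS.M" using sm[OF coeff_ringD(5)[OF S coeff_ringD(2)[OF S]] a] by (simp add: A.minus_sm)
      have "a \<oplus> b = free_eval A y (f \<oplus>\<^bsub>F\<^esub> g)" using h f g e by simp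
      then show "a \<oplus> b \<in> free_eval A y ` carrier WS.M" using WS.add_closed_M[OF f(1) g(1)] by simp
      have "a \<otimes> b = free_eval A y (f \<otimes>\<^bsub>WS.M\<^esub> g)" unfolding m using h f g e by simp
      then show "a \<otimes> b \<in> free_eval A y ` carrier WS.M" using WS.mult_closed_M[OF f(1) g(1)] by simp
    qed
  qed
  moreover have "y ` {..<n} \<subseteq> ?R"
  proof
    fix a assume "a \<in> y ` {..<n}"
    then obtain i where i: "i < n" "a = y i" by blast
    then have "free_eval A y (bs [i]) = a" using eb[of "[i]"] y by (simp add: word_eval_def)
    moreover have "bs [i] \<in> carrier WS.M" using i by simp
    ultimately show "a \<in> ?R" unfolding c by blast
  qed
  ultimately show "?L \<subseteq> ?R" unfolding subalgebra_generated_def by blast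
  show "?R \<subseteq> ?L"
  proof
    fix a assume "a \<in> ?R"
    then obtain f where f: "f \<in> carrier F" "\<forall>w. f w \<in> S" "a = free_eval A y f" by blast
    show "a \<in> ?L" unfolding subalgebra_generated_def
    proof (intro InterI CollectI)
      fix B assume "B \<in> {B. is_subalgebra S A B \<and> y ` {..<n} \<subseteq> B}"
      then have B: "subring B A" "\<And>s b. s \<in> S \<Longrightarrow> b \<in> B \<Longrightarrow> s \<odot> b \<in> B" "\<And>i. i < n \<Longrightarrow> y i \<in> B"
        by (auto simp: is_subalgebra_def)
      have w: "word_eval A y w \<in> B" if "set w \<subseteq> {..<n}" for w
        using that subringE(3,6)[OF B(1)] B(3) by (induct w) (auto simp: word_eval_def)
      have "free_eval A y f \<in> B" using f(1,2)
      proof -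
        have "f \<in> carrier WS.M" using f c by blast
        then show ?thesis
        proof (induct f rule: WS.M_induct)
          case (basis u)
          then have "set u \<subseteq> {..<n}" by auto
          then show ?case using w[of u] eb[of u] by simp
        next
          case (add f g)
          then have "free_eval A y (f \<oplus>\<^bsub>F\<^esub> g) = free_eval A y f \<oplus> free_eval A y g" using linear_mapD(2)[OF lin e e] by blast
          then show ?case using add subringE(7)[OF B(1)] by simp
        next
          case (smult s f)
          then have "free_eval A y (s \<odot>\<^bsub>F\<^esub> f) = s \<odot> free_eval A y f" using linear_mapD(3)[OF lin UNIV_I e] by blast
          then show ?case using smult B(2) by simp
        qed
      qed
      then show "a \<in> B" using f(3) by simp
    qed
  qed
qed

end

end

text \<open>The quotient stays in k[q, 1/q] and not merely in the local ring. This is needed where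
  the form of A is reduced by \<open>unif\<close> times itself: on that quotient a Laurent
  polynomial acts through its value at 1.\<close>

lemma laurent_ev1: "c \<in> laurent \<Longrightarrow> (c - const (ev1 c)) / unif \<in> laurent"
proof -
  assume "c \<in> laurent"
  then obtain p m where c: "c = Fraction_Field.Fract p 1 / qvar ^ m" by (auto simp: laurent_def)
  have q: "qvar ^ m = Fraction_Field.Fract ([:0, 1:] ^ m) (1 :: 'a poly)" for m
    by (induct m) (simp_all add: One_fract_def[symmetric] qvar_def del: mult_pCons_left)
  have q1: "poly ([:0, 1:] ^ m) (1 :: 'a) = 1" by simp
  have q0: "[:0, 1:] ^ m \<noteq> (0 :: 'a poly)" by simp
  have cf: "c = Fraction_Field.Fract p ([:0, 1:] ^ m)" unfolding c q by simp
  have e: "ev1 c = poly p 1" unfolding cf using ev1_Fract[of "[:0, 1:] ^ m" p] q1 by simp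
  let ?p = "p - [:poly p 1:] * [:0, 1:] ^ m"
  have "poly ?p 1 = 0" using q1 by simp
  then obtain s where s: "?p = [:- 1, 1:] * s" by (metis dvd_def poly_eq_0_iff_dvd)
  have "c - const (poly p 1) = Fraction_Field.Fract ?p ([:0, 1:] ^ m)"
    unfolding const_def cf using q0 by (subst diff_fract) simp_all
  also have "\<dots> = unif * Fraction_Field.Fract s ([:0, 1:] ^ m)"
    unfolding s unif_eq by simp
  finally have "(c - const (ev1 c)) / unif = Fraction_Field.Fract s ([:0, 1:] ^ m)" by (simp add: e)
  also have "\<dots> = Fraction_Field.Fract s 1 / qvar ^ m" unfolding q by simp
  finally show ?thesis unfolding laurent_def by blast
qed

section \<open>The semiclassical limit\<close>

declare unif_laurent [simp] const_laurent [simp]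

lemma word_eval_Cons: "word_eval A x (i # w) = x i \<otimes>\<^bsub>A\<^esub> word_eval A x w"
  by (simp add: word_eval_def)

lemma (in free_alg) quad_ideal_trunc:
  assumes "quad_space n UNIV G" "f \<in> quad_ideal G"
  shows "trunc p f \<in> quad_ideal G"
proof -
  have "in_quad n G q (trunc p f)" for q
  proof (cases "q = p")
    case True
    show ?thesis by (rule in_quad_cong[OF assms(1)]) (use assms(2) True in \<open>auto simp: quad_ideal_def trunc_def words_def\<close>)
  next
    case False
    show ?thesis by (rule in_quad_cong[OF assms(1) in_quad_0[OF assms(1)]]) (use False in \<open>auto simp: trunc_def words_def\<close>)
  qed
  then show ?thesis using assms(2) by (simp add: quad_ideal_def)
qed

locale quantum =
  fixes A :: "('k::field_char_0 poly fract, 'a) module" (structure) and n :: nat and x :: "nat \<Rightarrow> 'a"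
  assumes quadratic: "is_quadratic_algebra A n x"
    and limit: "admits_semiclassical_limit A (gen_form A n x)"
    and polynomial: "is_polynomial_algebra (scl_limit A n x) n (scl_gen A n x)"
begin

abbreviation "Bg \<equiv> gen_form A n x"
abbreviation "\<Phi> \<equiv> poly_eval (scl_limit A n x) n (scl_gen A n x)"

sublocale A: coeff_algebra UNIV A
  using quadratic by (simp add: is_quadratic_algebra_def coeff_algebra_def)

sublocale Bg: laurent_lattice A Bg
  using limit by unfold_locales (simp add: admits_semiclassical_limit_def)

sublocale F: free_alg n "TYPE('k poly fract)" .
sublocale F0: free_alg n "TYPE('k)" .
sublocale P: polynomials n "TYPE('k)" .
sublocale PF: polynomials n "TYPE('k poly fract)" .

abbreviation "ev \<equiv> free_eval A x"

lemma x_closed [simp]: "i < n \<Longrightarrow> x i \<in> carrier A"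
  using quadratic by (auto simp: is_quadratic_algebra_def)

lemma ev_linear: "linear_map UNIV F.F A ev"
  by (rule F.free_eval_linear[OF A.coeff_algebra_axioms x_closed])

lemmas ev = linear_mapD[OF ev_linear]

lemma ev_add [simp]: "f \<in> carrier F.F \<Longrightarrow> g \<in> carrier F.F \<Longrightarrow> ev (\<lambda>w. f w + g w) = ev f \<oplus> ev g"
  and ev_sm [simp]: "f \<in> carrier F.F \<Longrightarrow> ev (\<lambda>w. c * f w) = c \<odot> ev f"
  and ev_closed [simp]: "f \<in> carrier F.F \<Longrightarrow> ev f \<in> carrier A"
  using ev(1)[of f] ev(2)[of f g] ev(3)[of c f] by simp_all

lemma ev_diff: "f \<in> carrier F.F \<Longrightarrow> g \<in> carrier F.F \<Longrightarrow> ev (\<lambda>w. f w - g w) = ev f \<ominus> ev g"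
  using additive.diff[OF linear_additive[OF F.W.M.ring_axioms A.ring_axioms ev_linear], of f g] by (simp add: F.F_minus)

lemma ev_bs: "set w \<subseteq> {..<n} \<Longrightarrow> ev (basis_elt w) = word_eval A x w"
  by (rule F.free_eval_bs[OF A.coeff_algebra_axioms x_closed])

lemma word_closed [simp]: "set w \<subseteq> {..<n} \<Longrightarrow> word_eval A x w \<in> carrier A"
  by (rule F.word_eval_closed[OF A.coeff_algebra_axioms x_closed])

lemma ev_surj: "a \<in> carrier A \<Longrightarrow> \<exists>f\<in>carrier F.F. a = ev f"
  using quadratic by (auto simp: is_quadratic_algebra_def)

lemma Bg_eq: "Bg = ev ` {f \<in> carrier F.F. \<forall>w. f w \<in> laurent}"
  unfolding gen_form_def by (rule F.subalgebra_generated_eq[OF A.coeff_algebra_axioms x_closed]) simp_all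

lemma ev_Bg: "f \<in> carrier F.F \<Longrightarrow> (\<And>w. f w \<in> laurent) \<Longrightarrow> ev f \<in> Bg"
  unfolding Bg_eq by blast

lemma Phi_iso: "\<Phi> \<in> algebra_iso UNIV P.P (spec A Bg)"
  using polynomial by (simp add: is_polynomial_algebra_def scl_limit_def)

lemma Phi_hom: "algebra_hom UNIV P.P (spec A Bg) \<Phi>" and Phi_inj: "inj_on \<Phi> (carrier P.P)"
  and Phi_surj: "\<Phi> ` carrier P.P = carrier (spec A Bg)"
  using algebra_isoD[OF Phi_iso] by blast+

lemma Phi_linear: "linear_map UNIV P.P (spec A Bg) \<Phi>"
  using Phi_hom by (simp add: algebra_hom_def)

lemma spec_cring: "cring (spec A Bg)"
  using limit by (simp add: admits_semiclassical_limit_def)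

lemma word_Bg: "set w \<subseteq> {..<n} \<Longrightarrow> word_eval A x w \<in> Bg"
proof -
  assume w: "set w \<subseteq> {..<n}"
  have "(basis_elt w :: nat list \<Rightarrow> 'k poly fract) v \<in> laurent" for v by (simp add: basis_elt_def)
  then show ?thesis using ev_Bg[OF F.bs_closed[OF w]] ev_bs[OF w] by simp
qed

lemma x_Bg: "i < n \<Longrightarrow> x i \<in> Bg"
  using word_Bg[of "[i]"] by (simp add: word_eval_def)

lemma Phi_Var: "i < n \<Longrightarrow> \<Phi> (Var i) = Bg.cls (x i)"
proof -
  assume i: "i < n"
  let ?C = "scl_limit A n x"
  have C: "cring ?C" using spec_cring by (simp add: scl_limit_def)
  interpret C: cring ?C by (rule C)
  have g: "scl_gen A n x j \<in> carrier ?C" if "j < n" for j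
    using x_Bg[OF that] by (auto simp: scl_gen_def scl_limit_def Bg.carrier_spec)
  let ?e = "\<lambda>j. if j = i then 1 else 0 :: nat"
  have m: "mono_eval ?C n (scl_gen A n x) ?e = scl_gen A n x i"
    by (rule P.mono_eval_single[where M = ?C and y = "scl_gen A n x" and i = i, OF C.monoid_axioms i g[OF i]])
  have gi: "scl_gen A n x i = Bg.cls (x i)" by (simp add: scl_gen_def)
  have "\<Phi> (Var i) = (\<Oplus>\<^bsub>?C\<^esub>g\<in>{?e}. (if g = ?e then 1 else 0) \<odot>\<^bsub>?C\<^esub> mono_eval ?C n (scl_gen A n x) g)"
    by (simp only: poly_eval_def lin_ext_def Var_def P.X.supp_basis_elt) (simp add: basis_elt_def)
  also have "\<dots> = 1 \<odot>\<^bsub>?C\<^esub> Bg.cls (x i)"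
  proof -
    have fs: "(\<Oplus>\<^bsub>?C\<^esub>g\<in>{?e}. h g) = h ?e" if "h ?e \<in> carrier ?C" for h
      using C.finsum_insert[of "{}" ?e h] that by simp
    have "1 \<odot>\<^bsub>?C\<^esub> Bg.cls (x i) \<in> carrier ?C"
      using Bg.cls_smult[of "x i" 1] x_Bg[OF i] by (simp add: scl_limit_def Bg.carrier_spec)
    then show ?thesis using m gi by (subst fs) simp_all
  qed
  also have "\<dots> = Bg.cls (x i)" using Bg.cls_smult[of "x i" 1] x_Bg[OF i] by (simp add: scl_limit_def)
  finally show ?thesis .
qed

lemma cls_word: "set w \<subseteq> {..<n} \<Longrightarrow> Bg.cls (word_eval A x w) = \<Phi> (word_eval P.P Var w)"
proof (induct w)
  case Nil
  then show ?case using Phi_hom by (simp add: word_eval_def algebra_hom_def Bg.cls_one[symmetric])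
next
  case (Cons i w)
  then have "word_eval P.P Var w \<in> carrier P.P" by (simp add: P.word_eval_P cnt_exps)
  then have "\<Phi> (Var i \<otimes>\<^bsub>P.P\<^esub> word_eval P.P Var w) = Bg.cls (x i) \<otimes>\<^bsub>spec A Bg\<^esub> Bg.cls (word_eval A x w)"
    using Phi_hom Cons by (simp add: algebra_hom_def Phi_Var)
  also have "\<dots> = Bg.cls (x i \<otimes> word_eval A x w)" using Cons by (intro Bg.cls_mult word_Bg x_Bg) auto
  finally show ?case by (simp only: word_eval_Cons)
qed

lemma cls_unif: "b \<in> Bg \<Longrightarrow> Bg.cls (unif \<odot> b) = \<zero>\<^bsub>spec A Bg\<^esub>"
  using Bg.cls_eq[of "unif \<odot> b" "\<zero>"] unif_laurent
  by (simp add: Bg.cls_zero a_minus_def q1_ideal_def)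

lemma cls_sm: "c \<in> laurent \<Longrightarrow> b \<in> Bg \<Longrightarrow> Bg.cls (c \<odot> b) = ev1 c \<odot>\<^bsub>spec A Bg\<^esub> Bg.cls b"
proof -
  assume c: "c \<in> laurent" and b: "b \<in> Bg"
  let ?d = "(c - const (ev1 c)) / unif"
  have "c = const (ev1 c) + unif * ?d" by simp
  then have "c \<odot> b = const (ev1 c) \<odot> b \<oplus> unif \<odot> (?d \<odot> b)"
    using A.sm_add[of "const (ev1 c)" "unif * ?d" b] A.sm_mult[of unif ?d b] b by simp
  also have "Bg.cls \<dots> = Bg.cls (const (ev1 c) \<odot> b) \<oplus>\<^bsub>spec A Bg\<^esub> \<zero>\<^bsub>spec A Bg\<^esub>"
    using laurent_ev1[OF c] b const_laurent unif_laurent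
    by (subst Bg.cls_add[symmetric]) (simp_all add: cls_unif)
  also have "\<dots> = ev1 c \<odot>\<^bsub>spec A Bg\<^esub> Bg.cls b"
  proof -
    interpret C: cring "spec A Bg" by (rule spec_cring)
    have "Bg.cls (const (ev1 c) \<odot> b) \<in> carrier (spec A Bg)" using b const_laurent by (auto simp: Bg.carrier_spec)
    then show ?thesis using b by (simp add: Bg.cls_smult)
  qed
  finally show ?thesis .
qed

lemma ev0_linear: "linear_map UNIV F0.F P.P (free_eval P.P Var)"
  by (rule F0.free_eval_linear[OF P.P_algebra P.Var_closed])

lemma ev0_bs: "set w \<subseteq> {..<n} \<Longrightarrow> free_eval P.P Var (basis_elt w) = basis_elt (cnt w)"
  using F0.free_eval_bs[OF P.P_algebra P.Var_closed, where w = w] by (simp add: P.word_eval_P)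

lemma ev1_carrier: "f \<in> carrier F.F \<Longrightarrow> ev1 \<circ> f \<in> carrier F0.F"
proof -
  assume f: "f \<in> carrier F.F"
  have "supp (ev1 \<circ> f) \<subseteq> supp f" by (auto simp: supp_def)
  then show ?thesis using f by (auto simp: F.carrier_F F0.carrier_F intro: finite_subset)
qed

text \<open>Computations in the limit are moved to the free algebra, where reduction only evaluates
  the coefficients at q = 1.\<close>

lemma cls_ev:
  assumes "f \<in> carrier F.F" "\<And>w. f w \<in> laurent"
  shows "Bg.cls (ev f) = \<Phi> (free_eval P.P Var (ev1 \<circ> f))"
proof -
  interpret WS: monoid_algebra_loc "laurent :: 'k poly fract set" "free_monoid {..<n}"
    by unfold_locales (auto simp: free_monoid_def)
  have c: "f \<in> carrier F.F \<and> (\<forall>w. f w \<in> laurent) \<longleftrightarrow> f \<in> carrier WS.M" for f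
    by (auto simp only: F.carrier_F WS.carrier_M F.W_sel)
  have "f \<in> carrier WS.M" using assms c by blast
  then show ?thesis
  proof (induct f rule: WS.M_induct)
    case (basis u)
    then have u: "set u \<subseteq> {..<n}" by auto
    have "ev1 \<circ> basis_elt u = (basis_elt u :: nat list \<Rightarrow> 'k)" by (auto simp: basis_elt_def)
    then show ?case using u by (simp add: ev_bs cls_word P.word_eval_P ev0_bs)
  next
    case (add f g)
    then have fg: "f \<in> carrier F.F" "\<And>w. f w \<in> laurent" "g \<in> carrier F.F" "\<And>w. g w \<in> laurent" using c by blast+
    have e: "ev1 \<circ> (f \<oplus>\<^bsub>WS.M\<^esub> g) = (ev1 \<circ> f) \<oplus>\<^bsub>F0.F\<^esub> (ev1 \<circ> g)" using fg by (auto simp: ev1_add laurent_loc)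
    have "\<Phi> (free_eval P.P Var (ev1 \<circ> (f \<oplus>\<^bsub>WS.M\<^esub> g))) =
        \<Phi> (free_eval P.P Var (ev1 \<circ> f) \<oplus>\<^bsub>P.P\<^esub> free_eval P.P Var (ev1 \<circ> g))"
      by (simp only: e linear_mapD(2)[OF ev0_linear ev1_carrier[OF fg(1)] ev1_carrier[OF fg(3)]])
    also have "\<dots> = Bg.cls (ev f) \<oplus>\<^bsub>spec A Bg\<^esub> Bg.cls (ev g)"
      unfolding add by (intro linear_mapD(2)[OF Phi_linear] linear_mapD(1)[OF ev0_linear] ev1_carrier fg)
    also have "\<dots> = Bg.cls (ev (f \<oplus>\<^bsub>WS.M\<^esub> g))" using fg by (simp add: Bg.cls_add ev_Bg)
    finally show ?case by (rule sym)
  next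
    case (smult s f)
    then have f: "f \<in> carrier F.F" "\<And>w. f w \<in> laurent" using c by blast+
    have e: "ev1 \<circ> (s \<odot>\<^bsub>WS.M\<^esub> f) = ev1 s \<odot>\<^bsub>F0.F\<^esub> (ev1 \<circ> f)" using f smult(1) by (auto simp: ev1_mult laurent_loc)
    have "\<Phi> (free_eval P.P Var (ev1 \<circ> (s \<odot>\<^bsub>WS.M\<^esub> f))) = \<Phi> (ev1 s \<odot>\<^bsub>P.P\<^esub> free_eval P.P Var (ev1 \<circ> f))"
      by (simp only: e linear_mapD(3)[OF ev0_linear UNIV_I ev1_carrier[OF f(1)]])
    also have "\<dots> = ev1 s \<odot>\<^bsub>spec A Bg\<^esub> Bg.cls (ev f)"
      unfolding smult by (intro linear_mapD(3)[OF Phi_linear] linear_mapD(1)[OF ev0_linear] ev1_carrier f UNIV_I)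
    also have "\<dots> = Bg.cls (ev (s \<odot>\<^bsub>WS.M\<^esub> f))" using f smult(1) by (simp add: cls_sm ev_Bg)
    finally show ?case by (rule sym)
  qed
qed

lemma common_denominator:
  assumes f: "f \<in> carrier F.F" "\<And>w. f w \<in> loc"
  shows "\<exists>s\<in>laurent. ev1 s \<noteq> 0 \<and> (\<forall>w. s * f w \<in> laurent)"
proof -
  have "finite (supp f)" using f by (simp add: F.carrier_F)
  then obtain s where s: "s \<in> laurent" "ev1 s \<noteq> 0" "\<forall>w\<in>supp f. s * f w \<in> laurent"
    using loc_denominator[of "supp f" f] f(2) by blast
  have "s * f w \<in> laurent" for w using s(3) by (cases "w \<in> supp f") (auto simp: supp_def)
  then show ?thesis using s by blast
qed

text \<open>The isomorphism with the polynomial algebra concerns classes of the form over k[q, 1/q].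
  Injectivity of \<open>\<Phi>\<close> gives \<open>relations\<close>, and the description of the
  zero class as \<open>unif\<close> times the form gives \<open>flat\<close>.\<close>

sublocale A_pres: presentation n A P.P x Var
proof
  show "x i \<in> carrier A" "Var i \<in> carrier P.P" if "i < n" for i using that by simp_all
  show "carrier A \<subseteq> ev ` carrier F.F" using ev_surj by blast
  note l0 = linear_mapD[OF ev0_linear]
  show "carrier P.P \<subseteq> free_eval P.P Var ` carrier F0.F"
  proof
    fix p assume "p \<in> carrier P.P"
    then show "p \<in> free_eval P.P Var ` carrier F0.F"
    proof (induct p rule: P.X.M_induct)
      case (basis e)
      then obtain w where "set w \<subseteq> {..<n}" "cnt w = e" using exps_cnt by (metis P.exponents_sel(1))
      then show ?case using ev0_bs[of w] F0.bs_closed[of w] by (metis imageI)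
    next
      case (add p q)
      then obtain f g where fg: "f \<in> carrier F0.F" "g \<in> carrier F0.F" "p = free_eval P.P Var f" "q = free_eval P.P Var g" by blast
      show ?case unfolding fg(3,4) l0(2)[OF fg(1,2), symmetric] using F0.W.M.a_closed[OF fg(1,2)] by (rule imageI)
    next
      case (smult c p)
      then obtain f where f: "f \<in> carrier F0.F" "p = free_eval P.P Var f" by blast
      show ?case unfolding f(2) l0(3)[OF UNIV_I f(1), symmetric] using F0.W.M.sm_closed[OF UNIV_I f(1)] by (rule imageI)
    qed
  qed
  fix f assume f: "f \<in> carrier F.F" "\<And>w. f w \<in> loc"
  \<comment> \<open>Multiplication by s brings f to Laurent coefficients. It can be undone: s is
    invertible in \<open>loc\<close>, and its value at 1 is a nonzero scalar of k.\<close>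
  obtain s where s: "s \<in> laurent" "ev1 s \<noteq> 0" "\<And>w. s * f w \<in> laurent" using common_denominator[OF f] by blast
  have s': "s \<in> loc" "s \<noteq> 0" "inverse s \<in> loc" using s laurent_loc loc_inverse by blast+
  let ?sf = "\<lambda>w. s * f w"
  have sf: "?sf \<in> carrier F.F" using F.W.smult_closed_M[of s f] f by simp
  have e1: "ev1 \<circ> ?sf = (\<lambda>w. ev1 s * (ev1 \<circ> f) w)" using f s' by (auto simp: ev1_mult)
  have cl: "Bg.cls (ev ?sf) = \<Phi> (ev1 s \<odot>\<^bsub>P.P\<^esub> free_eval P.P Var (ev1 \<circ> f))"
    using cls_ev[OF sf s(3)] l0(3)[OF UNIV_I ev1_carrier[OF f(1)], of "ev1 s"] unfolding e1 by simp
  have pc: "free_eval P.P Var (ev1 \<circ> f) \<in> carrier P.P" using l0(1) ev1_carrier f by blast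
  have z: "\<Phi> \<zero>\<^bsub>P.P\<^esub> = \<zero>\<^bsub>spec A Bg\<^esub>"
    using additive.zero[OF linear_additive[OF P.X.M.ring_axioms _ Phi_linear]] spec_cring by (simp add: cring_def)
  show "free_eval P.P Var (ev1 \<circ> f) = \<zero>\<^bsub>P.P\<^esub>" if "ev f = \<zero>"
  proof -
    have "ev ?sf = \<zero>" using that f by simp
    then have "\<Phi> (ev1 s \<odot>\<^bsub>P.P\<^esub> free_eval P.P Var (ev1 \<circ> f)) = \<Phi> \<zero>\<^bsub>P.P\<^esub>"
      using cl z Bg.cls_zero by simp
    then have 0: "ev1 s \<odot>\<^bsub>P.P\<^esub> free_eval P.P Var (ev1 \<circ> f) = \<zero>\<^bsub>P.P\<^esub>"
      using inj_onD[OF Phi_inj] P.X.M.sm_closed[OF UNIV_I pc] P.X.M.zero_closed by blast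
    have "free_eval P.P Var (ev1 \<circ> f) = (inverse (ev1 s) * ev1 s) \<odot>\<^bsub>P.P\<^esub> free_eval P.P Var (ev1 \<circ> f)" using s(2) by simp
    also have "\<dots> = \<zero>\<^bsub>P.P\<^esub>" using 0 by (simp add: fun_eq_iff)
    finally show ?thesis .
  qed
  show "\<exists>g\<in>carrier F.F. (\<forall>w. g w \<in> loc) \<and> ev f = unif \<odot> ev g" if h: "free_eval P.P Var (ev1 \<circ> f) = \<zero>\<^bsub>P.P\<^esub>"
  proof -
    have "Bg.cls (ev ?sf) = Bg.cls \<zero>" using cl h z by (simp add: Bg.cls_zero[symmetric])
    then have "ev ?sf \<ominus> \<zero> \<in> q1_ideal A Bg" using Bg.cls_eq[of "ev ?sf" "\<zero>"] ev_Bg[OF sf s(3)] by blast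
    then obtain b where b: "b \<in> Bg" "ev ?sf = unif \<odot> b" using sf by (auto simp: q1_ideal_def a_minus_def)
    then obtain g where g: "g \<in> carrier F.F" "\<And>w. g w \<in> laurent" "b = ev g" unfolding Bg_eq by blast
    let ?g = "\<lambda>w. inverse s * g w"
    have gc: "?g \<in> carrier F.F" using F.W.smult_closed_M[of "inverse s" g] g by simp
    have "?g w \<in> loc" for w using s'(3) g(2) laurent_loc loc_mult by blast
    moreover have "ev f = unif \<odot> ev ?g"
    proof -
      have "ev f = (inverse s * s) \<odot> ev f" using s' f by simp
      also have "\<dots> = inverse s \<odot> ev ?sf" using f by (simp add: A.sm_mult)
      also have "\<dots> = (unif * inverse s) \<odot> b" unfolding b(2) using b(1) by (simp add: A.sm_mult[symmetric] mult.commute)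
      also have "\<dots> = unif \<odot> ev ?g" using g by (simp add: A.sm_mult)
      finally show ?thesis .
    qed
    ultimately show ?thesis using gc by (intro bexI[of _ ?g] conjI allI) auto
  qed
qed

abbreviation "LA \<equiv> A_pres.lattice"
abbreviation "rA \<equiv> A_pres.red"

sublocale RA: reduction A P.P LA rA
  by (rule A_pres.reduction)

lemma ev_LA: "f \<in> carrier F.F \<Longrightarrow> (\<And>w. f w \<in> loc) \<Longrightarrow> ev f \<in> LA"
  and rA_ev: "f \<in> carrier F.F \<Longrightarrow> (\<And>w. f w \<in> loc) \<Longrightarrow> rA (ev f) = free_eval P.P Var (ev1 \<circ> f)"
  using A_pres.red_eval[of f] by (auto simp: A_pres.lattice_def A_pres.LF_def)

lemma word_LA: "set w \<subseteq> {..<n} \<Longrightarrow> word_eval A x w \<in> LA"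
  and rA_word: "set w \<subseteq> {..<n} \<Longrightarrow> rA (word_eval A x w) = basis_elt (cnt w)"
proof -
  assume w: "set w \<subseteq> {..<n}"
  have l: "(basis_elt w :: nat list \<Rightarrow> 'k poly fract) v \<in> loc" for v by (simp add: basis_elt_def)
  have e: "ev1 \<circ> basis_elt w = (basis_elt w :: nat list \<Rightarrow> 'k)" by (auto simp: basis_elt_def)
  show "word_eval A x w \<in> LA" using ev_LA[OF F.bs_closed[OF w] l] ev_bs[OF w] by simp
  show "rA (word_eval A x w) = basis_elt (cnt w)" using rA_ev[OF F.bs_closed[OF w] l] ev_bs[OF w] e ev0_bs[OF w] by simp
qed

lemma x_LA: "i < n \<Longrightarrow> x i \<in> LA" and rA_x: "i < n \<Longrightarrow> rA (x i) = Var i"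
  using word_LA[of "[i]"] rA_word[of "[i]"] by (simp_all add: word_eval_def cnt_simps P.Var_eq)

lemma Bg_LA: "b \<in> Bg \<Longrightarrow> b \<in> LA" and cls_Phi: "b \<in> Bg \<Longrightarrow> Bg.cls b = \<Phi> (rA b)"
proof -
  assume "b \<in> Bg"
  then obtain f where f: "f \<in> carrier F.F" "\<And>w. f w \<in> laurent" "b = ev f" unfolding Bg_eq by blast
  have l: "f w \<in> loc" for w using f(2) laurent_loc by blast
  show "b \<in> LA" "Bg.cls b = \<Phi> (rA b)"
    using ev_LA[OF f(1) l] rA_ev[OF f(1) l] cls_ev[OF f(1,2)] f(3) by simp_all
qed

lemma lift_Bg: "p \<in> carrier P.P \<Longrightarrow> \<exists>b\<in>Bg. rA b = p"
proof -
  assume p: "p \<in> carrier P.P"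
  then obtain b where b: "b \<in> Bg" "\<Phi> p = Bg.cls b" using Phi_surj Bg.carrier_spec by blast
  then have "\<Phi> p = \<Phi> (rA b)" by (simp add: cls_Phi)
  then have "rA b = p" using inj_onD[OF Phi_inj] p RA.r_closed[OF Bg_LA[OF b(1)]] by metis
  then show ?thesis using b by blast
qed

section \<open>The commutator divided by q - 1 and the Poisson bracket of the limit\<close>

definition br where "br a b = (1 / unif) \<odot> (a \<otimes> b \<ominus> b \<otimes> a)"

lemma unif_br: "a \<in> carrier A \<Longrightarrow> b \<in> carrier A \<Longrightarrow> unif \<odot> br a b = a \<otimes> b \<ominus> b \<otimes> a"
  by (simp add: br_def A.sm_mult[symmetric])

lemma br_closed: "a \<in> carrier A \<Longrightarrow> b \<in> carrier A \<Longrightarrow> br a b \<in> carrier A"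
  by (simp add: br_def)

lemma br_eqI: "a \<in> carrier A \<Longrightarrow> b \<in> carrier A \<Longrightarrow> c \<in> carrier A \<Longrightarrow> a \<otimes> b \<ominus> b \<otimes> a = unif \<odot> c \<Longrightarrow> c = br a b"
  using RA.unif_cancel[of c "br a b"] unif_br[of a b] br_closed[of a b] by simp

lemma br_LA: "a \<in> LA \<Longrightarrow> b \<in> LA \<Longrightarrow> br a b \<in> LA"
proof -
  assume a: "a \<in> LA" and b: "b \<in> LA"
  have "rA (a \<otimes> b \<ominus> b \<otimes> a) = rA a \<otimes>\<^bsub>P.P\<^esub> rA b \<ominus>\<^bsub>P.P\<^esub> rA b \<otimes>\<^bsub>P.P\<^esub> rA a"
    using a b by (simp add: RA.r_diff RA.r_mult del: P.X.M_sel)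
  also have "\<dots> = \<zero>\<^bsub>P.P\<^esub>"
    using a b P.P_comm[of "rA a" "rA b"] by (simp del: P.X.M_sel)
  finally obtain c where c: "c \<in> LA" "a \<otimes> b \<ominus> b \<otimes> a = unif \<odot> c"
    using RA.r_ker[of "a \<otimes> b \<ominus> b \<otimes> a"] a b by auto
  then show ?thesis using br_eqI[of a b c] a b by auto
qed

lemma br_Bg: "a \<in> Bg \<Longrightarrow> b \<in> Bg \<Longrightarrow> br a b \<in> Bg"
proof -
  interpret C: cring "spec A Bg" by (rule spec_cring)
  assume a: "a \<in> Bg" and b: "b \<in> Bg"
  have "Bg.cls (a \<otimes> b) = Bg.cls (b \<otimes> a)"
    using a b C.m_comm[of "Bg.cls a" "Bg.cls b"] by (simp add: Bg.cls_mult Bg.carrier_spec)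
  then obtain c where c: "c \<in> Bg" "a \<otimes> b \<ominus> b \<otimes> a = unif \<odot> c" using a b by (auto simp: Bg.cls_eq q1_ideal_def)
  then show ?thesis using br_eqI[of a b c] a b by auto
qed

lemma br_add: "a \<in> carrier A \<Longrightarrow> a' \<in> carrier A \<Longrightarrow> b \<in> carrier A \<Longrightarrow> br (a \<oplus> a') b = br a b \<oplus> br a' b"
  by (simp add: br_def A.l_distr A.r_distr A.sm_add_r[symmetric] a_minus_def A.minus_add A.a_ac)

lemma br_sm: "a \<in> carrier A \<Longrightarrow> b \<in> carrier A \<Longrightarrow> br (c \<odot> a) b = c \<odot> br a b"
  by (simp add: br_def A.sm_ml A.sm_mr A.sm_diff_r[symmetric] A.sm_mult[symmetric] mult.commute)

lemma br_anti: "a \<in> carrier A \<Longrightarrow> b \<in> carrier A \<Longrightarrow> br b a = \<ominus> br a b"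
  by (simp add: br_def A.sm_minus_r[symmetric] a_minus_def A.minus_add A.a_comm)

lemma rA_br_cong: "a \<in> LA \<Longrightarrow> a' \<in> LA \<Longrightarrow> b \<in> LA \<Longrightarrow> rA a = rA a' \<Longrightarrow> rA (br a b) = rA (br a' b)"
proof -
  assume h: "a \<in> LA" "a' \<in> LA" "b \<in> LA" "rA a = rA a'"
  then obtain c where c: "c \<in> LA" "a = a' \<oplus> unif \<odot> c" using RA.r_eq_iff[of a a'] by blast
  have "br a b = br a' b \<oplus> unif \<odot> br c b" unfolding c(2) using c(1) h by (simp add: br_add br_sm)
  then show ?thesis using h c(1) by (simp add: RA.r_add br_LA del: P.X.M_sel)
qed

lemma rA_br_cong2: "a \<in> LA \<Longrightarrow> b \<in> LA \<Longrightarrow> b' \<in> LA \<Longrightarrow> rA b = rA b' \<Longrightarrow> rA (br a b) = rA (br a b')"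
  using rA_br_cong[of b b' a] br_anti[of b a] br_anti[of b' a] RA.r_minus[of "br b a"] RA.r_minus[of "br b' a"] br_LA
  by (simp add: RA.L_carrier)

text \<open>The bracket of the limit is formed with representatives in the form over k[q, 1/q], but
  is needed for all elements of the lattice over \<open>loc\<close>. Each of these has the same
  reduction as an element of the form, and the reduction of \<open>br\<close> depends only on the
  reductions of its arguments.\<close>

theorem bracket: "a \<in> LA \<Longrightarrow> b \<in> LA \<Longrightarrow> scl_bracket A n x (rA a) (rA b) = rA (br a b)"
proof -
  assume a: "a \<in> LA" and b: "b \<in> LA"
  obtain a' where a': "a' \<in> Bg" "rA a' = rA a" using lift_Bg[of "rA a"] a by auto
  obtain b' where b': "b' \<in> Bg" "rA b' = rA b" using lift_Bg[of "rA b"] b by auto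
  note L = Bg_LA[OF a'(1)] Bg_LA[OF b'(1)]
  \<comment> \<open>\<open>spec_bracket\<close> is a union over all representatives and all
    solutions of the commutator equation. The solution is unique because \<open>unif\<close> can be
    cancelled in A, and the class is independent of the representatives, so that the union is a
    single coset.\<close>
  have all: "spec_class A Bg \<beta> = Bg.cls (br a' b')"
    if "c \<in> Bg.cls a'" "d \<in> Bg.cls b'" "\<beta> \<in> Bg" "c \<otimes> d \<ominus> d \<otimes> c = unif \<odot> \<beta>" for c d \<beta>
  proof -
    have c: "c \<in> Bg" "Bg.cls c = Bg.cls a'" and d: "d \<in> Bg" "Bg.cls d = Bg.cls b'" using that a' b' Bg.cls_mem by blast+
    have "rA c = rA a'" "rA d = rA b'"
      using c d a' b' inj_onD[OF Phi_inj] RA.r_closed Bg_LA by (metis cls_Phi)+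
    then have "rA (br c d) = rA (br a' b')"
      using rA_br_cong[of c a' d] rA_br_cong2[of a' d b'] Bg_LA c d L by simp
    moreover have "\<beta> = br c d" using that c d by (intro br_eqI) auto
    ultimately show ?thesis using c d a' b' br_Bg by (simp add: cls_Phi)
  qed
  have "spec_bracket A Bg (Bg.cls a') (Bg.cls b') = Bg.cls (br a' b')"
  proof -
    have m: "a' \<in> Bg.cls a'" "b' \<in> Bg.cls b'" using a' b' Bg.cls_mem by blast+
    have "br a' b' \<in> Bg" "a' \<otimes> b' \<ominus> b' \<otimes> a' = unif \<odot> br a' b'"
      using br_Bg a' b' unif_br[of a' b'] by auto
    then have "Bg.cls (br a' b') \<subseteq> spec_bracket A Bg (Bg.cls a') (Bg.cls b')"
      unfolding spec_bracket_def using m by blast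
    moreover have "spec_bracket A Bg (Bg.cls a') (Bg.cls b') \<subseteq> Bg.cls (br a' b')"
      unfolding spec_bracket_def using all by blast
    ultimately show ?thesis by blast
  qed
  moreover have "\<Phi> (rA a) = Bg.cls a'" "\<Phi> (rA b) = Bg.cls b'" using cls_Phi a' b' by metis+
  moreover have "Bg.cls (br a' b') = \<Phi> (rA (br a' b'))" using cls_Phi br_Bg a' b' by blast
  moreover have "rA (br a' b') = rA (br a b)"
    using rA_br_cong[OF L(1) a L(2) a'(2)] rA_br_cong2[OF a L(2) b b'(2)] by simp
  moreover have "rA (br a b) \<in> carrier P.P" using br_LA[OF a b] by simp
  ultimately show ?thesis unfolding scl_bracket_def Let_def by (simp add: inv_into_f_f[OF Phi_inj])
qed

end

section \<open>A basis of the quantum algebra\<close>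

lemma sum_if_eq: "finite A \<Longrightarrow> (\<Sum>a\<in>A. (if a = b then (1 :: 'c::comm_ring_1) else 0) * f a) = (if b \<in> A then f b else 0)"
  by (simp add: if_distrib[of "\<lambda>c. c * _"] cong: if_cong)

context quantum
begin

section \<open>The quadratic relations and Nakayama's lemma\<close>

definition ext2 :: "(nat \<Rightarrow> nat \<Rightarrow> 'k poly fract) \<Rightarrow> nat list \<Rightarrow> 'k poly fract" where
  "ext2 g = (\<lambda>w. case w of [i, j] \<Rightarrow> if i < n \<and> j < n then g i j else 0 | _ \<Rightarrow> 0)"

lemma ext2_words: "w \<notin> words n 2 \<Longrightarrow> ext2 g w = 0"
  by (auto simp: ext2_def words_def split: list.splits)

lemma ext2_closed [simp]: "ext2 g \<in> carrier F.F"
  by (rule F.words_F[OF ext2_words])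

lemma ext2_free_part: "f \<in> free_part {..<n} 2 \<Longrightarrow> ext2 (\<lambda>i j. f [i, j]) = f"
proof
  fix w assume f: "f \<in> free_part {..<n} 2"
  show "ext2 (\<lambda>i j. f [i, j]) w = f w"
  proof (cases "w \<in> words n 2")
    case True
    then obtain i j where "w = [i, j]" "i < n" "j < n" by (auto simp: words_def numeral_2_eq_2 length_Suc_conv)
    then show ?thesis by (simp add: ext2_def)
  next
    case False
    then show ?thesis using f ext2_words[OF False] by (simp add: F.free_part_words)
  qed
qed

definition rel where "rel g \<longleftrightarrow> ev (ext2 g) = \<zero>"

lemma rel_space: "quad_space n UNIV rel"
  unfolding quad_space_def
proof (intro conjI allI impI)
  fix g h assume g: "rel g"
  show "rel h" if "\<forall>i<n. \<forall>j<n. g i j = h i j"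
  proof -
    have "ext2 h = ext2 g" using that by (auto simp: ext2_def fun_eq_iff split: list.splits)
    then show ?thesis using g by (simp add: rel_def)
  qed
  show "rel (\<lambda>i j. g i j + h i j)" if "rel h"
  proof -
    have "ext2 (\<lambda>i j. g i j + h i j) = (\<lambda>w. ext2 g w + ext2 h w)" by (auto simp: ext2_def fun_eq_iff split: list.splits)
    then show ?thesis using g that by (simp add: rel_def)
  qed
  show "rel (\<lambda>i j. c * g i j)" for c
  proof -
    have "ext2 (\<lambda>i j. c * g i j) = (\<lambda>w. c * ext2 g w)" by (auto simp: ext2_def fun_eq_iff split: list.splits)
    then show ?thesis using g by (simp add: rel_def)
  qed
next
  let ?z = "\<lambda>i j. 0 :: 'k poly fract"
  have e: "ext2 ?z = (\<lambda>w. 0 * ext2 ?z w)" by (auto simp: ext2_def fun_eq_iff split: list.splits)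
  have "ev (\<lambda>w. 0 * ext2 ?z w) = 0 \<odot> ev (ext2 ?z)" by (rule ev_sm[OF ext2_closed])
  then show "rel ?z" unfolding rel_def by (simp only: e[symmetric] A.sm_l_0 ev_closed ext2_closed)
qed

lemma forms_rel: "F.forms rel = quad_relations A n x"
  by (auto simp: F.forms_def quad_relations_def rel_def ext2_free_part)

text \<open>The relations of A form an ideal generated in degree two, hence a homogeneous one. This
  confines the argument for generation by chosen words to one degree, where there are finitely many
  words.\<close>

lemma ev_trunc: "f \<in> carrier F.F \<Longrightarrow> ev f = \<zero> \<Longrightarrow> ev (F.trunc p f) = \<zero>"
proof -
  assume f: "f \<in> carrier F.F" "ev f = \<zero>"
  have k: "{f \<in> carrier F.F. ev f = \<zero>} = F.quad_ideal rel"
    using quadratic F.quad_ideal_Idl[OF rel_space] by (simp add: is_quadratic_algebra_def forms_rel)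
  then have "f \<in> F.quad_ideal rel" using f by blast
  then have "F.trunc p f \<in> F.quad_ideal rel" by (rule F.quad_ideal_trunc[OF rel_space])
  then show ?thesis using k by blast
qed

text \<open>Elimination of one generator at a time: in the equation for \<open>v s\<close> the
  coefficient of \<open>v s\<close> is 1 minus a multiple of \<open>unif\<close>, a unit of the
  local ring. Solving for it and substituting into the other equations preserves their form.\<close>

lemma nakayama:
  assumes "finite U" "\<And>u. u \<in> U \<Longrightarrow> v u \<in> carrier A"
    and N: "N \<subseteq> carrier A" "\<And>a b. a \<in> N \<Longrightarrow> b \<in> N \<Longrightarrow> a \<oplus> b \<in> N" "\<And>c a. c \<in> loc \<Longrightarrow> a \<in> N \<Longrightarrow> c \<odot> a \<in> N"
    and h: "\<And>u. u \<in> U \<Longrightarrow> \<exists>c. (\<forall>w. c w \<in> loc) \<and> (\<exists>a\<in>N. v u = a \<oplus> unif \<odot> (\<Oplus>w\<in>U. c w \<odot> v w))"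
  shows "\<forall>u\<in>U. v u \<in> (N :: 'a set)"
  using assms(1,2) h
proof (induct U rule: finite_induct)
  case (insert s U)
  have vc: "v u \<in> carrier A" if "u \<in> insert s U" for u using insert(4) that by blast
  have sc: "(\<Oplus>w\<in>U. c w \<odot> v w) \<in> carrier A" for c using vc by (intro A.finsum_closed) auto
  have split: "(\<Oplus>w\<in>insert s U. c w \<odot> v w) = c s \<odot> v s \<oplus> (\<Oplus>w\<in>U. c w \<odot> v w)" for c
    using insert(1,2) vc by (intro A.finsum_insert) auto
  have comb: "(\<Oplus>w\<in>U. (c w + l * d w) \<odot> v w) = (\<Oplus>w\<in>U. c w \<odot> v w) \<oplus> l \<odot> (\<Oplus>w\<in>U. d w \<odot> v w)" for c d l
  proof -
    have "(\<Oplus>w\<in>U. (c w + l * d w) \<odot> v w) = (\<Oplus>w\<in>U. c w \<odot> v w \<oplus> l \<odot> (d w \<odot> v w))"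
      by (rule A.finsum_cong') (use vc in \<open>auto simp: A.sm_add A.sm_mult\<close>)
    also have "\<dots> = (\<Oplus>w\<in>U. c w \<odot> v w) \<oplus> (\<Oplus>w\<in>U. l \<odot> (d w \<odot> v w))"
      by (rule A.finsum_addf) (use vc in auto)
    also have "(\<Oplus>w\<in>U. l \<odot> (d w \<odot> v w)) = l \<odot> (\<Oplus>w\<in>U. d w \<odot> v w)"
      by (rule A.sm_finsum[symmetric]) (use vc in auto)
    finally show ?thesis .
  qed
  obtain c a where c: "\<And>w. c w \<in> loc" and a: "a \<in> N"
      and vs: "v s = a \<oplus> unif \<odot> (c s \<odot> v s \<oplus> (\<Oplus>w\<in>U. c w \<odot> v w))"
    using insert(5)[of s] unfolding split by blast
  let ?S = "\<Oplus>w\<in>U. c w \<odot> v w"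
  have ac: "a \<in> carrier A" using a N by blast
  \<comment> \<open>The unit that solves the equation of the eliminated generator; it lies in
    \<open>loc\<close> because its inverse has value 1 at q = 1.\<close>
  define t where "t = inverse (1 - unif * c s)"
  have tl: "t \<in> loc" "t * (1 - unif * c s) = 1"
    using loc_inverse[of "1 - unif * c s"] c by (simp_all add: t_def loc_diff loc_mult ev1_diff ev1_mult)
  have "(1 - unif * c s) \<odot> v s = a \<oplus> unif \<odot> ?S"
  proof -
    let ?z = "unif \<odot> (c s \<odot> v s)"
    have z: "?z \<in> carrier A" using vc by simp
    have 1: "(1 - unif * c s) \<odot> v s = v s \<ominus> ?z"
      using A.sm_add[of 1 "- (unif * c s)" "v s"] vc[of s] by (simp add: a_minus_def A.sm_minus A.sm_mult)
    have "a \<oplus> unif \<odot> (c s \<odot> v s \<oplus> ?S) = (a \<oplus> unif \<odot> ?S) \<oplus> ?z"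
      using vc[of s] sc[of c] ac by (simp add: A.sm_add_r A.a_ac)
    then have 2: "v s = (a \<oplus> unif \<odot> ?S) \<oplus> ?z" by (rule trans[OF vs])
    have 3: "(a \<oplus> unif \<odot> ?S) \<oplus> ?z \<ominus> ?z = a \<oplus> unif \<odot> ?S" using z ac sc[of c] by (simp add: a_minus_def A.a_assoc A.r_neg)
    show ?thesis by (rule trans[OF 1 trans[OF arg_cong[of _ _ "\<lambda>w. w \<ominus> ?z", OF 2] 3]])
  qed
  then have "t \<odot> ((1 - unif * c s) \<odot> v s) = t \<odot> a \<oplus> (unif * t) \<odot> ?S"
    using ac sc[of c] by (simp add: A.sm_add_r A.sm_mult[symmetric] mult.commute)
  then have vs': "v s = t \<odot> a \<oplus> (unif * t) \<odot> ?S"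
    using tl vc[of s] by (simp add: A.sm_mult[symmetric])
  have ta: "t \<odot> a \<in> N" using N tl a by blast
  have IH: "\<forall>u\<in>U. v u \<in> N"
  proof (rule insert(3))
    fix u assume u: "u \<in> U"
    obtain d e where d: "\<And>w. d w \<in> loc" and e: "e \<in> N"
      and vu: "v u = e \<oplus> unif \<odot> (d s \<odot> v s \<oplus> (\<Oplus>w\<in>U. d w \<odot> v w))"
      using insert(5)[of u] u unfolding split by blast
    let ?R = "\<Oplus>w\<in>U. d w \<odot> v w" and ?l = "unif * d s * t"
    have ec: "e \<in> carrier A" using e N by blast
    have tac: "t \<odot> a \<in> carrier A" using ac by simp
    have "unif \<odot> (d s \<odot> v s \<oplus> ?R) = (unif * d s) \<odot> (t \<odot> a) \<oplus> unif \<odot> (?R \<oplus> ?l \<odot> ?S)"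
      using sc[of c] sc[of d] tac vc[of s]
      by (subst vs') (simp add: A.sm_add_r A.sm_mult[symmetric] A.a_ac mult.assoc mult.left_commute mult.commute)
    then have "v u = (e \<oplus> (unif * d s) \<odot> (t \<odot> a)) \<oplus> unif \<odot> (\<Oplus>w\<in>U. (d w + ?l * c w) \<odot> v w)"
      using vu ec tac sc[of c] sc[of d] by (simp add: comb A.a_assoc)
    moreover have "e \<oplus> (unif * d s) \<odot> (t \<odot> a) \<in> N" using N e ta d by (simp add: loc_mult)
    moreover have "\<forall>w. d w + ?l * c w \<in> loc" using c d tl by (simp add: loc_add loc_mult)
    ultimately show "\<exists>c. (\<forall>w. c w \<in> loc) \<and> (\<exists>a\<in>N. v u = a \<oplus> unif \<odot> (\<Oplus>w\<in>U. c w \<odot> v w))"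
      by (intro exI[of _ "\<lambda>w. d w + ?l * c w"] conjI bexI)
  qed (use vc in simp)
  \<comment> \<open>Zero is adjoined to N to accommodate the empty sum.\<close>
  have SN: "(\<Oplus>w\<in>V. c w \<odot> v w) \<in> insert \<zero> N" if "finite V" "V \<subseteq> U" for V
    using that
  proof (induct V rule: finite_induct)
    case (insert w V)
    then have cw: "c w \<odot> v w \<in> N" "\<And>u. u \<in> insert w V \<Longrightarrow> v u \<in> carrier A" using IH N c vc by auto
    have "(\<Oplus>w\<in>insert w V. c w \<odot> v w) = c w \<odot> v w \<oplus> (\<Oplus>w\<in>V. c w \<odot> v w)"
      using insert cw by (intro A.finsum_insert) auto
    then show ?case using insert cw N by auto
  qed simp
  have "(unif * t) \<odot> ?S \<in> insert \<zero> N"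
    using SN[OF insert(1) order_refl] N(3)[of "unif * t" ?S] tl by (auto simp: loc_mult)
  then have "v s \<in> N" using vs' ta N ac by auto
  then show ?case using IH by simp
qed simp

text \<open>All words with the content \<open>e\<close> reduce to the same monomial; one of them is chosen.  The chosen
  words form a basis of \<open>A\<close>, since they do so at \<open>q = 1\<close>.\<close>

definition cw :: "(nat \<Rightarrow> nat) \<Rightarrow> nat list" where
  "cw e = (SOME w. set w \<subseteq> {..<n} \<and> cnt w = e)"

definition b where "b e = word_eval A x (cw e)"

abbreviation "bas \<equiv> lin_ext A b"

abbreviation "\<E> p \<equiv> cnt ` words n p"

lemma cw: "e \<in> exps n \<Longrightarrow> set (cw e) \<subseteq> {..<n} \<and> cnt (cw e) = e"
  unfolding cw_def using exps_cnt by (rule someI_ex)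

lemma E_exps: "e \<in> \<E> p \<Longrightarrow> e \<in> exps n"
  by (auto simp: words_def cnt_exps)

lemma cw_words: "e \<in> \<E> p \<Longrightarrow> cw e \<in> words n p"
proof -
  assume "e \<in> \<E> p"
  then obtain w where w: "w \<in> words n p" "e = cnt w" by blast
  then have "set (cw e) \<subseteq> {..<n}" "cnt (cw e) = cnt w" using cw[of e] by (auto simp: words_def cnt_exps)
  then show ?thesis using w cnt_length[of "cw e" n] cnt_length[of w n] by (simp add: words_def)
qed

lemma b_closed [simp]: "e \<in> exps n \<Longrightarrow> b e \<in> carrier A"
  and b_LA: "e \<in> exps n \<Longrightarrow> b e \<in> LA" and rA_b: "e \<in> exps n \<Longrightarrow> rA (b e) = basis_elt e"
  using cw[of e] word_LA[of "cw e"] rA_word[of "cw e"] by (auto simp: b_def)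

lemma bas_linear: "linear_map UNIV PF.P A bas"
  by (rule PF.X.lin_ext_linear[OF A.coeff_algebra_axioms]) simp

lemmas bas = linear_mapD[OF bas_linear]

lemma bas_sum: "c \<in> carrier PF.P \<Longrightarrow> bas c = (\<Oplus>e\<in>supp c. c e \<odot> b e)"
  by (simp add: lin_ext_def)

lemma carrier_PF: "c \<in> carrier PF.P \<longleftrightarrow> finite (supp c) \<and> supp c \<subseteq> exps n"
  by (simp add: PF.X.carrier_M)

lemma bas_LA: "c \<in> carrier PF.P \<Longrightarrow> (\<And>e. c e \<in> loc) \<Longrightarrow> bas c \<in> LA"
  and rA_bas: "c \<in> carrier PF.P \<Longrightarrow> (\<And>e. c e \<in> loc) \<Longrightarrow> rA (bas c) = ev1 \<circ> c"
proof -
  assume c: "c \<in> carrier PF.P" and l: "\<And>e. c e \<in> loc"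
  have m: "(\<lambda>e. c e \<odot> b e) \<in> supp c \<rightarrow> LA" using c l b_LA by (auto simp: carrier_PF)
  then show "bas c \<in> LA" unfolding bas_sum[OF c] by (rule RA.L_finsum)
  have "rA (bas c) = (\<Oplus>\<^bsub>P.P\<^esub>e\<in>supp c. rA (c e \<odot> b e))" unfolding bas_sum[OF c] by (rule RA.r_finsum[OF m])
  also have "\<dots> = (\<Oplus>\<^bsub>P.P\<^esub>e\<in>supp c. ev1 (c e) \<odot>\<^bsub>P.P\<^esub> basis_elt e)"
    by (rule P.X.M.finsum_cong') (use c l b_LA rA_b in \<open>auto simp: carrier_PF RA.r_sm subset_iff simp del: P.X.M_sel\<close>)
  also have "\<dots> = ev1 \<circ> c"
  proof
    fix d
    have "(\<Oplus>\<^bsub>P.P\<^esub>e\<in>supp c. ev1 (c e) \<odot>\<^bsub>P.P\<^esub> basis_elt e) d = (\<Sum>e\<in>supp c. (ev1 (c e) \<odot>\<^bsub>P.P\<^esub> basis_elt e) d)"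
      by (rule P.X.finsum_M) (use c in \<open>auto simp: carrier_PF subset_iff simp del: P.X.M_sel\<close>)
    also have "\<dots> = (\<Sum>e\<in>supp c. (if e = d then 1 else 0) * ev1 (c e))"
      by (intro sum.cong) (auto simp: basis_elt_def)
    also have "\<dots> = (ev1 \<circ> c) d" using c by (subst sum_if_eq) (auto simp: carrier_PF supp_def)
    finally show "(\<Oplus>\<^bsub>P.P\<^esub>e\<in>supp c. ev1 (c e) \<odot>\<^bsub>P.P\<^esub> basis_elt e) d = (ev1 \<circ> c) d" .
  qed
  finally show "rA (bas c) = ev1 \<circ> c" .
qed

lemma bas_div:
  assumes c: "c \<in> carrier PF.P" "\<And>e. c e \<in> loc" "bas c = \<zero>"
  shows "(\<lambda>e. c e / unif) \<in> carrier PF.P" "\<And>e. c e / unif \<in> loc" "bas (\<lambda>e. c e / unif) = \<zero>"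
proof -
  let ?d = "\<lambda>e. (1 / unif) * c e"
  have d: "?d \<in> carrier PF.P" using PF.X.smult_closed_M[of "1 / unif" c] c by simp
  then show "(\<lambda>e. c e / unif) \<in> carrier PF.P" by simp
  have "ev1 \<circ> c = rA \<zero>" using rA_bas[OF c(1,2)] c(3) by simp
  then have "ev1 (c e) = 0" for e by (auto simp: fun_eq_iff)
  then show "c e / unif \<in> loc" for e using ev1_eq_0 c(2) by blast
  have "bas ?d = (1 / unif) \<odot> bas c" using bas(3)[of "1 / unif" c] c(1) by simp
  then show "bas (\<lambda>e. c e / unif) = \<zero>" using c(3) by simp
qed

text \<open>After clearing denominators, a relation between the chosen words reduces to a relation
  between distinct monomials, so that all its coefficients vanish at q = 1. Dividing them by
  \<open>unif\<close> gives another relation, and by repetition the coefficients are divisible by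
  every power of \<open>unif\<close>.\<close>

lemma bas_inj0:
  assumes c: "c \<in> carrier PF.P" "bas c = \<zero>"
  shows "c = (\<lambda>e. 0)"
proof -
  obtain m where m: "\<forall>e\<in>supp c. unif ^ m * c e \<in> loc" using unif_power_loc_finite[of "supp c" c] c(1) by (auto simp: carrier_PF)
  let ?c = "\<lambda>e. unif ^ m * c e"
  have c': "?c \<in> carrier PF.P" using PF.X.smult_closed_M[of "unif ^ m" c] c by simp
  have l: "?c e \<in> loc" for e using m by (cases "c e = 0") (auto simp: supp_def)
  have z: "bas ?c = \<zero>" using bas(3)[of "unif ^ m" c] c by simp
  have "\<exists>d. d \<in> carrier PF.P \<and> (\<forall>e. d e \<in> loc) \<and> bas d = \<zero> \<and> (\<forall>e. ?c e = unif ^ r * d e)" for r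
  proof (induct r)
    case 0
    then show ?case using c' l z by (intro exI[of _ ?c]) simp
  next
    case (Suc r)
    then obtain d where d: "d \<in> carrier PF.P" "\<And>e. d e \<in> loc" "bas d = \<zero>" "\<And>e. ?c e = unif ^ r * d e" by blast
    show ?case using bas_div[OF d(1-3)] d(4) by (intro exI[of _ "\<lambda>e. d e / unif"]) simp
  qed
  then have "?c e = 0" for e by (intro loc_separated) blast
  then have "c e = 0" for e by simp
  then show ?thesis by (rule ext)
qed

lemma bas_inj: "inj_on bas (carrier PF.P)"
proof (rule inj_onI)
  fix c d assume h: "c \<in> carrier PF.P" "d \<in> carrier PF.P" "bas c = bas d"
  interpret a: additive PF.P A bas by (rule linear_additive[OF PF.X.M.ring_axioms A.ring_axioms bas_linear])
  have z: "bas (c \<ominus>\<^bsub>PF.P\<^esub> d) = \<zero>" using h by (simp add: a.diff del: PF.X.M_sel)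
  have "c \<ominus>\<^bsub>PF.P\<^esub> d = \<zero>\<^bsub>PF.P\<^esub>" using bas_inj0[OF PF.X.M.minus_closed[OF h(1,2)] z] by simp
  then show "c = d" using h by (simp del: PF.X.M_sel)
qed

lemma bas_basis: "e \<in> exps n \<Longrightarrow> bas (basis_elt e) = b e"
  by (rule PF.X.lin_ext_basis[OF A.coeff_algebra_axioms]) simp_all

text \<open>A word and the chosen word of the same content have the same reduction, so that they
  differ by \<open>unif\<close> times an integral combination of words. Once this combination is cut
  down to degree p, Nakayama's lemma applies to the words of length p.\<close>

lemma word_span:
  assumes w: "w \<in> words n p"
  shows "\<exists>c. c \<in> carrier PF.P \<and> (\<forall>e. c e \<in> loc) \<and> supp c \<subseteq> \<E> p \<and> word_eval A x w = bas c"
proof -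
  let ?N = "bas ` {c \<in> carrier PF.P. (\<forall>e. c e \<in> loc) \<and> supp c \<subseteq> \<E> p}"
  have "\<forall>u\<in>words n p. word_eval A x u \<in> ?N"
  proof (rule nakayama)
    show "finite (words n p)" by simp
    show "word_eval A x u \<in> carrier A" if "u \<in> words n p" for u using that by (simp add: words_def)
    show "?N \<subseteq> carrier A" using bas(1) by blast
    show "a \<oplus> a' \<in> ?N" if a: "a \<in> ?N" and a': "a' \<in> ?N" for a a'
    proof -
      obtain c d where cd: "c \<in> carrier PF.P" "\<forall>e. c e \<in> loc" "supp c \<subseteq> \<E> p" "a = bas c"
        "d \<in> carrier PF.P" "\<forall>e. d e \<in> loc" "supp d \<subseteq> \<E> p" "a' = bas d" using a a' by blast
      have "a \<oplus> a' = bas (\<lambda>e. c e + d e)" using bas(2)[OF cd(1,5)] cd by simp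
      moreover have "supp (\<lambda>e. c e + d e) \<subseteq> \<E> p" using PF.X.supp_sum_subset(1)[of c d] cd by blast
      ultimately show ?thesis using PF.X.add_closed_M[OF cd(1,5)] cd(2,6) by (auto simp: loc_add)
    qed
    show "s \<odot> a \<in> ?N" if s: "s \<in> loc" and a: "a \<in> ?N" for s a
    proof -
      obtain c where c: "c \<in> carrier PF.P" "\<forall>e. c e \<in> loc" "supp c \<subseteq> \<E> p" "a = bas c" using a by blast
      have "s \<odot> a = bas (\<lambda>e. s * c e)" using bas(3)[OF UNIV_I c(1), of s] c by simp
      moreover have "supp (\<lambda>e. s * c e) \<subseteq> \<E> p" using PF.X.supp_sum_subset(2)[of s c] c by blast
      ultimately show ?thesis using PF.X.smult_closed_M[of s c] c s by (auto simp: loc_mult)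
    qed
    fix u assume u: "u \<in> words n p"
    have us: "set u \<subseteq> {..<n}" "length u = p" using u by (auto simp: words_def)
    let ?e = "cnt u"
    have e: "?e \<in> \<E> p" using u by blast
    have ce: "set (cw ?e) \<subseteq> {..<n}" "length (cw ?e) = p" using cw_words[OF e] by (auto simp: words_def)
    let ?f = "\<lambda>v. basis_elt u v - basis_elt (cw ?e) v :: 'k poly fract"
    have ec: "ev ?f = word_eval A x u \<ominus> b ?e" using ev_diff[OF F.bs_closed[OF us(1)] F.bs_closed[OF ce(1)]] us ce by (simp add: ev_bs b_def)
    have "rA (ev ?f) = \<zero>\<^bsub>P.P\<^esub>" unfolding ec
      using RA.r_diff[OF word_LA[OF us(1)] b_LA[OF E_exps[OF e]]] rA_word[OF us(1)] rA_b[OF E_exps[OF e]] P.mon_closed[OF E_exps[OF e]]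
      by (simp del: P.X.M_sel)
    moreover have "ev ?f \<in> LA" unfolding ec using word_LA[OF us(1)] b_LA[OF E_exps[OF e]] by simp
    ultimately obtain a where a: "a \<in> LA" "ev ?f = unif \<odot> a" using RA.r_ker by blast
    then obtain g where g: "g \<in> carrier F.F" "\<And>w. g w \<in> loc" "a = ev g" by (auto simp: A_pres.lattice_def A_pres.LF_def)
    let ?h = "\<lambda>v. ?f v - unif * g v"
    have fF: "?f \<in> carrier F.F" using F.W.M.minus_closed[OF F.bs_closed[OF us(1)] F.bs_closed[OF ce(1)]]
      F.F_minus[OF F.bs_closed[OF us(1)] F.bs_closed[OF ce(1)]] by simp
    have gF: "(\<lambda>v. unif * g v) \<in> carrier F.F" using F.W.smult_closed_M[of unif g] g by simp
    have hF: "?h \<in> carrier F.F" using F.W.M.minus_closed[OF fF gF] F.F_minus[OF fF gF] by simp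
    have "ev ?h = \<zero>" using ev_diff[OF fF gF] a g by simp
    \<comment> \<open>The element \<open>g\<close> found by division may have components in all
      degrees. The relation \<open>?h\<close> is homogeneous up to \<open>unif\<close> times
      \<open>g\<close>, and its part of degree p is again a relation, in which \<open>g\<close> is
      replaced by its component of degree p.\<close>
    then have "ev (F.trunc p ?h) = \<zero>" by (rule ev_trunc[OF hF])
    moreover have "F.trunc p ?h = (\<lambda>v. ?f v - unif * F.trunc p g v)"
      using us ce by (auto simp: F.trunc_def basis_elt_def fun_eq_iff)
    moreover have tF: "F.trunc p g \<in> carrier F.F" using g by simp
    moreover have uF: "(\<lambda>v. unif * F.trunc p g v) \<in> carrier F.F" using F.W.smult_closed_M[of unif "F.trunc p g"] tF by simp
    ultimately have "ev ?f \<ominus> unif \<odot> ev (F.trunc p g) = \<zero>" using ev_diff[OF fF uF] by simp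
    then have "word_eval A x u \<ominus> b ?e \<ominus> unif \<odot> ev (F.trunc p g) = \<zero>" unfolding ec .
    then have "word_eval A x u = b ?e \<oplus> unif \<odot> ev (F.trunc p g)"
      using A.eq_add_if_minus[of "word_eval A x u" "b ?e"] us E_exps[OF e] tF by simp
    moreover have "ev (F.trunc p g) = (\<Oplus>w\<in>words n p. g w \<odot> word_eval A x w)"
    proof -
      have "supp (F.trunc p g) \<subseteq> words n p" using g(1) by (auto simp: F.trunc_def supp_def F.carrier_F words_def split: if_splits)
      moreover have "words n p \<subseteq> lists {..<n}" by (auto simp: words_def)
      ultimately have "ev (F.trunc p g) = (\<Oplus>w\<in>words n p. F.trunc p g w \<odot> word_eval A x w)"
        using F.free_eval_sum[OF A.coeff_algebra_axioms x_closed tF words_finite] by simp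
      also have "\<dots> = (\<Oplus>w\<in>words n p. g w \<odot> word_eval A x w)"
        by (rule A.finsum_cong') (auto simp: F.trunc_def words_def)
      finally show ?thesis .
    qed
    moreover have "b ?e \<in> ?N"
    proof (rule image_eqI[of _ _ "basis_elt ?e"])
      show "b ?e = bas (basis_elt ?e)" by (rule bas_basis[OF E_exps[OF e], symmetric])
      have "(basis_elt ?e :: (nat \<Rightarrow> nat) \<Rightarrow> 'k poly fract) d \<in> loc" for d by (simp add: basis_elt_def)
      then show "basis_elt ?e \<in> {c \<in> carrier PF.P. (\<forall>e. c e \<in> loc) \<and> supp c \<subseteq> \<E> p}"
        using PF.mon_closed[OF E_exps[OF e]] e by (simp del: PF.X.M_sel)
    qed
    ultimately show "\<exists>c. (\<forall>w. c w \<in> loc) \<and> (\<exists>a\<in>?N. word_eval A x u = a \<oplus> unif \<odot> (\<Oplus>w\<in>words n p. c w \<odot> word_eval A x w))"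
      using g(2) by (intro exI[of _ g] conjI bexI[of _ "b ?e"]) auto
  qed
  then show ?thesis using w by blast
qed

definition \<phi> where "\<phi> a = inv_into (carrier PF.P) bas a"

lemma phi_bas: "c \<in> carrier PF.P \<Longrightarrow> \<phi> (bas c) = c"
  unfolding \<phi>_def by (rule inv_into_f_f[OF bas_inj])

text \<open>Taken with all of k(q) this shows that the chosen words span A, and with
  \<open>loc\<close> that elements of the lattice have integral coordinates.\<close>

lemma span_closed:
  assumes S: "coeff_ring S" "\<And>w. set w \<subseteq> {..<n} \<Longrightarrow> \<exists>c\<in>carrier PF.P. (\<forall>e. c e \<in> S) \<and> word_eval A x w = bas c"
    and f: "f \<in> carrier F.F" "\<And>w. f w \<in> S"
  shows "\<exists>c\<in>carrier PF.P. (\<forall>e. c e \<in> S) \<and> ev f = bas c"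
proof -
  interpret WS: monoid_algebra_loc S "free_monoid {..<n}"
    using S(1) by unfold_locales (auto simp: free_monoid_def)
  have c: "f \<in> carrier F.F \<and> (\<forall>w. f w \<in> S) \<longleftrightarrow> f \<in> carrier WS.M" for f
    by (auto simp only: F.carrier_F WS.carrier_M F.W_sel)
  have "f \<in> carrier WS.M" using f c by blast
  then show ?thesis
  proof (induct f rule: WS.M_induct)
    case (basis u)
    then have "set u \<subseteq> {..<n}" by auto
    then show ?case using S(2) ev_bs by metis
  next
    case (add f g)
    then obtain c' d where cd: "c' \<in> carrier PF.P" "\<forall>e. c' e \<in> S" "ev f = bas c'" "d \<in> carrier PF.P" "\<forall>e. d e \<in> S" "ev g = bas d" by blast
    have fg: "f \<in> carrier F.F" "g \<in> carrier F.F" using add c by blast+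
    show ?case
      using cd bas(2)[OF cd(1,4)] fg PF.X.add_closed_M[OF cd(1,4)] coeff_ringD(3)[OF S(1)]
      by (intro bexI[of _ "\<lambda>e. c' e + d e"]) auto
  next
    case (smult s f)
    then obtain c' where cd: "c' \<in> carrier PF.P" "\<forall>e. c' e \<in> S" "ev f = bas c'" by blast
    have f: "f \<in> carrier F.F" using smult c by blast
    show ?case
      using cd bas(3)[OF UNIV_I cd(1), of s] f PF.X.smult_closed_M[OF UNIV_I cd(1), of s] coeff_ringD(4)[OF S(1)] smult(1)
      by (intro bexI[of _ "\<lambda>e. s * c' e"]) auto
  qed
qed

lemma word_span': "set w \<subseteq> {..<n} \<Longrightarrow> \<exists>c\<in>carrier PF.P. (\<forall>e. c e \<in> loc) \<and> word_eval A x w = bas c"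
  using word_span[of w "length w"] by (auto simp: words_def)

lemma bas_surj: "a \<in> carrier A \<Longrightarrow> \<exists>c\<in>carrier PF.P. a = bas c"
proof -
  assume "a \<in> carrier A"
  then obtain f where "f \<in> carrier F.F" "a = ev f" using ev_surj by blast
  moreover have "\<exists>c\<in>carrier PF.P. (\<forall>e. c e \<in> UNIV) \<and> word_eval A x w = bas c" if "set w \<subseteq> {..<n}" for w
    using word_span'[OF that] by blast
  ultimately show ?thesis using span_closed[OF coeff_ring_UNIV _ _ UNIV_I, of f] by blast
qed

lemma phi_closed: "a \<in> carrier A \<Longrightarrow> \<phi> a \<in> carrier PF.P" and bas_phi: "a \<in> carrier A \<Longrightarrow> bas (\<phi> a) = a"
  using bas_surj phi_bas by metis+

lemma phi_add: "a \<in> carrier A \<Longrightarrow> a' \<in> carrier A \<Longrightarrow> \<phi> (a \<oplus> a') e = \<phi> a e + \<phi> a' e"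
proof -
  assume h: "a \<in> carrier A" "a' \<in> carrier A"
  note c = phi_closed[OF h(1)] phi_closed[OF h(2)]
  have "a \<oplus> a' = bas (\<phi> a \<oplus>\<^bsub>PF.P\<^esub> \<phi> a')" using bas(2)[OF c] bas_phi h by simp
  then show ?thesis using phi_bas[OF PF.X.M.a_closed[OF c]] by simp
qed

lemma phi_sm: "a \<in> carrier A \<Longrightarrow> \<phi> (s \<odot> a) e = s * \<phi> a e"
proof -
  assume h: "a \<in> carrier A"
  note c = phi_closed[OF h]
  have "s \<odot> a = bas (s \<odot>\<^bsub>PF.P\<^esub> \<phi> a)" using bas(3)[OF UNIV_I c] bas_phi h by simp
  then show ?thesis using phi_bas[OF PF.X.M.sm_closed[OF UNIV_I c]] by simp
qed

lemma phi_finsum: "finite K \<Longrightarrow> (\<And>i. i \<in> K \<Longrightarrow> f i \<in> carrier A) \<Longrightarrow> \<phi> (\<Oplus>i\<in>K. f i) e = (\<Sum>i\<in>K. \<phi> (f i) e)"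
proof (induct K rule: finite_induct)
  case empty
  then show ?case using phi_sm[of "\<zero>" 0 e] by simp
next
  case (insert i K)
  then have "f \<in> K \<rightarrow> carrier A" "f i \<in> carrier A" by auto
  then show ?case using insert by (simp add: phi_add)
qed

lemma phi_expand: "a \<in> carrier A \<Longrightarrow>
  \<exists>K. finite K \<and> K \<subseteq> exps n \<and> (\<forall>e. e \<notin> K \<longrightarrow> \<phi> a e = 0) \<and> a = (\<Oplus>e\<in>K. \<phi> a e \<odot> b e)"
  using phi_closed[of a] bas_sum[of "\<phi> a"] bas_phi[of a] by (intro exI[of _ "supp (\<phi> a)"]) (auto simp: carrier_PF supp_def)

lemma phi_loc: "a \<in> LA \<Longrightarrow> \<phi> a e \<in> loc" and phi_ev1: "a \<in> LA \<Longrightarrow> rA a e = ev1 (\<phi> a e)"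
proof -
  assume "a \<in> LA"
  then obtain f where f: "f \<in> carrier F.F" "\<And>w. f w \<in> loc" "a = ev f" by (auto simp: A_pres.lattice_def A_pres.LF_def)
  obtain c where c: "c \<in> carrier PF.P" "\<And>e. c e \<in> loc" "a = bas c"
    using span_closed[OF coeff_ring_loc word_span' f(1,2)] f(3) by blast
  then show "\<phi> a e \<in> loc" "rA a e = ev1 (\<phi> a e)" using phi_bas[OF c(1)] rA_bas[OF c(1,2)] by simp_all
qed

text \<open>The coordinates \<open>\<gamma> w e\<close> of the word \<open>w\<close> encode the relations of \<open>A\<close>.\<close>

definition \<gamma> where "\<gamma> w = \<phi> (word_eval A x w)"

lemma gamma_loc [simp]: "set w \<subseteq> {..<n} \<Longrightarrow> \<gamma> w e \<in> loc"
  by (simp add: \<gamma>_def phi_loc word_LA)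

lemma gamma_ev1: "set w \<subseteq> {..<n} \<Longrightarrow> ev1 (\<gamma> w e) = (if e = cnt w then 1 else 0)"
  using phi_ev1[OF word_LA, of w e] by (simp add: \<gamma>_def rA_word basis_elt_def)

lemma gamma_supp: "w \<in> words n p \<Longrightarrow> e \<notin> \<E> p \<Longrightarrow> \<gamma> w e = 0"
  using word_span[of w p] phi_bas by (auto simp: \<gamma>_def supp_def)

lemma word_expand: "w \<in> words n p \<Longrightarrow> word_eval A x w = (\<Oplus>e\<in>\<E> p. \<gamma> w e \<odot> word_eval A x (cw e))"
proof -
  assume w: "w \<in> words n p"
  have wc: "word_eval A x w \<in> carrier A" using w by (auto simp: words_def)
  have "supp (\<gamma> w) \<subseteq> \<E> p" using gamma_supp[OF w] by (auto simp: supp_def)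
  moreover have g: "word_eval A x w = bas (\<gamma> w)" "\<gamma> w \<in> carrier PF.P" using bas_phi[OF wc] phi_closed[OF wc] by (simp_all add: \<gamma>_def)
  moreover have "finite (\<E> p)" "\<E> p \<subseteq> exps n" using E_exps by auto
  ultimately have "bas (\<gamma> w) = (\<Oplus>e\<in>\<E> p. \<gamma> w e \<odot> b e)"
    by (intro PF.X.lin_ext_superset[OF A.coeff_algebra_axioms]) simp_all
  then show ?thesis using g(1) by (simp add: b_def)
qed

text \<open>Rewriting the factor w inside a longer product by chosen words does not change the
  element of A. In degree three the first two and the last two letters can both be rewritten in this
  way, with the same result; this associativity is the source of \<open>lift3\<close>.\<close>

lemma gamma_mult:
  assumes w: "w \<in> words n p" and u: "set u \<subseteq> {..<n}" and v: "set v \<subseteq> {..<n}"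
  shows "\<gamma> (u @ w @ v) d = (\<Sum>e\<in>\<E> p. \<gamma> w e * \<gamma> (u @ cw e @ v) d)"
proof -
  have ws: "set w \<subseteq> {..<n}" using w by (simp add: words_def)
  have cs: "set (cw e) \<subseteq> {..<n}" if "e \<in> \<E> p" for e using cw_words[OF that] by (simp add: words_def)
  have ap: "word_eval A x (u @ v) = word_eval A x u \<otimes> word_eval A x v" if "set u \<subseteq> {..<n}" "set v \<subseteq> {..<n}" for u v
    by (rule F.word_eval_append[OF A.coeff_algebra_axioms x_closed that])
  have split: "word_eval A x (u @ t @ v) = word_eval A x u \<otimes> word_eval A x t \<otimes> word_eval A x v" if "set t \<subseteq> {..<n}" for t
    using ap[of u "t @ v"] ap[of t v] u v that by (simp add: A.m_assoc)
  have "word_eval A x (u @ w @ v) = word_eval A x u \<otimes> (\<Oplus>e\<in>\<E> p. \<gamma> w e \<odot> word_eval A x (cw e)) \<otimes> word_eval A x v"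
    unfolding split[OF ws] using word_expand[OF w] by simp
  also have "\<dots> = (\<Oplus>e\<in>\<E> p. word_eval A x u \<otimes> (\<gamma> w e \<odot> word_eval A x (cw e)) \<otimes> word_eval A x v)"
  proof -
    let ?f = "\<lambda>e. \<gamma> w e \<odot> word_eval A x (cw e)"
    have f: "?f \<in> \<E> p \<rightarrow> carrier A" and g: "(\<lambda>e. word_eval A x u \<otimes> ?f e) \<in> \<E> p \<rightarrow> carrier A" using cs u by auto
    have "word_eval A x u \<otimes> (\<Oplus>e\<in>\<E> p. ?f e) = (\<Oplus>e\<in>\<E> p. word_eval A x u \<otimes> ?f e)"
      by (rule A.finsum_rdistr[OF _ _ f]) (use u in simp_all)
    then show ?thesis using A.finsum_ldistr[OF _ word_closed[OF v] g] by simp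
  qed
  also have "\<dots> = (\<Oplus>e\<in>\<E> p. \<gamma> w e \<odot> word_eval A x (u @ cw e @ v))"
    by (rule A.finsum_cong') (use u v cs in \<open>auto simp: split A.sm_ml A.sm_mr\<close>)
  finally have "\<gamma> (u @ w @ v) d = (\<Sum>e\<in>\<E> p. \<phi> (\<gamma> w e \<odot> word_eval A x (u @ cw e @ v)) d)"
    unfolding \<gamma>_def[of "u @ w @ v"] using cs u v by (subst phi_finsum[symmetric]) auto
  also have "\<dots> = (\<Sum>e\<in>\<E> p. \<gamma> w e * \<gamma> (u @ cw e @ v) d)"
    by (rule sum.cong) (use cs u v in \<open>auto simp: phi_sm \<gamma>_def\<close>)
  finally show ?thesis .
qed

end

section \<open>The quadratic dual and its reduction\<close>

lemma words_2: "w \<in> words n 2 \<Longrightarrow> \<exists>i j. w = [i, j] \<and> i < n \<and> j < n"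
  by (auto simp: words_def numeral_2_eq_2 length_Suc_conv)

lemma words_3: "w \<in> words n 3 \<Longrightarrow> \<exists>i j k. w = [i, j, k] \<and> i < n \<and> j < n \<and> k < n"
  by (auto simp: words_def numeral_3_eq_3 length_Suc_conv)

lemma words_lists [simp]: "[i, j] \<in> words n 2 \<longleftrightarrow> i < n \<and> j < n" "[i, j, k] \<in> words n 3 \<longleftrightarrow> i < n \<and> j < n \<and> k < n"
  by (auto simp: words_def)

lemma sum_words_2: "(\<Sum>i<n. \<Sum>j<n. h [i, j]) = (\<Sum>w\<in>words n 2. (h w :: 'c::comm_monoid_add))"
proof -
  have "(\<Sum>w\<in>words n 2. h w) = (\<Sum>(i, j)\<in>{..<n} \<times> {..<n}. h [i, j])"
    by (rule sum.reindex_bij_witness[of _ "\<lambda>(i, j). [i, j]" "\<lambda>w. (w ! 0, w ! 1)"]) (auto dest!: words_2)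
  then show ?thesis by (simp add: sum.cartesian_product)
qed

lemma cnt_mset: "cnt u = cnt w \<longleftrightarrow> mset u = mset w"
  by (auto simp: cnt_def fun_eq_iff multiset_eq_iff count_mset)

lemma cnt_2: "cnt [a, c] = cnt [i, j] \<Longrightarrow> (a = i \<and> c = j) \<or> (a = j \<and> c = i)"
proof -
  assume "cnt [a, c] = cnt [i, j]"
  then have m: "mset [a, c] = mset [i, j]" by (simp only: cnt_mset)
  then have "a \<in> set [i, j]" by (metis list.set_intros(1) set_mset_mset)
  moreover have "mset [c] = mset [i, j] - {#a#}" using m by (metis add_mset_remove_trivial mset.simps(2))
  ultimately show ?thesis by auto
qed

lemma cnt_3: "cnt [a, c, d] = cnt [i, j, k] \<Longrightarrow>
  (a = i \<and> cnt [c, d] = cnt [j, k]) \<or> (a = j \<and> cnt [c, d] = cnt [i, k]) \<or> (a = k \<and> cnt [c, d] = cnt [i, j])"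
proof -
  assume h: "cnt [a, c, d] = cnt [i, j, k]"
  then have m: "mset [a, c, d] = mset [i, j, k]" by (simp only: cnt_mset)
  then have "a \<in> set [i, j, k]" by (metis list.set_intros(1) set_mset_mset)
  moreover have "mset [c, d] = mset [i, j, k] - {#a#}" using m by (metis add_mset_remove_trivial mset.simps(2))
  ultimately show ?thesis unfolding cnt_mset by (auto simp: add_mset_commute)
qed

lemma cnt_swap: "cnt [i, j] = cnt [j, i]"
  unfolding cnt_mset by (simp add: add_mset_commute)

lemma in_quad_mono: "in_quad n G p a \<Longrightarrow> (\<And>g. G g \<Longrightarrow> H g) \<Longrightarrow> in_quad n H p a"
proof (induction n G p a rule: in_quad.induct)
  case (3 n G p a)
  then obtain \<nu> where "\<forall>v\<in>words n p. G (\<lambda>i j. \<nu> (i # j # v))"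
      "\<forall>i<n. in_quad n G (Suc p) (\<lambda>w. a (i # w) - \<nu> (i # w))" by auto
  then show ?case using 3 unfolding in_quad.simps(3) by (intro exI[of _ \<nu>]) blast
qed simp_all

context quantum
begin

text \<open>The quadratic forms that annihilate the relations of \<open>A\<close>: they are determined by their values
  on the chosen words, which can be prescribed.  So they deform the symmetric forms.\<close>

definition GF where
  "GF g \<longleftrightarrow> (\<forall>f\<in>quad_relations A n x. (\<Sum>i<n. \<Sum>j<n. g i j * f [i, j]) = 0)"

definition GL where "GL g \<longleftrightarrow> GF g \<and> (\<forall>i<n. \<forall>j<n. g i j \<in> loc)"

lemma GF_space: "quad_space n UNIV GF"
  unfolding quad_space_def
proof (intro conjI allI impI)
  fix g h assume g: "GF g"
  show "GF h" if "\<forall>i<n. \<forall>j<n. g i j = h i j" using g that by (simp add: GF_def)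
  show "GF (\<lambda>i j. g i j + h i j)" if "GF h" using g that by (simp add: GF_def distrib_right sum.distrib)
  show "GF (\<lambda>i j. c * g i j)" for c using g by (simp add: GF_def mult.assoc sum_distrib_left[symmetric])
qed (simp add: GF_def)

lemma annihilator_GF: "annihilator n (quad_relations A n x) = F.forms GF"
  by (simp add: annihilator_def F.forms_def GF_def)

lemma ext2_pair [simp]: "i < n \<Longrightarrow> j < n \<Longrightarrow> ext2 g [i, j] = g i j"
  by (simp add: ext2_def)

lemma ev_lincomb:
  assumes "finite K" "\<And>e. e \<in> K \<Longrightarrow> set (u e) \<subseteq> {..<n}"
  shows "(\<lambda>w. \<Sum>e\<in>K. c e * basis_elt (u e) w) \<in> carrier F.F \<and>
    ev (\<lambda>w. \<Sum>e\<in>K. c e * basis_elt (u e) w) = (\<Oplus>e\<in>K. c e \<odot> word_eval A x (u e))"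
  using assms
proof (induct K rule: finite_induct)
  case empty
  have z: "(\<lambda>w. 0) \<in> carrier F.F" using F.W.M.zero_closed by simp
  have "ev (\<lambda>w. 0) = \<zero>" using ev_sm[OF z, of 0] z by simp
  then show ?case using z by simp
next
  case (insert e K)
  let ?r = "\<lambda>w. \<Sum>e\<in>K. c e * basis_elt (u e) w"
  have r: "?r \<in> carrier F.F" "ev ?r = (\<Oplus>e\<in>K. c e \<odot> word_eval A x (u e))" using insert by auto
  have b: "basis_elt (u e) \<in> carrier F.F" using insert by simp
  then have cb: "(\<lambda>w. c e * basis_elt (u e) w) \<in> carrier F.F" using F.W.smult_closed_M[of "c e"] by simp
  have eq: "(\<lambda>w. \<Sum>e\<in>insert e K. c e * basis_elt (u e) w) = (\<lambda>w. c e * basis_elt (u e) w + ?r w)" using insert by simp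
  have "ev (\<lambda>w. c e * basis_elt (u e) w + ?r w) = c e \<odot> word_eval A x (u e) \<oplus> ev ?r"
    using ev_add[OF cb r(1)] ev_sm[OF b, of "c e"] ev_bs[of "u e"] insert by simp
  also have "\<dots> = (\<Oplus>e\<in>insert e K. c e \<odot> word_eval A x (u e))"
    unfolding r(2) using insert by (intro A.finsum_insert[symmetric]) auto
  finally show ?case using eq F.W.add_closed_M[OF cb r(1)] by simp
qed

text \<open>g is a linear form on V \<otimes> V that kills the relations. It is applied to the
  relation that expresses the word [i, j] by the chosen words.\<close>

lemma GF_expand:
  assumes g: "GF g" and ij: "i < n" "j < n"
  shows "g i j = (\<Sum>e\<in>\<E> 2. \<gamma> [i, j] e * ext2 g (cw e))"
proof -
  let ?s = "\<lambda>w. \<Sum>e\<in>\<E> 2. \<gamma> [i, j] e * basis_elt (cw e) w" and ?b = "basis_elt [i, j] :: nat list \<Rightarrow> 'k poly fract"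
  define f where "f = (\<lambda>w. ?b w - ?s w)"
  have fin: "finite (\<E> 2)" by simp
  have cs: "cw e \<in> words n 2" "set (cw e) \<subseteq> {..<n}" if "e \<in> \<E> 2" for e using cw_words[OF that] by (simp_all add: words_def)
  have "?s \<in> carrier F.F \<and> ev ?s = (\<Oplus>e\<in>\<E> 2. \<gamma> [i, j] e \<odot> word_eval A x (cw e))"
    by (rule ev_lincomb[OF fin]) (rule cs(2))
  then have s: "?s \<in> carrier F.F" "ev ?s = (\<Oplus>e\<in>\<E> 2. \<gamma> [i, j] e \<odot> word_eval A x (cw e))"
    by (rule conjunct1, rule conjunct2)
  have w: "[i, j] \<in> words n 2" using ij by simp
  have b: "?b \<in> carrier F.F" "ev ?b = word_eval A x [i, j]" using ij ev_bs[of "[i, j]"] by simp_all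
  have "ev f = \<zero>"
    unfolding f_def ev_diff[OF b(1) s(1)] b(2) s(2) word_expand[OF w, symmetric] using ij by (simp add: a_minus_def A.r_neg)
  moreover have "f \<in> free_part {..<n} 2"
    unfolding F.free_part_words
  proof (intro allI impI)
    fix v assume v: "v \<notin> words n 2"
    then have "?s v = 0" using cs by (intro sum.neutral) (auto simp: basis_elt_def)
    then show "f v = 0" unfolding f_def using v w by (auto simp: basis_elt_def)
  qed
  ultimately have "(\<Sum>a<n. \<Sum>c<n. g a c * f [a, c]) = 0" using g by (simp add: GF_def quad_relations_def)
  then have "(\<Sum>a<n. \<Sum>c<n. ext2 g [a, c] * f [a, c]) = 0" by simp
  then have "(\<Sum>w\<in>words n 2. ext2 g w * f w) = 0" using sum_words_2[of "\<lambda>w. ext2 g w * f w" n] by simp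
  then have "(\<Sum>w\<in>words n 2. ext2 g w * ?b w) = (\<Sum>w\<in>words n 2. ext2 g w * ?s w)"
    unfolding f_def by (simp only: right_diff_distrib sum_subtractf right_minus_eq)
  moreover have bb: "(\<Sum>w\<in>words n 2. ext2 g w * basis_elt u w) = ext2 g u" if "u \<in> words n 2" for u
  proof -
    have "(\<Sum>w\<in>words n 2. ext2 g w * basis_elt u w) = (\<Sum>w\<in>words n 2. if w = u then ext2 g w else 0)"
      by (rule sum.cong) (simp_all add: basis_elt_def)
    then show ?thesis using that by simp
  qed
  moreover have "(\<Sum>w\<in>words n 2. ext2 g w * ?s w) = (\<Sum>e\<in>\<E> 2. \<gamma> [i, j] e * (\<Sum>w\<in>words n 2. ext2 g w * basis_elt (cw e) w))"
    unfolding sum_distrib_left by (subst sum.swap) (simp add: mult.left_commute)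
  ultimately show ?thesis using w ij cs by simp
qed

text \<open>Conversely, values \<open>r\<close> on the chosen words may be prescribed freely:
  composed with the coordinates in A they give a linear form that kills the relations.\<close>

lemma GF_I:
  assumes h: "\<And>i j. i < n \<Longrightarrow> j < n \<Longrightarrow> g i j = (\<Sum>e\<in>\<E> 2. \<gamma> [i, j] e * r e)"
  shows "GF g"
  unfolding GF_def
proof
  fix f assume "f \<in> quad_relations A n x"
  then have f: "f \<in> free_part {..<n} 2" "ev f = \<zero>" by (auto simp: quad_relations_def)
  have fc: "f \<in> carrier F.F" using f(1) by (simp add: F.free_part_iff)
  have s: "supp f \<subseteq> words n 2" using f(1) by (auto simp: F.free_part_words supp_def)
  have "ev f = (\<Oplus>w\<in>words n 2. f w \<odot> word_eval A x w)"
    by (rule F.free_eval_sum[OF A.coeff_algebra_axioms x_closed fc words_finite s]) (auto simp: words_def)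
  then have e0: "(\<Oplus>w\<in>words n 2. f w \<odot> word_eval A x w) = \<zero>" using f(2) by simp
  have z: "(\<Sum>w\<in>words n 2. f w * \<gamma> w e) = 0" for e
  proof -
    have c: "word_eval A x w \<in> carrier A" if "w \<in> words n 2" for w using that by (simp add: words_def)
    have "(\<Sum>w\<in>words n 2. f w * \<gamma> w e) = (\<Sum>w\<in>words n 2. \<phi> (f w \<odot> word_eval A x w) e)"
      by (rule sum.cong) (simp_all add: phi_sm[OF c] \<gamma>_def)
    also have "\<dots> = \<phi> (\<Oplus>w\<in>words n 2. f w \<odot> word_eval A x w) e"
      by (rule phi_finsum[symmetric]) (use c in auto)
    also have "\<dots> = \<phi> \<zero> e" using e0 by simp
    also have "\<dots> = 0" using phi_sm[of "\<zero>" 0 e] by simp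
    finally show ?thesis .
  qed
  have "(\<Sum>i<n. \<Sum>j<n. g i j * f [i, j]) = (\<Sum>i<n. \<Sum>j<n. (\<Sum>e\<in>\<E> 2. \<gamma> [i, j] e * r e) * f [i, j])"
    by (intro sum.cong refl) (simp add: h)
  also have "\<dots> = (\<Sum>w\<in>words n 2. (\<Sum>e\<in>\<E> 2. \<gamma> w e * r e) * f w)" by (rule sum_words_2)
  also have "\<dots> = (\<Sum>e\<in>\<E> 2. r e * (\<Sum>w\<in>words n 2. f w * \<gamma> w e))"
    unfolding sum_distrib_left sum_distrib_right by (subst sum.swap) (simp add: mult.commute mult.left_commute)
  finally show "(\<Sum>i<n. \<Sum>j<n. g i j * f [i, j]) = 0" by (simp add: z)
qed

text \<open>At q = 1 the coordinates of a word are concentrated at its own content, so that a single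
  term of the sum survives.\<close>

lemma sum_gamma_ev1:
  assumes w: "w \<in> words n p" and r: "\<And>e. e \<in> \<E> p \<Longrightarrow> r e \<in> loc"
  shows "(\<Sum>e\<in>\<E> p. \<gamma> w e * r e) \<in> loc" "ev1 (\<Sum>e\<in>\<E> p. \<gamma> w e * r e) = ev1 (r (cnt w))"
proof -
  have ws: "set w \<subseteq> {..<n}" using w by (simp add: words_def)
  have l: "\<gamma> w e * r e \<in> loc" if "e \<in> \<E> p" for e using r[OF that] ws by (simp add: loc_mult)
  then show "(\<Sum>e\<in>\<E> p. \<gamma> w e * r e) \<in> loc" by (rule loc_sum)
  have "ev1 (\<Sum>e\<in>\<E> p. \<gamma> w e * r e) = (\<Sum>e\<in>\<E> p. ev1 (\<gamma> w e * r e))" by (rule ev1_sum[OF l])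
  also have "\<dots> = (\<Sum>e\<in>\<E> p. if e = cnt w then ev1 (r e) else 0)"
    by (rule sum.cong) (use r ws in \<open>simp_all add: ev1_mult gamma_ev1\<close>)
  also have "\<dots> = ev1 (r (cnt w))" using w by simp
  finally show "ev1 (\<Sum>e\<in>\<E> p. \<gamma> w e * r e) = ev1 (r (cnt w))" .
qed

lemma GL_ev1: "GL g \<Longrightarrow> i < n \<Longrightarrow> j < n \<Longrightarrow> ev1 (g i j) = ev1 (ext2 g (cw (cnt [i, j])))"
proof -
  assume g: "GL g" and ij: "i < n" "j < n"
  have "ext2 g (cw e) \<in> loc" if "e \<in> \<E> 2" for e
    using words_2[OF cw_words[OF that]] g by (auto simp: GL_def)
  then show ?thesis using sum_gamma_ev1[of "[i, j]" 2 "\<lambda>e. ext2 g (cw e)"] GF_expand[of g i j] g ij by (simp add: GL_def)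
qed

lemma cnt_cw: "w \<in> words n p \<Longrightarrow> cnt (cw (cnt w)) = cnt w"
  using cw[of "cnt w"] E_exps[of "cnt w" p] by blast

lemma cw_2: "i < n \<Longrightarrow> j < n \<Longrightarrow> cw (cnt [i, j]) = [i, j] \<or> cw (cnt [i, j]) = [j, i]"
  using cnt_cw[of "[i, j]" 2] words_2[OF cw_words, of "cnt [i, j]"] by (auto dest!: cnt_2)

sublocale FF: flat_forms n GL
proof
  have s: "GF g \<Longrightarrow> GF (\<lambda>i j. c * g i j)" for g c using quad_spaceD(4)[OF GF_space] by blast
  show "quad_space n loc GL"
    unfolding quad_space_def
  proof (intro conjI allI impI)
    show "GL h" if "GL g" "\<forall>i<n. \<forall>j<n. g i j = h i j" for g h
      using that quad_spaceD(1)[OF GF_space, of g h] by (simp add: GL_def)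
    show "GL (\<lambda>i j. 0)" using quad_spaceD(2)[OF GF_space] by (simp add: GL_def)
    show "GL (\<lambda>i j. g i j + h i j)" if "GL g" "GL h" for g h
      using that quad_spaceD(3)[OF GF_space, of g h] by (simp add: GL_def loc_add)
    show "GL (\<lambda>i j. c * g i j)" if "c \<in> loc" "GL g" for c g
      using that s[of g c] by (simp add: GL_def loc_mult)
  qed
  show "g i j \<in> loc" if "GL g" "i < n" "j < n" for g i j using that by (simp add: GL_def)
  show "GL g" if "GL (\<lambda>i j. unif * g i j)" "\<And>i j. i < n \<Longrightarrow> j < n \<Longrightarrow> g i j \<in> loc" for g
    using that s[of "\<lambda>i j. unif * g i j" "1 / unif"] by (simp add: GL_def)
  show "sym_form n (\<lambda>i j. ev1 (g i j))" if "GL g" for g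
    unfolding sym_form_def using GL_ev1[OF that] by (simp add: cnt_swap)
next
  fix s assume s: "sym_form n (s :: nat \<Rightarrow> nat \<Rightarrow> 'k)"
  \<comment> \<open>The entries of s at the chosen words are prescribed as constants. The chosen
    word may be [j, i] instead of [i, j], which the symmetry of s makes irrelevant at q = 1.\<close>
  let ?r = "\<lambda>e. const (s (cw e ! 0) (cw e ! 1))"
  let ?g = "\<lambda>i j. \<Sum>e\<in>\<E> 2. \<gamma> [i, j] e * ?r e"
  have "GF ?g" by (rule GF_I) simp
  moreover have "?g i j \<in> loc" "ev1 (?g i j) = s i j" if "i < n" "j < n" for i j
    using sum_gamma_ev1[of "[i, j]" 2 ?r] cw_2[OF that] s that by (auto simp: sym_form_def)
  ultimately show "\<exists>g. GL g \<and> (\<forall>i<n. \<forall>j<n. ev1 (g i j) = s i j)"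
    by (intro exI[of _ ?g]) (simp add: GL_def)
next
  fix t assume t: "\<And>i. i < n \<Longrightarrow> sym_form n (\<lambda>j k. t i j k) \<and> sym_form n (\<lambda>j k. t j k i :: 'k)"
  \<comment> \<open>The same recipe in degree three: the values of t at the chosen words of length
    three are composed with the coordinates in A.\<close>
  let ?r = "\<lambda>e. const (t (cw e ! 0) (cw e ! 1) (cw e ! 2))"
  let ?h = "\<lambda>w. \<Sum>e\<in>\<E> 3. \<gamma> w e * ?r e"
  \<comment> \<open>With an empty u or an empty v this puts \<open>?h\<close>, as a function of two
    adjacent letters, into the shape required by \<open>GF_I\<close>. Hence the same tensor
    annihilates the relations in the first two letters and in the last two letters.\<close>
  have split: "?h (u @ w @ v) = (\<Sum>d\<in>\<E> 2. \<gamma> w d * ?h (u @ cw d @ v))"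
    if "set u \<subseteq> {..<n}" "set v \<subseteq> {..<n}" "w \<in> words n 2" for u v w
  proof -
    have "?h (u @ w @ v) = (\<Sum>e\<in>\<E> 3. (\<Sum>d\<in>\<E> 2. \<gamma> w d * \<gamma> (u @ cw d @ v) e) * ?r e)"
      by (intro sum.cong refl) (simp only: gamma_mult[OF that(3,1,2)])
    also have "\<dots> = (\<Sum>d\<in>\<E> 2. \<gamma> w d * ?h (u @ cw d @ v))"
      unfolding sum_distrib_left sum_distrib_right by (subst sum.swap) (simp add: mult.assoc)
    finally show ?thesis .
  qed
  have GF1: "GF (\<lambda>j k. ?h [i, j, k])" if i: "i < n" for i
  proof (rule GF_I[where r = "\<lambda>d. ?h ([i] @ cw d)"])
    show "?h [i, j, k] = (\<Sum>d\<in>\<E> 2. \<gamma> [j, k] d * ?h ([i] @ cw d))" if "j < n" "k < n" for j k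
      using split[of "[i]" "[]" "[j, k]"] i that by simp
  qed
  have GF2: "GF (\<lambda>j k. ?h [j, k, i])" if i: "i < n" for i
  proof (rule GF_I[where r = "\<lambda>d. ?h (cw d @ [i])"])
    show "?h [j, k, i] = (\<Sum>d\<in>\<E> 2. \<gamma> [j, k] d * ?h (cw d @ [i]))" if "j < n" "k < n" for j k
      using split[of "[]" "[i]" "[j, k]"] i that by simp
  qed
  have ev: "?h [i, j, k] \<in> loc" "ev1 (?h [i, j, k]) = t i j k" if ijk: "i < n" "j < n" "k < n" for i j k
  proof -
    have m: "[i, j, k] \<in> words n 3" using ijk by simp
    obtain a c d where acd: "cw (cnt [i, j, k]) = [a, c, d]" "a < n" "c < n" "d < n"
      using words_3[OF cw_words[of "cnt [i, j, k]" 3]] m by blast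
    have "cnt [a, c, d] = cnt [i, j, k]" using cnt_cw[OF m] acd by simp
    \<comment> \<open>The chosen word is a permutation of [i, j, k], and both symmetries together
      make t invariant under all permutations.\<close>
    from cnt_3[OF this] have "t a c d = t i j k"
      using t ijk unfolding sym_form_def by (auto dest!: cnt_2)
    then have "ev1 (?r (cnt [i, j, k])) = t i j k" using acd(1) by simp
    then show "?h [i, j, k] \<in> loc" "ev1 (?h [i, j, k]) = t i j k" using sum_gamma_ev1[OF m, of ?r] by simp_all
  qed
  show "\<exists>h. (\<forall>i<n. GL (\<lambda>j k. h i j k) \<and> GL (\<lambda>j k. h j k i)) \<and> (\<forall>i<n. \<forall>j<n. \<forall>k<n. ev1 (h i j k) = t i j k)"
    by (intro exI[of _ "\<lambda>i j k. ?h [i, j, k]"]) (use GF1 GF2 ev in \<open>simp add: GL_def\<close>)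
qed

lemma GL_GF: "in_quad n GL p a \<Longrightarrow> in_quad n GF p a"
  by (erule in_quad_mono) (simp add: GL_def)

text \<open>A membership in the ideal over k(q) involves the coefficients of \<nu> on finitely many
  words only, so that one power of \<open>unif\<close> clears all denominators of the
  decomposition.\<close>

lemma GF_denominators: "in_quad n GF p a \<Longrightarrow> \<exists>N. in_quad n GL p (\<lambda>w. unif ^ N * a w)"
proof (induction p arbitrary: a rule: nat_less_induct)
  case (1 p a)
  consider "p = 0" | "p = Suc 0" | q where "p = Suc (Suc q)" by (metis not0_implies_Suc)
  then show ?case
  proof cases
    case 3
    then obtain \<nu> where nu: "\<forall>v\<in>words n q. GF (\<lambda>i j. \<nu> (i # j # v))"
      "\<And>i. i < n \<Longrightarrow> in_quad n GF (Suc q) (\<lambda>w. a (i # w) - \<nu> (i # w))" using 1(2) by auto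
    have sm: "in_quad n GL r (\<lambda>w. unif ^ M * b w)" if "in_quad n GL r (\<lambda>w. unif ^ N * b w)" "N \<le> M" for r b N M
    proof -
      have "unif ^ (M - N) \<in> loc" by (simp add: loc_power)
      from in_quad_smult[OF FF.space this that(1)] show ?thesis using that(2)
        by (simp add: mult.assoc[symmetric] power_add[symmetric])
    qed
    have "\<forall>i. \<exists>N. i < n \<longrightarrow> in_quad n GL (Suc q) (\<lambda>w. unif ^ N * (a (i # w) - \<nu> (i # w)))"
      using 1(1)[rule_format, of "Suc q"] 3 nu(2) by auto
    then obtain N where N: "\<And>i. i < n \<Longrightarrow> in_quad n GL (Suc q) (\<lambda>w. unif ^ N i * (a (i # w) - \<nu> (i # w)))" by metis
    obtain m where m: "\<forall>w\<in>words n p. unif ^ m * \<nu> w \<in> loc" using unif_power_loc_finite[of "words n p" \<nu>] by auto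
    \<comment> \<open>One exponent for all parts: m clears the coefficients of \<nu>, and the sum
      dominates every \<open>N i\<close>.\<close>
    let ?M = "m + (\<Sum>i<n. N i)"
    have "GL (\<lambda>i j. unif ^ ?M * \<nu> (i # j # v))" if v: "v \<in> words n q" for v
    proof -
      have "unif ^ ?M * \<nu> (i # j # v) \<in> loc" if "i < n" "j < n" for i j
        using loc_mult[OF loc_power[of unif "\<Sum>i<n. N i"], of "unif ^ m * \<nu> (i # j # v)"] m 3 v that
        by (simp add: power_add mult.assoc mult.left_commute)
      then show ?thesis using quad_spaceD(4)[OF GF_space UNIV_I, of _ "unif ^ ?M"] nu(1) v by (simp add: GL_def)
    qed
    moreover have "in_quad n GL (Suc q) (\<lambda>w. unif ^ ?M * a (i # w) - unif ^ ?M * \<nu> (i # w))" if i: "i < n" for i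
    proof -
      have "N i \<le> ?M" using member_le_sum[of i "{..<n}" N] i by simp
      from sm[OF N[OF i] this] show ?thesis by (simp add: right_diff_distrib)
    qed
    ultimately have "in_quad n GL p (\<lambda>w. unif ^ ?M * a w)"
      unfolding 3 in_quad.simps(3) by (intro exI[of _ "\<lambda>w. unif ^ ?M * \<nu> w"]) blast
    then show ?thesis by blast
  qed (use 1(2) in auto)
qed

text \<open>An integral element of the ideal over k(q) lies in the integral ideal: some power of
  \<open>unif\<close> brings it there, and saturation removes the factors one after the
  other.\<close>

lemma GF_lattice:
  assumes "in_quad n GF p a" "\<And>w. w \<in> words n p \<Longrightarrow> a w \<in> loc"
  shows "in_quad n GL p a"
proof -
  obtain N where N: "in_quad n GL p (\<lambda>w. unif ^ N * a w)" using GF_denominators[OF assms(1)] by blast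
  then show ?thesis
  proof (induct N)
    case (Suc N)
    then have "in_quad n GL p (\<lambda>w. unif * (unif ^ N * a w))" by (simp add: mult.assoc)
    then have "in_quad n GL p (\<lambda>w. unif ^ N * a w)"
      by (rule FF.in_quad_saturated) (use assms(2) in \<open>simp add: loc_mult loc_power\<close>)
    then show ?case by (rule Suc(1))
  qed simp
qed

section \<open>The ideals of the quadratic dual and of the exterior algebra, and the reduction
  between them\<close>

abbreviation "D \<equiv> quad_dual A n x"
abbreviation "E \<equiv> (exterior_algebra n :: ('k, (nat list \<Rightarrow> 'k) set) graded)"

lemma dual_ideal: "quad_dual_ideal A n x = F.quad_ideal GF"
  unfolding quad_dual_ideal_def annihilator_GF by (rule F.quad_ideal_Idl[OF GF_space])

text \<open>Squares of vectors are symmetric tensors, and by polarisation the symmetric tensors are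
  spanned by such squares, since 2 is invertible.\<close>

lemma exterior_ideal: "(exterior_ideal n :: (nat list \<Rightarrow> 'k) set) = F0.quad_ideal (sym_form n)" (is "_ = ?I")
proof -
  let ?S = "{v \<otimes>\<^bsub>F0.F\<^esub> v | v. v \<in> free_part {..<n} 1}"
  have S: "?S \<subseteq> carrier F0.F" by (auto simp: F0.free_part_iff simp del: F0.W.M_sel)
  have vv: "(v \<otimes>\<^bsub>F0.F\<^esub> v) w = (if length w = 2 then v [w ! 0] * v [w ! 1] else 0)" if v: "v \<in> free_part {..<n} 1" for v :: "nat list \<Rightarrow> 'k" and w
  proof -
    have vc: "finite (supp v)" using v by (simp add: F0.free_part_iff F0.carrier_F)
    have l: "u \<in> supp v \<Longrightarrow> \<exists>i. u = [i]" for u using v by (auto simp: free_part_def length_Suc_conv)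
    have "(v \<otimes>\<^bsub>F0.F\<^esub> v) w = (\<Sum>u\<in>supp v. \<Sum>u'\<in>supp v. if u @ u' = w then v u * v u' else 0)"
      using F0.W.mult_M[OF vc vc order_refl order_refl, of w] by simp
    also have "\<dots> = (if length w = 2 then v [w ! 0] * v [w ! 1] else 0)"
    proof (cases "length w = 2")
      case True
      then obtain i j where w: "w = [i, j]" by (auto simp: numeral_2_eq_2 length_Suc_conv)
      have "(\<Sum>u\<in>supp v. \<Sum>u'\<in>supp v. if u @ u' = w then v u * v u' else 0)
        = (\<Sum>u\<in>supp v. \<Sum>u'\<in>supp v. if u' = [j] then (if u = [i] then v u * v u' else 0) else 0)"
        by (intro sum.cong refl) (auto simp: w dest!: l)
      also have "\<dots> = (\<Sum>u\<in>supp v. if u = [i] then v [i] * v [j] else 0)"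
        using vc by (intro sum.cong refl) (auto simp: supp_def)
      also have "\<dots> = v [i] * v [j]" using vc by (auto simp: supp_def)
      finally show ?thesis using w by simp
    next
      case False
      then show ?thesis by (auto intro!: sum.neutral dest!: l)
    qed
    finally show ?thesis .
  qed
  have "?S \<subseteq> F0.forms (sym_form n)"
    using S by (auto simp: F0.forms_def free_part_def sym_form_def vv supp_def split: if_splits simp del: F0.W.M_sel)
  then have 1: "exterior_ideal n \<subseteq> ?I"
    unfolding exterior_ideal_def
    using F0.W.M.genideal_minimal[OF F0.quad_ideal_ideal[OF sym_form_space]] F0.forms_quad_ideal[OF sym_form_space] by blast
  have I: "ideal (exterior_ideal n) F0.F" unfolding exterior_ideal_def by (rule F0.W.M.genideal_ideal[OF S])
  interpret J: algebra_ideal UNIV F0.F "exterior_ideal n"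
    using I F0.W.coeff_algebra_M by (simp add: algebra_ideal_def free_algebra_def)
  have sq: "v \<otimes>\<^bsub>F0.F\<^esub> v \<in> exterior_ideal n" if "v \<in> free_part {..<n} 1" for v :: "nat list \<Rightarrow> 'k"
    unfolding exterior_ideal_def using F0.W.M.genideal_self[OF S] that by blast
  have fp: "F0.bs [i] \<in> free_part {..<n} 1" "(\<lambda>w. F0.bs [i] w + F0.bs [j] w) \<in> free_part {..<n} 1"
    if "i < n" "j < n" for i j
    using that by (auto simp: F0.free_part_words words_def basis_elt_def simp del: One_nat_def)
  have fsum: "(\<Oplus>\<^bsub>F0.F\<^esub>i\<in>K. h i) \<in> exterior_ideal n" if "finite K" "\<And>i. i \<in> K \<Longrightarrow> h i \<in> exterior_ideal n" for K :: "nat list set" and h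
    using that
  proof (induct K rule: finite_induct)
    case (insert i K)
    then have "h \<in> K \<rightarrow> carrier F0.F" "h i \<in> carrier F0.F" using J.a_subset by blast+
    then have "(\<Oplus>\<^bsub>F0.F\<^esub>i\<in>insert i K. h i) = h i \<oplus>\<^bsub>F0.F\<^esub> (\<Oplus>\<^bsub>F0.F\<^esub>i\<in>K. h i)" using insert by (intro F0.W.M.finsum_insert) auto
    then show ?case using insert by (simp del: F0.W.M_sel)
  qed (simp del: F0.W.M_sel)
  have "F0.forms (sym_form n) \<subseteq> exterior_ideal n"
  proof
    fix f assume f: "f \<in> F0.forms (sym_form n)"
    \<comment> \<open>The symmetrised word is the square of a sum of two basis vectors minus their
      squares. Summation over all words meets each word and its reversal, hence the factor
      1/2.\<close>
    let ?h = "\<lambda>u. (f u / 2) \<odot>\<^bsub>F0.F\<^esub> (\<lambda>w. basis_elt u w + basis_elt (rev u) w)"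
    have h: "?h u \<in> exterior_ideal n" if u: "u \<in> words n 2" for u
    proof -
      obtain i j where ij: "u = [i, j]" "i < n" "j < n" using words_2[OF u] by blast
      let ?s = "basis_elt [i] \<oplus>\<^bsub>F0.F\<^esub> basis_elt [j]"
      note c = F0.bs_closed[of "[i]"] F0.bs_closed[of "[j]"]
      have "?s \<otimes>\<^bsub>F0.F\<^esub> ?s = (basis_elt [i, i] \<oplus>\<^bsub>F0.F\<^esub> basis_elt [j, i]) \<oplus>\<^bsub>F0.F\<^esub> (basis_elt [i, j] \<oplus>\<^bsub>F0.F\<^esub> basis_elt [j, j])"
        using c ij by (simp add: F0.W.M.l_distr F0.W.M.r_distr F0.bs_mult del: F0.W.M_sel)
      moreover have "?s \<otimes>\<^bsub>F0.F\<^esub> ?s \<in> exterior_ideal n" using sq[OF fp(2)[OF ij(2,3)]] by simp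
      moreover have "F0.bs [i, i] \<in> exterior_ideal n" "F0.bs [j, j] \<in> exterior_ideal n"
        using sq[OF fp(1)[OF ij(2,2)]] sq[OF fp(1)[OF ij(3,3)]] by (simp_all add: F0.bs_mult)
      ultimately have "?s \<otimes>\<^bsub>F0.F\<^esub> ?s \<oplus>\<^bsub>F0.F\<^esub> (- 1) \<odot>\<^bsub>F0.F\<^esub> (basis_elt [i, i] \<oplus>\<^bsub>F0.F\<^esub> basis_elt [j, j]) \<in> exterior_ideal n"
        by (intro J.a_closed J.I_sm UNIV_I)
      also have "?s \<otimes>\<^bsub>F0.F\<^esub> ?s \<oplus>\<^bsub>F0.F\<^esub> (- 1) \<odot>\<^bsub>F0.F\<^esub> (basis_elt [i, i] \<oplus>\<^bsub>F0.F\<^esub> basis_elt [j, j])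
        = (\<lambda>w. basis_elt u w + basis_elt (rev u) w)"
        unfolding \<open>?s \<otimes>\<^bsub>F0.F\<^esub> ?s = _\<close> using ij(1) by (simp add: fun_eq_iff)
      finally show ?thesis by (rule J.I_sm[OF UNIV_I])
    qed
    have "(\<Oplus>\<^bsub>F0.F\<^esub>u\<in>words n 2. ?h u) \<in> exterior_ideal n" by (rule fsum[OF words_finite h])
    moreover have "(\<Oplus>\<^bsub>F0.F\<^esub>u\<in>words n 2. ?h u) = f"
    proof
      fix w
      have hc: "?h \<in> words n 2 \<rightarrow> carrier F0.F" using h J.a_subset by blast
      have rw: "rev w \<in> words n 2 \<longleftrightarrow> w \<in> words n 2" by (simp add: words_def)
      have "(\<Oplus>\<^bsub>F0.F\<^esub>u\<in>words n 2. ?h u) w = (\<Sum>u\<in>words n 2. ?h u w)" by (rule F0.W.finsum_M[OF hc])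
      also have "\<dots> = (\<Sum>u\<in>words n 2. (if u = w then f u / 2 else 0) + (if u = rev w then f u / 2 else 0))"
        by (rule sum.cong) (auto simp: basis_elt_def)
      also have "\<dots> = (if w \<in> words n 2 then f w / 2 + f (rev w) / 2 else 0)" by (simp add: sum.distrib rw)
      also have "\<dots> = f w"
        using f words_2[of w n] by (auto simp: F0.forms_def F0.free_part_words sym_form_def)
      finally show "(\<Oplus>\<^bsub>F0.F\<^esub>u\<in>words n 2. ?h u) w = f w" .
    qed
    ultimately show "f \<in> exterior_ideal n" by (simp del: F0.W.M_sel)
  qed
  then have "?I \<subseteq> exterior_ideal n"
    unfolding F0.quad_ideal_Idl[OF sym_form_space, symmetric] by (rule F0.W.M.genideal_minimal[OF I])
  then show ?thesis using 1 by blast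
qed

sublocale D: graded_quot n "TYPE('k poly fract)" "quad_dual_ideal A n x"
  rewrites "graded_free_quot {..<n} (quad_dual_ideal A n x) = D"
proof -
  show "graded_quot n (quad_dual_ideal A n x)"
    unfolding dual_ideal
    by (rule graded_quot.intro[OF F.quad_ideal_ideal[OF GF_space] F.quad_ideal_trunc[OF GF_space]])
qed (simp add: quad_dual_def)

sublocale E: graded_quot n "TYPE('k)" "exterior_ideal n"
  rewrites "graded_free_quot {..<n} (exterior_ideal n) = E"
proof -
  show "graded_quot n (exterior_ideal n :: (nat list \<Rightarrow> 'k) set)"
    unfolding exterior_ideal
    by (rule graded_quot.intro[OF F0.quad_ideal_ideal[OF sym_form_space] F0.quad_ideal_trunc[OF sym_form_space]])
qed (simp add: exterior_algebra_def)

abbreviation "\<xi> i \<equiv> D.xi i"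
abbreviation "\<eta> i \<equiv> E.xi i"

lemma dual_gen_xi: "dual_gen A n x i = \<xi> i" and ext_gen_eta: "ext_gen n i = \<eta> i"
  by (simp_all add: dual_gen_def ext_gen_def)

text \<open>The lattice in the quadratic dual is generated by the \<open>(q - 1) \<xi>\<^sub>i\<close>: only for this rescaling do the
  graded commutators with the \<open>\<xi>\<^sub>i\<close>, and with them the differential, preserve the lattice and have a
  nonzero reduction.\<close>

definition scl where "scl f = (\<lambda>w. unif ^ length w * f w)"

lemma scl_closed [simp]: "f \<in> carrier F.F \<Longrightarrow> scl f \<in> carrier F.F"
  by (rule F.restrict_F[of f]) (auto simp: scl_def)

lemma scl_linear: "linear_map UNIV F.F F.F scl"
  by (rule linear_mapI, simp) (auto simp: scl_def algebra_simps)

lemma dual_eval: "f \<in> carrier F.F \<Longrightarrow> free_eval D (\<lambda>i. unif \<odot>\<^bsub>D\<^esub> \<xi> i) f = D.cls (scl f)"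
proof -
  have y: "unif \<odot>\<^bsub>D\<^esub> \<xi> i \<in> carrier D" if "i < n" for i using that by simp
  have "linear_map UNIV F.F D (free_eval D (\<lambda>i. unif \<odot>\<^bsub>D\<^esub> \<xi> i))" by (rule F.free_eval_linear[OF D.E_algebra y])
  note l = linear_mapD[OF this] and s = linear_mapD[OF scl_linear]
  have w: "word_eval D (\<lambda>i. unif \<odot>\<^bsub>D\<^esub> \<xi> i) w = unif ^ length w \<odot>\<^bsub>D\<^esub> D.cls (basis_elt w)" if "set w \<subseteq> {..<n}" for w
    using that
  proof (induct w)
    case Nil
    then show ?case by (simp add: word_eval_def D.cls_hom(4))
  next
    case (Cons i w)
    then have i: "i < n" "set w \<subseteq> {..<n}" by auto
    have c: "D.cls (basis_elt w) \<in> carrier D" using i by auto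
    have "word_eval D (\<lambda>i. unif \<odot>\<^bsub>D\<^esub> \<xi> i) (i # w) = (unif \<odot>\<^bsub>D\<^esub> \<xi> i) \<otimes>\<^bsub>D\<^esub> (unif ^ length w \<odot>\<^bsub>D\<^esub> D.cls (basis_elt w))"
      by (simp only: word_eval_Cons Cons(1)[OF i(2)])
    also have "\<dots> = (unif * unif ^ length w) \<odot>\<^bsub>D\<^esub> (\<xi> i \<otimes>\<^bsub>D\<^esub> D.cls (basis_elt w))"
      using c D.xi_closed[OF i(1)] by (simp only: D.E.sm_ml D.E.sm_mr D.E.sm_mult[symmetric] mult.commute[of "unif ^ _"] D.E.sm_closed D.E.m_closed UNIV_I)
    finally show ?case by (simp only: D.cls_bs_Cons[OF i] length_Cons power_Suc)
  qed
  assume "f \<in> carrier F.F"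
  then show ?thesis
  proof (induct f rule: F.bs_induct)
    case (basis w)
    have "scl (basis_elt w) = unif ^ length w \<odot>\<^bsub>F.F\<^esub> basis_elt w" by (auto simp: scl_def basis_elt_def)
    then show ?case using F.free_eval_bs[OF D.E_algebra y basis] w[OF basis] D.cls_hom(3)[of "basis_elt w"] F.bs_closed[OF basis] by simp
  next
    case (add f g)
    then show ?case using l(2)[OF add(1,2)] s(2)[OF add(1,2)] D.cls_hom(1)[of "scl f" "scl g"] by (simp del: F.W.M_sel)
  next
    case (smult c f)
    then show ?case using l(3)[OF UNIV_I smult(1)] s(3)[OF UNIV_I smult(1)] D.cls_hom(3)[of "scl f" c] by (simp del: F.W.M_sel)
  qed
qed

lemma ext_eval: "f \<in> carrier F0.F \<Longrightarrow> free_eval E \<eta> f = E.cls f"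
proof -
  have "linear_map UNIV F0.F E (free_eval E \<eta>)" by (rule F0.free_eval_linear[OF E.E_algebra E.xi_closed])
  note l = linear_mapD[OF this]
  have w: "word_eval E \<eta> w = E.cls (basis_elt w)" if "set w \<subseteq> {..<n}" for w
    using that
  proof (induct w)
    case Nil
    then show ?case by (simp add: word_eval_def E.cls_hom(4))
  next
    case (Cons i w)
    then have i: "i < n" "set w \<subseteq> {..<n}" by auto
    show ?case by (simp only: word_eval_Cons Cons(1)[OF i(2)] E.cls_bs_Cons[OF i])
  qed
  assume "f \<in> carrier F0.F"
  then show ?thesis
  proof (induct f rule: F0.bs_induct)
    case (basis w)
    then show ?case using F0.free_eval_bs[OF E.E_algebra E.xi_closed basis] w[OF basis] by simp
  next
    case (add f g)
    then show ?case using l(2)[OF add(1,2)] E.cls_hom(1)[of f g] by (simp del: F0.W.M_sel)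
  next
    case (smult c f)
    then show ?case using l(3)[OF UNIV_I smult(1)] E.cls_hom(3)[of f c] by (simp del: F0.W.M_sel)
  qed
qed

text \<open>Saturation enters through \<open>relations\<close>: an integral relation of the dual
  lies in the integral ideal, hence reduces to a relation of the exterior algebra. For
  \<open>flat\<close> the reduction of f is lifted to an integral element of the ideal, and the
  difference of f and the lift is divisible by \<open>unif\<close>.\<close>

sublocale D_pres: presentation n D E "\<lambda>i. unif \<odot>\<^bsub>D\<^esub> \<xi> i" \<eta>
proof
  show "unif \<odot>\<^bsub>D\<^esub> \<xi> i \<in> carrier D" "\<eta> i \<in> carrier E" if "i < n" for i using that by auto
  show "carrier D \<subseteq> free_eval D (\<lambda>i. unif \<odot>\<^bsub>D\<^esub> \<xi> i) ` carrier F.F"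
  proof
    fix a assume "a \<in> carrier D"
    then obtain f where f: "f \<in> carrier F.F" "a = D.cls f" by (auto simp: D.E_carrier)
    let ?g = "\<lambda>w. f w / unif ^ length w"
    have "?g \<in> carrier F.F" by (rule F.restrict_F[OF f(1)]) simp
    moreover have "scl ?g = f" by (auto simp: scl_def)
    ultimately show "a \<in> free_eval D (\<lambda>i. unif \<odot>\<^bsub>D\<^esub> \<xi> i) ` carrier F.F" using f(2) dual_eval[of ?g] by auto
  qed
  show "carrier E \<subseteq> free_eval E \<eta> ` carrier F0.F" using ext_eval by (auto simp: E.E_carrier)
  fix f assume f: "f \<in> carrier F.F" "\<And>w. f w \<in> loc"
  have e: "ev1 \<circ> f \<in> carrier F0.F" by (rule ev1_carrier[OF f(1)])
  have Gz: "F.quad_ideal GF \<subseteq> carrier F.F" by (auto simp: F.quad_ideal_def)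
  show "free_eval E \<eta> (ev1 \<circ> f) = \<zero>\<^bsub>E\<^esub>" if z: "free_eval D (\<lambda>i. unif \<odot>\<^bsub>D\<^esub> \<xi> i) f = \<zero>\<^bsub>D\<^esub>"
  proof -
    have "scl f \<in> F.quad_ideal GF" using z dual_eval[OF f(1)] D.cls_eq_0[of "scl f"] f(1) by (simp add: dual_ideal)
    then have q: "in_quad n GF p (scl f)" for p by (simp add: F.quad_ideal_def)
    \<comment> \<open>In degree p the rescaling of the generators is multiplication by
      \<open>unif ^ p\<close>, which is undone over k(q).\<close>
    have "in_quad n GF p f" for p
      by (rule in_quad_cong[OF GF_space in_quad_smult[OF GF_space UNIV_I q, where c = "1 / unif ^ p"]]) (auto simp: scl_def words_def)
    from FF.in_quad_ev1[OF GF_lattice[OF this f(2)]] have "\<forall>p. in_quad n (sym_form n) p (ev1 \<circ> f)"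
      unfolding comp_def by blast
    then have "ev1 \<circ> f \<in> exterior_ideal n" using e unfolding exterior_ideal F0.quad_ideal_def by blast
    then show ?thesis using E.cls_eq_0[OF e] ext_eval[OF e] by simp
  qed
  assume z: "free_eval E \<eta> (ev1 \<circ> f) = \<zero>\<^bsub>E\<^esub>"
  then have "ev1 \<circ> f \<in> F0.quad_ideal (sym_form n)" using E.cls_eq_0[OF e] ext_eval[OF e] by (simp add: exterior_ideal)
  then have "in_quad n (sym_form n) p (ev1 \<circ> f)" for p by (simp add: F0.quad_ideal_def)
  then have "\<exists>b. in_quad n GL p b \<and> (\<forall>w\<in>words n p. ev1 (b w) = (ev1 \<circ> f) w)" for p by (rule FF.in_quad_lift)
  then obtain b where b: "\<And>p. in_quad n GL p (b p)" "\<And>p w. w \<in> words n p \<Longrightarrow> ev1 (b p w) = ev1 (f w)" by (metis comp_apply)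
  \<comment> \<open>The lifts are chosen in each degree separately; k bounds the degrees that occur
    in f, so that the assembled element has finite support.\<close>
  obtain k where k: "\<And>w. f w \<noteq> 0 \<Longrightarrow> length w < k" using F.carrier_F_bound[OF f(1)] by blast
  let ?c = "\<lambda>w. set w \<subseteq> {..<n} \<and> length w < k"
  let ?b = "\<lambda>w. if ?c w then b (length w) w else 0"
  let ?g = "\<lambda>w. if ?c w then (f w - b (length w) w) / unif else 0"
  have Fc: "h \<in> carrier F.F" if "\<And>w. \<not> ?c w \<Longrightarrow> h w = 0" for h
  proof -
    have "supp h \<subseteq> (\<Union>p<k. words n p)" using that by (auto simp: supp_def words_def)
    then have "finite (supp h)" by (rule finite_subset) simp
    then show ?thesis using that by (auto simp: F.carrier_F supp_def)
  qed
  have bF: "?b \<in> carrier F.F" by (rule Fc) auto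
  have gF: "?g \<in> carrier F.F" by (rule Fc) auto
  have bl: "b (length w) w \<in> loc" if "?c w" for w using FF.in_quad_loc[OF b(1), of w "length w"] that by (simp add: words_def)
  have gl: "?g w \<in> loc" for w
  proof (cases "?c w")
    case True
    then have "w \<in> words n (length w)" by (simp add: words_def)
    then have "(f w - b (length w) w) / unif \<in> loc" using b(2) bl[OF True] f(2)[of w] by (intro ev1_eq_0 loc_diff) (simp_all add: ev1_diff)
    then show ?thesis using True by simp
  next
    case False
    then show ?thesis by auto
  qed
  have sb: "scl ?b \<in> F.quad_ideal GF"
  proof -
    have "in_quad n GF p (scl ?b)" for p
    proof (cases "p < k")
      case True
      show ?thesis
        by (rule in_quad_cong[OF GF_space in_quad_smult[OF GF_space UNIV_I GL_GF[OF b(1)[of p]], where c = "unif ^ p"]])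
          (use True in \<open>auto simp: scl_def words_def\<close>)
    next
      case False
      show ?thesis by (rule in_quad_cong[OF GF_space in_quad_0[OF GF_space]]) (use False in \<open>auto simp: scl_def words_def\<close>)
    qed
    then show ?thesis using bF by (simp add: F.quad_ideal_def)
  qed
  have gen: "scl f = scl b' \<oplus>\<^bsub>F.F\<^esub> unif \<odot>\<^bsub>F.F\<^esub> scl g'" if "\<And>w. f w = b' w + unif * g' w" for b' g'
    by (simp add: scl_def that fun_eq_iff distrib_left mult.left_commute)
  have "f w = ?b w + unif * ?g w" for w
  proof (cases "?c w")
    case False
    have "f w = 0" using False k[of w] f(1) by (auto simp: F.carrier_F supp_def)
    then show ?thesis using False by auto
  qed simp
  from gen[OF this] have "scl f = scl ?b \<oplus>\<^bsub>F.F\<^esub> unif \<odot>\<^bsub>F.F\<^esub> scl ?g" .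
  moreover have "unif \<odot>\<^bsub>F.F\<^esub> scl ?g \<in> carrier F.F" using F.W.M.sm_closed[OF UNIV_I scl_closed[OF gF]] .
  ultimately have "D.cls (scl f) = D.cls (scl ?b) \<oplus>\<^bsub>D\<^esub> unif \<odot>\<^bsub>D\<^esub> D.cls (scl ?g)"
    using D.cls_hom(1)[OF scl_closed[OF bF]] D.cls_hom(3)[OF scl_closed[OF gF]] by simp
  also have "D.cls (scl ?b) = \<zero>\<^bsub>D\<^esub>" using sb D.cls_eq_0[OF scl_closed[OF bF]] by (simp add: dual_ideal)
  also have "\<zero>\<^bsub>D\<^esub> \<oplus>\<^bsub>D\<^esub> unif \<odot>\<^bsub>D\<^esub> D.cls (scl ?g) = unif \<odot>\<^bsub>D\<^esub> D.cls (scl ?g)"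
    using D.cls_closed[OF scl_closed[OF gF]] by (intro D.E.l_zero D.E.sm_closed UNIV_I)
  finally have eq: "free_eval D (\<lambda>i. unif \<odot>\<^bsub>D\<^esub> \<xi> i) f = unif \<odot>\<^bsub>D\<^esub> free_eval D (\<lambda>i. unif \<odot>\<^bsub>D\<^esub> \<xi> i) ?g"
    by (simp only: dual_eval[OF f(1)] dual_eval[OF gF])
  show "\<exists>g\<in>carrier F.F. (\<forall>w. g w \<in> loc) \<and> free_eval D (\<lambda>i. unif \<odot>\<^bsub>D\<^esub> \<xi> i) f = unif \<odot>\<^bsub>D\<^esub> free_eval D (\<lambda>i. unif \<odot>\<^bsub>D\<^esub> \<xi> i) g"
    by (intro bexI[OF _ gF] conjI allI gl eq)
qed

abbreviation "LE \<equiv> D_pres.lattice"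
abbreviation "rE \<equiv> D_pres.red"

sublocale RE: reduction D E LE rE
  by (rule D_pres.reduction)

end

section \<open>The differentials\<close>

lemma (in coeff_algebra) finsum_diff:
  "f \<in> I \<rightarrow> carrier A \<Longrightarrow> g \<in> I \<rightarrow> carrier A \<Longrightarrow> (\<Oplus>i\<in>I. f i \<ominus> g i) = (\<Oplus>i\<in>I. f i) \<ominus> (\<Oplus>i\<in>I. g i)"
proof -
  assume h: "f \<in> I \<rightarrow> carrier A" "g \<in> I \<rightarrow> carrier A"
  note m = coeff_ringD(5)[OF S coeff_ringD(2)[OF S]]
  have "(\<Oplus>i\<in>I. f i \<ominus> g i) = (\<Oplus>i\<in>I. f i \<oplus> (- 1) \<odot> g i)"
    by (rule finsum_cong') (use h m in \<open>auto simp: a_minus_def minus_sm Pi_iff\<close>)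
  also have "\<dots> = (\<Oplus>i\<in>I. f i) \<oplus> (\<Oplus>i\<in>I. (- 1) \<odot> g i)" by (rule finsum_addf) (use h m in auto)
  also have "(\<Oplus>i\<in>I. (- 1) \<odot> g i) = (- 1) \<odot> (\<Oplus>i\<in>I. g i)" by (rule sm_finsum[symmetric, OF m h(2)])
  finally show ?thesis using h by (simp add: a_minus_def minus_sm)
qed

context graded_quot
begin

lemma cls_form_sum:
  assumes "\<And>i j. i \<in> K \<Longrightarrow> j \<in> L i \<Longrightarrow> set (u i j) \<subseteq> {..<n}"
  shows "(\<Oplus>\<^bsub>E\<^esub>i\<in>K. \<Oplus>\<^bsub>E\<^esub>j\<in>L i. c i j \<odot>\<^bsub>E\<^esub> cls (bs (u i j))) = cls (\<lambda>w. \<Sum>i\<in>K. \<Sum>j\<in>L i. c i j * bs (u i j) w)"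
proof -
  let ?h = "\<lambda>i j. c i j \<odot>\<^bsub>F\<^esub> bs (u i j)"
  have c: "?h i j \<in> carrier F" if "i \<in> K" "j \<in> L i" for i j
    by (rule W.M.sm_closed[OF UNIV_I bs_closed[OF assms[OF that]]])
  then have h: "?h i \<in> L i \<rightarrow> carrier F" if "i \<in> K" for i using that by blast
  have H: "(\<lambda>i. \<Oplus>\<^bsub>F\<^esub>j\<in>L i. ?h i j) \<in> K \<rightarrow> carrier F" using W.M.finsum_closed[OF h] by blast
  have e: "(\<Oplus>\<^bsub>F\<^esub>i\<in>K. \<Oplus>\<^bsub>F\<^esub>j\<in>L i. ?h i j) = (\<lambda>w. \<Sum>i\<in>K. \<Sum>j\<in>L i. c i j * bs (u i j) w)"
  proof
    fix w
    have "(\<Oplus>\<^bsub>F\<^esub>i\<in>K. \<Oplus>\<^bsub>F\<^esub>j\<in>L i. ?h i j) w = (\<Sum>i\<in>K. (\<Oplus>\<^bsub>F\<^esub>j\<in>L i. ?h i j) w)" by (rule W.finsum_M[OF H])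
    also have "\<dots> = (\<Sum>i\<in>K. \<Sum>j\<in>L i. c i j * bs (u i j) w)"
      by (rule sum.cong[OF refl]) (use W.finsum_M[OF h] in simp)
    finally show "(\<Oplus>\<^bsub>F\<^esub>i\<in>K. \<Oplus>\<^bsub>F\<^esub>j\<in>L i. ?h i j) w = (\<Sum>i\<in>K. \<Sum>j\<in>L i. c i j * bs (u i j) w)" .
  qed
  have i: "cls (\<Oplus>\<^bsub>F\<^esub>j\<in>L i. ?h i j) = (\<Oplus>\<^bsub>E\<^esub>j\<in>L i. c i j \<odot>\<^bsub>E\<^esub> cls (bs (u i j)))" if "i \<in> K" for i
  proof -
    have "cls (\<Oplus>\<^bsub>F\<^esub>j\<in>L i. ?h i j) = (\<Oplus>\<^bsub>E\<^esub>j\<in>L i. cls (?h i j))" by (rule additive.finsum[OF cls_additive h[OF that]])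
    also have "\<dots> = (\<Oplus>\<^bsub>E\<^esub>j\<in>L i. c i j \<odot>\<^bsub>E\<^esub> cls (bs (u i j)))"
      by (rule E.finsum_cong') (use assms that in \<open>simp_all add: cls_hom(3) del: W.M_sel\<close>)
    finally show ?thesis .
  qed
  have "cls (\<Oplus>\<^bsub>F\<^esub>i\<in>K. \<Oplus>\<^bsub>F\<^esub>j\<in>L i. ?h i j) = (\<Oplus>\<^bsub>E\<^esub>i\<in>K. cls (\<Oplus>\<^bsub>F\<^esub>j\<in>L i. ?h i j))"
    by (rule additive.finsum[OF cls_additive H])
  also have "\<dots> = (\<Oplus>\<^bsub>E\<^esub>i\<in>K. \<Oplus>\<^bsub>E\<^esub>j\<in>L i. c i j \<odot>\<^bsub>E\<^esub> cls (bs (u i j)))"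
    by (rule E.finsum_cong') (use i in \<open>auto intro!: E.finsum_closed dest: assms\<close>)
  finally show ?thesis using e by simp
qed

lemma xi_grade: "i < n \<Longrightarrow> xi i \<in> grade E 1"
proof -
  assume "i < n"
  then have "bs [i] \<in> free_part {..<n} 1" by (auto simp: free_part_words words_def basis_elt_def)
  then show ?thesis by (auto simp: E_grade)
qed

lemma sgE_xi: "i < n \<Longrightarrow> sgE (xi i) = \<ominus>\<^bsub>E\<^esub> xi i"
  using sgE_sign[OF xi_grade] by (simp add: alt_sign_def)

text \<open>Uniqueness for the derivations \<open>y_j^*\<close> of the limit. The value at 1 is
  forced to be zero by the Leibniz rule, and the remaining values are determined by left
  multiplication with generators.\<close>

lemma odd_derivation_eq:
  assumes lin: "linear_map UNIV E E d" "linear_map UNIV E E d'"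
    and der: "\<And>i u v. u \<in> grade E i \<Longrightarrow> v \<in> carrier E \<Longrightarrow> d (u \<otimes>\<^bsub>E\<^esub> v) = d u \<otimes>\<^bsub>E\<^esub> v \<oplus>\<^bsub>E\<^esub> alt_sign E i (u \<otimes>\<^bsub>E\<^esub> d v)"
      "\<And>i u v. u \<in> grade E i \<Longrightarrow> v \<in> carrier E \<Longrightarrow> d' (u \<otimes>\<^bsub>E\<^esub> v) = d' u \<otimes>\<^bsub>E\<^esub> v \<oplus>\<^bsub>E\<^esub> alt_sign E i (u \<otimes>\<^bsub>E\<^esub> d' v)"
    and gen: "\<And>i. i < n \<Longrightarrow> d (xi i) = d' (xi i)" and a: "a \<in> carrier E"
  shows "d a = d' a"
  using a
proof (induct a rule: E_induct)
  case one
  have o: "\<one>\<^bsub>E\<^esub> \<in> grade E 0" by (rule E.one_g[OF E_graded])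
  have z: "y = \<zero>\<^bsub>E\<^esub>" if "y \<in> carrier E" "y = y \<oplus>\<^bsub>E\<^esub> y" for y
    using that E.add.l_cancel_one'[of y y] by simp
  have "h \<one>\<^bsub>E\<^esub> = \<zero>\<^bsub>E\<^esub>" if h: "linear_map UNIV E E h"
    and e: "h (\<one>\<^bsub>E\<^esub> \<otimes>\<^bsub>E\<^esub> \<one>\<^bsub>E\<^esub>) = h \<one>\<^bsub>E\<^esub> \<otimes>\<^bsub>E\<^esub> \<one>\<^bsub>E\<^esub> \<oplus>\<^bsub>E\<^esub> alt_sign E 0 (\<one>\<^bsub>E\<^esub> \<otimes>\<^bsub>E\<^esub> h \<one>\<^bsub>E\<^esub>)" for h
  proof (rule z)
    show c: "h \<one>\<^bsub>E\<^esub> \<in> carrier E" by (rule linear_mapD(1)[OF h E.one_closed])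
    show "h \<one>\<^bsub>E\<^esub> = h \<one>\<^bsub>E\<^esub> \<oplus>\<^bsub>E\<^esub> h \<one>\<^bsub>E\<^esub>" using e c by (simp only: alt_sign_def E.l_one E.r_one E.one_closed even_zero if_True)
  qed
  from this[OF lin(1) der(1)[OF o E.one_closed]] this[OF lin(2) der(2)[OF o E.one_closed]]
  show ?case by simp
next
  case (xi i a)
  then show ?case using der(1)[OF xi_grade, of i a] der(2)[OF xi_grade, of i a] gen by simp
qed (simp_all add: linear_mapD[OF lin(1)] linear_mapD[OF lin(2)])

end

context quantum
begin

section \<open>Graded commutators in the quadratic dual and the derivations of the exterior
  algebra\<close>

abbreviation "pb \<equiv> scl_bracket A n x"

text \<open>The relations of the exterior algebra in degree two are the symmetric forms, so that
  classes agree as soon as the difference of the representatives is symmetric.\<close>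

lemma ext_cls_eqI:
  assumes "\<And>w. w \<notin> words n 2 \<Longrightarrow> f w = 0" "\<And>w. w \<notin> words n 2 \<Longrightarrow> g w = 0"
    and s: "\<And>i j. i < n \<Longrightarrow> j < n \<Longrightarrow> f [i, j] - g [i, j] = f [j, i] - g [j, i]"
  shows "E.cls f = E.cls g"
proof -
  have c: "f \<in> carrier F0.F" "g \<in> carrier F0.F" using F0.words_F assms by blast+
  have "(\<lambda>w. f w - g w) \<in> F0.forms (sym_form n)"
    using assms by (simp add: F0.forms_def F0.free_part_words sym_form_def)
  then have "f \<ominus>\<^bsub>F0.F\<^esub> g \<in> exterior_ideal n"
    using F0.forms_quad_ideal[OF sym_form_space] c by (auto simp: exterior_ideal F0.F_minus simp del: F0.W.M_sel)
  then show ?thesis using E.Q.cl_eq[OF c] by simp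
qed

lemma eta_anticomm: "i < n \<Longrightarrow> j < n \<Longrightarrow> \<eta> i \<otimes>\<^bsub>E\<^esub> \<eta> j = \<ominus>\<^bsub>E\<^esub> (\<eta> j \<otimes>\<^bsub>E\<^esub> \<eta> i)"
proof -
  assume ij: "i < n" "j < n"
  have "E.cls (basis_elt [i, j]) = E.cls (\<lambda>w. - 1 * basis_elt [j, i] w)"
  proof (rule ext_cls_eqI)
    show "F0.bs [i, j] w = 0" "- 1 * F0.bs [j, i] w = 0" if "w \<notin> words n 2" for w
      using that ij by (auto simp: basis_elt_def)
    show "F0.bs [i, j] [a, c] - - 1 * F0.bs [j, i] [a, c] = F0.bs [i, j] [c, a] - - 1 * F0.bs [j, i] [c, a]" for a c
      by (simp add: basis_elt_def conj_commute)
  qed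
  also have "\<dots> = (- 1) \<odot>\<^bsub>E\<^esub> E.cls (basis_elt [j, i])" using ij E.cls_hom(3)[of "basis_elt [j, i]" "- 1"] by simp
  also have "\<dots> = \<ominus>\<^bsub>E\<^esub> E.cls (basis_elt [j, i])" using ij by (intro E.E.minus_sm[symmetric] E.cls_closed) simp
  finally show ?thesis using ij by (simp add: E.cls_hom(2) F0.bs_mult)
qed

lemma eta_comm: "a \<in> carrier E \<Longrightarrow> j < n \<Longrightarrow> \<eta> j \<otimes>\<^bsub>E\<^esub> a = E.sgE a \<otimes>\<^bsub>E\<^esub> \<eta> j"
proof (induct a rule: E.E_induct)
  have h: "algebra_hom UNIV E E E.sgE" by (rule E.sgE_hom)
  note l = linear_mapD[of UNIV E E E.sgE]
  {
    case one
    then show ?case using h by (simp add: algebra_hom_def)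
  next
    case (xi i a)
    have s: "E.sgE a \<in> carrier E" "E.sgE (\<eta> i \<otimes>\<^bsub>E\<^esub> a) = \<ominus>\<^bsub>E\<^esub> \<eta> i \<otimes>\<^bsub>E\<^esub> E.sgE a"
      using h xi l(1) by (auto simp: algebra_hom_def E.sgE_xi)
    have "\<eta> j \<otimes>\<^bsub>E\<^esub> (\<eta> i \<otimes>\<^bsub>E\<^esub> a) = (\<eta> j \<otimes>\<^bsub>E\<^esub> \<eta> i) \<otimes>\<^bsub>E\<^esub> a" using xi by (simp add: E.E.m_assoc)
    also have "\<dots> = \<ominus>\<^bsub>E\<^esub> (\<eta> i \<otimes>\<^bsub>E\<^esub> (\<eta> j \<otimes>\<^bsub>E\<^esub> a))"
      unfolding eta_anticomm[OF xi(4,1)] using xi by (simp add: E.E.m_assoc E.E.l_minus)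
    also have "\<dots> = E.sgE (\<eta> i \<otimes>\<^bsub>E\<^esub> a) \<otimes>\<^bsub>E\<^esub> \<eta> j" using xi s by (simp add: E.E.m_assoc E.E.l_minus)
    finally show ?case .
  next
    case (add a b)
    then show ?case using h l by (simp add: algebra_hom_def E.E.l_distr E.E.r_distr)
  next
    case (smult c a)
    then show ?case using h l by (simp add: algebra_hom_def E.E.sm_ml E.E.sm_mr)
  }
qed

lemma LE_cases: "m \<in> LE \<Longrightarrow> \<exists>f\<in>D_pres.LF. m = D.cls (scl f)"
  and LE_I: "f \<in> D_pres.LF \<Longrightarrow> D.cls (scl f) \<in> LE"
  and rE_cls: "f \<in> D_pres.LF \<Longrightarrow> rE (D.cls (scl f)) = E.cls (ev1 \<circ> f)"
proof -
  have e: "free_eval D (\<lambda>i. unif \<odot>\<^bsub>D\<^esub> \<xi> i) f = D.cls (scl f)" if "f \<in> D_pres.LF" for f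
    using dual_eval D_pres.LF_D that by blast
  then show "m \<in> LE \<Longrightarrow> \<exists>f\<in>D_pres.LF. m = D.cls (scl f)" by (force simp: D_pres.lattice_def)
  assume f: "f \<in> D_pres.LF"
  show "D.cls (scl f) \<in> LE" unfolding D_pres.lattice_def e[OF f, symmetric] using f by (rule imageI)
  show "rE (D.cls (scl f)) = E.cls (ev1 \<circ> f)"
    unfolding e[OF f, symmetric] D_pres.red_eval[OF f] by (rule ext_eval[OF D_pres.ev1_F0[OF D_pres.LF_D(1)[OF f]]])
qed

lemma prE_LE: "m \<in> LE \<Longrightarrow> D.prE p m \<in> LE" and rE_prE: "m \<in> LE \<Longrightarrow> rE (D.prE p m) = E.prE p (rE m)"
  and sgE_LE: "m \<in> LE \<Longrightarrow> D.sgE m \<in> LE" and rE_sgE: "m \<in> LE \<Longrightarrow> rE (D.sgE m) = E.sgE (rE m)"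
proof -
  assume "m \<in> LE"
  then obtain f where f: "f \<in> D_pres.LF" "m = D.cls (scl f)" using LE_cases by blast
  note c = D_pres.LF_D(1)[OF f(1)]
  have pm: "(- 1 :: 'k poly fract) ^ l \<in> loc \<and> ev1 ((- 1) ^ l :: 'k poly fract) = (- 1) ^ l" for l
    by (cases "even l") (simp_all add: loc_uminus ev1_uminus)
  have t: "F.trunc p f \<in> D_pres.LF" using f(1) by (simp add: D_pres.LF_def) (simp add: F.trunc_def)
  have n: "D.neg f \<in> D_pres.LF" using f(1) pm by (simp add: D_pres.LF_def) (simp add: D.neg_def loc_mult)
  have "D.prE p m = D.cls (scl (F.trunc p f))"
    unfolding f(2) D.prE_cls[OF scl_closed[OF c]] by (rule arg_cong[of _ _ D.cls]) (auto simp: scl_def F.trunc_def)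
  then show "D.prE p m \<in> LE" "rE (D.prE p m) = E.prE p (rE m)"
    using LE_I[OF t] rE_cls[OF t] rE_cls[OF f(1)] E.prE_cls[OF D_pres.ev1_F0[OF c]]
    by (auto simp: f(2) F.trunc_def F0.trunc_def comp_def if_distrib cong: if_cong)
  have "D.sgE m = D.cls (scl (D.neg f))"
    unfolding f(2) D.sgE_cls[OF scl_closed[OF c]] by (rule arg_cong[of _ _ D.cls]) (auto simp: scl_def D.neg_def)
  moreover have "ev1 \<circ> D.neg f = E.neg (ev1 \<circ> f)"
    using pm D_pres.LF_D(2)[OF f(1)] by (simp add: fun_eq_iff D.neg_def E.neg_def ev1_mult)
  ultimately show "D.sgE m \<in> LE" "rE (D.sgE m) = E.sgE (rE m)"
    using LE_I[OF n] rE_cls[OF n] rE_cls[OF f(1)] E.sgE_cls[OF D_pres.ev1_F0[OF c]] f(2) by simp_all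
qed

lemma y_LE [simp]: "i < n \<Longrightarrow> unif \<odot>\<^bsub>D\<^esub> \<xi> i \<in> LE" and rE_y: "i < n \<Longrightarrow> rE (unif \<odot>\<^bsub>D\<^esub> \<xi> i) = \<eta> i"
proof -
  assume i: "i < n"
  have b: "basis_elt [i] \<in> D_pres.LF" using D_pres.LF_closed(4)[of "[i]"] i by simp
  have "scl (basis_elt [i]) = unif \<odot>\<^bsub>F.F\<^esub> basis_elt [i]" by (auto simp: scl_def basis_elt_def)
  then have "D.cls (scl (basis_elt [i])) = unif \<odot>\<^bsub>D\<^esub> \<xi> i" using D.cls_hom(3)[of "basis_elt [i]" unif] i by simp
  moreover have "ev1 \<circ> basis_elt [i] = (basis_elt [i] :: nat list \<Rightarrow> 'k)" by (auto simp: basis_elt_def)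
  ultimately show "unif \<odot>\<^bsub>D\<^esub> \<xi> i \<in> LE" "rE (unif \<odot>\<^bsub>D\<^esub> \<xi> i) = \<eta> i" using LE_I[OF b] rE_cls[OF b] by simp_all
qed

abbreviation "act j \<equiv> inner_differential.D D D.sgE (\<xi> j)"

lemma act_inner: "j < n \<Longrightarrow> inner_differential UNIV D (grade D) D.prE D.sgE (\<xi> j)"
  unfolding inner_differential_def inner_differential_axioms_def
  using D.E_algebra D.E_graded D.sgE_hom D.sgE_sign D.xi_grade by blast

lemmas act_def = inner_differential.D_def[OF act_inner]
lemmas act = linear_mapD[OF inner_differential.D_linear[OF act_inner]]

text \<open>The commutator is taken with \<xi> j itself, whereas the lattice is generated by its
  multiples with \<open>unif\<close>. The commutator with such a multiple reduces to zero, since the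
  exterior algebra is graded commutative; hence it is \<open>unif\<close> times a lattice element,
  and the factor is cancelled in the dual.\<close>

lemma act_LE: "j < n \<Longrightarrow> m \<in> LE \<Longrightarrow> act j m \<in> LE"
proof -
  assume j: "j < n" and m: "m \<in> LE"
  have c: "m \<in> carrier D" "D.sgE m \<in> carrier D" using m sgE_LE by auto
  have e: "unif \<odot>\<^bsub>D\<^esub> act j m = (unif \<odot>\<^bsub>D\<^esub> \<xi> j) \<otimes>\<^bsub>D\<^esub> m \<ominus>\<^bsub>D\<^esub> D.sgE m \<otimes>\<^bsub>D\<^esub> (unif \<odot>\<^bsub>D\<^esub> \<xi> j)"
    using j c by (simp add: act_def D.E.sm_diff_r D.E.sm_ml D.E.sm_mr)
  have "rE (unif \<odot>\<^bsub>D\<^esub> act j m) = \<eta> j \<otimes>\<^bsub>E\<^esub> rE m \<ominus>\<^bsub>E\<^esub> E.sgE (rE m) \<otimes>\<^bsub>E\<^esub> \<eta> j"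
    unfolding e using j m sgE_LE[OF m] by (simp add: RE.r_diff RE.r_mult rE_y rE_sgE)
  also have "\<dots> = \<zero>\<^bsub>E\<^esub>" using eta_comm[OF RE.r_closed[OF m] j] m j rE_sgE[OF m] RE.r_closed[OF sgE_LE[OF m]]
    by (simp add: a_minus_def E.E.r_neg)
  finally obtain d where "d \<in> LE" "unif \<odot>\<^bsub>D\<^esub> act j m = unif \<odot>\<^bsub>D\<^esub> d"
    using RE.r_ker[of "unif \<odot>\<^bsub>D\<^esub> act j m"] e j m sgE_LE[OF m] by auto
  then show ?thesis using RE.unif_cancel[of "act j m" d] act(1)[OF j c(1)] by auto
qed

lemma D_form_zero: "GF g \<Longrightarrow> D.cls (ext2 g) = \<zero>\<^bsub>D\<^esub>"
proof -
  assume g: "GF g"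
  have "GF (\<lambda>i j. ext2 g [i, j])" by (rule quad_spaceD(1)[OF GF_space g]) simp
  then have "ext2 g \<in> F.forms GF" by (simp add: F.forms_def F.free_part_words ext2_words)
  then have "ext2 g \<in> quad_dual_ideal A n x" using F.forms_quad_ideal[OF GF_space] by (auto simp: dual_ideal)
  then show ?thesis using D.cls_eq_0[OF ext2_closed] by simp
qed

text \<open>The coordinate at e of a product of two generators of A is a linear form that kills the
  relations. By \<open>D_form_zero\<close> the products of \<xi> i and \<xi> k, weighted with these
  coordinates, sum to zero in the dual.\<close>

lemma GF_gamma: "e \<in> \<E> 2 \<Longrightarrow> GF (\<lambda>i j. \<gamma> [i, j] e)"
  by (rule GF_I[where r = "\<lambda>d. if d = e then 1 else 0"]) (simp add: if_distrib[of "\<lambda>c. _ * c"] cong: if_cong)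

lemma bracket_coeff:
  assumes rs: "r < n" "s < n"
  shows "pb (Var r) (Var s) e = ev1 ((\<gamma> [r, s] e - \<gamma> [s, r] e) / unif)"
proof -
  have w: "x r \<otimes> x s = word_eval A x [r, s]" "x s \<otimes> x r = word_eval A x [s, r]" using rs by (simp_all add: word_eval_def)
  have d: "\<phi> (a \<ominus> a') e = \<phi> a e - \<phi> a' e" if "a \<in> carrier A" "a' \<in> carrier A" for a a'
    using that phi_add[of a "(- 1) \<odot> a'" e] by (simp add: a_minus_def A.minus_sm phi_sm)
  have c: "word_eval A x [r, s] \<in> carrier A" "word_eval A x [s, r] \<in> carrier A" using rs by simp_all
  have "\<phi> (br (x r) (x s)) e = (\<gamma> [r, s] e - \<gamma> [s, r] e) / unif"
    unfolding br_def w using c by (simp add: phi_sm d \<gamma>_def)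
  then show ?thesis
    using bracket[OF x_LA x_LA, of r s] phi_ev1[OF br_LA[OF x_LA x_LA], of r s e] rs by (simp add: rA_x)
qed

text \<open>Let e be the content of [j, m]. The relation of the dual with the coefficients
  \<open>\<gamma> [i, k] e\<close> reduces at q = 1 to the anticommutation of the generators j and
  m. The anticommutator of \<xi> j and \<xi> m is therefore given by the deviations of these
  coefficients from their values at q = 1. The antisymmetric part of the deviations, divided by q -
  1, is the coefficient of the brackets of the variables at the monomial e, which the second
  derivatives extract.\<close>

lemma act_y:
  assumes j: "j < n" and m: "m < n"
  shows "rE (act j (unif \<odot>\<^bsub>D\<^esub> \<xi> m)) = \<ominus>\<^bsub>E\<^esub> (\<Oplus>\<^bsub>E\<^esub>s\<in>{..<n}. \<Oplus>\<^bsub>E\<^esub>r\<in>{..<s}.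
    pdiff m (pdiff j (pb (Var r) (Var s))) (\<lambda>i. 0) \<odot>\<^bsub>E\<^esub> (\<eta> r \<otimes>\<^bsub>E\<^esub> \<eta> s))"
proof -
  define e where "e = cnt [j, m]"
  \<comment> \<open>For j = m the anticommutator is twice a square, while only one word has this
    content. The same factor 2 is the second derivative of the square of a variable.\<close>
  define \<nu> where "\<nu> = (if j = m then 2 else 1 :: 'k poly fract)"
  define \<nu>0 where "\<nu>0 = (if j = m then 2 else 1 :: 'k)"
  have "ev1 2 = (2 :: 'k)" "(2 :: 'k poly fract) \<in> loc" using ev1_add[of 1 1] loc_add[of 1 1] by simp_all
  then have nu: "\<nu> \<in> loc" "ev1 \<nu> = \<nu>0" by (simp_all add: \<nu>_def \<nu>0_def)
  have e: "e \<in> \<E> 2" using j m by (auto simp: e_def)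
  let ?i = "\<lambda>i k. if cnt [i, k] = e then 1 else 0 :: 'k poly fract"
  define d where "d = (\<lambda>i k. (\<gamma> [i, k] e - ?i i k) / unif)"
  have dl: "d i k \<in> loc" if "i < n" "k < n" for i k
    unfolding d_def using that by (intro ev1_eq_0 loc_diff) (auto simp: ev1_diff gamma_ev1)
  let ?f = "ext2 (\<lambda>i k. - \<nu> * d i k)"
  have fL: "?f \<in> D_pres.LF"
  proof -
    have "?f w \<in> loc" for w using dl nu by (auto simp: ext2_def loc_mult loc_uminus split: list.splits)
    then show ?thesis using ext2_closed by (simp add: D_pres.LF_def)
  qed
  \<comment> \<open>The anticommutator is \<nu> times the indicator of the content e, which is the
    value of \<open>\<gamma> [i, k] e\<close> at q = 1. Replacing the indicator by this coordinate
    gives a relation of the dual and leaves a remainder with the factor \<open>unif\<close>.\<close>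
  have v: "basis_elt [j, m] w + basis_elt [m, j] w = \<nu> * ext2 (\<lambda>i k. \<gamma> [i, k] e) w + unif * ?f w" for w
  proof (cases "w \<in> words n 2")
    case True
    then obtain a c where w: "w = [a, c]" "a < n" "c < n" using words_2 by blast
    have "basis_elt [j, m] w + basis_elt [m, j] w = \<nu> * ?i a c"
      using cnt_2[of a c j m] cnt_swap[of j m] by (auto simp: basis_elt_def w e_def \<nu>_def)
    moreover have "\<gamma> [a, c] e = ?i a c + unif * d a c" by (simp add: d_def)
    moreover have "\<nu> * r = \<nu> * (r + u * s) + u * (- \<nu> * s)" for r s u by (simp add: algebra_simps)
    ultimately show ?thesis using w by (simp only: ext2_pair)
  next
    case False
    then have "w \<noteq> [j, m]" "w \<noteq> [m, j]" using j m by auto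
    then show ?thesis by (simp add: ext2_words[OF False] basis_elt_def)
  qed
  have cf: "(\<lambda>w. unif * ?f w) \<in> carrier F.F" using F.W.M.sm_closed[OF UNIV_I ext2_closed] by simp
  have cg: "(\<lambda>w. \<nu> * ext2 (\<lambda>i k. \<gamma> [i, k] e) w) \<in> carrier F.F" using F.W.M.sm_closed[OF UNIV_I ext2_closed] by simp
  have "\<xi> j \<otimes>\<^bsub>D\<^esub> \<xi> m \<oplus>\<^bsub>D\<^esub> \<xi> m \<otimes>\<^bsub>D\<^esub> \<xi> j = D.cls (\<lambda>w. basis_elt [j, m] w + basis_elt [m, j] w)"
    using j m by (simp add: D.cls_hom(1,2) F.bs_mult)
  also have "\<dots> = D.cls (\<lambda>w. \<nu> * ext2 (\<lambda>i k. \<gamma> [i, k] e) w) \<oplus>\<^bsub>D\<^esub> D.cls (\<lambda>w. unif * ?f w)"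
    unfolding v using D.cls_hom(1)[OF cg cf] by simp
  also have "D.cls (\<lambda>w. \<nu> * ext2 (\<lambda>i k. \<gamma> [i, k] e) w) = \<nu> \<odot>\<^bsub>D\<^esub> D.cls (ext2 (\<lambda>i k. \<gamma> [i, k] e))"
    using D.cls_hom(3)[OF ext2_closed, of \<nu>] by simp
  also have "\<dots> = \<zero>\<^bsub>D\<^esub>" unfolding D_form_zero[OF GF_gamma[OF e]] by simp
  finally have x: "\<xi> j \<otimes>\<^bsub>D\<^esub> \<xi> m \<oplus>\<^bsub>D\<^esub> \<xi> m \<otimes>\<^bsub>D\<^esub> \<xi> j = D.cls (\<lambda>w. unif * ?f w)" using D.cls_closed[OF cf] by simp
  have sg: "D.sgE (unif \<odot>\<^bsub>D\<^esub> \<xi> m) = \<ominus>\<^bsub>D\<^esub> (unif \<odot>\<^bsub>D\<^esub> \<xi> m)"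
    using D.sgE_hom m by (simp add: algebra_hom_def linear_map_def D.sgE_xi D.E.sm_minus_r)
  have "act j (unif \<odot>\<^bsub>D\<^esub> \<xi> m) = unif \<odot>\<^bsub>D\<^esub> (\<xi> j \<otimes>\<^bsub>D\<^esub> \<xi> m \<oplus>\<^bsub>D\<^esub> \<xi> m \<otimes>\<^bsub>D\<^esub> \<xi> j)"
    using j m by (simp add: act_def sg a_minus_def D.E.l_minus D.E.sm_ml D.E.sm_mr D.E.sm_add_r)
  also have "\<dots> = D.cls (\<lambda>w. unif * (unif * ?f w))" unfolding x using D.cls_hom(3)[OF cf] by simp
  \<comment> \<open>One factor comes from the rescaled generator and the other one from the
    remainder; together they are the rescaling in degree two, so that the result lies in the lattice
    with reduction given by \<open>?f\<close>.\<close>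
  also have "(\<lambda>w. unif * (unif * ?f w)) = scl ?f"
    by (auto simp: scl_def ext2_def fun_eq_iff split: list.splits)
  finally have l: "rE (act j (unif \<odot>\<^bsub>D\<^esub> \<xi> m)) = E.cls (ev1 \<circ> ?f)" using rE_cls[OF fL] by simp
  let ?C = "\<lambda>s r. pdiff m (pdiff j (pb (Var r) (Var s))) (\<lambda>i. 0)"
  have C: "?C s r = \<nu>0 * (ev1 (d r s) - ev1 (d s r))" if "r < n" "s < n" for r s
  proof -
    have ee: "(\<lambda>i. 0)(m := 1, j := Suc (((\<lambda>i. 0)(m := 1)) j)) = e"
      unfolding e_def by (auto simp: cnt_simps fun_eq_iff)
    have "?C s r = \<nu>0 * pb (Var r) (Var s) e"
      unfolding pdiff_def using ee by (auto simp: \<nu>0_def)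
    also have "(\<gamma> [r, s] e - \<gamma> [s, r] e) / unif = d r s - d s r"
      using cnt_swap[of r s] by (simp add: d_def diff_divide_distrib)
    ultimately show ?thesis using bracket_coeff[OF that, of e] dl that by (simp add: ev1_diff)
  qed
  let ?G = "\<lambda>w. \<Sum>s<n. \<Sum>r<s. ?C s r * basis_elt [r, s] w"
  have G0: "?G w = 0" if "w \<notin> words n 2" for w
    using that by (intro sum.neutral ballI) (auto simp: basis_elt_def)
  have G: "?G [a, c] = (if a < c then ?C c a else 0)" if "a < n" "c < n" for a c
  proof -
    have "?G [a, c] = (\<Sum>s<n. if s = c then \<Sum>r<s. if r = a then ?C s r else 0 else 0)"
    proof (rule sum.cong[OF refl])
      fix s
      have b: "basis_elt [r, s] [a, c] = (if r = a \<and> s = c then 1 else 0 :: 'k)" for r s by (auto simp: basis_elt_def)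
      show "(\<Sum>r<s. ?C s r * basis_elt [r, s] [a, c]) = (if s = c then \<Sum>r<s. if r = a then ?C s r else 0 else 0)"
        by (cases "s = c") (simp_all add: b if_distrib[of "\<lambda>c. _ * c"] cong: if_cong)
    qed
    then show ?thesis using that by simp
  qed
  have "(\<Oplus>\<^bsub>E\<^esub>s\<in>{..<n}. \<Oplus>\<^bsub>E\<^esub>r\<in>{..<s}. ?C s r \<odot>\<^bsub>E\<^esub> (\<eta> r \<otimes>\<^bsub>E\<^esub> \<eta> s))
    = (\<Oplus>\<^bsub>E\<^esub>s\<in>{..<n}. \<Oplus>\<^bsub>E\<^esub>r\<in>{..<s}. ?C s r \<odot>\<^bsub>E\<^esub> E.cls (basis_elt [r, s]))"
    by (intro E.E.finsum_cong') (auto intro!: E.E.finsum_closed E.E.finsum_cong' simp: E.cls_hom(2) F0.bs_mult simp del: F0.W.M_sel)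
  also have "\<dots> = E.cls ?G" by (rule E.cls_form_sum) auto
  finally have R: "(\<Oplus>\<^bsub>E\<^esub>s\<in>{..<n}. \<Oplus>\<^bsub>E\<^esub>r\<in>{..<s}. ?C s r \<odot>\<^bsub>E\<^esub> (\<eta> r \<otimes>\<^bsub>E\<^esub> \<eta> s)) = E.cls ?G" .
  have Gc: "?G \<in> carrier F0.F" by (rule F0.words_F[OF G0])
  have "\<ominus>\<^bsub>E\<^esub> E.cls ?G = (- 1) \<odot>\<^bsub>E\<^esub> E.cls ?G" by (rule E.E.minus_sm[OF E.cls_closed[OF Gc]])
  also have "\<dots> = E.cls (\<lambda>w. - 1 * ?G w)" using E.cls_hom(3)[OF Gc, of "- 1"] by simp
  \<comment> \<open>The sum over r < s has coefficients above the diagonal only, whereas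
    \<open>?f\<close> is an arbitrary matrix; the two have the same class because their
    antisymmetrisations agree.\<close>
  also have "\<dots> = E.cls (ev1 \<circ> ?f)"
  proof (rule ext_cls_eqI)
    show "- 1 * ?G w = 0" if "w \<notin> words n 2" for w using G0[OF that] by simp
    show "(ev1 \<circ> ?f) w = 0" if "w \<notin> words n 2" for w using ext2_words[OF that] by simp
    fix a c assume ac: "a < n" "c < n"
    have f: "(ev1 \<circ> ?f) [i, k] = - \<nu>0 * ev1 (d i k)" if "i < n" "k < n" for i k
      using that nu dl[OF that] by (simp add: ev1_mult ev1_uminus loc_mult)
    show "- 1 * ?G [a, c] - (ev1 \<circ> ?f) [a, c] = - 1 * ?G [c, a] - (ev1 \<circ> ?f) [c, a]"
      unfolding G[OF ac] G[OF ac(2,1)] f[OF ac] f[OF ac(2,1)] C[OF ac] C[OF ac(2,1)]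
      by (cases a c rule: linorder_cases) (simp_all add: algebra_simps)
  qed
  finally show ?thesis unfolding R l by (rule sym)
qed

abbreviation "ind j \<equiv> RE.induced (act j)"

context
  fixes j assumes j: "j < n"
begin

interpretation ac: inner_differential UNIV D "grade D" D.prE D.sgE "\<xi> j" by (rule act_inner[OF j])

lemma ind_r: "m \<in> LE \<Longrightarrow> ind j (rE m) = rE (act j m)" and ind_linear: "linear_map UNIV E E (ind j)"
  by (rule RE.induced_r[OF act_LE[OF j]] RE.induced_linear[OF act_LE[OF j]]; simp add: act[OF j])+

lemma ind_eta: "m < n \<Longrightarrow> ind j (\<eta> m) = rE (act j (unif \<odot>\<^bsub>D\<^esub> \<xi> m))"
  using ind_r[OF y_LE] rE_y by simp

lemma ind_derivation: "u \<in> grade E p \<Longrightarrow> v \<in> carrier E \<Longrightarrow>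
  ind j (u \<otimes>\<^bsub>E\<^esub> v) = ind j u \<otimes>\<^bsub>E\<^esub> v \<oplus>\<^bsub>E\<^esub> alt_sign E p (u \<otimes>\<^bsub>E\<^esub> ind j v)"
proof -
  assume u: "u \<in> grade E p" and v: "v \<in> carrier E"
  have uc: "u \<in> carrier E" using u by (simp add: E.E_grade_iff)
  obtain a b where a: "a \<in> LE" "rE a = u" and b: "b \<in> LE" "rE b = v" using RE.r_surj uc v by metis
  have "ind j (u \<otimes>\<^bsub>E\<^esub> v) = rE (act j (a \<otimes>\<^bsub>D\<^esub> b))" using ind_r[of "a \<otimes>\<^bsub>D\<^esub> b"] a b by (auto simp: RE.r_mult)
  also have "\<dots> = ind j u \<otimes>\<^bsub>E\<^esub> v \<oplus>\<^bsub>E\<^esub> E.sgE u \<otimes>\<^bsub>E\<^esub> ind j v"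
    using a b by (simp add: ac.D_mult RE.r_add RE.r_mult act_LE[OF j] sgE_LE rE_sgE flip: ind_r)
  also have "E.sgE u \<otimes>\<^bsub>E\<^esub> ind j v = alt_sign E p (u \<otimes>\<^bsub>E\<^esub> ind j v)"
    using E.sgE_sign[OF u] uc linear_mapD(1)[OF ind_linear v] by (simp add: alt_sign_def E.E.l_minus)
  finally show ?thesis .
qed

text \<open>The derivation required by \<open>THE\<close> is exhibited as a reduction, which
  inherits linearity and the Leibniz rule; only its values on the generators have to be
  computed.\<close>

lemma dual_action_ind: "dual_action n pb j = ind j"
  unfolding dual_action_def Let_def ext_gen_eta
proof (rule the_equality, goal_cases)
  case 1
  have "ind j \<in> extensional (carrier E)" by (simp add: RE.induced_def)
  then show ?case using ind_linear ind_derivation ind_eta act_y[OF j] by simp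
next
  case (2 d)
  then have d: "d \<in> extensional (carrier E)" "linear_map UNIV E E d"
    "\<And>p u v. u \<in> grade E p \<Longrightarrow> v \<in> carrier E \<Longrightarrow> d (u \<otimes>\<^bsub>E\<^esub> v) = d u \<otimes>\<^bsub>E\<^esub> v \<oplus>\<^bsub>E\<^esub> alt_sign E p (u \<otimes>\<^bsub>E\<^esub> d v)"
    "\<And>m. m < n \<Longrightarrow> d (\<eta> m) = ind j (\<eta> m)" by (simp_all add: ind_eta act_y[OF j])
  show ?case
  proof (rule extensionalityI[OF d(1)])
    show "ind j \<in> extensional (carrier E)" by (simp add: RE.induced_def)
    show "d a = ind j a" if "a \<in> carrier E" for a
      by (rule E.odd_derivation_eq[OF d(2) ind_linear d(3) ind_derivation d(4) that])
  qed
qed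

end

section \<open>The lattice of the tensor product and the differential as a graded commutator\<close>

sublocale GT: graded_tensor A D D.prE D.sgE
  by unfold_locales (rule D.E_graded, rule D.sgE_hom, rule D.sgE_sign)

sublocale GT0: graded_tensor P.P E E.prE E.sgE
  by unfold_locales (rule E.E_graded, rule E.sgE_hom, rule E.sgE_sign)

sublocale TR: tensor_reduction A P.P LA rA D E LE rE "exps n" b \<phi> "\<lambda>p. p"
proof
  show "e \<in> exps n \<Longrightarrow> b e \<in> carrier A" for e by (rule b_closed)
  show "\<phi> (a \<oplus> a') e = \<phi> a e + \<phi> a' e" if "a \<in> carrier A" "a' \<in> carrier A" for a a' e using that by (rule phi_add)
  show "\<phi> (c \<odot> a) e = c * \<phi> a e" if "a \<in> carrier A" for a c e using that by (rule phi_sm)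
  show "\<exists>K. finite K \<and> K \<subseteq> exps n \<and> (\<forall>e. e \<notin> K \<longrightarrow> \<phi> a e = 0) \<and> a = (\<Oplus>e\<in>K. \<phi> a e \<odot> b e)" if "a \<in> carrier A" for a
    using that by (rule phi_expand)
  show "e \<in> exps n \<Longrightarrow> rA (b e) \<in> carrier P.P" "e \<in> exps n \<Longrightarrow> b e \<in> LA" for e using b_LA by auto
  show "(p \<oplus>\<^bsub>P.P\<^esub> p') e = p e + p' e" "(c \<odot>\<^bsub>P.P\<^esub> p) e = c * p e" for p p' c e by simp_all
  show "\<exists>K. finite K \<and> K \<subseteq> exps n \<and> (\<forall>e. e \<notin> K \<longrightarrow> p e = 0) \<and> p = (\<Oplus>\<^bsub>P.P\<^esub>e\<in>K. p e \<odot>\<^bsub>P.P\<^esub> rA (b e))" if p: "p \<in> carrier P.P" for p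
  proof -
    have s: "finite (supp p)" "supp p \<subseteq> exps n" using p by (simp_all add: P.X.carrier_M)
    have "p = (\<Oplus>\<^bsub>P.P\<^esub>e\<in>supp p. p e \<odot>\<^bsub>P.P\<^esub> basis_elt e)" by (rule P.X.M_expand[OF p])
    also have "\<dots> = (\<Oplus>\<^bsub>P.P\<^esub>e\<in>supp p. p e \<odot>\<^bsub>P.P\<^esub> rA (b e))"
      by (rule P.X.M.finsum_cong') (use s in \<open>auto simp: rA_b b_LA subset_iff simp del: P.X.M_sel\<close>)
    finally show ?thesis using s by (intro exI[of _ "supp p"]) (auto simp: supp_def)
  qed
  show "\<phi> a e \<in> loc" "rA a e = ev1 (\<phi> a e)" if "a \<in> LA" for a e using phi_loc[OF that] phi_ev1[OF that] by simp_all
qed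

abbreviation "T \<equiv> GT.T"
abbreviation "T0 \<equiv> GT0.T"
abbreviation "tens \<equiv> GT.tens"
abbreviation "tens0 \<equiv> GT0.tens"
abbreviation "B \<equiv> TR.B"
abbreviation "psi \<equiv> TR.psi"

sublocale TB: reduction T T0 B psi
  by (rule TR.tensor_reduction)

definition theta where "theta = (\<Oplus>\<^bsub>T\<^esub>i\<in>{..<n}. tens (x i) (\<xi> i))"

lemma theta_Pi: "(\<lambda>i. tens (x i) (\<xi> i)) \<in> {..<n} \<rightarrow> carrier T"
  by auto

text \<open>In coordinates the orthogonality of the two sets of relations becomes visible: the
  coordinate of the square at e is the class of the quadratic form \<open>\<gamma> [i, k] e\<close>,
  which annihilates the relations of A and is thus zero in the dual.\<close>

lemma theta_sq: "theta \<otimes>\<^bsub>T\<^esub> theta = \<zero>\<^bsub>T\<^esub>"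
proof (rule TR.T.coeff_eqI)
  have tc: "theta \<in> carrier T" unfolding theta_def by (rule GT.T.finsum_closed[OF theta_Pi])
  then show "theta \<otimes>\<^bsub>T\<^esub> theta \<in> carrier T" "\<zero>\<^bsub>T\<^esub> \<in> carrier T" by simp_all
  fix e
  interpret c: additive T D "TR.T.coeff e"
    by (rule linear_additive[OF GT.T.ring_axioms D.E.ring_axioms TR.T.coeff_linear])
  have t: "tens (x i) (\<xi> i) \<otimes>\<^bsub>T\<^esub> tens (x k) (\<xi> k) = tens (word_eval A x [i, k]) (D.cls (basis_elt [i, k]))" if "i < n" "k < n" for i k
    using that by (simp add: GT.tens_mult word_eval_def D.cls_hom(2) F.bs_mult)
  have co: "TR.T.coeff e (tens (x i) (\<xi> i) \<otimes>\<^bsub>T\<^esub> tens (x k) (\<xi> k)) = \<gamma> [i, k] e \<odot>\<^bsub>D\<^esub> D.cls (basis_elt [i, k])" if "i < n" "k < n" for i k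
    using that by (simp add: t TR.T.coeff_tens \<gamma>_def)
  have m: "(\<lambda>k. tens (x i) (\<xi> i) \<otimes>\<^bsub>T\<^esub> tens (x k) (\<xi> k)) \<in> {..<n} \<rightarrow> carrier T" if "i < n" for i using that by auto
  have r: "tens (x i) (\<xi> i) \<otimes>\<^bsub>T\<^esub> theta = (\<Oplus>\<^bsub>T\<^esub>k\<in>{..<n}. tens (x i) (\<xi> i) \<otimes>\<^bsub>T\<^esub> tens (x k) (\<xi> k))" if "i < n" for i
    unfolding theta_def by (rule GT.T.finsum_rdistr[OF finite_lessThan _ theta_Pi]) (use that in auto)
  have r2: "TR.T.coeff e (\<Oplus>\<^bsub>T\<^esub>k\<in>{..<n}. tens (x i) (\<xi> i) \<otimes>\<^bsub>T\<^esub> tens (x k) (\<xi> k))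
    = (\<Oplus>\<^bsub>D\<^esub>k\<in>{..<n}. \<gamma> [i, k] e \<odot>\<^bsub>D\<^esub> D.cls (basis_elt [i, k]))" if i: "i < n" for i
    unfolding c.finsum[OF m[OF i]] by (rule D.E.finsum_cong') (use i in \<open>simp_all add: co Pi_iff\<close>)
  have "theta \<otimes>\<^bsub>T\<^esub> theta = (\<Oplus>\<^bsub>T\<^esub>i\<in>{..<n}. tens (x i) (\<xi> i) \<otimes>\<^bsub>T\<^esub> theta)"
    by (subst theta_def) (rule GT.T.finsum_ldistr[OF finite_lessThan tc theta_Pi])
  also have "\<dots> = (\<Oplus>\<^bsub>T\<^esub>i\<in>{..<n}. \<Oplus>\<^bsub>T\<^esub>k\<in>{..<n}. tens (x i) (\<xi> i) \<otimes>\<^bsub>T\<^esub> tens (x k) (\<xi> k))"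
    by (rule GT.T.finsum_cong') (use r GT.T.finsum_closed[OF m] in \<open>simp_all add: Pi_iff\<close>)
  finally have "TR.T.coeff e (theta \<otimes>\<^bsub>T\<^esub> theta) = (\<Oplus>\<^bsub>D\<^esub>i\<in>{..<n}. TR.T.coeff e (\<Oplus>\<^bsub>T\<^esub>k\<in>{..<n}. tens (x i) (\<xi> i) \<otimes>\<^bsub>T\<^esub> tens (x k) (\<xi> k)))"
    using c.finsum[of "\<lambda>i. \<Oplus>\<^bsub>T\<^esub>k\<in>{..<n}. tens (x i) (\<xi> i) \<otimes>\<^bsub>T\<^esub> tens (x k) (\<xi> k)" "{..<n}"] GT.T.finsum_closed[OF m] by simp
  also have "\<dots> = (\<Oplus>\<^bsub>D\<^esub>i\<in>{..<n}. \<Oplus>\<^bsub>D\<^esub>k\<in>{..<n}. \<gamma> [i, k] e \<odot>\<^bsub>D\<^esub> D.cls (basis_elt [i, k]))"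
    by (rule D.E.finsum_cong') (use r2 in \<open>simp_all add: Pi_iff D.E.finsum_closed\<close>)
  also have "\<dots> = D.cls (\<lambda>w. \<Sum>i<n. \<Sum>k<n. \<gamma> [i, k] e * basis_elt [i, k] w)" by (rule D.cls_form_sum) auto
  also have "(\<lambda>w. \<Sum>i<n. \<Sum>k<n. \<gamma> [i, k] e * basis_elt [i, k] w) = ext2 (\<lambda>i k. \<gamma> [i, k] e)"
  proof
    fix w
    have "(\<Sum>i<n. \<Sum>k<n. \<gamma> [i, k] e * basis_elt [i, k] w) = (\<Sum>u\<in>words n 2. \<gamma> u e * basis_elt u w)" by (rule sum_words_2)
    also have "\<dots> = (\<Sum>u\<in>words n 2. if u = w then \<gamma> u e else 0)" by (rule sum.cong) (auto simp: basis_elt_def)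
    also have "\<dots> = ext2 (\<lambda>i k. \<gamma> [i, k] e) w"
      using words_2[of w n] ext2_words[of w] by auto
    finally show "(\<Sum>i<n. \<Sum>k<n. \<gamma> [i, k] e * basis_elt [i, k] w) = ext2 (\<lambda>i k. \<gamma> [i, k] e) w" .
  qed
  also have "D.cls (ext2 (\<lambda>i k. \<gamma> [i, k] e)) = \<zero>\<^bsub>D\<^esub>"
  proof (cases "e \<in> \<E> 2")
    case True
    then show ?thesis by (rule D_form_zero[OF GF_gamma])
  next
    case False
    \<comment> \<open>Products of two generators have no coordinates outside the contents of degree
      two, so that the form vanishes there.\<close>
    have "GF (\<lambda>i k. 0)" by (rule quad_spaceD(2)[OF GF_space])
    then have "GF (\<lambda>i k. \<gamma> [i, k] e)"
      by (rule quad_spaceD(1)[OF GF_space]) (use False gamma_supp[of "[_, _]" 2] in simp)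
    then show ?thesis by (rule D_form_zero)
  qed
  finally show "TR.T.coeff e (theta \<otimes>\<^bsub>T\<^esub> theta) = TR.T.coeff e \<zero>\<^bsub>T\<^esub>" by simp
qed

lemma theta_grade: "theta \<in> tensor_grade A D 1"
proof -
  interpret p: additive T T "GT.prT 1" by (rule linear_additive[OF GT.T.ring_axioms GT.T.ring_axioms GT.prT_linear])
  have "GT.prT 1 theta = (\<Oplus>\<^bsub>T\<^esub>i\<in>{..<n}. GT.prT 1 (tens (x i) (\<xi> i)))" unfolding theta_def by (rule p.finsum[OF theta_Pi])
  also have "\<dots> = theta" unfolding theta_def
    by (rule GT.T.finsum_cong') (use D.xi_grade in \<open>auto simp: GT.prT_tens D.E_grade_iff\<close>)
  finally show ?thesis using theta_Pi by (simp add: GT.tensor_grade_iff theta_def)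
qed

sublocale dT: inner_differential UNIV T "tensor_grade A D" GT.prT GT.sgT theta
  by unfold_locales (rule GT.T_graded, rule GT.sgT_hom, rule GT.sgT_sign, assumption, rule theta_grade)

abbreviation "dT \<equiv> dT.D"

lemma dT_tens: "l \<in> carrier A \<Longrightarrow> m \<in> carrier D \<Longrightarrow>
  dT (tens l m) = (\<Oplus>\<^bsub>T\<^esub>i\<in>{..<n}. tens (x i \<otimes> l) (\<xi> i \<otimes>\<^bsub>D\<^esub> m) \<ominus>\<^bsub>T\<^esub> tens (l \<otimes> x i) (D.sgE m \<otimes>\<^bsub>D\<^esub> \<xi> i))"
proof -
  assume l: "l \<in> carrier A" and m: "m \<in> carrier D"
  have s: "D.sgE m \<in> carrier D" using D.sgE_hom m by (simp add: algebra_hom_def linear_map_def)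
  have "theta \<otimes>\<^bsub>T\<^esub> tens l m = (\<Oplus>\<^bsub>T\<^esub>i\<in>{..<n}. tens (x i) (\<xi> i) \<otimes>\<^bsub>T\<^esub> tens l m)"
    unfolding theta_def by (rule GT.T.finsum_ldistr[OF finite_lessThan _ theta_Pi]) (use l m in auto)
  also have "\<dots> = (\<Oplus>\<^bsub>T\<^esub>i\<in>{..<n}. tens (x i \<otimes> l) (\<xi> i \<otimes>\<^bsub>D\<^esub> m))"
    by (rule GT.T.finsum_cong') (use l m in \<open>auto simp: GT.tens_mult\<close>)
  finally have 1: "theta \<otimes>\<^bsub>T\<^esub> tens l m = (\<Oplus>\<^bsub>T\<^esub>i\<in>{..<n}. tens (x i \<otimes> l) (\<xi> i \<otimes>\<^bsub>D\<^esub> m))" .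
  have "tens l (D.sgE m) \<otimes>\<^bsub>T\<^esub> theta = (\<Oplus>\<^bsub>T\<^esub>i\<in>{..<n}. tens l (D.sgE m) \<otimes>\<^bsub>T\<^esub> tens (x i) (\<xi> i))"
    unfolding theta_def by (rule GT.T.finsum_rdistr[OF finite_lessThan _ theta_Pi]) (use l s in auto)
  also have "\<dots> = (\<Oplus>\<^bsub>T\<^esub>i\<in>{..<n}. tens (l \<otimes> x i) (D.sgE m \<otimes>\<^bsub>D\<^esub> \<xi> i))"
    by (rule GT.T.finsum_cong') (use l s in \<open>auto simp: GT.tens_mult\<close>)
  finally have 2: "tens l (D.sgE m) \<otimes>\<^bsub>T\<^esub> theta = (\<Oplus>\<^bsub>T\<^esub>i\<in>{..<n}. tens (l \<otimes> x i) (D.sgE m \<otimes>\<^bsub>D\<^esub> \<xi> i))" .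
  show ?thesis unfolding dT.D_def GT.sgT_tens[OF l m] 1 2
    by (rule GT.T.finsum_diff[symmetric]) (use l m s in auto)
qed

lemma Kbar_env_diff_eq: "Kbar_env_diff A n x = restrict dT (carrier T)"
  unfolding Kbar_env_diff_def Let_def dual_gen_xi
proof (rule the_equality, goal_cases)
  have f: "dT (tens l m) = (\<Oplus>\<^bsub>T\<^esub>i\<in>{..<n}. tens (x i \<otimes> l) (\<xi> i \<otimes>\<^bsub>D\<^esub> m) \<oplus>\<^bsub>T\<^esub> alt_sign T (p + 1) (tens (l \<otimes> x i) (m \<otimes>\<^bsub>D\<^esub> \<xi> i)))"
    if l: "l \<in> carrier A" and m: "m \<in> grade D p" for l m p
  proof -
    have mc: "m \<in> carrier D" using m by (simp add: D.E_grade_iff)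
    \<comment> \<open>The sign of degree p + 1 is the negative of the parity automorphism on m, and
      this is how the graded commutator expresses it.\<close>
    have "tens (x i \<otimes> l) (\<xi> i \<otimes>\<^bsub>D\<^esub> m) \<ominus>\<^bsub>T\<^esub> tens (l \<otimes> x i) (D.sgE m \<otimes>\<^bsub>D\<^esub> \<xi> i)
        = tens (x i \<otimes> l) (\<xi> i \<otimes>\<^bsub>D\<^esub> m) \<oplus>\<^bsub>T\<^esub> alt_sign T (p + 1) (tens (l \<otimes> x i) (m \<otimes>\<^bsub>D\<^esub> \<xi> i))" if "i < n" for i
      using that l mc D.sgE_sign[OF m] additive.minus[OF GT.tens_additive(2), of "l \<otimes> x i" "m \<otimes>\<^bsub>D\<^esub> \<xi> i"]
      by (auto simp: alt_sign_def a_minus_def D.E.l_minus)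
    then show ?thesis unfolding dT_tens[OF l mc]
      by (intro GT.T.finsum_cong') (use l mc in \<open>auto simp: alt_sign_def\<close>)
  qed
  {
    case 1
    have "linear_map UNIV T T (restrict dT (carrier T))"
      using dT.D_linear by (simp add: linear_map_def)
    moreover have "restrict dT (carrier T) (tens l m) = dT (tens l m)" if "l \<in> carrier A" "m \<in> grade D p" for l m p
      using that by (simp add: D.E_grade_iff)
    ultimately show ?case using f by simp
  next
    case (2 d)
    show ?case
    proof (rule extensionalityI)
      show "d \<in> extensional (carrier T)" "restrict dT (carrier T) \<in> extensional (carrier T)" using 2 by auto
      have "d t = dT t" if "t \<in> carrier T" for t
        by (rule GT.linear_eq_homogeneous[OF _ dT.D_linear _ that]) (use 2 f in auto)
      then show "d t = restrict dT (carrier T) t" if "t \<in> carrier T" for t using that by simp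
    qed
  }
qed

text \<open>Here \<open>x\<^sub>i l\<close> is replaced by \<open>l x\<^sub>i + (q - 1) br x\<^sub>i l\<close>, after which every term lies in the lattice.\<close>

lemma dT_tens': "l \<in> carrier A \<Longrightarrow> m \<in> carrier D \<Longrightarrow> dT (tens l m) =
  (\<Oplus>\<^bsub>T\<^esub>i\<in>{..<n}. tens (l \<otimes> x i) (act i m) \<oplus>\<^bsub>T\<^esub> tens (br (x i) l) ((unif \<odot>\<^bsub>D\<^esub> \<xi> i) \<otimes>\<^bsub>D\<^esub> m))"
proof -
  assume l: "l \<in> carrier A" and m: "m \<in> carrier D"
  have s: "D.sgE m \<in> carrier D" using D.sgE_hom m by (simp add: algebra_hom_def linear_map_def)
  have "tens (x i \<otimes> l) (\<xi> i \<otimes>\<^bsub>D\<^esub> m) \<ominus>\<^bsub>T\<^esub> tens (l \<otimes> x i) (D.sgE m \<otimes>\<^bsub>D\<^esub> \<xi> i)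
    = tens (l \<otimes> x i) (act i m) \<oplus>\<^bsub>T\<^esub> tens (br (x i) l) ((unif \<odot>\<^bsub>D\<^esub> \<xi> i) \<otimes>\<^bsub>D\<^esub> m)" if i: "i < n" for i
  proof -
    have c: "l \<otimes> x i \<in> carrier A" "br (x i) l \<in> carrier A" "\<xi> i \<otimes>\<^bsub>D\<^esub> m \<in> carrier D" "D.sgE m \<otimes>\<^bsub>D\<^esub> \<xi> i \<in> carrier D"
      using i l m s br_closed by auto
    have "x i \<otimes> l = l \<otimes> x i \<oplus> unif \<odot> br (x i) l"
      using unif_br[of "x i" l] A.eq_add_if_minus[of "x i \<otimes> l" "l \<otimes> x i"] i l br_closed by simp
    then have "tens (x i \<otimes> l) (\<xi> i \<otimes>\<^bsub>D\<^esub> m) = tens (l \<otimes> x i) (\<xi> i \<otimes>\<^bsub>D\<^esub> m) \<oplus>\<^bsub>T\<^esub> tens (br (x i) l) ((unif \<odot>\<^bsub>D\<^esub> \<xi> i) \<otimes>\<^bsub>D\<^esub> m)"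
      using c m i by (simp add: GT.tens(2,4) GT.tens(5)[symmetric] D.E.sm_ml)
    moreover have "tens (l \<otimes> x i) (act i m) = tens (l \<otimes> x i) (\<xi> i \<otimes>\<^bsub>D\<^esub> m) \<ominus>\<^bsub>T\<^esub> tens (l \<otimes> x i) (D.sgE m \<otimes>\<^bsub>D\<^esub> \<xi> i)"
      unfolding act_def[OF i] by (rule additive.diff[OF GT.tens_additive(2)[OF c(1)] c(3,4)])
    moreover have "tens (l \<otimes> x i) (\<xi> i \<otimes>\<^bsub>D\<^esub> m) \<in> carrier T" "tens (l \<otimes> x i) (D.sgE m \<otimes>\<^bsub>D\<^esub> \<xi> i) \<in> carrier T"
      "tens (br (x i) l) ((unif \<odot>\<^bsub>D\<^esub> \<xi> i) \<otimes>\<^bsub>D\<^esub> m) \<in> carrier T" using c m i by auto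
    ultimately show ?thesis by (simp add: a_minus_def GT.T.a_ac)
  qed
  then show ?thesis unfolding dT_tens[OF l m]
    by (intro GT.T.finsum_cong') (use l m act(1) br_closed in auto)
qed

lemma dT_B_tens:
  assumes l: "l \<in> LA" and m: "m \<in> LE"
  shows "dT (tens l m) \<in> B" "psi (dT (tens l m)) = (\<Oplus>\<^bsub>T0\<^esub>i\<in>{..<n}.
    tens0 (Var i \<otimes>\<^bsub>P.P\<^esub> rA l) (dual_action n pb i (rE m)) \<oplus>\<^bsub>T0\<^esub> tens0 (pb (Var i) (rA l)) (ext_gen n i \<otimes>\<^bsub>E\<^esub> rE m))"
proof -
  have e: "dT (tens l m) = (\<Oplus>\<^bsub>T\<^esub>i\<in>{..<n}. tens (l \<otimes> x i) (act i m) \<oplus>\<^bsub>T\<^esub> tens (br (x i) l) ((unif \<odot>\<^bsub>D\<^esub> \<xi> i) \<otimes>\<^bsub>D\<^esub> m))"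
    by (rule dT_tens') (use l m in auto)
  have c: "(\<lambda>i. tens (l \<otimes> x i) (act i m) \<oplus>\<^bsub>T\<^esub> tens (br (x i) l) ((unif \<odot>\<^bsub>D\<^esub> \<xi> i) \<otimes>\<^bsub>D\<^esub> m)) \<in> {..<n} \<rightarrow> B"
    using l m x_LA act_LE br_LA by auto
  show "dT (tens l m) \<in> B" unfolding e by (rule TB.L_finsum[OF c])
  have t: "psi (tens (l \<otimes> x i) (act i m) \<oplus>\<^bsub>T\<^esub> tens (br (x i) l) ((unif \<odot>\<^bsub>D\<^esub> \<xi> i) \<otimes>\<^bsub>D\<^esub> m))
    = tens0 (Var i \<otimes>\<^bsub>P.P\<^esub> rA l) (dual_action n pb i (rE m)) \<oplus>\<^bsub>T0\<^esub> tens0 (pb (Var i) (rA l)) (ext_gen n i \<otimes>\<^bsub>E\<^esub> rE m)" if i: "i < n" for i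
  proof -
    have b: "tens (l \<otimes> x i) (act i m) \<in> B" "tens (br (x i) l) ((unif \<odot>\<^bsub>D\<^esub> \<xi> i) \<otimes>\<^bsub>D\<^esub> m) \<in> B"
      using l m i x_LA act_LE br_LA by auto
    \<comment> \<open>The rewritten differential has the generator to the right of l, the formula
      for the limit has the variable on the left; commutativity of the polynomial algebra identifies
      them.\<close>
    have "rA (l \<otimes> x i) = Var i \<otimes>\<^bsub>P.P\<^esub> rA l"
      using RA.r_mult[OF l x_LA[OF i]] P.P_comm[OF RA.r_closed[OF l] P.Var_closed[OF i]] by (simp only: rA_x[OF i])
    moreover have "rA (br (x i) l) = pb (Var i) (rA l)" using bracket[OF x_LA[OF i] l] by (simp add: rA_x[OF i])
    moreover have "rE (act i m) = dual_action n pb i (rE m)" using dual_action_ind[OF i] ind_r[OF i m] by simp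
    moreover have "rE ((unif \<odot>\<^bsub>D\<^esub> \<xi> i) \<otimes>\<^bsub>D\<^esub> m) = ext_gen n i \<otimes>\<^bsub>E\<^esub> rE m" using i m by (simp add: RE.r_mult rE_y ext_gen_eta)
    moreover have "psi (tens (l \<otimes> x i) (act i m)) = tens0 (rA (l \<otimes> x i)) (rE (act i m))"
      "psi (tens (br (x i) l) ((unif \<odot>\<^bsub>D\<^esub> \<xi> i) \<otimes>\<^bsub>D\<^esub> m)) = tens0 (rA (br (x i) l)) (rE ((unif \<odot>\<^bsub>D\<^esub> \<xi> i) \<otimes>\<^bsub>D\<^esub> m))"
      using l m i x_LA act_LE br_LA by (auto intro!: TR.psi_tens)
    ultimately show ?thesis using TB.r_add[OF b] by simp
  qed
  have "psi (dT (tens l m)) = (\<Oplus>\<^bsub>T0\<^esub>i\<in>{..<n}. psi (tens (l \<otimes> x i) (act i m) \<oplus>\<^bsub>T\<^esub> tens (br (x i) l) ((unif \<odot>\<^bsub>D\<^esub> \<xi> i) \<otimes>\<^bsub>D\<^esub> m)))"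
    unfolding e by (rule TB.r_finsum[OF c])
  also have "\<dots> = (\<Oplus>\<^bsub>T0\<^esub>i\<in>{..<n}.
    tens0 (Var i \<otimes>\<^bsub>P.P\<^esub> rA l) (dual_action n pb i (rE m)) \<oplus>\<^bsub>T0\<^esub> tens0 (pb (Var i) (rA l)) (ext_gen n i \<otimes>\<^bsub>E\<^esub> rE m))"
  proof (rule GT0.T.finsum_cong'[OF refl])
    show "(\<lambda>i. tens0 (Var i \<otimes>\<^bsub>P.P\<^esub> rA l) (dual_action n pb i (rE m)) \<oplus>\<^bsub>T0\<^esub> tens0 (pb (Var i) (rA l)) (ext_gen n i \<otimes>\<^bsub>E\<^esub> rE m)) \<in> {..<n} \<rightarrow> carrier T0"
      using c TB.r_closed by (auto simp: t[symmetric] Pi_iff)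
    show "psi (tens (l \<otimes> x i) (act i m) \<oplus>\<^bsub>T\<^esub> tens (br (x i) l) ((unif \<odot>\<^bsub>D\<^esub> \<xi> i) \<otimes>\<^bsub>D\<^esub> m))
      = tens0 (Var i \<otimes>\<^bsub>P.P\<^esub> rA l) (dual_action n pb i (rE m)) \<oplus>\<^bsub>T0\<^esub> tens0 (pb (Var i) (rA l)) (ext_gen n i \<otimes>\<^bsub>E\<^esub> rE m)" if "i \<in> {..<n}" for i
      using t that by simp
  qed
  finally show "psi (dT (tens l m)) = (\<Oplus>\<^bsub>T0\<^esub>i\<in>{..<n}.
    tens0 (Var i \<otimes>\<^bsub>P.P\<^esub> rA l) (dual_action n pb i (rE m)) \<oplus>\<^bsub>T0\<^esub> tens0 (pb (Var i) (rA l)) (ext_gen n i \<otimes>\<^bsub>E\<^esub> rE m))" .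
qed

lemmas dT_lin = linear_mapD[OF dT.D_linear]

lemma dT_B: "t \<in> B \<Longrightarrow> dT t \<in> B"
  by (induct t rule: TR.B_induct) (simp_all add: dT_B_tens(1) dT_lin)

lemma d0_psi: "t \<in> B \<Longrightarrow> TB.induced dT (psi t) = psi (dT t)" and d0_linear: "linear_map UNIV T0 T0 (TB.induced dT)"
  by (rule TB.induced_r[OF dT_B] TB.induced_linear[OF dT_B]; simp add: dT_lin)+

text \<open>Every pure tensor of the limit lifts to a pure tensor of lattice elements, on which the
  value of the differential is known. That the prescribed values extend linearly is thereby a
  consequence of the existence of the lattice differential, and uniqueness holds since pure tensors
  generate.\<close>

lemma Kbar_poisson_diff_eq: "Kbar_poisson_diff n pb = TB.induced dT"
  unfolding Kbar_poisson_diff_def Let_def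
proof (rule the_equality, goal_cases)
  have f: "TB.induced dT (tens0 a u) = (\<Oplus>\<^bsub>T0\<^esub>j\<in>{..<n}.
    tens0 (Var j \<otimes>\<^bsub>P.P\<^esub> a) (dual_action n pb j u) \<oplus>\<^bsub>T0\<^esub> tens0 (pb (Var j) a) (ext_gen n j \<otimes>\<^bsub>E\<^esub> u))"
    if a: "a \<in> carrier P.P" and u: "u \<in> carrier E" for a u
  proof -
    obtain l m where lm: "l \<in> LA" "rA l = a" "m \<in> LE" "rE m = u" using RA.r_surj[OF a] RE.r_surj[OF u] by blast
    have "TB.induced dT (tens0 a u) = psi (dT (tens l m))"
      using d0_psi[OF TR.tens_B[OF lm(1,3)]] TR.psi_tens[OF lm(1,3)] lm by simp
    then show ?thesis using dT_B_tens(2)[OF lm(1,3)] lm by simp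
  qed
  {
    case 1
    have "TB.induced dT \<in> extensional (carrier T0)" by (simp add: TB.induced_def)
    then show ?case using d0_linear f by blast
  next
    case (2 d)
    show ?case
    proof (rule extensionalityI)
      show "d \<in> extensional (carrier T0)" "TB.induced dT \<in> extensional (carrier T0)" using 2 by (auto simp: TB.induced_def)
      show "d t = TB.induced dT t" if "t \<in> carrier T0" for t
        by (rule GT0.T_linear_eq[OF _ d0_linear _ that]) (use 2 f in auto)
    qed
  }
qed

lemma prT_B: "t \<in> B \<Longrightarrow> GT.prT i t \<in> B \<and> psi (GT.prT i t) = GT0.prT i (psi t)"
proof (induct t rule: TR.B_induct)
  case (tens a m)
  then show ?case by (simp add: GT.prT_tens GT0.prT_tens prE_LE rE_prE TR.psi_tens RA.L_carrier RE.L_carrier del: P.X.M_sel)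
next
  case (add s t)
  then show ?case by (simp add: linear_mapD[OF GT.prT_linear] linear_mapD[OF GT0.prT_linear] TB.r_add)
qed

end

lemma reduction_with:
  fixes A :: "('k::field poly fract, 'a) module" and A0 :: "('k, 'b) module"
  assumes "reduction A A0 L r"
  shows "reduction (with_diff (with_grade A g) d) (with_diff (with_grade A0 g0) d0) L r"
proof -
  interpret reduction A A0 L r by (rule assms)
  let ?A = "with_diff (with_grade A g) d" and ?B = "with_diff (with_grade A0 g0) d0"
  have c: "coeff_algebra UNIV ?A" "coeff_algebra UNIV ?B"
    by (rule coeff_algebra_cong[OF A.coeff_algebra_axioms] coeff_algebra_cong[OF A0.coeff_algebra_axioms]; simp)+
  interpret A': coeff_algebra UNIV ?A by (rule c)
  have "subring L ?A" by (rule A'.subringI) auto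
  then show ?thesis
    unfolding reduction_def reduction_axioms_def is_subalgebra_def
    using c r_closed r_add r_mult r_one r_sm r_surj r_ker span by simp
qed

context quantum
begin

theorem q_deformation: "is_q_deformation (Kbar_env A n x) (Kbar_poisson n pb)"
proof (rule reduction_deformation)
  let ?R = "Kbar_env A n x" and ?S = "Kbar_poisson n pb"
  have R: "?R = with_diff (with_grade T (tensor_grade A D)) (restrict dT (carrier T))"
    by (simp only: Kbar_env_def Kbar_env_diff_eq)
  have R0: "?S = with_diff (with_grade T0 (tensor_grade P.P E)) (TB.induced dT)"
    by (simp only: Kbar_poisson_def Kbar_poisson_diff_eq)
  have sel: "carrier ?R = carrier T" "grade ?R = tensor_grade A D" "grade ?S = tensor_grade P.P E"
    "t \<in> carrier T \<Longrightarrow> diff ?R t = dT t" "diff ?S = TB.induced dT"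
    "add ?R = add T" "mult ?R = mult T" "zero ?R = zero T" "smult ?R = smult T" "alt_sign ?R = alt_sign T" for t
    by (simp_all add: R R0)
  have gc: "t \<in> tensor_grade A D i \<Longrightarrow> t \<in> carrier T" for t i by (simp add: GT.tensor_grade_iff)
  show "reduction ?R ?S B psi" unfolding R R0 by (rule reduction_with[OF TB.reduction_axioms])
  show "graded_by UNIV ?R (grade ?R) GT.prT" "graded_by UNIV ?S (grade ?S) GT0.prT"
    unfolding sel unfolding R R0 by (simp_all add: GT.T_graded GT0.T_graded)
  show "linear_map UNIV ?R ?R (diff ?R)"
    using dT.D_linear by (simp add: linear_map_def sel)
  show "diff ?R a \<in> grade ?R (Suc i)" if "a \<in> grade ?R i" for a i
    using that dT.D_grade[of a i] gc[of a i] by (simp add: sel)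
  show "diff ?R (diff ?R a) = \<zero>\<^bsub>?R\<^esub>" if "a \<in> carrier ?R" for a
    using that dT.D_D[OF theta_sq] by (simp add: sel)
  show "diff ?R (a \<otimes>\<^bsub>?R\<^esub> b) = (diff ?R a \<otimes>\<^bsub>?R\<^esub> b) \<oplus>\<^bsub>?R\<^esub> alt_sign ?R i (a \<otimes>\<^bsub>?R\<^esub> diff ?R b)"
    if "a \<in> grade ?R i" "b \<in> carrier ?R" for a b i
    using that dT.D_leibniz[of a i b] gc[of a i] by (simp add: sel)
  show "GT.prT i t \<in> B" "psi (GT.prT i t) = GT0.prT i (psi t)" if "t \<in> B" for t i using prT_B[OF that] by blast+
  show "diff ?R t \<in> B" "psi (diff ?R t) = diff ?S (psi t)" if "t \<in> B" for t
    using that dT_B[OF that] d0_psi[OF that] by (simp_all add: sel)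
qed

end

theorem proposition26:
  fixes A :: "('k::field_char_0 poly fract, 'a) module" and n :: nat and x :: "nat \<Rightarrow> 'a"
  assumes "is_koszul_algebra A n x"
    and "is_form A (gen_form A n x)"
    and "admits_semiclassical_limit A (gen_form A n x)"
    and "is_polynomial_algebra (scl_limit A n x) n (scl_gen A n x)"
    and "\<exists>\<phi> \<in> algebra_iso UNIV (poisson_env n (scl_bracket A n x))
                   (spec (enveloping A) (env_form A n x)).
           \<forall>i<n. \<phi> (env_gen n (scl_bracket A n x) (Inl i)) =
                     spec_class (enveloping A) (env_form A n x) (env_left A (x i)) \<and>
                 \<phi> (env_gen n (scl_bracket A n x) (Inr i)) =
                     spec_class (enveloping A) (env_form A n x) (Omega_tilde A (x i))"
  shows "is_q_deformation (Kbar_env A n x) (Kbar_poisson n (scl_bracket A n x))"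
proof -
  interpret quantum A n x
    using assms(1,3,4) by unfold_locales (simp_all add: is_koszul_algebra_def)
  show ?thesis by (rule q_deformation)
qed

end
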